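(* Let $\mathbb{K}$ be a commutative superring with $\mathbb{K}\supseteq\mathbb{Q}$ and let $\mathfrak{g}$ be a Lie $\mathbb{K}$-superalgebra. For every $c\in\mathbb{K}_0^\times$, the series $\varphi_c(t)=\frac{t}{e^{t/c}-1}\in\mathbb{K}_0[[t]]$ gives a representation by coderivations $\Phi_c:\mathfrak{g}\to Hom(S(\mathfrak{g}),S(\mathfrak{g}))$.
   Context: Conventions. A commutative superring $\mathbb{K}=\mathbb{K}_0\oplus\mathbb{K}_1$ is a unital $\mathbb{Z}/2$-graded ring with $ab=(-1)^{p(a)p(b)}ba$ and $a^2=0$ for $a\in\mathbb{K}_1$; $p$ denotes parity, and formulas containing $p(\cdot)$ are written for nonzero homogeneous elements and extended by linearity. $\mathbb{K}_0^\times$ is the group of units of $\mathbb{K}_0$; $\mathbb{K}\supseteq\mathbb{Q}$ means all positive integers are invertible in $\mathbb{K}$. A $\mathbb{K}$-module $M=M_0\oplus M_1$ is a graded right module with $p(m\alpha)=p(m)+p(\alpha)$, and $\alpha m:=(-1)^{p(\alpha)p(m)}m\alpha$. $Hom(M,N)$ is the graded group of right $\mathbb{K}$-linear maps; $(F\otimes G)(v\otimes w)=(-1)^{p(G)p(v)}F(v)\otimes G(w)$; $[F,G]=F\circ G-(-1)^{p(F)p(G)}G\circ F$ on $Hom(M,M)$. A Lie $\mathbb{K}$-superalgebra is a $\mathbb{K}$-module $\mathfrak{g}$ with an even $\mathbb{K}$-bilinear bracket satisfying $[X,Y]=-(-1)^{p(X)p(Y)}[Y,X]$; $[X,X]=0$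 for $X\in\mathfrak{g}_0$; $[[X,Y],Z]=[X,[Y,Z]]-(-1)^{p(X)p(Y)}[Y,[X,Z]]$; $[Y,[Y,Y]]=0$ for $Y\in\mathfrak{g}_1$. Write $\mathrm{ad}X=[X,\cdot]$. $S(\mathfrak{g})$ is the quotient of the tensor algebra $T(\mathfrak{g})$ by the ideal generated by $v\otimes w-(-1)^{p(v)p(w)}w\otimes v$ and $u\otimes u$ ($u\in\mathfrak{g}_1$); $\Delta:S(\mathfrak{g})\to S(\mathfrak{g})\otimes S(\mathfrak{g})$ is the superalgebra morphism with $\Delta(X)=X\otimes1+1\otimes X$ for $X\in\mathfrak{g}$. A coderivation of $S(\mathfrak{g})$ is a $\Phi\in Hom(S(\mathfrak g),S(\mathfrak g))$ with $\Delta\circ\Phi=(\Phi\otimes id+id\otimes\Phi)\circ\Delta$. For $\varphi=\sum_nc_nt^n\in\mathbb{K}_0[[t]]$ and $a\in\mathfrak{g}$, let $\varphi^a\in Hom(S(\mathfrak{g}),\mathfrak{g})$ be given by $\varphi^a(1)=c_0a$ and $$\varphi^a(X_1\cdots X_n)=(-1)^{p(a)(p(X_1)+\cdots+p(X_n))}\,c_n\sum_{s\in\Sigma_n}\alpha(X_{s(1)},\dots,X_{s(n)})\,\mathrm{ad}X_{s(1)}\circ\cdots\circ\mathrm{ad}X_{s(n)}(a),$$ with $\alpha=\pm1$ the Koszul sign such that $\alpha(X_{s(1)},\dots,X_{s(n)})X_{s(1)}\cdots X_{s(n)}=X_1\cdots X_n$ in $S(\mathfrak{g})$; put $\Phi^a=\mathrm{Mult}\circ(id\otimes\varphi^a)\circ\Delta$,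 $\mathrm{Mult}$ being the multiplication of $S(\mathfrak g)$. $\Phi_c$ is the map $a\mapsto\Phi^a$ obtained from $\varphi=\varphi_c$. "Representation by coderivations" means a morphism of Lie superalgebras $\mathfrak{g}\to Hom(S(\mathfrak{g}),S(\mathfrak{g}))$ (so $[\Phi_c^a,\Phi_c^b]=\Phi_c^{[a,b]}$) all of whose values are coderivations. *)

theory Defs
  imports
    "HOL-Algebra.QuotRing"
    "HOL-Algebra.Free_Abelian_Groups"
    "HOL-Combinatorics.Permutations"
    "HOL-Computational_Algebra.Formal_Power_Series"
    "HOL-Library.Z2"
begin

section \<open>Superrings and supermodules\<close>

text \<open>
  Parities are elements of the two-element field \<^typ>\<open>bit\<close>, so that \<open>+\<close> and \<open>*\<close> on parities are
  those of \<open>\<int>/2\<close>.  The ground superring is a type of class \<^class>\<open>ring_1\<close> together with the family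
  \<open>K\<close> of its homogeneous parts \<open>K 0\<close> and \<open>K 1\<close>.  As for the record \<open>module\<close> of HOL-Algebra, a
  module record extends the record of rings; its fields for multiplication and unit are
  meaningful for algebras only, and are never used for a mere module or a Lie superalgebra.
\<close>

record ('k, 'm) supermod = "'m ring" +
  rsmult :: "'m \<Rightarrow> 'k \<Rightarrow> 'm" (infixl "\<star>\<index>" 70)
  grade :: "bit \<Rightarrow> 'm set"

definition ksign :: "bit \<Rightarrow> 'k::ring_1"
  where "ksign p = (if p = 0 then 1 else - 1)"

definition supergrading :: "('k, 'm, 'e) supermod_scheme \<Rightarrow> bool"
  where "supergrading M \<longleftrightarrow>
    (\<forall>p. subgroup (grade M p) (add_monoid M)) \<and>
    (\<forall>m\<in>carrier M. \<exists>!uv. fst uv \<in> grade M 0 \<and> snd uv \<in> grade M 1 \<and> m = fst uv \<oplus>\<^bsub>M\<^esub> snd uv)"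

definition component :: "('k, 'm, 'e) supermod_scheme \<Rightarrow> bit \<Rightarrow> 'm \<Rightarrow> 'm"
  where "component M p m = (THE u. u \<in> grade M p \<and> (\<exists>v\<in>grade M (p + 1). m = u \<oplus>\<^bsub>M\<^esub> v))"

definition regular_mod :: "(bit \<Rightarrow> 'k::ring_1 set) \<Rightarrow> ('k, 'k) supermod"
  where "regular_mod K =
    \<lparr>carrier = UNIV, monoid.mult = (*), one = 1, ring.zero = 0, add = (+), rsmult = (*), grade = K\<rparr>"

locale comm_superring =
  fixes K :: "bit \<Rightarrow> 'k::ring_1 set"
  assumes K_grading: "supergrading (regular_mod K)"
    and K_one: "1 \<in> K 0"
    and K_mult: "\<lbrakk>a \<in> K p; b \<in> K q\<rbrakk> \<Longrightarrow> a * b \<in> K (p + q)"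
    and K_supercomm: "\<lbrakk>a \<in> K p; b \<in> K q\<rbrakk> \<Longrightarrow> a * b = ksign (p * q) * (b * a)"
    and K_odd_square: "a \<in> K 1 \<Longrightarrow> a * a = 0"

definition even_units :: "(bit \<Rightarrow> 'k::ring_1 set) \<Rightarrow> 'k set"
  where "even_units K = {c \<in> K 0. \<exists>d\<in>K 0. c * d = 1 \<and> d * c = 1}"

locale supermodule = comm_superring K + abelian_group M
  for K :: "bit \<Rightarrow> 'k::ring_1 set" and M :: "('k, 'm, 'e) supermod_scheme" (structure) +
  assumes M_grading: "supergrading M"
    and rsmult_closed: "m \<in> carrier M \<Longrightarrow> m \<star> \<alpha> \<in> carrier M"
    and rsmult_l_distr: "\<lbrakk>m \<in> carrier M; n \<in> carrier M\<rbrakk> \<Longrightarrow> (m \<oplus> n) \<star> \<alpha> = m \<star> \<alpha> \<oplus> n \<star> \<alpha>"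
    and rsmult_r_distr: "m \<in> carrier M \<Longrightarrow> m \<star> (\<alpha> + \<beta>) = m \<star> \<alpha> \<oplus> m \<star> \<beta>"
    and rsmult_assoc: "m \<in> carrier M \<Longrightarrow> m \<star> (\<alpha> * \<beta>) = m \<star> \<alpha> \<star> \<beta>"
    and rsmult_one: "m \<in> carrier M \<Longrightarrow> m \<star> 1 = m"
    and rsmult_grade: "\<lbrakk>m \<in> grade M p; \<alpha> \<in> K q\<rbrakk> \<Longrightarrow> m \<star> \<alpha> \<in> grade M (p + q)"

text \<open>
  Sign rules are stated for homogeneous elements and extended by linearity; here and below the
  extension is the sum over the homogeneous components.  For homogeneous \<open>\<alpha>\<close> and \<open>m\<close> the left action
  is \<open>\<alpha> m = (-1) ^ (p(\<alpha>) p(m)) m \<alpha>\<close>.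
\<close>

definition lsmult :: "(bit \<Rightarrow> 'k::ring_1 set) \<Rightarrow> ('k, 'm, 'e) supermod_scheme \<Rightarrow> 'k \<Rightarrow> 'm \<Rightarrow> 'm"
  where "lsmult K M \<alpha> m =
    (\<Oplus>\<^bsub>M\<^esub>p\<in>{0,1}. \<Oplus>\<^bsub>M\<^esub>q\<in>{0,1}.
       component M q m \<star>\<^bsub>M\<^esub> component (regular_mod K) p \<alpha> \<star>\<^bsub>M\<^esub> ksign (p * q))"

text \<open>
  Maps between carriers are taken in the extensional function space, so that equality of
  functions is equality on the carrier.  The right action on homomorphisms is
  \<open>(F \<alpha>)(m) = F (\<alpha> m)\<close>, which agrees with \<open>(\<alpha> F)(m) = \<alpha> (F m)\<close>.
\<close>

definition Hom_mod :: "(bit \<Rightarrow> 'k::ring_1 set) \<Rightarrow> ('k, 'm, 'e) supermod_scheme \<Rightarrow>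
    ('k, 'n, 'f) supermod_scheme \<Rightarrow> ('k, 'm \<Rightarrow> 'n) supermod"
  where "Hom_mod K M N =
    (let H = {F \<in> carrier M \<rightarrow>\<^sub>E carrier N.
        (\<forall>x\<in>carrier M. \<forall>y\<in>carrier M. F (x \<oplus>\<^bsub>M\<^esub> y) = F x \<oplus>\<^bsub>N\<^esub> F y) \<and>
        (\<forall>x\<in>carrier M. \<forall>\<alpha>. F (x \<star>\<^bsub>M\<^esub> \<alpha>) = F x \<star>\<^bsub>N\<^esub> \<alpha>)}
     in \<lparr>carrier = H, monoid.mult = undefined, one = undefined,
         ring.zero = (\<lambda>x\<in>carrier M. \<zero>\<^bsub>N\<^esub>),
         add = (\<lambda>F G. \<lambda>x\<in>carrier M. F x \<oplus>\<^bsub>N\<^esub> G x),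
         rsmult = (\<lambda>F \<alpha>. \<lambda>x\<in>carrier M. F (lsmult K M \<alpha> x)),
         grade = (\<lambda>p. {F \<in> H. \<forall>q. \<forall>x\<in>grade M q. F x \<in> grade N (p + q)})\<rparr>)"

section \<open>Lie superalgebras\<close>

record ('k, 'm) lie_super = "('k, 'm) supermod" +
  bracket :: "'m \<Rightarrow> 'm \<Rightarrow> 'm"

text \<open>
  \<open>K\<close>-bilinearity over a superring means: biadditive, balanced, and right linear in the second
  argument.
\<close>

locale lie_superalgebra = supermodule K L
  for K :: "bit \<Rightarrow> 'k::ring_1 set" and L :: "('k, 'm, 'e) lie_super_scheme" (structure) +
  assumes br_closed: "\<lbrakk>x \<in> carrier L; y \<in> carrier L\<rbrakk> \<Longrightarrow> bracket L x y \<in> carrier L"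
    and br_l_distr: "\<lbrakk>x \<in> carrier L; y \<in> carrier L; z \<in> carrier L\<rbrakk> \<Longrightarrow>
      bracket L (x \<oplus> y) z = bracket L x z \<oplus> bracket L y z"
    and br_r_distr: "\<lbrakk>x \<in> carrier L; y \<in> carrier L; z \<in> carrier L\<rbrakk> \<Longrightarrow>
      bracket L x (y \<oplus> z) = bracket L x y \<oplus> bracket L x z"
    and br_balanced: "\<lbrakk>x \<in> carrier L; y \<in> carrier L\<rbrakk> \<Longrightarrow>
      bracket L (x \<star> \<alpha>) y = bracket L x (lsmult K L \<alpha> y)"
    and br_linear: "\<lbrakk>x \<in> carrier L; y \<in> carrier L\<rbrakk> \<Longrightarrow> bracket L x (y \<star> \<alpha>) = bracket L x y \<star> \<alpha>"
    and br_even: "\<lbrakk>x \<in> grade L p; y \<in> grade L q\<rbrakk> \<Longrightarrow> bracket L x y \<in> grade L (p + q)"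
    and br_antisym: "\<lbrakk>x \<in> grade L p; y \<in> grade L q\<rbrakk> \<Longrightarrow>
      bracket L x y = \<ominus> (bracket L y x \<star> ksign (p * q))"
    and br_alternating: "x \<in> grade L 0 \<Longrightarrow> bracket L x x = \<zero>"
    and br_jacobi: "\<lbrakk>x \<in> grade L p; y \<in> grade L q; z \<in> grade L r\<rbrakk> \<Longrightarrow>
      bracket L (bracket L x y) z =
        bracket L x (bracket L y z) \<ominus> bracket L y (bracket L x z) \<star> ksign (p * q)"
    and br_odd_cube: "y \<in> grade L 1 \<Longrightarrow> bracket L y (bracket L y y) = \<zero>"

definition lie_hom :: "(bit \<Rightarrow> 'k::ring_1 set) \<Rightarrow> ('k, 'm, 'e) lie_super_scheme \<Rightarrow>
    ('k, 'n, 'f) lie_super_scheme \<Rightarrow> ('m \<Rightarrow> 'n) \<Rightarrow> bool"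
  where "lie_hom K L L' f \<longleftrightarrow>
    restrict f (carrier L) \<in> grade (Hom_mod K L L') 0 \<and>
    (\<forall>x\<in>carrier L. \<forall>y\<in>carrier L. f (bracket L x y) = bracket L' (f x) (f y))"

definition End_lie :: "(bit \<Rightarrow> 'k::ring_1 set) \<Rightarrow> ('k, 'm, 'e) supermod_scheme \<Rightarrow> ('k, 'm \<Rightarrow> 'm) lie_super"
  where "End_lie K M =
    (let H = Hom_mod K M M
     in supermod.extend H (lie_super.fields (\<lambda>F G.
       \<Oplus>\<^bsub>H\<^esub>p\<in>{0,1}. \<Oplus>\<^bsub>H\<^esub>q\<in>{0,1}.
         compose (carrier M) (component H p F) (component H q G) \<ominus>\<^bsub>H\<^esub>
         compose (carrier M) (component H q G) (component H p F) \<star>\<^bsub>H\<^esub> ksign (p * q))))"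

section \<open>Tensor products\<close>

text \<open>
  \<open>M \<otimes> N\<close> is the free abelian group on \<open>carrier M \<times> carrier N\<close> modulo biadditivity and
  \<open>m \<alpha> \<otimes> n = m \<otimes> \<alpha> n\<close>.
\<close>

definition tensor_rel :: "(bit \<Rightarrow> 'k::ring_1 set) \<Rightarrow> ('k, 'm, 'e) supermod_scheme \<Rightarrow>
    ('k, 'n, 'f) supermod_scheme \<Rightarrow> ('m \<times> 'n \<Rightarrow>\<^sub>0 int) set"
  where "tensor_rel K M N =
    {frag_of (m \<oplus>\<^bsub>M\<^esub> m', n) - frag_of (m, n) - frag_of (m', n) | m m' n.
       m \<in> carrier M \<and> m' \<in> carrier M \<and> n \<in> carrier N} \<union>
    {frag_of (m, n \<oplus>\<^bsub>N\<^esub> n') - frag_of (m, n) - frag_of (m, n') | m n n'.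
       m \<in> carrier M \<and> n \<in> carrier N \<and> n' \<in> carrier N} \<union>
    {frag_of (m \<star>\<^bsub>M\<^esub> \<alpha>, n) - frag_of (m, lsmult K N \<alpha> n) | m n \<alpha>.
       m \<in> carrier M \<and> n \<in> carrier N}"

definition tensor_ker :: "(bit \<Rightarrow> 'k::ring_1 set) \<Rightarrow> ('k, 'm, 'e) supermod_scheme \<Rightarrow>
    ('k, 'n, 'f) supermod_scheme \<Rightarrow> ('m \<times> 'n \<Rightarrow>\<^sub>0 int) set"
  where "tensor_ker K M N =
    generate (free_Abelian_group (carrier M \<times> carrier N)) (tensor_rel K M N)"

definition pure_tensor :: "(bit \<Rightarrow> 'k::ring_1 set) \<Rightarrow> ('k, 'm, 'e) supermod_scheme \<Rightarrow>
    ('k, 'n, 'f) supermod_scheme \<Rightarrow> 'm \<Rightarrow> 'n \<Rightarrow> ('m \<times> 'n \<Rightarrow>\<^sub>0 int) set"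
  where "pure_tensor K M N m n =
    tensor_ker K M N #>\<^bsub>free_Abelian_group (carrier M \<times> carrier N)\<^esub> frag_of (m, n)"

definition tensor_ab :: "(bit \<Rightarrow> 'k::ring_1 set) \<Rightarrow> ('k, 'm, 'e) supermod_scheme \<Rightarrow>
    ('k, 'n, 'f) supermod_scheme \<Rightarrow> ('m \<times> 'n \<Rightarrow>\<^sub>0 int) set ring"
  where "tensor_ab K M N =
    (let Q = free_Abelian_group (carrier M \<times> carrier N) Mod tensor_ker K M N
     in \<lparr>carrier = carrier Q, monoid.mult = undefined, one = undefined,
         ring.zero = \<one>\<^bsub>Q\<^esub>, add = (\<otimes>\<^bsub>Q\<^esub>)\<rparr>)"

text \<open>The additive map on \<open>M \<otimes> N\<close> with prescribed values on pure tensors.\<close>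

definition tensor_lift :: "(bit \<Rightarrow> 'k::ring_1 set) \<Rightarrow> ('k, 'm, 'e) supermod_scheme \<Rightarrow>
    ('k, 'n, 'f) supermod_scheme \<Rightarrow> ('a, 'h) ring_scheme \<Rightarrow> ('m \<Rightarrow> 'n \<Rightarrow> 'a) \<Rightarrow>
    ('m \<times> 'n \<Rightarrow>\<^sub>0 int) set \<Rightarrow> 'a"
  where "tensor_lift K M N A f =
    (THE h. h \<in> extensional (carrier (tensor_ab K M N)) \<and>
       h \<in> hom (add_monoid (tensor_ab K M N)) (add_monoid A) \<and>
       (\<forall>m\<in>carrier M. \<forall>n\<in>carrier N. h (pure_tensor K M N m n) = f m n))"

definition tensor_mod :: "(bit \<Rightarrow> 'k::ring_1 set) \<Rightarrow> ('k, 'm, 'e) supermod_scheme \<Rightarrow>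
    ('k, 'n, 'f) supermod_scheme \<Rightarrow> ('k, ('m \<times> 'n \<Rightarrow>\<^sub>0 int) set) supermod"
  where "tensor_mod K M N =
    (let V = tensor_ab K M N
     in ring.extend V (supermod.fields
       (\<lambda>t \<alpha>. tensor_lift K M N V (\<lambda>m n. pure_tensor K M N m (n \<star>\<^bsub>N\<^esub> \<alpha>)) t)
       (\<lambda>r. generate (add_monoid V)
          {pure_tensor K M N m n | m n p q. m \<in> grade M p \<and> n \<in> grade N q \<and> p + q = r})))"

text \<open>\<open>(a \<otimes> b) (c \<otimes> d) = (-1) ^ (p(b) p(c)) a c \<otimes> b d\<close>\<close>

definition tensor_alg :: "(bit \<Rightarrow> 'k::ring_1 set) \<Rightarrow> ('k, 'm, 'e) supermod_scheme \<Rightarrow>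
    ('k, 'n, 'f) supermod_scheme \<Rightarrow> ('k, ('m \<times> 'n \<Rightarrow>\<^sub>0 int) set) supermod"
  where "tensor_alg K A B =
    (let V = tensor_mod K A B
     in V\<lparr>monoid.mult := (\<lambda>t t'.
            tensor_lift K A B V (\<lambda>a b.
              tensor_lift K A B V (\<lambda>c d.
                \<Oplus>\<^bsub>V\<^esub>p\<in>{0,1}. \<Oplus>\<^bsub>V\<^esub>q\<in>{0,1}.
                  pure_tensor K A B (a \<otimes>\<^bsub>A\<^esub> component A q c) (component B p b \<otimes>\<^bsub>B\<^esub> d)
                    \<star>\<^bsub>V\<^esub> ksign (p * q)) t') t),
          one := pure_tensor K A B \<one>\<^bsub>A\<^esub> \<one>\<^bsub>B\<^esub>\<rparr>)"

text \<open>\<open>(F \<otimes> G) (v \<otimes> w) = (-1) ^ (p(G) p(v)) F v \<otimes> G w\<close>\<close>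

definition tensor_map :: "(bit \<Rightarrow> 'k::ring_1 set) \<Rightarrow> ('k, 'm, 'e) supermod_scheme \<Rightarrow>
    ('k, 'n, 'f) supermod_scheme \<Rightarrow> ('k, 'm', 'e') supermod_scheme \<Rightarrow>
    ('k, 'n', 'f') supermod_scheme \<Rightarrow> ('m \<Rightarrow> 'm') \<Rightarrow> ('n \<Rightarrow> 'n') \<Rightarrow>
    ('m \<times> 'n \<Rightarrow>\<^sub>0 int) set \<Rightarrow> ('m' \<times> 'n' \<Rightarrow>\<^sub>0 int) set"
  where "tensor_map K M N M' N' F G =
    (let V = tensor_mod K M' N'
     in tensor_lift K M N V (\<lambda>v w.
       \<Oplus>\<^bsub>V\<^esub>p\<in>{0,1}. \<Oplus>\<^bsub>V\<^esub>q\<in>{0,1}.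
         pure_tensor K M' N' (F (component M p v)) (component (Hom_mod K N N') q G w)
           \<star>\<^bsub>V\<^esub> ksign (q * p)))"

section \<open>Tensor algebra and symmetric algebra\<close>

text \<open>The free monoid, written additively as \<^typ>\<open>'a \<Rightarrow>\<^sub>0 int\<close> requires of its exponents.\<close>

datatype 'a fmon = FMon (letters: "'a list")

instantiation fmon :: (type) monoid_add
begin

definition zero_fmon :: "'a fmon" where "0 = FMon []"

definition plus_fmon :: "'a fmon \<Rightarrow> 'a fmon \<Rightarrow> 'a fmon"
  where "u + v = FMon (letters u @ letters v)"

instance by standard (auto simp: zero_fmon_def plus_fmon_def)

end

text \<open>
  \<open>T(L)\<close> is the tensor ring of the \<open>K\<close>-bimodule \<open>L\<close>: the ring generated by the scalars and the
  elements of \<open>L\<close>, subject to the relations saying that the scalars form an image of the ring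
  \<open>K\<close> and that \<open>L\<close> maps into it by a morphism of \<open>K\<close>-bimodules.  Without these relations it is
  the ring of noncommutative integer polynomials in the letters \<open>Inl \<alpha>\<close> and \<open>Inr x\<close>, which is
  the monoid ring of \<^typ>\<open>('k + 'm) fmon\<close>.
\<close>

type_synonym ('k, 'm) words = "('k + 'm) fmon \<Rightarrow>\<^sub>0 int"

definition word_ring :: "('k, 'm, 'e) supermod_scheme \<Rightarrow> ('k, 'm) words ring"
  where "word_ring L =
    \<lparr>carrier = {f. \<forall>w\<in>Poly_Mapping.keys f. set (letters w) \<subseteq> range Inl \<union> Inr ` carrier L},
     monoid.mult = (*), one = 1, ring.zero = 0, add = (+)\<rparr>"

definition scal_word :: "'k \<Rightarrow> ('k, 'm) words"
  where "scal_word \<alpha> = frag_of (FMon [Inl \<alpha>])"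

definition vec_word :: "'m \<Rightarrow> ('k, 'm) words"
  where "vec_word x = frag_of (FMon [Inr x])"

definition tens_alg_rel :: "(bit \<Rightarrow> 'k::ring_1 set) \<Rightarrow> ('k, 'm, 'e) supermod_scheme \<Rightarrow>
    ('k, 'm) words set"
  where "tens_alg_rel K L =
    {scal_word 1 - 1} \<union>
    {scal_word (\<alpha> + \<beta>) - scal_word \<alpha> - scal_word \<beta> | \<alpha> \<beta>. True} \<union>
    {scal_word (\<alpha> * \<beta>) - scal_word \<alpha> * scal_word \<beta> | \<alpha> \<beta>. True} \<union>
    {vec_word (x \<oplus>\<^bsub>L\<^esub> y) - vec_word x - vec_word y | x y. x \<in> carrier L \<and> y \<in> carrier L} \<union>
    {vec_word (x \<star>\<^bsub>L\<^esub> \<alpha>) - vec_word x * scal_word \<alpha> | x \<alpha>. x \<in> carrier L} \<union>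
    {vec_word (lsmult K L \<alpha> x) - scal_word \<alpha> * vec_word x | x \<alpha>. x \<in> carrier L}"

definition tens_alg_ker :: "(bit \<Rightarrow> 'k::ring_1 set) \<Rightarrow> ('k, 'm, 'e) supermod_scheme \<Rightarrow>
    ('k, 'm) words set"
  where "tens_alg_ker K L = Idl\<^bsub>word_ring L\<^esub> (tens_alg_rel K L)"

definition tens_scal :: "(bit \<Rightarrow> 'k::ring_1 set) \<Rightarrow> ('k, 'm, 'e) supermod_scheme \<Rightarrow>
    'k \<Rightarrow> ('k, 'm) words set"
  where "tens_scal K L \<alpha> = tens_alg_ker K L +>\<^bsub>word_ring L\<^esub> scal_word \<alpha>"

definition tens_vec :: "(bit \<Rightarrow> 'k::ring_1 set) \<Rightarrow> ('k, 'm, 'e) supermod_scheme \<Rightarrow>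
    'm \<Rightarrow> ('k, 'm) words set"
  where "tens_vec K L x = tens_alg_ker K L +>\<^bsub>word_ring L\<^esub> vec_word x"

definition list_prod :: "('a, 'e) monoid_scheme \<Rightarrow> 'a list \<Rightarrow> 'a"
  where "list_prod R xs = foldr (\<otimes>\<^bsub>R\<^esub>) xs \<one>\<^bsub>R\<^esub>"

text \<open>The parity of \<open>x\<^sub>1 \<otimes> \<dots> \<otimes> x\<^sub>n \<alpha>\<close> is \<open>p(x\<^sub>1) + \<dots> + p(x\<^sub>n) + p(\<alpha>)\<close>.\<close>

definition tens_alg :: "(bit \<Rightarrow> 'k::ring_1 set) \<Rightarrow> ('k, 'm, 'e) supermod_scheme \<Rightarrow>
    ('k, ('k, 'm) words set) supermod"
  where "tens_alg K L =
    (let R = word_ring L Quot tens_alg_ker K L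
     in ring.extend R (supermod.fields
       (\<lambda>t \<alpha>. t \<otimes>\<^bsub>R\<^esub> tens_scal K L \<alpha>)
       (\<lambda>r. generate (add_monoid R)
          {list_prod R (map (tens_vec K L) xs) \<otimes>\<^bsub>R\<^esub> tens_scal K L \<alpha> | xs ps \<alpha> q.
             list_all2 (\<lambda>x p. x \<in> grade L p) xs ps \<and> \<alpha> \<in> K q \<and> sum_list ps + q = r})))"

definition sym_ideal :: "(bit \<Rightarrow> 'k::ring_1 set) \<Rightarrow> ('k, 'm, 'e) supermod_scheme \<Rightarrow>
    ('k, 'm) words set set"
  where "sym_ideal K L =
    (let T = tens_alg K L; \<iota> = tens_vec K L
     in Idl\<^bsub>T\<^esub>
      ({\<iota> v \<otimes>\<^bsub>T\<^esub> \<iota> w \<ominus>\<^bsub>T\<^esub> (\<iota> w \<otimes>\<^bsub>T\<^esub> \<iota> v) \<star>\<^bsub>T\<^esub> ksign (p * q) | v w p q.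
          v \<in> grade L p \<and> w \<in> grade L q} \<union>
       {\<iota> u \<otimes>\<^bsub>T\<^esub> \<iota> u | u. u \<in> grade L 1}))"

definition quot_alg :: "('k::ring_1, 'a, 'e) supermod_scheme \<Rightarrow> 'a set \<Rightarrow> ('k, 'a set) supermod"
  where "quot_alg A I =
    ring.extend (A Quot I) (supermod.fields
      (\<lambda>C \<alpha>. C \<otimes>\<^bsub>A Quot I\<^esub> (I +>\<^bsub>A\<^esub> (\<one>\<^bsub>A\<^esub> \<star>\<^bsub>A\<^esub> \<alpha>)))
      (\<lambda>p. (\<lambda>a. I +>\<^bsub>A\<^esub> a) ` grade A p))"

definition sym_alg :: "(bit \<Rightarrow> 'k::ring_1 set) \<Rightarrow> ('k, 'm, 'e) supermod_scheme \<Rightarrow>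
    ('k, ('k, 'm) words set set) supermod"
  where "sym_alg K L = quot_alg (tens_alg K L) (sym_ideal K L)"

definition sym_vec :: "(bit \<Rightarrow> 'k::ring_1 set) \<Rightarrow> ('k, 'm, 'e) supermod_scheme \<Rightarrow>
    'm \<Rightarrow> ('k, 'm) words set set"
  where "sym_vec K L x = sym_ideal K L +>\<^bsub>tens_alg K L\<^esub> tens_vec K L x"

definition superalg_hom :: "(bit \<Rightarrow> 'k::ring_1 set) \<Rightarrow> ('k, 'a, 'e) supermod_scheme \<Rightarrow>
    ('k, 'b, 'f) supermod_scheme \<Rightarrow> ('a \<Rightarrow> 'b) set"
  where "superalg_hom K A B = ring_hom A B \<inter> grade (Hom_mod K A B) 0"

definition sym_coprod :: "(bit \<Rightarrow> 'k::ring_1 set) \<Rightarrow> ('k, 'm, 'e) supermod_scheme \<Rightarrow>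
    ('k, 'm) words set set \<Rightarrow> (('k, 'm) words set set \<times> ('k, 'm) words set set \<Rightarrow>\<^sub>0 int) set"
  where "sym_coprod K L =
    (let S = sym_alg K L; SS = tensor_alg K S S
     in THE D. D \<in> superalg_hom K S SS \<and>
       (\<forall>x\<in>carrier L. D (sym_vec K L x) =
          pure_tensor K S S (sym_vec K L x) \<one>\<^bsub>S\<^esub> \<oplus>\<^bsub>SS\<^esub> pure_tensor K S S \<one>\<^bsub>S\<^esub> (sym_vec K L x)))"

definition sym_mult :: "(bit \<Rightarrow> 'k::ring_1 set) \<Rightarrow> ('k, 'm, 'e) supermod_scheme \<Rightarrow>
    (('k, 'm) words set set \<times> ('k, 'm) words set set \<Rightarrow>\<^sub>0 int) set \<Rightarrow> ('k, 'm) words set set"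
  where "sym_mult K L =
    (let S = sym_alg K L in tensor_lift K S S S (\<lambda>x y. x \<otimes>\<^bsub>S\<^esub> y))"

definition coderivation :: "(bit \<Rightarrow> 'k::ring_1 set) \<Rightarrow> ('k, 'm, 'e) supermod_scheme \<Rightarrow>
    (('k, 'm) words set set \<Rightarrow> ('k, 'm) words set set) \<Rightarrow> bool"
  where "coderivation K L F \<longleftrightarrow>
    (let S = sym_alg K L; I = (\<lambda>x\<in>carrier S. x)
     in F \<in> carrier (Hom_mod K S S) \<and>
       (\<forall>x\<in>carrier S. sym_coprod K L (F x) =
          tensor_map K S S S S F I (sym_coprod K L x) \<oplus>\<^bsub>tensor_mod K S S\<^esub>
          tensor_map K S S S S I F (sym_coprod K L x)))"

section \<open>The maps attached to a power series\<close>

text \<open>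
  Parity of the Koszul sign of the reordering \<open>X\<^bsub>s 0\<^esub>, \<dots>, X\<^bsub>s (n - 1)\<^esub>\<close> of homogeneous elements
  \<open>X\<^sub>i\<close> of parity \<open>ps ! i\<close>: each inversion of two odd elements contributes a sign.
\<close>

definition koszul :: "bit list \<Rightarrow> (nat \<Rightarrow> nat) \<Rightarrow> bit"
  where "koszul ps s =
    (\<Sum>(i, j) \<in> {(i, j). i < j \<and> j < length ps \<and> s j < s i}. ps ! s i * ps ! s j)"

text \<open>
  \<open>\<phi>\<^sup>a\<close>, with indices starting from 0 and with the sum over the homogeneous components of \<open>a\<close>.
  The value at 1 is the case of the empty list.
\<close>

definition series_map :: "(bit \<Rightarrow> 'k::ring_1 set) \<Rightarrow> ('k, 'm, 'e) lie_super_scheme \<Rightarrow> 'k fps \<Rightarrow> 'm \<Rightarrow>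
    ('k, 'm) words set set \<Rightarrow> 'm"
  where "series_map K L \<phi> a =
    (let S = sym_alg K L
     in THE F. F \<in> carrier (Hom_mod K S L) \<and>
       (\<forall>X ps. list_all2 (\<lambda>x p. x \<in> grade L p) X ps \<longrightarrow>
          F (list_prod S (map (sym_vec K L) X)) =
            (\<Oplus>\<^bsub>L\<^esub>q\<in>{0,1}.
               lsmult K L (fps_nth \<phi> (length X))
                 (\<Oplus>\<^bsub>L\<^esub>s\<in>{s. s permutes {..<length X}}.
                    foldr (\<lambda>i. bracket L (X ! s i)) [0..<length X] (component L q a)
                      \<star>\<^bsub>L\<^esub> ksign (koszul ps s))
               \<star>\<^bsub>L\<^esub> ksign (q * sum_list ps))))"

text \<open>
  \<open>\<Phi>\<^sup>a = Mult \<circ> (id \<otimes> \<phi>\<^sup>a) \<circ> \<Delta>\<close>, where \<open>L\<close> is regarded as a submodule of \<open>S(L)\<close>.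
\<close>

definition series_coder :: "(bit \<Rightarrow> 'k::ring_1 set) \<Rightarrow> ('k, 'm, 'e) lie_super_scheme \<Rightarrow> 'k fps \<Rightarrow> 'm \<Rightarrow>
    ('k, 'm) words set set \<Rightarrow> ('k, 'm) words set set"
  where "series_coder K L \<phi> a =
    (let S = sym_alg K L;
         f = compose (carrier S) (sym_vec K L) (series_map K L \<phi> a)
     in (\<lambda>x\<in>carrier S.
          sym_mult K L (tensor_map K S S S S (\<lambda>y\<in>carrier S. y) f (sym_coprod K L x))))"

definition rep_by_coderivations :: "(bit \<Rightarrow> 'k::ring_1 set) \<Rightarrow> ('k, 'm, 'e) lie_super_scheme \<Rightarrow>
    ('m \<Rightarrow> ('k, 'm) words set set \<Rightarrow> ('k, 'm) words set set) \<Rightarrow> bool"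
  where "rep_by_coderivations K L \<Phi> \<longleftrightarrow>
    lie_hom K L (End_lie K (sym_alg K L)) \<Phi> \<and> (\<forall>a\<in>carrier L. coderivation K L (\<Phi> a))"

text \<open>\<open>ring_inv\<close> is only applied to units.\<close>

definition ring_inv :: "'k::ring_1 \<Rightarrow> 'k"
  where "ring_inv x = (THE y. x * y = 1 \<and> y * x = 1)"

text \<open>\<open>e\<^bsup>t/c\<^esup>\<close> and \<open>t / (e\<^bsup>t/c\<^esup> - 1)\<close>; the library's exponential series is restricted to fields.\<close>

definition exp_series :: "'k::ring_1 \<Rightarrow> 'k fps"
  where "exp_series c = Abs_fps (\<lambda>n. ring_inv (of_nat (fact n)) * ring_inv c ^ n)"

definition phi_series :: "(bit \<Rightarrow> 'k::ring_1 set) \<Rightarrow> 'k \<Rightarrow> 'k fps"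
  where "phi_series K c =
    (THE \<phi>. (\<forall>n. fps_nth \<phi> n \<in> K 0) \<and> \<phi> * (exp_series c - 1) = fps_X)"

lemma ring_inv_unique:
  fixes x y :: "'k::ring_1"
  assumes "x * y = 1" "y * x = 1"
  shows "ring_inv x = y"
  unfolding ring_inv_def
proof (rule the_equality)
  show "x * y = 1 \<and> y * x = 1" using assms by simp
next
  fix z assume z: "x * z = 1 \<and> z * x = 1"
  have "z = (y * x) * z" using assms by simp
  also have "\<dots> = y" using z by (simp add: mult.assoc)
  finally show "z = y" .
qed

context comm_superring
begin

lemma K_0_closed:
  shows K_zero: "0 \<in> K 0"
    and K_add: "\<lbrakk>a \<in> K 0; b \<in> K 0\<rbrakk> \<Longrightarrow> a + b \<in> K 0"
    and K_minus: "a \<in> K 0 \<Longrightarrow> - a \<in> K 0"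
proof -
  let ?A = "add_monoid (regular_mod K)"
  have sg: "subgroup (K p) ?A" for p
    using K_grading unfolding supergrading_def regular_mod_def by simp
  show z: "0 \<in> K 0" using subgroup.one_closed[OF sg[of 0]] by (simp add: regular_mod_def)
  show "\<lbrakk>a \<in> K 0; b \<in> K 0\<rbrakk> \<Longrightarrow> a + b \<in> K 0"
    using subgroup.m_closed[OF sg[of 0], of a b] by (simp add: regular_mod_def)
  have "inv\<^bsub>?A\<^esub> a = - a" for a :: 'k
    unfolding m_inv_def regular_mod_def
    by (rule the_equality) (auto simp: eq_neg_iff_add_eq_0)
  then show "a \<in> K 0 \<Longrightarrow> - a \<in> K 0"
    using subgroup.m_inv_closed[OF sg[of 0], of a] by simp
qed

lemma K_mult_0: "\<lbrakk>a \<in> K 0; b \<in> K 0\<rbrakk> \<Longrightarrow> a * b \<in> K 0"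
  using K_mult[of a 0 b 0] by simp

lemma K_sum: "(\<And>i. i \<in> I \<Longrightarrow> f i \<in> K 0) \<Longrightarrow> (\<Sum>i\<in>I. f i) \<in> K 0"
  by (induction I rule: infinite_finite_induct) (auto simp: K_zero K_add)

lemma K_of_nat: "of_nat n \<in> K 0"
  by (induction n) (auto simp: K_zero K_add K_one)

lemma K_power: "a \<in> K 0 \<Longrightarrow> a ^ n \<in> K 0"
  by (induction n) (auto simp: K_one K_mult_0)

lemma K_ring_inv_of_nat:
  assumes "of_nat n * (x::'k) = 1"
  shows "(ring_inv (of_nat n) :: 'k) \<in> K 0" "of_nat n * ring_inv (of_nat n) = (1::'k)"
proof -
  have inv: "ring_inv (of_nat n) = x"
    by (rule ring_inv_unique) (use assms mult_of_nat_commute[of n x] in simp_all)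
  have dec: "\<exists>!uv. fst uv \<in> K 0 \<and> snd uv \<in> K 1 \<and> y = fst uv + snd uv" for y
    using K_grading unfolding supergrading_def regular_mod_def by simp
  obtain u v where uv: "u \<in> K 0" "v \<in> K 1" "x = u + v"
    using ex1_implies_ex[OF dec[of x]] by blast
  have nv: "of_nat n * v \<in> K 1" using K_mult[OF K_of_nat uv(2)] by simp
  have nu: "of_nat n * u \<in> K 0" using K_mult_0[OF K_of_nat uv(1)] .
  have eq: "1 = of_nat n * u + of_nat n * v" using assms uv by (simp add: distrib_left)
  have z1: "0 \<in> K 1"
    using K_grading subgroup.one_closed[of "K 1" "add_monoid (regular_mod K)"]
    unfolding supergrading_def regular_mod_def by simp
  have "(of_nat n * u, of_nat n * v) = (1, 0)"
    by (rule ex1E[OF dec[of 1]]) (metis add.right_neutral eq fst_conv snd_conv nu nv z1 K_one)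
  then have "of_nat n * u = 1" by simp
  then have "ring_inv (of_nat n) = u"
    by (intro ring_inv_unique) (use mult_of_nat_commute[of n u] in simp_all)
  then show "ring_inv (of_nat n) \<in> K 0" using uv by simp
  show "of_nat n * ring_inv (of_nat n) = (1::'k)" using inv assms by simp
qed

text \<open>The description of \<^const>\<open>phi_series\<close> is satisfied by exactly one series.\<close>

lemma phi_series_ex1:
  assumes rat: "\<forall>n::nat. n > 0 \<longrightarrow> (\<exists>x::'k. of_nat n * x = 1)"
    and c: "c \<in> even_units K"
  shows "\<exists>!\<phi>. (\<forall>n. fps_nth \<phi> n \<in> K 0) \<and> \<phi> * (exp_series c - 1) = fps_X"
proof -
  obtain d where d: "c \<in> K 0" "d \<in> K 0" "c * d = 1" "d * c = 1"
    using c by (auto simp: even_units_def)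
  have dc: "ring_inv c = d" by (rule ring_inv_unique) (use d in auto)
  have one: "ring_inv 1 = (1::'k)" by (rule ring_inv_unique) auto
  define u where "u = fps_shift 1 (exp_series c)"
  have e: "exp_series c - 1 = u * fps_X"
  proof (rule fps_ext)
    fix n show "fps_nth (exp_series c - 1) n = fps_nth (u * fps_X) n"
      by (cases n) (simp_all add: u_def exp_series_def one)
  qed
  have u0: "fps_nth u 0 = d" by (simp add: u_def exp_series_def one dc)
  have uK: "fps_nth u n \<in> K 0" for n
  proof -
    have "0 < (fact (Suc n) :: nat)" by (rule fact_gt_zero)
    then obtain x :: 'k where "of_nat (fact (Suc n)) * x = 1" using rat by blast
    then have "ring_inv (of_nat (fact (Suc n))) \<in> K 0" by (rule K_ring_inv_of_nat)
    then show ?thesis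
      unfolding u_def exp_series_def fps_shift_nth fps_nth_Abs_fps dc Suc_eq_plus1[symmetric]
      by (intro K_mult_0 K_power d)
  qed
  define l where "l = fps_left_inverse u c"
  define r where "r = fps_right_inverse u c"
  have lu: "l * u = 1" unfolding l_def by (rule fps_left_inverse) (simp add: u0 d)
  have ur: "u * r = 1" unfolding r_def by (rule fps_right_inverse) (simp add: u0 d)
  have lK: "fps_nth l n \<in> K 0" for n
  proof (induction n rule: less_induct)
    case (less n)
    show ?case
    proof (cases n)
      case 0 then show ?thesis using d by (simp add: l_def)
    next
      case (Suc m)
      have "fps_nth l n = - (\<Sum>i=0..m. fps_nth l i * fps_nth u (n - i)) * c"
        by (simp add: l_def Suc sum_negf)
      also have "\<dots> \<in> K 0"
        using less Suc by (intro K_mult_0 K_minus K_sum uK d) auto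
      finally show ?thesis .
    qed
  qed
  show ?thesis
  proof (rule ex1I[of _ l], intro conjI allI lK)
    show "l * (exp_series c - 1) = fps_X"
      unfolding e mult.assoc[symmetric] lu by simp
  next
    fix \<phi> assume "(\<forall>n. fps_nth \<phi> n \<in> K 0) \<and> \<phi> * (exp_series c - 1) = fps_X"
    then have "\<phi> * u * fps_X = 1 * fps_X" unfolding e mult.assoc by simp
    then have "fps_shift 1 (\<phi> * u * fps_X) = fps_shift 1 (1 * fps_X)" by (rule arg_cong)
    then have pu: "\<phi> * u = 1" unfolding fps_shift_times_fps_X' .
    have "\<phi> = \<phi> * (u * r)" by (simp add: ur)
    also have "\<dots> = r" unfolding mult.assoc[symmetric] pu by simp
    finally have "\<phi> = r" .
    moreover have "l = l * (u * r)" by (simp add: ur)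
    then have "l = r" unfolding mult.assoc[symmetric] lu by simp
    ultimately show "\<phi> = l" by simp
  qed
qed

end

end

theory Submission
  imports Defs "HOL-Computational_Algebra.Polynomial"
begin

text \<open>
  A coderivation \<open>\<Phi>\<^sub>f = Mult \<circ> (id \<otimes> f) \<circ> \<Delta>\<close> is determined by \<open>f : S(L) \<rightarrow> L\<close>, and the supercommutator of \<open>\<Phi>\<^sub>f\<close> and
  \<open>\<Phi>\<^sub>g\<close> is \<open>\<Phi>\<^sub>h\<close> with \<open>h = f \<circ> \<Phi>\<^sub>g - (-1) ^ (p(f) p(g)) g \<circ> \<Phi>\<^sub>f\<close>.  So the task is to compare maps \<open>S(L) \<rightarrow> L\<close>, which
  form a Lie superalgebra under the convolution bracket.  In it \<open>\<phi>\<^sup>a = \<Sum>\<^sub>n c\<^sub>n (ad \<theta>)\<^sup>n a\<close>, where \<open>\<theta>\<close> is the projection onto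
  degree 1 and \<open>a\<close> is regarded as a constant map.  Composition with \<open>\<Phi>\<^sub>g\<close> is a derivation of the
  convolution bracket that sends \<open>\<theta>\<close> to \<open>g\<close> and kills constants; hence the part of \<open>h\<close> of degree \<open>N\<close> is
  a combination of the brackets of \<open>(ad \<theta>)\<^sup>l a\<close> and \<open>(ad \<theta>)\<^sup>k b\<close> with \<open>k + l = N\<close>, and so is
  \<open>(ad \<theta>)\<^sup>N [a, b]\<close> by the Leibniz rule.  The coefficients agree by an identity for the \<open>c\<^sub>n\<close> that is equivalent to
  the functional equation \<open>\<psi>(s + t) (1 + \<psi>(s) + \<psi>(t)) = \<psi>(s) \<psi>(t)\<close> of \<open>\<psi>(t) = 1 / (e\<^sup>t - 1)\<close>.
\<close>

section \<open>Signs and gradings\<close>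

text \<open>\<open>S(L)\<close> has no basis, since \<open>L\<close> need not be free: maps out of
  it come only from its universal property, and equalities are tested on products of homogeneous
  letters. In particular the signed sum over permutations that defines \<phi>^a is not visibly well
  defined on \<open>S(L)\<close>. The iterated bracket with \<theta> is, because it is built from
  the coproduct; the sum over permutations is then computed as its value on a product. The
  coproduct, the convolution bracket and composition with a coderivation all obey a Leibniz rule in
  the first letter, so each identity between them becomes an induction on lists in which a letter is
  fed to one of the maps. For the coefficients, let s and t stand for ad \<theta> acting on a and on
  b. Composing (ad \<theta>)^n a with the coderivation of \<phi>^b gives minus the difference
  quotient ((s + t)^n - s^n) / t times \<phi>(t). Summing over n, and exchanging a and b for the
  other half of the commutator, the relation to be proved reads (\<phi>(s + t) - \<phi>(s))
  \<phi>(t) / t + (\<phi>(s + t) - \<phi>(t)) \<phi>(s) / s + \<phi>(s + t) = 0. For c = 1 this is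
  the equation for \<psi>(t) = \<phi>(t) / t; general c only rescales t and \<phi>.\<close>

lemma ksign_0 [simp]: "ksign 0 = (1::'k::ring_1)"
  and ksign_1 [simp]: "ksign 1 = (- 1::'k::ring_1)"
  by (simp_all add: ksign_def)

lemma ksign_mult: "ksign p * ksign q = (ksign (p + q) :: 'k::ring_1)"
  by (cases p; cases q) simp_all

lemma ksign_commute: "ksign p * a = a * (ksign p :: 'k::ring_1)"
  by (cases p) simp_all

declare add_bit_eq_xor [simp del] mult_bit_eq_and [simp del]

lemma bit_one_add_one [simp]: "1 + 1 = (0::bit)"
  by (simp add: one_add_one)

lemma bit_add_self [simp]: "p + p = (0::bit)"
  by (cases p) simp_all

lemma bit_add_self_left [simp]: "p + (p + q) = (q::bit)"
  by (cases p; cases q) simp_all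

lemma bit_mult_self [simp]: "p * p = (p::bit)"
  by (cases p) simp_all

lemma bit_mult_self_left [simp]: "p * (p * q) = (p * q::bit)"
  by (cases p) simp_all

lemma bit_neq_iff: "p \<noteq> q \<longleftrightarrow> q = p + (1::bit)"
  by (cases p; cases q) simp_all

lemmas bit_ac = add.commute add.left_commute add.assoc mult.commute mult.left_commute mult.assoc
  distrib_left distrib_right

lemma (in abelian_monoid) finsum_bit:
  "f 0 \<in> carrier G \<Longrightarrow> f 1 \<in> carrier G \<Longrightarrow> (\<Oplus>p\<in>{0, 1::bit}. f p) = f 0 \<oplus> f 1"
  by (subst finsum_insert) (auto simp: finsum_insert)

lemma (in abelian_group) idem_zero: "x \<in> carrier G \<Longrightarrow> x \<oplus> x = x \<Longrightarrow> x = \<zero>"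
  using add.l_cancel_one[of x x] by simp

lemma (in abelian_group) eq_of_diff_zero:
  assumes "x \<in> carrier G" "y \<in> carrier G" "x \<oplus> \<ominus> y = \<zero>"
  shows "x = y"
  using minus_equality[OF assms(3)] assms by simp

lemma (in abelian_group) abelian_group: "abelian_group G"
  by (rule abelian_group_axioms)

section \<open>Additive maps between abelian groups\<close>

definition additive_map :: "('a, 'x) ring_scheme \<Rightarrow> ('b, 'y) ring_scheme \<Rightarrow> ('a \<Rightarrow> 'b) \<Rightarrow> bool"
  where "additive_map M N F \<longleftrightarrow> (\<forall>x\<in>carrier M. F x \<in> carrier N) \<and>
    (\<forall>x\<in>carrier M. \<forall>y\<in>carrier M. F (x \<oplus>\<^bsub>M\<^esub> y) = F x \<oplus>\<^bsub>N\<^esub> F y)"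

lemma additive_map_hom: "additive_map M N F \<longleftrightarrow> F \<in> hom (add_monoid M) (add_monoid N)"
  by (auto simp: additive_map_def hom_def)

lemma additive_mapI:
  "(\<And>x. x \<in> carrier M \<Longrightarrow> F x \<in> carrier N) \<Longrightarrow>
    (\<And>x y. x \<in> carrier M \<Longrightarrow> y \<in> carrier M \<Longrightarrow> F (x \<oplus>\<^bsub>M\<^esub> y) = F x \<oplus>\<^bsub>N\<^esub> F y) \<Longrightarrow> additive_map M N F"
  by (simp add: additive_map_def)

lemma additive_map_closed: "additive_map M N F \<Longrightarrow> x \<in> carrier M \<Longrightarrow> F x \<in> carrier N"
  and additive_map_add: "additive_map M N F \<Longrightarrow> x \<in> carrier M \<Longrightarrow> y \<in> carrier M \<Longrightarrow>
    F (x \<oplus>\<^bsub>M\<^esub> y) = F x \<oplus>\<^bsub>N\<^esub> F y"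
  by (auto simp: additive_map_def)

lemma additive_map_zero:
  assumes "abelian_group M" "abelian_group N" "additive_map M N F"
  shows "F \<zero>\<^bsub>M\<^esub> = \<zero>\<^bsub>N\<^esub>"
proof -
  interpret M: abelian_group M by fact
  interpret N: abelian_group N by fact
  have c: "F \<zero>\<^bsub>M\<^esub> \<in> carrier N" using additive_map_closed[OF assms(3)] by simp
  show ?thesis
    by (rule N.idem_zero[OF c])
      (use additive_map_add[OF assms(3), of "\<zero>\<^bsub>M\<^esub>" "\<zero>\<^bsub>M\<^esub>", symmetric] in simp)
qed

lemma additive_map_minus:
  assumes "abelian_group M" "abelian_group N" "additive_map M N F" "x \<in> carrier M"
  shows "F (\<ominus>\<^bsub>M\<^esub> x) = \<ominus>\<^bsub>N\<^esub> F x"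
proof -
  interpret M: abelian_group M by fact
  interpret N: abelian_group N by fact
  have "F (\<ominus>\<^bsub>M\<^esub> x) \<oplus>\<^bsub>N\<^esub> F x = \<zero>\<^bsub>N\<^esub>"
    using additive_map_add[OF assms(3), of "\<ominus>\<^bsub>M\<^esub> x" x] additive_map_zero[OF assms(1-3)] assms(4)
    by (simp add: M.l_neg)
  then show ?thesis
    by (rule N.minus_equality[symmetric]) (simp_all add: additive_map_closed[OF assms(3)] assms(4))
qed

lemma additive_map_compose:
  "additive_map M N F \<Longrightarrow> additive_map N P G \<Longrightarrow> additive_map M P (\<lambda>x. G (F x))"
  by (simp add: additive_map_def)

lemma additive_map_sum:
  assumes "abelian_group N" "additive_map M N F" "additive_map M N G"
  shows "additive_map M N (\<lambda>x. F x \<oplus>\<^bsub>N\<^esub> G x)"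
proof -
  interpret N: abelian_group N by fact
  show ?thesis using assms(2,3) by (auto simp: additive_map_def N.a_ac)
qed

lemma additive_map_finsum:
  assumes "abelian_group M" "abelian_group N" "additive_map M N F" "\<And>i. i \<in> I \<Longrightarrow> f i \<in> carrier M"
  shows "F (finsum M f I) = finsum N (\<lambda>i. F (f i)) I"
proof -
  interpret M: abelian_group M by fact
  interpret N: abelian_group N by fact
  show ?thesis using assms(4)
  proof (induction I rule: infinite_finite_induct)
    case (insert i I)
    then show ?case
      by (subst M.finsum_insert; (subst N.finsum_insert)?)
        (auto simp: Pi_def additive_map_closed[OF assms(3)] additive_map_add[OF assms(3)])
  qed (use additive_map_zero[OF assms(1-3)] in auto)
qed

section \<open>Graded groups and homogeneous components\<close>

locale graded_group = abelian_group M
  for M :: "('k, 'm, 'e) supermod_scheme" (structure) +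
  assumes grading: "supergrading M"
begin

lemma grade_subgroup: "subgroup (grade M p) (add_monoid M)"
  using grading by (simp add: supergrading_def)

lemma grade_carrier: "m \<in> grade M p \<Longrightarrow> m \<in> carrier M"
  using subgroup.subset[OF grade_subgroup[of p]] by auto

lemma grade_zero [simp]: "\<zero> \<in> grade M p"
  using subgroup.one_closed[OF grade_subgroup[of p]] by simp

lemma grade_add: "m \<in> grade M p \<Longrightarrow> n \<in> grade M p \<Longrightarrow> m \<oplus> n \<in> grade M p"
  using subgroup.m_closed[OF grade_subgroup[of p]] by simp

lemma grade_minus: "m \<in> grade M p \<Longrightarrow> \<ominus> m \<in> grade M p"
  using subgroup.m_inv_closed[OF grade_subgroup[of p]] by (simp add: a_inv_def)

lemma grade_decomp_unique:
  assumes "u \<in> grade M 0" "v \<in> grade M 1" "u' \<in> grade M 0" "v' \<in> grade M 1" "u \<oplus> v = u' \<oplus> v'"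
  shows "u = u'" "v = v'"
proof -
  have "u \<oplus> v \<in> carrier M" using assms grade_carrier by auto
  then have "\<exists>!uv. fst uv \<in> grade M 0 \<and> snd uv \<in> grade M 1 \<and> u \<oplus> v = fst uv \<oplus> snd uv"
    using grading by (auto simp: supergrading_def)
  then have "(u, v) = (u', v')" using assms by (elim ex1E) (metis fst_conv snd_conv)
  then show "u = u'" "v = v'" by auto
qed

lemma grade_decomp_unique':
  assumes "u \<in> grade M p" "v \<in> grade M (p + 1)" "u' \<in> grade M p" "v' \<in> grade M (p + 1)"
    "u \<oplus> v = u' \<oplus> v'"
  shows "u = u'"
proof (cases "p = 0")
  case True
  then show ?thesis using grade_decomp_unique[of u v u' v'] assms by simp
next
  case False
  then have 1: "p = 1" by simp
  then have "v \<oplus> u = v' \<oplus> u'" using assms by (metis a_comm grade_carrier)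
  then show ?thesis using grade_decomp_unique[of v u v' u'] assms 1 by simp
qed

lemma component_eqI:
  assumes "u \<in> grade M p" "v \<in> grade M (p + 1)"
  shows "component M p (u \<oplus> v) = u"
  unfolding component_def
  by (rule the_equality) (use assms grade_decomp_unique' in blast)+

lemma ex_decomp:
  assumes "m \<in> carrier M"
  shows "\<exists>u\<in>grade M p. \<exists>v\<in>grade M (p + 1). m = u \<oplus> v"
proof -
  obtain u v where uv: "u \<in> grade M 0" "v \<in> grade M 1" "m = u \<oplus> v"
    using grading assms unfolding supergrading_def by fast
  then have "m = v \<oplus> u" by (simp add: a_comm grade_carrier)
  with uv have "\<exists>u\<in>grade M 0. \<exists>v\<in>grade M 1. m = u \<oplus> v" "\<exists>u\<in>grade M 1. \<exists>v\<in>grade M 0. m = u \<oplus> v"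
    by blast+
  then show ?thesis by (cases p) simp_all
qed

lemma component_grade: "m \<in> carrier M \<Longrightarrow> component M p m \<in> grade M p"
  using ex_decomp[of m p] component_eqI by force

lemma component_closed [simp]: "m \<in> carrier M \<Longrightarrow> component M p m \<in> carrier M"
  using component_grade grade_carrier by blast

lemma component_of_grade: "m \<in> grade M q \<Longrightarrow> component M p m = (if p = q then m else \<zero>)"
  using component_eqI[of m q "\<zero>"] component_eqI[of "\<zero>" "q + 1" m] bit_neq_iff[of q p]
  by (auto simp: grade_carrier)

lemma component_sum: "m \<in> carrier M \<Longrightarrow> component M 0 m \<oplus> component M 1 m = m"
proof -
  assume m: "m \<in> carrier M"
  obtain u v where uv: "u \<in> grade M 0" "v \<in> grade M 1" "m = u \<oplus> v"
    using ex_decomp[OF m, of 0] by auto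
  then have "m = v \<oplus> u" by (simp add: a_comm grade_carrier)
  then show ?thesis using component_eqI[of u 0 v] component_eqI[of v 1 u] uv by simp
qed

lemma component_add:
  assumes "m \<in> carrier M" "n \<in> carrier M"
  shows "component M p (m \<oplus> n) = component M p m \<oplus> component M p n"
proof -
  obtain u v where m: "u \<in> grade M p" "v \<in> grade M (p + 1)" "m = u \<oplus> v"
    using ex_decomp[OF assms(1)] by blast
  obtain u' v' where n: "u' \<in> grade M p" "v' \<in> grade M (p + 1)" "n = u' \<oplus> v'"
    using ex_decomp[OF assms(2)] by blast
  have "m \<oplus> n = (u \<oplus> u') \<oplus> (v \<oplus> v')" using m n grade_carrier by (simp add: a_ac)
  then show ?thesis
    using component_eqI[of "u \<oplus> u'" p "v \<oplus> v'"] m n by (simp add: component_eqI grade_add)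
qed

lemma component_additive: "additive_map M M (component M p)"
  by (simp add: additive_map_def component_add)

lemma grade_induct:
  assumes "m \<in> carrier M"
    and "\<And>p m. m \<in> grade M p \<Longrightarrow> P m"
    and "\<And>m n. m \<in> carrier M \<Longrightarrow> n \<in> carrier M \<Longrightarrow> P m \<Longrightarrow> P n \<Longrightarrow> P (m \<oplus> n)"
  shows "P m"
  using component_sum[OF assms(1)] assms(3)[of "component M 0 m" "component M 1 m"]
    assms(2)[OF component_grade] assms(1) by auto

text \<open>The passage from sign rules, which hold for homogeneous elements only, to arbitrary
  elements.\<close>

lemma additive_eq_on_grades:
  assumes "additive_map M N F" "additive_map M N G" "\<And>p m. m \<in> grade M p \<Longrightarrow> F m = G m"
    "m \<in> carrier M"
  shows "F m = G m"
  using assms(4)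
  by (rule grade_induct) (use assms(1-3) in \<open>auto simp: additive_map_add\<close>)

end

text \<open>Two decompositions of one element differ by a decomposition of zero, so uniqueness has
  to be checked only there.\<close>

lemma supergradingI:
  assumes "abelian_group M"
    and "\<And>p. subgroup (grade M p) (add_monoid M)"
    and ex: "\<And>m. m \<in> carrier M \<Longrightarrow> \<exists>u\<in>grade M 0. \<exists>v\<in>grade M 1. m = u \<oplus>\<^bsub>M\<^esub> v"
    and un: "\<And>u v. u \<in> grade M 0 \<Longrightarrow> v \<in> grade M 1 \<Longrightarrow> u \<oplus>\<^bsub>M\<^esub> v = \<zero>\<^bsub>M\<^esub> \<Longrightarrow> u = \<zero>\<^bsub>M\<^esub>"
  shows "supergrading M"
proof -
  interpret abelian_group M by fact
  have gc: "x \<in> carrier M" if "x \<in> grade M p" for x p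
    using subgroup.subset[OF assms(2)[of p]] that by auto
  have sub: "x \<ominus>\<^bsub>M\<^esub> y \<in> grade M p" if "x \<in> grade M p" "y \<in> grade M p" for x y p
    using subgroup.m_closed[OF assms(2)[of p]] subgroup.m_inv_closed[OF assms(2)[of p]] that
    by (simp add: a_inv_def a_minus_def)
  have eq: "u = u' \<and> v = v'"
    if h: "u \<in> grade M 0" "v \<in> grade M 1" "u' \<in> grade M 0" "v' \<in> grade M 1" "u \<oplus>\<^bsub>M\<^esub> v = u' \<oplus>\<^bsub>M\<^esub> v'"
    for u v u' v'
  proof -
    have c: "u \<in> carrier M" "v \<in> carrier M" "u' \<in> carrier M" "v' \<in> carrier M" using h gc by auto
    have "(u \<ominus>\<^bsub>M\<^esub> u') \<oplus>\<^bsub>M\<^esub> (v \<ominus>\<^bsub>M\<^esub> v') = (u \<oplus>\<^bsub>M\<^esub> v) \<ominus>\<^bsub>M\<^esub> (u' \<oplus>\<^bsub>M\<^esub> v')"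
      using c by (simp add: a_minus_def minus_add a_ac)
    also have "\<dots> = \<zero>\<^bsub>M\<^esub>" using h(5) c by (simp add: a_minus_def r_neg)
    finally have "u \<ominus>\<^bsub>M\<^esub> u' = \<zero>\<^bsub>M\<^esub>" using un[OF sub sub] h by blast
    then have "u = u'" using c eq_of_diff_zero by (simp add: a_minus_def)
    then show ?thesis using h(5) c by simp
  qed
  show ?thesis
    unfolding supergrading_def
  proof (intro conjI allI ballI)
    fix m assume "m \<in> carrier M"
    then obtain u v where uv: "u \<in> grade M 0" "v \<in> grade M 1" "m = u \<oplus>\<^bsub>M\<^esub> v" using ex by blast
    show "\<exists>!uv. fst uv \<in> grade M 0 \<and> snd uv \<in> grade M 1 \<and> m = fst uv \<oplus>\<^bsub>M\<^esub> snd uv"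
      by (rule ex1I[of _ "(u, v)"]) (use uv eq in auto)
  qed (rule assms(2))
qed

lemma (in comm_superring) regular_graded: "graded_group (regular_mod K)"
proof -
  have "abelian_group (regular_mod K)"
  proof (rule abelian_groupI)
    fix x show "\<exists>y\<in>carrier (regular_mod K). y \<oplus>\<^bsub>regular_mod K\<^esub> x = \<zero>\<^bsub>regular_mod K\<^esub>"
      by (auto simp: regular_mod_def intro: exI[of _ "- x"])
  qed (auto simp: regular_mod_def ac_simps)
  then show ?thesis
    by (simp add: graded_group_def graded_group_axioms_def K_grading)
qed

section \<open>Right modules and the left action of scalars\<close>

locale right_module = abelian_group M
  for M :: "('k::ring_1, 'm, 'e) supermod_scheme" (structure) +
  assumes smult_closed: "m \<in> carrier M \<Longrightarrow> m \<star> \<alpha> \<in> carrier M"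
    and smult_l_distr: "m \<in> carrier M \<Longrightarrow> n \<in> carrier M \<Longrightarrow> (m \<oplus> n) \<star> \<alpha> = m \<star> \<alpha> \<oplus> n \<star> \<alpha>"
    and smult_r_distr: "m \<in> carrier M \<Longrightarrow> m \<star> (\<alpha> + \<beta>) = m \<star> \<alpha> \<oplus> m \<star> \<beta>"
    and smult_assoc: "m \<in> carrier M \<Longrightarrow> m \<star> (\<alpha> * \<beta>) = m \<star> \<alpha> \<star> \<beta>"
    and smult_one: "m \<in> carrier M \<Longrightarrow> m \<star> 1 = m"
begin

lemma smult_additive: "additive_map M M (\<lambda>m. m \<star> \<alpha>)"
  by (simp add: additive_map_def smult_closed smult_l_distr)

lemma zero_smult [simp]: "\<zero> \<star> \<alpha> = \<zero>"
  using additive_map_zero[OF abelian_group abelian_group smult_additive] .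

lemma minus_smult: "m \<in> carrier M \<Longrightarrow> (\<ominus> m) \<star> \<alpha> = \<ominus> (m \<star> \<alpha>)"
  using additive_map_minus[OF abelian_group abelian_group smult_additive] .

lemma smult_zero [simp]: "m \<in> carrier M \<Longrightarrow> m \<star> 0 = \<zero>"
proof -
  assume m: "m \<in> carrier M"
  show ?thesis
    by (rule idem_zero) (use m smult_r_distr[of m 0 0, symmetric] in \<open>simp_all add: smult_closed\<close>)
qed

lemma smult_minus: "m \<in> carrier M \<Longrightarrow> m \<star> (- \<alpha>) = \<ominus> (m \<star> \<alpha>)"
proof -
  assume m: "m \<in> carrier M"
  have "m \<star> (- \<alpha>) \<oplus> m \<star> \<alpha> = \<zero>" using m smult_r_distr[of m "- \<alpha>" \<alpha>] by simp
  then show ?thesis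
    by (rule minus_equality[symmetric]) (simp_all add: m smult_closed)
qed

lemma smult_neg_one: "m \<in> carrier M \<Longrightarrow> m \<star> (- 1) = \<ominus> m"
  by (simp add: smult_minus smult_one)

lemma smult_ksign: "m \<in> carrier M \<Longrightarrow> m \<star> ksign p = (if p = 0 then m else \<ominus> m)"
  by (cases p) (simp_all add: smult_one smult_neg_one)

lemma smult_ksign_ksign: "m \<in> carrier M \<Longrightarrow> m \<star> ksign p \<star> ksign q = m \<star> ksign (p + q)"
  by (simp add: smult_assoc[symmetric] ksign_mult)

lemma smult_ksign_commute: "m \<in> carrier M \<Longrightarrow> m \<star> ksign p \<star> \<alpha> = m \<star> \<alpha> \<star> ksign p"
  by (simp add: smult_assoc[symmetric] ksign_commute)

lemma additive_ksign:
  assumes "abelian_group N" "additive_map N M F" shows "additive_map N M (\<lambda>x. F x \<star> ksign p)"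
  using assms by (auto simp: additive_map_def smult_closed smult_l_distr)

end

sublocale supermodule \<subseteq> right_module M
  by unfold_locales
    (simp_all add: rsmult_closed rsmult_l_distr rsmult_r_distr rsmult_assoc rsmult_one)

sublocale supermodule \<subseteq> graded_group M
  by unfold_locales (rule M_grading)

context comm_superring
begin

abbreviation kcomp :: "bit \<Rightarrow> 'k \<Rightarrow> 'k"
  where "kcomp \<equiv> component (regular_mod K)"

lemma regular_simps [simp]:
  "carrier (regular_mod K) = UNIV" "grade (regular_mod K) = K" "\<zero>\<^bsub>regular_mod K\<^esub> = 0"
  "add (regular_mod K) = (+)" "rsmult (regular_mod K) = (*)"
  by (simp_all add: regular_mod_def)

lemma kcomp_K: "kcomp p a \<in> K p"
  using graded_group.component_grade[OF regular_graded] by simp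

lemma kcomp_sum: "kcomp 0 a + kcomp 1 a = a"
  using graded_group.component_sum[OF regular_graded, of a] by simp

lemma kcomp_add: "kcomp p (a + b) = kcomp p a + kcomp p b"
  using graded_group.component_add[OF regular_graded, of a b p] by simp

lemma kcomp_of_K: "a \<in> K q \<Longrightarrow> kcomp p a = (if p = q then a else 0)"
  using graded_group.component_of_grade[OF regular_graded, of a q p] by simp

lemma K_zero' [simp]: "0 \<in> K p"
  using graded_group.grade_zero[OF regular_graded] by simp

lemma K_add': "a \<in> K p \<Longrightarrow> b \<in> K p \<Longrightarrow> a + b \<in> K p"
  using graded_group.grade_add[OF regular_graded, of a p b] by simp

lemma K_ksign [simp]: "ksign p \<in> K 0"
  by (simp add: ksign_def K_one K_minus)

lemma K_even_commute: "c \<in> K 0 \<Longrightarrow> c * a = a * c"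
proof -
  assume c: "c \<in> K 0"
  have "c * kcomp p a = kcomp p a * c" for p
    using K_supercomm[OF c kcomp_K[of p a]] by simp
  then show ?thesis by (metis distrib_left distrib_right kcomp_sum)
qed

lemma K_induct:
  assumes "\<And>p a. a \<in> K p \<Longrightarrow> P a" "\<And>a b. P a \<Longrightarrow> P b \<Longrightarrow> P (a + b)"
  shows "P a"
  using assms(1)[OF kcomp_K] assms(2) kcomp_sum by metis

end

context supermodule
begin

lemma smult_even_commute: "m \<in> carrier M \<Longrightarrow> c \<in> K 0 \<Longrightarrow> m \<star> c \<star> \<alpha> = m \<star> \<alpha> \<star> c"
  by (simp add: rsmult_assoc[symmetric] K_even_commute)

lemma ksign_grade: "m \<in> grade M p \<Longrightarrow> m \<star> ksign q \<in> grade M p"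
  using rsmult_grade[of m p "ksign q" 0] by simp

lemma even_smult_grade: "m \<in> grade M p \<Longrightarrow> c \<in> K 0 \<Longrightarrow> m \<star> c \<in> grade M p"
  using rsmult_grade[of m p c 0] by simp

text \<open>An odd scalar exchanges the even and the odd part, whence the shift of the index by the
  parity of the scalar.\<close>

lemma component_smult:
  assumes "m \<in> carrier M" "\<alpha> \<in> K q"
  shows "component M p (m \<star> \<alpha>) = component M (p + q) m \<star> \<alpha>"
proof -
  have "m = component M (p + q) m \<oplus> component M (p + q + 1) m"
    using component_sum[OF assms(1)] assms(1) by (cases "p + q") (auto simp: a_comm)
  then have "m \<star> \<alpha> = component M (p + q) m \<star> \<alpha> \<oplus> component M (p + q + 1) m \<star> \<alpha>"
    using assms(1) by (metis component_closed rsmult_l_distr)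
  moreover have "component M (p + q) m \<star> \<alpha> \<in> grade M p"
    using rsmult_grade[OF component_grade[OF assms(1), of "p + q"] assms(2)] by (simp add: add.assoc)
  moreover have "component M (p + q + 1) m \<star> \<alpha> \<in> grade M (p + 1)"
    using rsmult_grade[OF component_grade[OF assms(1), of "p + q + 1"] assms(2)] by (simp add: bit_ac)
  ultimately show ?thesis using component_eqI by simp
qed

lemma lsmult_expand:
  "m \<in> carrier M \<Longrightarrow> lsmult K M \<alpha> m =
    (component M 0 m \<star> kcomp 0 \<alpha> \<oplus> component M 1 m \<star> kcomp 0 \<alpha>) \<oplus>
    (component M 0 m \<star> kcomp 1 \<alpha> \<oplus> \<ominus> (component M 1 m \<star> kcomp 1 \<alpha>))"
  unfolding lsmult_def by (simp add: finsum_bit rsmult_closed rsmult_one smult_neg_one a_ac)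

lemma lsmult_closed [simp]: "m \<in> carrier M \<Longrightarrow> lsmult K M \<alpha> m \<in> carrier M"
  by (simp add: lsmult_expand rsmult_closed)

lemma lsmult_add: "m \<in> carrier M \<Longrightarrow> n \<in> carrier M \<Longrightarrow>
    lsmult K M \<alpha> (m \<oplus> n) = lsmult K M \<alpha> m \<oplus> lsmult K M \<alpha> n"
  by (simp add: lsmult_expand rsmult_closed component_add rsmult_l_distr minus_add a_ac)

lemma lsmult_additive: "additive_map M M (lsmult K M \<alpha>)"
  by (simp add: additive_map_def lsmult_add)

lemma lsmult_add_scal: "m \<in> carrier M \<Longrightarrow> lsmult K M (\<alpha> + \<beta>) m = lsmult K M \<alpha> m \<oplus> lsmult K M \<beta> m"
  by (simp add: lsmult_expand rsmult_closed kcomp_add rsmult_r_distr minus_add a_ac)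

lemma lsmult_homog: "m \<in> grade M q \<Longrightarrow> \<alpha> \<in> K p \<Longrightarrow> lsmult K M \<alpha> m = m \<star> \<alpha> \<star> ksign (p * q)"
  by (cases p; cases q)
    (simp_all add: lsmult_expand component_of_grade kcomp_of_K grade_carrier rsmult_closed rsmult_one
      smult_neg_one minus_smult)

lemma lsmult_even: "m \<in> carrier M \<Longrightarrow> c \<in> K 0 \<Longrightarrow> lsmult K M c m = m \<star> c"
proof -
  assume m: "m \<in> carrier M" and "c \<in> K 0"
  then show ?thesis
    by (intro additive_eq_on_grades[OF lsmult_additive smult_additive _ m])
      (auto simp: lsmult_homog grade_carrier rsmult_closed rsmult_one)
qed

lemma lsmult_grade: "m \<in> grade M q \<Longrightarrow> \<alpha> \<in> K p \<Longrightarrow> lsmult K M \<alpha> m \<in> grade M (p + q)"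
  using rsmult_grade[of m q \<alpha> p] by (simp add: lsmult_homog ksign_grade add.commute)

text \<open>The sign of the left action depends on the parity of its argument, which
  \<open>\<beta>\<close> changes; the sign from interchanging \<open>\<alpha>\<close> and
  \<open>\<beta>\<close> compensates for this.\<close>

lemma lsmult_rsmult: "m \<in> carrier M \<Longrightarrow> lsmult K M \<alpha> (m \<star> \<beta>) = lsmult K M \<alpha> m \<star> \<beta>"
proof (induction \<alpha> rule: K_induct)
  case a: (1 p \<alpha>)
  show ?case
  proof (induction \<beta> rule: K_induct)
    case b: (1 q \<beta>)
    have A: "additive_map M M (\<lambda>m. lsmult K M \<alpha> (m \<star> \<beta>))"
      using additive_map_compose[OF smult_additive lsmult_additive] .
    have B: "additive_map M M (\<lambda>m. lsmult K M \<alpha> m \<star> \<beta>)"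
      using additive_map_compose[OF lsmult_additive smult_additive] .
    show ?case
    proof (rule additive_eq_on_grades[OF A B _ a(2)])
      fix r m assume m: "m \<in> grade M r"
      have "m \<star> \<beta> \<star> \<alpha> \<star> ksign (p * (r + q)) = m \<star> \<alpha> \<star> ksign (p * r) \<star> \<beta>"
      proof -
        have "m \<star> \<beta> \<star> \<alpha> = m \<star> \<alpha> \<star> \<beta> \<star> ksign (q * p)"
          using m a(1) b
          by (simp add: grade_carrier rsmult_assoc[symmetric] K_supercomm[of \<beta> q \<alpha> p] ksign_commute mult.assoc)
        then show ?thesis using m
          by (simp add: grade_carrier rsmult_closed smult_ksign_ksign smult_ksign_commute[of _ _ \<beta>] bit_ac)
      qed
      then show "lsmult K M \<alpha> (m \<star> \<beta>) = lsmult K M \<alpha> m \<star> \<beta>"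
        using m a b by (simp add: lsmult_homog[of _ r] lsmult_homog[OF rsmult_grade])
    qed
  qed (use a in \<open>simp add: rsmult_r_distr lsmult_add rsmult_closed\<close>)
qed (simp add: lsmult_add_scal rsmult_closed rsmult_l_distr)

end

section \<open>The symmetric algebra\<close>

lemma ring_extend_simps [simp]:
  "carrier (ring.extend R m) = carrier R" "monoid.mult (ring.extend R m) = monoid.mult R"
  "one (ring.extend R m) = one R" "ring.zero (ring.extend R m) = ring.zero R"
  "add (ring.extend R m) = add R"
  by (simp_all add: ring.extend_def)

lemma supermod_fields_simps [simp]:
  "rsmult (ring.extend R (supermod.fields s g)) = s" "grade (ring.extend R (supermod.fields s g)) = g"
  by (simp_all add: ring.extend_def supermod.fields_def)

lemma abelian_group_cong_ops:
  assumes "abelian_group R" "carrier R' = carrier R" "ring.zero R' = ring.zero R" "add R' = add R"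
  shows "abelian_group R'"
proof -
  interpret R: abelian_group R by fact
  show ?thesis
    by (rule abelian_groupI) (use assms R.l_neg R.a_inv_closed in \<open>auto simp: R.a_ac\<close>)
qed

lemma ring_cong_ops:
  assumes "ring R" "carrier R' = carrier R" "monoid.mult R' = monoid.mult R" "one R' = one R"
    "ring.zero R' = ring.zero R" "add R' = add R"
  shows "ring R'"
proof -
  interpret R: ring R by fact
  show ?thesis
    by (intro ringI monoidI abelian_group_cong_ops[OF R.is_abelian_group])
      (simp_all add: assms R.m_assoc R.l_distr R.r_distr)
qed

lemma ideal_cong_ops:
  assumes "ideal I R" "carrier R' = carrier R" "monoid.mult R' = monoid.mult R" "one R' = one R"
    "ring.zero R' = ring.zero R" "add R' = add R"
  shows "ideal I R'"
  using assms ring_cong_ops[of R R']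
  by (simp add: ideal_def ideal_axioms_def additive_subgroup_def subgroup_def m_inv_def)

section \<open>The word ring and its two successive quotients, the tensor algebra and the symmetric
  algebra\<close>

lemma frag_of_mult: "frag_of u * frag_of v = frag_of (u + v)"
  by (simp add: mult_single)

definition valid_word :: "('k, 'm, 'e) supermod_scheme \<Rightarrow> ('k + 'm) fmon set"
  where "valid_word M = {w. set (letters w) \<subseteq> range Inl \<union> Inr ` carrier M}"

lemma word_ring_carrier: "carrier (word_ring M) = {f. Poly_Mapping.keys f \<subseteq> valid_word M}"
  by (auto simp: word_ring_def valid_word_def)

lemma word_ring_simps [simp]:
  "monoid.mult (word_ring M) = (*)" "one (word_ring M) = 1" "ring.zero (word_ring M) = 0"
  "add (word_ring M) = (+)"
  by (simp_all add: word_ring_def)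

lemma valid_word_zero [simp]: "0 \<in> valid_word M"
  by (simp add: valid_word_def zero_fmon_def)

lemma valid_word_plus: "u \<in> valid_word M \<Longrightarrow> v \<in> valid_word M \<Longrightarrow> u + v \<in> valid_word M"
  by (auto simp: valid_word_def plus_fmon_def)

lemma word_ring_closed [simp]:
  "f \<in> carrier (word_ring M) \<Longrightarrow> g \<in> carrier (word_ring M) \<Longrightarrow> f + g \<in> carrier (word_ring M)"
  "f \<in> carrier (word_ring M) \<Longrightarrow> g \<in> carrier (word_ring M) \<Longrightarrow> f - g \<in> carrier (word_ring M)"
  "f \<in> carrier (word_ring M) \<Longrightarrow> g \<in> carrier (word_ring M) \<Longrightarrow> f * g \<in> carrier (word_ring M)"
  "f \<in> carrier (word_ring M) \<Longrightarrow> - f \<in> carrier (word_ring M)"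
  "0 \<in> carrier (word_ring M)" "1 \<in> carrier (word_ring M)"
  "frag_of w \<in> carrier (word_ring M) \<longleftrightarrow> w \<in> valid_word M"
  using keys_add[of f g] keys_diff[of f g] keys_mult[of f g] valid_word_plus
  unfolding word_ring_carrier by (blast | simp)+

lemma ring_word_ring: "ring (word_ring M)"
proof (rule ringI)
  show "abelian_group (word_ring M)"
  proof (rule abelian_groupI)
    fix x assume "x \<in> carrier (word_ring M)"
    then have "- x \<in> carrier (word_ring M)" by simp
    then show "\<exists>y\<in>carrier (word_ring M). y \<oplus>\<^bsub>word_ring M\<^esub> x = \<zero>\<^bsub>word_ring M\<^esub>"
      by (rule bexI[rotated]) simp
  qed (auto simp: ac_simps)
  show "Group.monoid (word_ring M)"
    by (rule monoidI) (auto simp: mult.assoc)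
qed (auto simp: distrib_left distrib_right)

lemma word_ring_uminus: "y \<in> carrier (word_ring M) \<Longrightarrow> \<ominus>\<^bsub>word_ring M\<^esub> y = - y"
proof -
  interpret W: ring "word_ring M" by (rule ring_word_ring)
  assume "y \<in> carrier (word_ring M)"
  then show ?thesis by (intro W.minus_equality) auto
qed

lemma scal_word_closed [simp]: "scal_word \<alpha> \<in> carrier (word_ring M)"
  by (auto simp: scal_word_def valid_word_def)

lemma vec_word_closed [simp]: "x \<in> carrier M \<Longrightarrow> vec_word x \<in> carrier (word_ring M)"
  by (auto simp: vec_word_def valid_word_def)

text \<open>The generators of \<open>sym_ideal\<close> lifted to words. With
  \<open>tens_alg_rel\<close> they present the symmetric algebra as a single quotient of the word
  ring, with quotient map \<open>sym_proj\<close>.\<close>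

definition sym_rel :: "('k::ring_1, 'm, 'e) supermod_scheme \<Rightarrow> ('k, 'm) words set"
  where "sym_rel M =
    {vec_word v * vec_word w - vec_word w * vec_word v * scal_word (ksign (p * q)) | v w p q.
      v \<in> grade M p \<and> w \<in> grade M q} \<union>
    {vec_word u * vec_word u | u. u \<in> grade M 1}"

definition sym_proj :: "(bit \<Rightarrow> 'k::ring_1 set) \<Rightarrow> ('k, 'm, 'e) supermod_scheme \<Rightarrow> ('k, 'm) words \<Rightarrow>
    ('k, 'm) words set set"
  where "sym_proj K M f = sym_ideal K M +>\<^bsub>tens_alg K M\<^esub> (tens_alg_ker K M +>\<^bsub>word_ring M\<^esub> f)"

context supermodule
begin

abbreviation "W \<equiv> word_ring M"
abbreviation "T \<equiv> tens_alg K M"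
abbreviation "S \<equiv> sym_alg K M"
abbreviation "\<pi> \<equiv> sym_proj K M"
abbreviation "ker\<^sub>T \<equiv> tens_alg_ker K M"

lemma tens_alg_rel_closed: "tens_alg_rel K M \<subseteq> carrier W"
  unfolding tens_alg_rel_def by (auto simp: rsmult_closed)

lemma tens_ker_ideal: "ideal ker\<^sub>T W"
  unfolding tens_alg_ker_def by (rule ring.genideal_ideal[OF ring_word_ring tens_alg_rel_closed])

lemma tens_simps:
  "carrier T = carrier (W Quot ker\<^sub>T)" "monoid.mult T = monoid.mult (W Quot ker\<^sub>T)"
  "one T = one (W Quot ker\<^sub>T)" "ring.zero T = ring.zero (W Quot ker\<^sub>T)" "add T = add (W Quot ker\<^sub>T)"
  by (simp_all add: tens_alg_def Let_def)

lemma tens_ring: "ring T"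
  by (rule ring_cong_ops[OF ideal.quotient_is_ring[OF tens_ker_ideal]]) (simp_all add: tens_simps)

lemma tens_proj_hom: "(+>\<^bsub>W\<^esub>) ker\<^sub>T \<in> ring_hom W T"
  using ideal.rcos_ring_hom[OF tens_ker_ideal] by (simp add: ring_hom_def tens_simps)

lemma tens_vec_closed: "x \<in> carrier M \<Longrightarrow> tens_vec K M x \<in> carrier T"
  and tens_scal_closed: "tens_scal K M \<alpha> \<in> carrier T"
  unfolding tens_vec_def tens_scal_def
  by (rule ring_hom_closed[OF tens_proj_hom], simp)+

lemma tens_rsmult: "t \<star>\<^bsub>T\<^esub> \<alpha> = t \<otimes>\<^bsub>T\<^esub> tens_scal K M \<alpha>"
  by (simp add: tens_alg_def Let_def)

definition sym_gens :: "('k, 'm) words set set"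
  where "sym_gens =
     {tens_vec K M v \<otimes>\<^bsub>T\<^esub> tens_vec K M w \<ominus>\<^bsub>T\<^esub> (tens_vec K M w \<otimes>\<^bsub>T\<^esub> tens_vec K M v) \<star>\<^bsub>T\<^esub> ksign (p * q) | v w p q.
          v \<in> grade M p \<and> w \<in> grade M q} \<union>
       {tens_vec K M u \<otimes>\<^bsub>T\<^esub> tens_vec K M u | u. u \<in> grade M 1}"

lemma sym_rel_closed: "sym_rel M \<subseteq> carrier W"
  unfolding sym_rel_def by (auto simp: grade_carrier)

lemma sym_gens_eq: "sym_gens = (+>\<^bsub>W\<^esub>) ker\<^sub>T ` sym_rel M"
proof -
  interpret W: ring W by (rule ring_word_ring)
  interpret T: ring T by (rule tens_ring)
  interpret h: ring_hom_ring W T "(+>\<^bsub>W\<^esub>) ker\<^sub>T"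
    by (rule ring_hom_ringI2[OF ring_word_ring tens_ring tens_proj_hom])
  have a: "tens_vec K M v \<otimes>\<^bsub>T\<^esub> tens_vec K M w = ker\<^sub>T +>\<^bsub>W\<^esub> (vec_word v * vec_word w)"
    if "v \<in> carrier M" "w \<in> carrier M" for v w
    using h.hom_mult[of "vec_word v" "vec_word w"] that by (simp add: tens_vec_def)
  have b: "(ker\<^sub>T +>\<^bsub>W\<^esub> f) \<ominus>\<^bsub>T\<^esub> (ker\<^sub>T +>\<^bsub>W\<^esub> g) \<star>\<^bsub>T\<^esub> \<alpha> = ker\<^sub>T +>\<^bsub>W\<^esub> (f - g * scal_word \<alpha>)"
    if fg: "f \<in> carrier W" "g \<in> carrier W" for f g \<alpha>
  proof -
    have "(ker\<^sub>T +>\<^bsub>W\<^esub> g) \<star>\<^bsub>T\<^esub> \<alpha> = ker\<^sub>T +>\<^bsub>W\<^esub> (g * scal_word \<alpha>)"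
      unfolding tens_rsmult tens_scal_def using h.hom_mult[of g "scal_word \<alpha>"] fg by simp
    moreover have "\<ominus>\<^bsub>T\<^esub> (ker\<^sub>T +>\<^bsub>W\<^esub> (g * scal_word \<alpha>)) = ker\<^sub>T +>\<^bsub>W\<^esub> (- (g * scal_word \<alpha>))"
      using h.hom_a_inv[of "g * scal_word \<alpha>"] fg by (simp add: word_ring_uminus)
    ultimately show ?thesis
      using h.hom_add[of f "- (g * scal_word \<alpha>)"] fg by (simp add: a_minus_def)
  qed
  have c: "tens_vec K M v \<otimes>\<^bsub>T\<^esub> tens_vec K M w \<ominus>\<^bsub>T\<^esub> (tens_vec K M w \<otimes>\<^bsub>T\<^esub> tens_vec K M v) \<star>\<^bsub>T\<^esub> ksign (p * q) =
      ker\<^sub>T +>\<^bsub>W\<^esub> (vec_word v * vec_word w - vec_word w * vec_word v * scal_word (ksign (p * q)))"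
    if "v \<in> grade M p" "w \<in> grade M q" for v w p q
    using that by (simp add: a b grade_carrier)
  have "sym_gens = 
      {ker\<^sub>T +>\<^bsub>W\<^esub> (vec_word v * vec_word w - vec_word w * vec_word v * scal_word (ksign (p * q))) | v w p q.
        v \<in> grade M p \<and> w \<in> grade M q} \<union> {ker\<^sub>T +>\<^bsub>W\<^esub> (vec_word u * vec_word u) | u. u \<in> grade M 1}"
    unfolding sym_gens_def
    by (simp add: c a grade_carrier cong: rev_conj_cong)
  also have "\<dots> = (+>\<^bsub>W\<^esub>) ker\<^sub>T ` sym_rel M"
    unfolding sym_rel_def image_Un by (intro arg_cong2[of _ _ _ _ "(\<union>)"]; blast)
  finally show ?thesis .
qed

lemma sym_gens_closed: "sym_gens \<subseteq> carrier T"
  unfolding sym_gens_eq using ring_hom_closed[OF tens_proj_hom] sym_rel_closed by blast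

lemma sym_ideal_eq: "sym_ideal K M = Idl\<^bsub>T\<^esub> sym_gens"
  by (simp add: sym_ideal_def sym_gens_def Let_def)

lemma sym_ideal_ideal: "ideal (sym_ideal K M) T"
  unfolding sym_ideal_eq by (rule ring.genideal_ideal[OF tens_ring sym_gens_closed])

lemma sym_simps:
  "carrier S = carrier (T Quot sym_ideal K M)" "monoid.mult S = monoid.mult (T Quot sym_ideal K M)"
  "one S = one (T Quot sym_ideal K M)" "ring.zero S = ring.zero (T Quot sym_ideal K M)"
  "add S = add (T Quot sym_ideal K M)"
  by (simp_all add: sym_alg_def quot_alg_def)

lemma sym_ring: "ring S"
  by (rule ring_cong_ops[OF ideal.quotient_is_ring[OF sym_ideal_ideal]]) (simp_all add: sym_simps)

lemma sym_quot_hom: "(+>\<^bsub>T\<^esub>) (sym_ideal K M) \<in> ring_hom T S"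
  using ideal.rcos_ring_hom[OF sym_ideal_ideal] by (simp add: ring_hom_def sym_simps)

lemma sym_proj_hom: "\<pi> \<in> ring_hom W S"
  using ring_hom_trans[OF tens_proj_hom sym_quot_hom] by (simp add: sym_proj_def[abs_def] comp_def)

lemma sym_proj_surj: "y \<in> carrier S \<Longrightarrow> \<exists>f\<in>carrier W. y = \<pi> f"
proof -
  assume "y \<in> carrier S"
  then obtain t where t: "t \<in> carrier T" "y = sym_ideal K M +>\<^bsub>T\<^esub> t"
    unfolding sym_simps by (auto simp: FactRing_simps)
  then obtain f where "f \<in> carrier W" "t = ker\<^sub>T +>\<^bsub>W\<^esub> f"
    by (auto simp: FactRing_def A_RCOSETS_def' a_r_coset_def' tens_simps)
  with t show ?thesis by (auto simp: sym_proj_def)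
qed

text \<open>The composite quotient map has no larger kernel than the relations force. The image of
  \<open>A\<close> in the tensor algebra is an ideal that contains the generators of
  \<open>sym_ideal\<close>, so \<open>f\<close> agrees with some element of \<open>A\<close> modulo
  \<open>ker\<^sub>T\<close>, and \<open>ker\<^sub>T\<close> lies in \<open>A\<close> as
  well.\<close>

lemma sym_proj_kernel:
  assumes A: "ideal A W" "tens_alg_rel K M \<subseteq> A" "sym_rel M \<subseteq> A"
    and f: "f \<in> carrier W" "\<pi> f = \<zero>\<^bsub>S\<^esub>"
  shows "f \<in> A"
proof -
  interpret A: ideal A W by fact
  interpret I: ideal "ker\<^sub>T" W by (rule tens_ker_ideal)
  interpret J: ideal "sym_ideal K M" T by (rule sym_ideal_ideal)
  have IA: "ker\<^sub>T \<subseteq> A"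
    unfolding tens_alg_ker_def by (rule A.genideal_minimal[OF A(1,2)])
  have "ideal ((+>\<^bsub>W\<^esub>) ker\<^sub>T ` A) (W Quot ker\<^sub>T)"
    by (rule A.ring_ideal_imp_quot_ideal[OF tens_ker_ideal A(1)])
  then have "ideal ((+>\<^bsub>W\<^esub>) ker\<^sub>T ` A) T" by (rule ideal_cong_ops) (simp_all add: tens_simps)
  then have JA: "sym_ideal K M \<subseteq> (+>\<^bsub>W\<^esub>) ker\<^sub>T ` A"
    unfolding sym_ideal_eq by (rule J.genideal_minimal) (use A(3) in \<open>auto simp: sym_gens_eq\<close>)
  have t: "ker\<^sub>T +>\<^bsub>W\<^esub> f \<in> carrier T" using ring_hom_closed[OF tens_proj_hom f(1)] .
  have "sym_ideal K M +>\<^bsub>T\<^esub> (ker\<^sub>T +>\<^bsub>W\<^esub> f) = sym_ideal K M"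
    using f(2) by (simp add: sym_proj_def sym_simps FactRing_def)
  then have "ker\<^sub>T +>\<^bsub>W\<^esub> f \<in> sym_ideal K M" using J.a_rcos_self[OF t] by simp
  then obtain g where g: "g \<in> A" "ker\<^sub>T +>\<^bsub>W\<^esub> f = ker\<^sub>T +>\<^bsub>W\<^esub> g" using JA by blast
  have "f \<in> ker\<^sub>T +>\<^bsub>W\<^esub> g" using I.a_rcos_self[OF f(1)] g by simp
  then obtain h where h: "h \<in> ker\<^sub>T" "f = h \<oplus>\<^bsub>W\<^esub> g" by (auto simp: a_r_coset_def r_coset_def)
  show ?thesis unfolding h(2) by (rule additive_subgroup.a_closed[OF A.additive_subgroup_axioms]) (use IA g(1) h(1) in auto)
qed

end

lemma word_ring_induct [consumes 1, case_names zero word diff]: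
  assumes "f \<in> carrier (word_ring M)" "P 0" "\<And>w. w \<in> valid_word M \<Longrightarrow> P (frag_of w)"
    "\<And>f g. f \<in> carrier (word_ring M) \<Longrightarrow> g \<in> carrier (word_ring M) \<Longrightarrow> P f \<Longrightarrow> P g \<Longrightarrow> P (f - g)"
  shows "P f"
  using free_Abelian_group_induct[of f "valid_word M" P] assms by (simp add: word_ring_carrier)

lemma additive_map_word_diff:
  assumes N: "abelian_group N" and F: "additive_map (word_ring M) N F"
    and "f \<in> carrier (word_ring M)" "g \<in> carrier (word_ring M)"
  shows "F (f - g) = F f \<oplus>\<^bsub>N\<^esub> \<ominus>\<^bsub>N\<^esub> F g"
proof -
  interpret W: ring "word_ring M" by (rule ring_word_ring)
  show ?thesis
    using additive_map_add[OF F, of f "- g"] additive_map_minus[OF W.is_abelian_group N F, of g] assms(3,4)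
    by (simp add: word_ring_uminus)
qed

lemma one_frag: "1 = (frag_of 0 :: ('k, 'm) words)"
  by (simp add: single_one)

context supermodule
begin

sublocale W: ring W by (rule ring_word_ring)
sublocale S: ring S by (rule sym_ring)
sublocale proj: ring_hom_ring W S \<pi>
  by (rule ring_hom_ringI2[OF ring_word_ring sym_ring sym_proj_hom])

section \<open>Generators and relations of the symmetric algebra\<close>

definition sc :: "'k \<Rightarrow> ('k, 'm) words set set"
  where "sc \<alpha> = \<pi> (scal_word \<alpha>)"

abbreviation vc :: "'m \<Rightarrow> ('k, 'm) words set set"
  where "vc \<equiv> sym_vec K M"

lemma vc_proj: "vc x = \<pi> (vec_word x)"
  by (simp add: sym_vec_def sym_proj_def tens_vec_def)

lemma sc_closed [simp]: "sc \<alpha> \<in> carrier S"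
  unfolding sc_def by (rule proj.hom_closed) simp

lemma vc_closed [simp]: "x \<in> carrier M \<Longrightarrow> vc x \<in> carrier S"
  unfolding vc_proj by (rule proj.hom_closed) simp

lemma proj_mult: "f \<in> carrier W \<Longrightarrow> g \<in> carrier W \<Longrightarrow> \<pi> (f * g) = \<pi> f \<otimes>\<^bsub>S\<^esub> \<pi> g"
  and proj_add: "f \<in> carrier W \<Longrightarrow> g \<in> carrier W \<Longrightarrow> \<pi> (f + g) = \<pi> f \<oplus>\<^bsub>S\<^esub> \<pi> g"
  and proj_one: "\<pi> 1 = \<one>\<^bsub>S\<^esub>"
  using proj.hom_mult[of f g] proj.hom_add[of f g] proj.hom_one by simp_all

lemma proj_rel:
  assumes "r \<in> tens_alg_rel K M \<union> sym_rel M" shows "\<pi> r = \<zero>\<^bsub>S\<^esub>"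
proof -
  interpret I: ideal "ker\<^sub>T" W by (rule tens_ker_ideal)
  interpret J: ideal "sym_ideal K M" T by (rule sym_ideal_ideal)
  have z: "\<zero>\<^bsub>S\<^esub> = sym_ideal K M" by (simp add: sym_simps FactRing_def)
  have "ker\<^sub>T +>\<^bsub>W\<^esub> r \<in> sym_ideal K M"
    using assms
  proof
    assume "r \<in> tens_alg_rel K M"
    then have "r \<in> ker\<^sub>T" unfolding tens_alg_ker_def
      using W.genideal_self[OF tens_alg_rel_closed] by blast
    then have "ker\<^sub>T +>\<^bsub>W\<^esub> r = \<zero>\<^bsub>T\<^esub>" using I.a_rcos_const by (simp add: tens_simps FactRing_def)
    then show ?thesis using additive_subgroup.zero_closed[OF J.additive_subgroup_axioms] by simp
  next
    assume "r \<in> sym_rel M"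
    then have "ker\<^sub>T +>\<^bsub>W\<^esub> r \<in> sym_gens" unfolding sym_gens_eq by blast
    then show ?thesis unfolding sym_ideal_eq using J.genideal_self[OF sym_gens_closed] by blast
  qed
  then show ?thesis unfolding sym_proj_def z using J.a_rcos_const by blast
qed

lemma proj_eqI:
  assumes "f \<in> carrier W" "g \<in> carrier W" "f - g \<in> tens_alg_rel K M \<union> sym_rel M"
  shows "\<pi> f = \<pi> g"
  using proj_add[of "f - g" g] proj_rel[OF assms(3)] assms(1,2) proj.hom_closed by simp

lemma sc_one: "sc 1 = \<one>\<^bsub>S\<^esub>"
  unfolding sc_def proj_one[symmetric] by (rule proj_eqI) (auto simp: tens_alg_rel_def)

lemma sc_add: "sc (\<alpha> + \<beta>) = sc \<alpha> \<oplus>\<^bsub>S\<^esub> sc \<beta>"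
proof -
  have "\<pi> (scal_word (\<alpha> + \<beta>)) = \<pi> (scal_word \<alpha> + scal_word \<beta>)"
    by (rule proj_eqI) (auto simp: tens_alg_rel_def diff_diff_eq[symmetric])
  then show ?thesis by (simp add: sc_def proj_add)
qed

lemma sc_mult: "sc (\<alpha> * \<beta>) = sc \<alpha> \<otimes>\<^bsub>S\<^esub> sc \<beta>"
proof -
  have "\<pi> (scal_word (\<alpha> * \<beta>)) = \<pi> (scal_word \<alpha> * scal_word \<beta>)"
    by (rule proj_eqI) (auto simp: tens_alg_rel_def)
  then show ?thesis by (simp add: sc_def proj_mult)
qed

lemma vc_add: "x \<in> carrier M \<Longrightarrow> y \<in> carrier M \<Longrightarrow> vc (x \<oplus> y) = vc x \<oplus>\<^bsub>S\<^esub> vc y"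
proof -
  assume xy: "x \<in> carrier M" "y \<in> carrier M"
  then have "vec_word (x \<oplus> y) - (vec_word x + vec_word y) \<in> tens_alg_rel K M"
    unfolding tens_alg_rel_def diff_diff_eq[symmetric] by blast
  with xy have "\<pi> (vec_word (x \<oplus> y)) = \<pi> (vec_word x + vec_word y)" by (intro proj_eqI) auto
  with xy show ?thesis by (simp add: vc_proj proj_add)
qed

lemma vc_smult: "x \<in> carrier M \<Longrightarrow> vc (x \<star> \<alpha>) = vc x \<otimes>\<^bsub>S\<^esub> sc \<alpha>"
proof -
  assume x: "x \<in> carrier M"
  then have "vec_word (x \<star> \<alpha>) - vec_word x * scal_word \<alpha> \<in> tens_alg_rel K M"
    unfolding tens_alg_rel_def by blast
  with x have "\<pi> (vec_word (x \<star> \<alpha>)) = \<pi> (vec_word x * scal_word \<alpha>)"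
    by (intro proj_eqI) (auto simp: rsmult_closed)
  with x show ?thesis by (simp add: vc_proj sc_def proj_mult)
qed

lemma vc_lsmult: "x \<in> carrier M \<Longrightarrow> vc (lsmult K M \<alpha> x) = sc \<alpha> \<otimes>\<^bsub>S\<^esub> vc x"
proof -
  assume x: "x \<in> carrier M"
  then have "vec_word (lsmult K M \<alpha> x) - scal_word \<alpha> * vec_word x \<in> tens_alg_rel K M"
    unfolding tens_alg_rel_def by blast
  with x have "\<pi> (vec_word (lsmult K M \<alpha> x)) = \<pi> (scal_word \<alpha> * vec_word x)"
    by (intro proj_eqI) auto
  with x show ?thesis by (simp add: vc_proj sc_def proj_mult)
qed

lemma vc_swap:
  assumes "x \<in> grade M p" "y \<in> grade M q"
  shows "vc x \<otimes>\<^bsub>S\<^esub> vc y = vc y \<otimes>\<^bsub>S\<^esub> vc x \<otimes>\<^bsub>S\<^esub> sc (ksign (p * q))"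
proof -
  have "vec_word x * vec_word y - vec_word y * vec_word x * scal_word (ksign (p * q)) \<in> sym_rel M"
    unfolding sym_rel_def using assms by blast
  with assms have "\<pi> (vec_word x * vec_word y) = \<pi> (vec_word y * vec_word x * scal_word (ksign (p * q)))"
    by (intro proj_eqI) (auto simp: grade_carrier)
  with assms show ?thesis by (simp add: vc_proj sc_def proj_mult grade_carrier)
qed

lemma vc_odd_square: "u \<in> grade M 1 \<Longrightarrow> vc u \<otimes>\<^bsub>S\<^esub> vc u = \<zero>\<^bsub>S\<^esub>"
proof -
  assume u: "u \<in> grade M 1"
  then have "vec_word u * vec_word u \<in> sym_rel M" unfolding sym_rel_def by blast
  then have "\<pi> (vec_word u * vec_word u) = \<zero>\<^bsub>S\<^esub>" by (intro proj_rel) simp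
  then show ?thesis using u by (simp add: vc_proj proj_mult grade_carrier)
qed

lemma S_smult: "y \<star>\<^bsub>S\<^esub> \<alpha> = y \<otimes>\<^bsub>S\<^esub> sc \<alpha>"
proof -
  interpret T: ring T by (rule tens_ring)
  have "\<one>\<^bsub>T\<^esub> \<otimes>\<^bsub>T\<^esub> tens_scal K M \<alpha> = tens_scal K M \<alpha>" using tens_scal_closed by simp
  then show ?thesis
    by (simp add: sym_alg_def quot_alg_def tens_rsmult sc_def sym_proj_def tens_scal_def)
qed

lemma sc_zero: "sc 0 = \<zero>\<^bsub>S\<^esub>"
  by (rule S.idem_zero) (simp_all add: sc_add[symmetric])

lemma sc_minus: "sc (- \<alpha>) = \<ominus>\<^bsub>S\<^esub> sc \<alpha>"
  by (rule S.minus_equality[symmetric]) (simp_all add: sc_add[symmetric] sc_zero)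

lemma sc_ksign: "sc (ksign p) = (if p = 0 then \<one>\<^bsub>S\<^esub> else \<ominus>\<^bsub>S\<^esub> \<one>\<^bsub>S\<^esub>)"
  by (cases p) (simp_all add: sc_one sc_minus)

text \<open>The universal property of \<open>S\<close>, for targets that are not algebras.\<close>

lemma module_lift:
  fixes N :: "('n, 'z) ring_scheme"
  assumes N: "abelian_group N" and n0: "n0 \<in> carrier N"
    and s: "\<And>\<alpha>. additive_map N N (s \<alpha>)" and v: "\<And>x. x \<in> carrier M \<Longrightarrow> additive_map N N (v x)"
    and s1: "\<And>n. n \<in> carrier N \<Longrightarrow> s 1 n = n"
    and sa: "\<And>\<alpha> \<beta> n. n \<in> carrier N \<Longrightarrow> s (\<alpha> + \<beta>) n = s \<alpha> n \<oplus>\<^bsub>N\<^esub> s \<beta> n"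
    and sm: "\<And>\<alpha> \<beta> n. n \<in> carrier N \<Longrightarrow> s (\<alpha> * \<beta>) n = s \<alpha> (s \<beta> n)"
    and va: "\<And>x y n. x \<in> carrier M \<Longrightarrow> y \<in> carrier M \<Longrightarrow> n \<in> carrier N \<Longrightarrow>
      v (x \<oplus> y) n = v x n \<oplus>\<^bsub>N\<^esub> v y n"
    and vs: "\<And>x \<alpha> n. x \<in> carrier M \<Longrightarrow> n \<in> carrier N \<Longrightarrow> v (x \<star> \<alpha>) n = v x (s \<alpha> n)"
    and vl: "\<And>x \<alpha> n. x \<in> carrier M \<Longrightarrow> n \<in> carrier N \<Longrightarrow> v (lsmult K M \<alpha> x) n = s \<alpha> (v x n)"
    and vv: "\<And>x y p q n. x \<in> grade M p \<Longrightarrow> y \<in> grade M q \<Longrightarrow> n \<in> carrier N \<Longrightarrow>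
      v x (v y n) = v y (v x (s (ksign (p * q)) n))"
    and v0: "\<And>u n. u \<in> grade M 1 \<Longrightarrow> n \<in> carrier N \<Longrightarrow> v u (v u n) = \<zero>\<^bsub>N\<^esub>"
  obtains h where "additive_map S N h" "h \<one>\<^bsub>S\<^esub> = n0"
    "\<And>\<alpha> y. y \<in> carrier S \<Longrightarrow> h (sc \<alpha> \<otimes>\<^bsub>S\<^esub> y) = s \<alpha> (h y)"
    "\<And>x y. x \<in> carrier M \<Longrightarrow> y \<in> carrier S \<Longrightarrow> h (vc x \<otimes>\<^bsub>S\<^esub> y) = v x (h y)"
proof -
  interpret N: abelian_group N by fact
  \<comment> \<open>A word acts on \<open>N\<close> letter by letter, its first letter being the
    outermost operator; this is the left action of the word ring on \<open>N\<close>.\<close>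
  define act where "act = case_sum s v"
  have act_closed: "foldr act ls n \<in> carrier N"
    if "set ls \<subseteq> range Inl \<union> Inr ` carrier M" "n \<in> carrier N" for ls n
    using that by (induction ls) (auto simp: act_def additive_map_closed[OF s] additive_map_closed[OF v])
  have "\<exists>h. additive_map W N h \<and> (\<forall>w\<in>valid_word M. h (frag_of w) = foldr act (letters w) n)"
    if "n \<in> carrier N" for n
  proof -
    have "(\<lambda>w. foldr act (letters w) n) ` valid_word M \<subseteq> carrier (add_monoid N)"
      using act_closed[OF _ that] by (auto simp: valid_word_def)
    then obtain h where h: "h \<in> hom (free_Abelian_group (valid_word M)) (add_monoid N)"
      "\<And>w. w \<in> valid_word M \<Longrightarrow> h (frag_of w) = foldr act (letters w) n"
      using comm_group.free_Abelian_group_universal[OF N.a_comm_group] by blast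
    have "additive_map W N h"
      using h(1) by (auto simp: additive_map_def hom_def Pi_def word_ring_carrier)
    with h show ?thesis by blast
  qed
  then obtain H where HA: "\<And>n. n \<in> carrier N \<Longrightarrow> additive_map W N (H n)"
    and HF: "\<And>n w. n \<in> carrier N \<Longrightarrow> w \<in> valid_word M \<Longrightarrow> H n (frag_of w) = foldr act (letters w) n"
    by metis
  have Hc: "H n f \<in> carrier N" if "n \<in> carrier N" "f \<in> carrier W" for n f
    using additive_map_closed[OF HA[OF that(1)] that(2)] .
  note Hd = additive_map_word_diff[OF N HA]
  have H0: "H n 0 = \<zero>\<^bsub>N\<^esub>" if "n \<in> carrier N" for n
    using additive_map_zero[OF W.is_abelian_group N HA[OF that]] by simp
  have H1: "H n 1 = n" if "n \<in> carrier N" for n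
    unfolding one_frag using HF[OF that valid_word_zero] by (simp add: zero_fmon_def)
  have foldr_add: "additive_map N N (foldr act ls)" if "set ls \<subseteq> range Inl \<union> Inr ` carrier M" for ls
    using that
  proof (induction ls)
    case (Cons l ls)
    have "additive_map N N (act l)" using Cons s v by (auto simp: act_def)
    moreover have "additive_map N N (foldr act ls)" using Cons by simp
    ultimately have "additive_map N N (\<lambda>n. act l (foldr act ls n))"
      by (rule additive_map_compose[rotated])
    then show ?case by (simp add: comp_def)
  qed (simp add: additive_map_def)
  have HL: "H n (frag_of u * g) = foldr act (letters u) (H n g)"
    if n: "n \<in> carrier N" and u: "u \<in> valid_word M" and g: "g \<in> carrier W" for n u g
    using g
  proof (induction g rule: word_ring_induct)
    case zero
    have "additive_map N N (foldr act (letters u))" using u by (intro foldr_add) (simp add: valid_word_def)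
    from additive_map_zero[OF N N this] show ?case using H0[OF n] by simp
  next
    case (word w)
    then show ?case
      using HF[OF n, of "u + w"] HF[OF n, of w] valid_word_plus[OF u] 
      by (simp add: frag_of_mult) (simp add: plus_fmon_def)
  next
    case (diff f g)
    have A: "additive_map N N (foldr act (letters u))" using u by (intro foldr_add) (simp add: valid_word_def)
    show ?case
      using diff u n additive_map_add[OF A, of "H n f" "\<ominus>\<^bsub>N\<^esub> H n g"] additive_map_minus[OF N N A, of "H n g"]
      by (simp add: right_diff_distrib Hd Hc)
  qed
  \<comment> \<open>Products of words act by composition. This replaces multiplicativity, which has
    no meaning for a target that is only a group.\<close>
  have HM: "H n (f * g) = H (H n g) f"
    if n: "n \<in> carrier N" and g: "g \<in> carrier W" and f: "f \<in> carrier W" for n f g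
    using f
  proof (induction f rule: word_ring_induct)
    case zero
    then show ?case by (simp add: H0 Hc n g)
  next
    case (word w)
    then show ?case by (simp add: HL HF Hc n g)
  next
    case (diff a b)
    then show ?case by (simp add: left_diff_distrib Hd Hc n g)
  qed
  have Hs: "H n (scal_word \<alpha>) = s \<alpha> n" if "n \<in> carrier N" for \<alpha> n
    using HF[OF that, of "FMon [Inl \<alpha>]"] by (simp add: scal_word_def valid_word_def act_def)
  have Hv: "H n (vec_word x) = v x n" if "n \<in> carrier N" "x \<in> carrier M" for x n
    using HF[OF that(1), of "FMon [Inr x]"] that by (simp add: vec_word_def valid_word_def act_def)
  \<comment> \<open>Annihilating every \<open>n\<close>, and not just \<open>n0\<close>, makes
    \<open>A\<close> a two-sided ideal; the annihilator of \<open>n0\<close> alone would only be a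
    left ideal.\<close>
  define A where "A = {f \<in> carrier W. \<forall>n\<in>carrier N. H n f = \<zero>\<^bsub>N\<^esub>}"
  have sc': "s \<alpha> n \<in> carrier N" if "n \<in> carrier N" for \<alpha> n using additive_map_closed[OF s that] .
  have vc': "v x n \<in> carrier N" if "n \<in> carrier N" "x \<in> carrier M" for x n
    using additive_map_closed[OF v[OF that(2)] that(1)] .
  have AI: "ideal A W"
  proof (rule idealI[OF ring_word_ring])
    show "subgroup A (add_monoid W)"
    proof (rule group.subgroupI[OF W.a_group])
      fix a b assume ab: "a \<in> A" "b \<in> A"
      then have "inv\<^bsub>add_monoid W\<^esub> a = - a" using word_ring_uminus[of a M] by (simp add: A_def a_inv_def)
      then show "inv\<^bsub>add_monoid W\<^esub> a \<in> A"
        using ab Hd[of _ 0 a] N.minus_equality[of "\<zero>\<^bsub>N\<^esub>" "\<zero>\<^bsub>N\<^esub>"] by (auto simp: A_def H0)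
      show "a \<otimes>\<^bsub>add_monoid W\<^esub> b \<in> A"
        using ab by (auto simp: A_def additive_map_add[OF HA, simplified])
    qed (auto simp: A_def intro!: exI[of _ 0] H0)
  next
    fix a x assume "a \<in> A" "x \<in> carrier W"
    then show "x \<otimes>\<^bsub>W\<^esub> a \<in> A" "a \<otimes>\<^bsub>W\<^esub> x \<in> A"
      by (auto simp: A_def HM Hc additive_map_zero[OF N N])
        (metis (no_types, lifting) HM H0 Hc N.zero_closed mult_zero_right word_ring_closed(5))
  qed
  have canc: "a \<oplus>\<^bsub>N\<^esub> (b \<oplus>\<^bsub>N\<^esub> (\<ominus>\<^bsub>N\<^esub> a \<oplus>\<^bsub>N\<^esub> \<ominus>\<^bsub>N\<^esub> b)) = \<zero>\<^bsub>N\<^esub>"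
    if "a \<in> carrier N" "b \<in> carrier N" for a b
    using N.r_neg[of "a \<oplus>\<^bsub>N\<^esub> b"] that by (simp add: N.minus_add N.a_assoc)
  have A1: "tens_alg_rel K M \<subseteq> A"
    unfolding tens_alg_rel_def A_def
    by (auto simp: Hd Hs Hv HM H1 sc' vc' rsmult_closed s1 sa sm va vs vl N.r_neg N.minus_add N.a_ac canc)
  have vv': "v x (v y n) \<oplus>\<^bsub>N\<^esub> \<ominus>\<^bsub>N\<^esub> v y (v x (s (ksign (p * q)) n)) = \<zero>\<^bsub>N\<^esub>"
    if "x \<in> grade M p" "y \<in> grade M q" "n \<in> carrier N" for x y p q n
    by (subst vv[OF that], rule N.r_neg) (use that in \<open>simp add: sc' vc' grade_carrier\<close>)
  have A2: "sym_rel M \<subseteq> A"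
    unfolding sym_rel_def A_def
    by (auto simp: Hd Hs Hv HM H1 sc' vc' grade_carrier v0 vv')
  have wd: "H n0 f = H n0 g" if fg: "f \<in> carrier W" "g \<in> carrier W" "\<pi> f = \<pi> g" for f g
  proof -
    have "\<pi> f = \<pi> (f - g) \<oplus>\<^bsub>S\<^esub> \<pi> g" using proj_add[of "f - g" g] fg by simp
    then have "\<pi> (f - g) = \<zero>\<^bsub>S\<^esub>"
      using fg S.add.r_cancel_one[of "\<pi> g" "\<pi> (f - g)"] proj.hom_closed by simp
    then have "f - g \<in> A" using fg by (intro sym_proj_kernel[OF AI A1 A2]) auto
    then have "H n0 f \<oplus>\<^bsub>N\<^esub> \<ominus>\<^bsub>N\<^esub> H n0 g = \<zero>\<^bsub>N\<^esub>" using Hd[OF n0, of f g] fg n0 by (auto simp: A_def)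
    then show ?thesis using N.eq_of_diff_zero[OF Hc[OF n0 fg(1)] Hc[OF n0 fg(2)]] by simp
  qed
  define h where "h y = H n0 (SOME f. f \<in> carrier W \<and> \<pi> f = y)" for y
  have hH: "h (\<pi> f) = H n0 f" if "f \<in> carrier W" for f
    unfolding h_def by (rule someI2[of _ f]) (use that in \<open>auto intro: wd\<close>)
  show ?thesis
  proof
    show "additive_map S N h"
    proof (rule additive_mapI)
      fix y assume "y \<in> carrier S"
      then obtain f where "f \<in> carrier W" "y = \<pi> f" using sym_proj_surj by blast
      then show "h y \<in> carrier N" by (simp add: hH Hc n0)
    next
      fix y z assume "y \<in> carrier S" "z \<in> carrier S"
      then obtain f g where f: "f \<in> carrier W" "y = \<pi> f" "g \<in> carrier W" "z = \<pi> g"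
        using sym_proj_surj by metis
      then have "y \<oplus>\<^bsub>S\<^esub> z = \<pi> (f + g)" by (simp add: proj_add)
      then show "h (y \<oplus>\<^bsub>S\<^esub> z) = h y \<oplus>\<^bsub>N\<^esub> h z"
        using f by (simp add: hH additive_map_add[OF HA[OF n0], simplified])
    qed
    show "h \<one>\<^bsub>S\<^esub> = n0" using hH[of 1] by (simp add: proj_one H1 n0)
  next
    fix \<alpha> y assume "y \<in> carrier S"
    then obtain f where f: "f \<in> carrier W" "y = \<pi> f" using sym_proj_surj by blast
    then have "sc \<alpha> \<otimes>\<^bsub>S\<^esub> y = \<pi> (scal_word \<alpha> * f)" by (simp add: sc_def proj_mult)
    then show "h (sc \<alpha> \<otimes>\<^bsub>S\<^esub> y) = s \<alpha> (h y)" using f by (simp add: hH HM Hs Hc n0)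
  next
    fix x y assume "y \<in> carrier S" and x: "x \<in> carrier M"
    then obtain f where f: "f \<in> carrier W" "y = \<pi> f" using sym_proj_surj by blast
    then have "vc x \<otimes>\<^bsub>S\<^esub> y = \<pi> (vec_word x * f)" using x by (simp add: vc_proj proj_mult)
    then show "h (vc x \<otimes>\<^bsub>S\<^esub> y) = v x (h y)" using f x by (simp add: hH HM Hv Hc n0)
  qed
qed

end

locale rational_supermodule = supermodule K M
  for K :: "bit \<Rightarrow> 'k::ring_1 set" and M :: "('k, 'm, 'e) supermod_scheme" (structure) +
  assumes rational: "\<forall>n::nat. n > 0 \<longrightarrow> (\<exists>x::'k. of_nat n * x = 1)"

section \<open>Monomials and the grading of the symmetric algebra\<close>

lemma list_prod_Nil [simp]: "list_prod R [] = \<one>\<^bsub>R\<^esub>"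
  and list_prod_Cons [simp]: "list_prod R (x # xs) = x \<otimes>\<^bsub>R\<^esub> list_prod R xs"
  by (simp_all add: list_prod_def)

lemma (in monoid) list_prod_closed: "set xs \<subseteq> carrier G \<Longrightarrow> list_prod G xs \<in> carrier G"
  by (induction xs) auto

context supermodule
begin

abbreviation vprod :: "'m list \<Rightarrow> ('k, 'm) words set set"
  where "vprod X \<equiv> list_prod S (map vc X)"

definition homog :: "'m list \<Rightarrow> bit list \<Rightarrow> bool"
  where "homog X ps \<longleftrightarrow> list_all2 (\<lambda>x p. x \<in> grade M p) X ps"

lemma homog_simps [simp]:
  "homog [] []" "homog (x # X) (p # ps) \<longleftrightarrow> x \<in> grade M p \<and> homog X ps"
  by (auto simp: homog_def)

lemma homog_Nil: "homog [] ps \<longleftrightarrow> ps = []"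
  by (simp add: homog_def)

lemma homog_induct [consumes 1, case_names Nil Cons]:
  assumes "homog X ps" "P [] []"
    "\<And>x p X ps. x \<in> grade M p \<Longrightarrow> homog X ps \<Longrightarrow> P X ps \<Longrightarrow> P (x # X) (p # ps)"
  shows "P X ps"
  using assms(1) unfolding homog_def
  by (induction rule: list_all2_induct) (use assms(2,3) in \<open>auto simp: homog_def\<close>)

lemma homog_carrier: "homog X ps \<Longrightarrow> set X \<subseteq> carrier M"
  by (induction rule: homog_induct) (auto simp: grade_carrier)

lemma vprod_closed [simp]: "set X \<subseteq> carrier M \<Longrightarrow> vprod X \<in> carrier S"
  by (rule S.list_prod_closed) auto

lemma sc_minus_one_mult: "y \<in> carrier S \<Longrightarrow> sc (- 1) \<otimes>\<^bsub>S\<^esub> y = \<ominus>\<^bsub>S\<^esub> y"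
  by (simp add: sc_minus sc_one S.l_minus)

lemma S_induct [consumes 1, case_names one scal vec add]:
  assumes y: "y \<in> carrier S" and 1: "P \<one>\<^bsub>S\<^esub>"
    and s: "\<And>\<alpha> y. y \<in> carrier S \<Longrightarrow> P y \<Longrightarrow> P (sc \<alpha> \<otimes>\<^bsub>S\<^esub> y)"
    and v: "\<And>x y. x \<in> carrier M \<Longrightarrow> y \<in> carrier S \<Longrightarrow> P y \<Longrightarrow> P (vc x \<otimes>\<^bsub>S\<^esub> y)"
    and a: "\<And>y z. y \<in> carrier S \<Longrightarrow> z \<in> carrier S \<Longrightarrow> P y \<Longrightarrow> P z \<Longrightarrow> P (y \<oplus>\<^bsub>S\<^esub> z)"
  shows "P y"
proof -
  obtain f where f: "f \<in> carrier W" "y = \<pi> f" using sym_proj_surj[OF y] by blast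
  have w: "P (\<pi> (frag_of (FMon ls)))" if "set ls \<subseteq> range Inl \<union> Inr ` carrier M" for ls
    using that
  proof (induction ls)
    case Nil
    then show ?case using 1 proj_one by (simp add: one_frag zero_fmon_def)
  next
    case (Cons l ls)
    have c: "FMon ls \<in> valid_word M" using Cons by (simp add: valid_word_def)
    have IH: "P (\<pi> (frag_of (FMon ls)))" using Cons by simp
    have "\<pi> (frag_of (FMon (l # ls))) = \<pi> (frag_of (FMon [l])) \<otimes>\<^bsub>S\<^esub> \<pi> (frag_of (FMon ls))"
      using proj_mult[of "frag_of (FMon [l])" "frag_of (FMon ls)"] Cons(2) c
      by (simp add: frag_of_mult plus_fmon_def valid_word_def)
    moreover have "\<pi> (frag_of (FMon ls)) \<in> carrier S" using c by (intro proj.hom_closed) simp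
    ultimately show ?case
      using Cons(2) IH s v
      by (cases l) (auto simp: sc_def vc_proj scal_word_def vec_word_def)
  qed
  have "P (\<pi> f)"
    using f(1)
  proof (induction f rule: word_ring_induct)
    case zero
    have "\<pi> 0 = sc 0 \<otimes>\<^bsub>S\<^esub> \<one>\<^bsub>S\<^esub>" using proj.hom_zero by (simp add: sc_zero)
    then show ?case using s[OF _ 1] by simp
  next
    case (word u)
    then show ?case using w[of "letters u"] by (simp add: valid_word_def)
  next
    case (diff f g)
    have "\<pi> (f - g) = \<pi> f \<oplus>\<^bsub>S\<^esub> sc (- 1) \<otimes>\<^bsub>S\<^esub> \<pi> g"
      using diff additive_map_word_diff[of S M \<pi> f g] S.is_abelian_group
      by (simp add: sc_minus_one_mult additive_map_def proj_add)
    then show ?case using diff a s by simp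
  qed
  then show ?thesis using f by simp
qed

lemma sc_vc_homog: "x \<in> grade M p \<Longrightarrow> \<alpha> \<in> K q \<Longrightarrow> sc \<alpha> \<otimes>\<^bsub>S\<^esub> vc x = vc x \<otimes>\<^bsub>S\<^esub> sc (\<alpha> * ksign (q * p))"
  by (simp add: vc_lsmult[symmetric] vc_smult[symmetric] lsmult_homog grade_carrier rsmult_assoc)

lemma K_mult_ksign: "\<alpha> \<in> K q \<Longrightarrow> \<alpha> * ksign p \<in> K q"
  using K_mult[of \<alpha> q "ksign p" 0] by simp

lemma sc_vprod_homog:
  assumes "homog X ps" "\<alpha> \<in> K q"
  shows "sc \<alpha> \<otimes>\<^bsub>S\<^esub> vprod X = vprod X \<otimes>\<^bsub>S\<^esub> sc (\<alpha> * ksign (q * sum_list ps))"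
  using assms
proof (induction arbitrary: \<alpha> rule: homog_induct)
  case Nil
  then show ?case by simp
next
  case (Cons x p X ps)
  have c: "x \<in> carrier M" "vprod X \<in> carrier S" using Cons homog_carrier grade_carrier by auto
  have "sc \<alpha> \<otimes>\<^bsub>S\<^esub> (vc x \<otimes>\<^bsub>S\<^esub> vprod X) = vc x \<otimes>\<^bsub>S\<^esub> (sc (\<alpha> * ksign (q * p)) \<otimes>\<^bsub>S\<^esub> vprod X)"
    using c Cons by (simp add: S.m_assoc[symmetric] sc_vc_homog)
  also have "\<dots> = vc x \<otimes>\<^bsub>S\<^esub> vprod X \<otimes>\<^bsub>S\<^esub> sc (\<alpha> * ksign (q * p) * ksign (q * sum_list ps))"
    using c Cons K_mult_ksign by (simp add: S.m_assoc)
  finally show ?case by (simp add: mult.assoc ksign_mult distrib_left)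
qed

text \<open>Scalars can be moved to the right of all letters at the cost of signs, and scalars and
  letters split into homogeneous parts, so these monomials generate the additive group of
  \<open>S\<close>.\<close>

lemma S_mono_induct [consumes 1, case_names mono add]:
  assumes y: "y \<in> carrier S"
    and m: "\<And>X ps \<alpha> q. homog X ps \<Longrightarrow> \<alpha> \<in> K q \<Longrightarrow> P (vprod X \<otimes>\<^bsub>S\<^esub> sc \<alpha>)"
    and a: "\<And>y z. y \<in> carrier S \<Longrightarrow> z \<in> carrier S \<Longrightarrow> P y \<Longrightarrow> P z \<Longrightarrow> P (y \<oplus>\<^bsub>S\<^esub> z)"
  shows "P y"
proof -
  \<comment> \<open>Nothing is known about \<open>P\<close> under left multiplication. The argument
    therefore runs on \<open>Q\<close>, the least additively closed set that contains the monomials,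
    and shows that left multiplication by generators preserves it.\<close>
  define C where "C P \<longleftrightarrow> (\<forall>X ps \<alpha> q. homog X ps \<longrightarrow> \<alpha> \<in> K q \<longrightarrow> P (vprod X \<otimes>\<^bsub>S\<^esub> sc \<alpha>)) \<and>
    (\<forall>y\<in>carrier S. \<forall>z\<in>carrier S. P y \<longrightarrow> P z \<longrightarrow> P (y \<oplus>\<^bsub>S\<^esub> z))" for P
  define Q where "Q = {y \<in> carrier S. \<forall>P. C P \<longrightarrow> P y}"
  have Qc: "Q \<subseteq> carrier S" by (auto simp: Q_def)
  have Qm: "vprod X \<otimes>\<^bsub>S\<^esub> sc \<alpha> \<in> Q" if "homog X ps" "\<alpha> \<in> K q" for X ps \<alpha> q
  proof -
    have "P (vprod X \<otimes>\<^bsub>S\<^esub> sc \<alpha>)" if "C P" for P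
      using that \<open>homog X ps\<close> \<open>\<alpha> \<in> K q\<close> unfolding C_def by blast
    moreover have "vprod X \<otimes>\<^bsub>S\<^esub> sc \<alpha> \<in> carrier S" using homog_carrier[OF that(1)] by simp
    ultimately show ?thesis unfolding Q_def by blast
  qed
  have Qa: "y \<oplus>\<^bsub>S\<^esub> z \<in> Q" if "y \<in> Q" "z \<in> Q" for y z
  proof -
    have "P (y \<oplus>\<^bsub>S\<^esub> z)" if "C P" for P
    proof -
      have "y \<in> carrier S" "z \<in> carrier S" "P y" "P z"
        using that \<open>y \<in> Q\<close> \<open>z \<in> Q\<close> unfolding Q_def by blast+
      then show ?thesis using that unfolding C_def by blast
    qed
    moreover have "y \<oplus>\<^bsub>S\<^esub> z \<in> carrier S" using that Qc by blast
    ultimately show ?thesis unfolding Q_def by blast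
  qed
  have QI: "P y" if "y \<in> Q" "\<And>X ps \<alpha> q. homog X ps \<Longrightarrow> \<alpha> \<in> K q \<Longrightarrow> P (vprod X \<otimes>\<^bsub>S\<^esub> sc \<alpha>)"
    "\<And>y z. y \<in> carrier S \<Longrightarrow> z \<in> carrier S \<Longrightarrow> P y \<Longrightarrow> P z \<Longrightarrow> P (y \<oplus>\<^bsub>S\<^esub> z)" for P y
  proof -
    have "C P" unfolding C_def using that(2,3) by blast
    then show ?thesis using that(1) unfolding Q_def by blast
  qed
  have sQ: "sc \<alpha> \<otimes>\<^bsub>S\<^esub> y \<in> Q" if "y \<in> Q" "\<alpha> \<in> K q" for y \<alpha> q
    using that(1)
  proof (rule QI)
    fix X ps \<beta> r assume h: "homog X ps" "\<beta> \<in> K r"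
    have "sc \<alpha> \<otimes>\<^bsub>S\<^esub> (vprod X \<otimes>\<^bsub>S\<^esub> sc \<beta>) = vprod X \<otimes>\<^bsub>S\<^esub> sc (\<alpha> * ksign (q * sum_list ps) * \<beta>)"
      using h homog_carrier[OF h(1)] sc_vprod_homog[OF h(1) that(2)]
      by (simp add: S.m_assoc[symmetric] sc_mult)
    then show "sc \<alpha> \<otimes>\<^bsub>S\<^esub> (vprod X \<otimes>\<^bsub>S\<^esub> sc \<beta>) \<in> Q"
      using Qm[OF h(1) K_mult[OF K_mult_ksign[OF that(2)] h(2)]] by simp
  qed (use Qa in \<open>auto simp: S.r_distr\<close>)
  have vQ: "vc x \<otimes>\<^bsub>S\<^esub> y \<in> Q" if "y \<in> Q" "x \<in> grade M q" for y x q
    using that(1)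
  proof (rule QI)
    fix X ps \<beta> r assume h: "homog X ps" "\<beta> \<in> K r"
    have "vc x \<otimes>\<^bsub>S\<^esub> (vprod X \<otimes>\<^bsub>S\<^esub> sc \<beta>) = vprod (x # X) \<otimes>\<^bsub>S\<^esub> sc \<beta>"
      using h homog_carrier[OF h(1)] that(2) by (simp add: S.m_assoc grade_carrier)
    then show "vc x \<otimes>\<^bsub>S\<^esub> (vprod X \<otimes>\<^bsub>S\<^esub> sc \<beta>) \<in> Q"
      using Qm[of "x # X" "q # ps" \<beta> r] h that(2) by simp
  qed (use Qa that(2) grade_carrier in \<open>auto simp: S.r_distr\<close>)
  have "y \<in> Q"
    using y
  proof (induction rule: S_induct)
    case one
    then show ?case using Qm[of "[]" "[]" 1 0] by (simp add: K_one sc_one)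
  next
    case (scal \<alpha> y)
    have "sc \<alpha> \<otimes>\<^bsub>S\<^esub> y = sc (kcomp 0 \<alpha>) \<otimes>\<^bsub>S\<^esub> y \<oplus>\<^bsub>S\<^esub> sc (kcomp 1 \<alpha>) \<otimes>\<^bsub>S\<^esub> y"
      using scal by (simp add: S.l_distr[symmetric] sc_add[symmetric] kcomp_sum)
    then show ?case using sQ[OF scal(2) kcomp_K] Qa by simp
  next
    case (vec x y)
    have "vc x \<otimes>\<^bsub>S\<^esub> y = vc (component M 0 x) \<otimes>\<^bsub>S\<^esub> y \<oplus>\<^bsub>S\<^esub> vc (component M 1 x) \<otimes>\<^bsub>S\<^esub> y"
      using vec by (simp add: S.l_distr[symmetric] vc_add[symmetric] component_sum)
    then show ?case using vQ[OF vec(3) component_grade[OF vec(1)]] Qa by simp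
  qed (rule Qa)
  then show ?thesis using QI m a by blast
qed

definition Sgens :: "bit \<Rightarrow> ('k, 'm) words set set set"
  where "Sgens r = {vprod X \<otimes>\<^bsub>S\<^esub> sc \<alpha> | X ps \<alpha> q. homog X ps \<and> \<alpha> \<in> K q \<and> sum_list ps + q = r}"

lemma Sgens_closed: "Sgens r \<subseteq> carrier S"
  using homog_carrier by (auto simp: Sgens_def)

text \<open>The grading of \<open>S\<close> is the image of that of the tensor algebra, and a
  homomorphism maps the subgroup generated by a set onto the one generated by its image.\<close>

lemma grade_S: "grade S r = generate (add_monoid S) (Sgens r)"
proof -
  define Q where "Q = W Quot ker\<^sub>T"
  interpret T: ring T by (rule tens_ring)
  interpret Q: ring Q unfolding Q_def by (rule ideal.quotient_is_ring[OF tens_ker_ideal])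
  note Qs = tens_simps[folded Q_def, symmetric]
  interpret q: ring_hom_ring Q S "(+>\<^bsub>T\<^esub>) (sym_ideal K M)"
    using sym_quot_hom by (intro ring_hom_ringI2[OF Q.ring_axioms sym_ring]) (simp add: ring_hom_def Qs)
  define G where "G = {list_prod Q (map (tens_vec K M) xs) \<otimes>\<^bsub>Q\<^esub> tens_scal K M \<alpha> | xs ps \<alpha> q.
      homog xs ps \<and> \<alpha> \<in> K q \<and> sum_list ps + q = r}"
  have gT: "grade T r = generate (add_monoid Q) G"
    by (simp add: tens_alg_def Let_def G_def homog_def Q_def)
  have vQ: "tens_vec K M x \<in> carrier Q" if "x \<in> carrier M" for x
    using tens_vec_closed[OF that] by (simp add: Qs)
  have sQ: "tens_scal K M \<alpha> \<in> carrier Q" for \<alpha>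
    using tens_scal_closed by (simp add: Qs)
  have tc: "list_prod Q (map (tens_vec K M) xs) \<in> carrier Q" if "set xs \<subseteq> carrier M" for xs
    by (rule Q.list_prod_closed) (use that vQ in auto)
  have Gc: "G \<subseteq> carrier Q"
    using tc sQ homog_carrier by (auto simp: G_def)
  have im: "sym_ideal K M +>\<^bsub>T\<^esub> list_prod Q (map (tens_vec K M) xs) = vprod xs" if "set xs \<subseteq> carrier M" for xs
    using that
    by (induction xs) (auto simp: tc vQ sym_vec_def)
  have im2: "sym_ideal K M +>\<^bsub>T\<^esub> (list_prod Q (map (tens_vec K M) xs) \<otimes>\<^bsub>Q\<^esub> tens_scal K M \<alpha>) = vprod xs \<otimes>\<^bsub>S\<^esub> sc \<alpha>"
    if "homog xs ps" for xs ps \<alpha>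
    using homog_carrier[OF that] by (simp add: tc sQ im sc_def sym_proj_def tens_scal_def[symmetric])
  have "(+>\<^bsub>T\<^esub>) (sym_ideal K M) ` G = Sgens r"
  proof
    show "(+>\<^bsub>T\<^esub>) (sym_ideal K M) ` G \<subseteq> Sgens r"
      unfolding G_def Sgens_def using im2 by fastforce
    show "Sgens r \<subseteq> (+>\<^bsub>T\<^esub>) (sym_ideal K M) ` G"
    proof
      fix y assume "y \<in> Sgens r"
      then obtain X ps \<alpha> q where h: "y = vprod X \<otimes>\<^bsub>S\<^esub> sc \<alpha>" "homog X ps" "\<alpha> \<in> K q" "sum_list ps + q = r"
        by (auto simp: Sgens_def)
      have "list_prod Q (map (tens_vec K M) X) \<otimes>\<^bsub>Q\<^esub> tens_scal K M \<alpha> \<in> G"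
        using h(2-4) unfolding G_def by blast
      then show "y \<in> (+>\<^bsub>T\<^esub>) (sym_ideal K M) ` G" unfolding h(1) im2[OF h(2), symmetric] by (rule imageI)
    qed
  qed
  moreover have "generate (add_monoid S) ((+>\<^bsub>T\<^esub>) (sym_ideal K M) ` G) =
      (+>\<^bsub>T\<^esub>) (sym_ideal K M) ` generate (add_monoid Q) G"
    using group_hom.generate_img[OF q.a_group_hom, of G] Gc by simp
  ultimately show ?thesis
    by (simp add: sym_alg_def quot_alg_def gT)
qed

lemma grade_S_subgroup: "subgroup (grade S p) (add_monoid S)"
  unfolding grade_S using group.generate_is_subgroup[OF S.a_group, of "Sgens p"] Sgens_closed by simp

lemma grade_S_mono: "homog X ps \<Longrightarrow> \<alpha> \<in> K q \<Longrightarrow> vprod X \<otimes>\<^bsub>S\<^esub> sc \<alpha> \<in> grade S (sum_list ps + q)"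
  unfolding grade_S by (rule generate.incl) (auto simp: Sgens_def)

lemma grade_S_add: "y \<in> grade S p \<Longrightarrow> z \<in> grade S p \<Longrightarrow> y \<oplus>\<^bsub>S\<^esub> z \<in> grade S p"
  using subgroup.m_closed[OF grade_S_subgroup[of p]] by simp

lemma grade_S_carrier: "y \<in> grade S p \<Longrightarrow> y \<in> carrier S"
  using subgroup.subset[OF grade_S_subgroup[of p]] by auto

lemma grade_S_induct [consumes 1, case_names mono add]:
  assumes "y \<in> grade S r"
    and m: "\<And>X ps \<alpha> q. homog X ps \<Longrightarrow> \<alpha> \<in> K q \<Longrightarrow> sum_list ps + q = r \<Longrightarrow> P (vprod X \<otimes>\<^bsub>S\<^esub> sc \<alpha>)"
    and a: "\<And>y z. y \<in> grade S r \<Longrightarrow> z \<in> grade S r \<Longrightarrow> P y \<Longrightarrow> P z \<Longrightarrow> P (y \<oplus>\<^bsub>S\<^esub> z)"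
  shows "P y"
  using assms(1) unfolding grade_S
proof (induction rule: generate.induct)
  case one
  have "vprod [] \<otimes>\<^bsub>S\<^esub> sc 0 = \<zero>\<^bsub>S\<^esub>" by (simp add: sc_zero)
  then show ?case using m[of "[]" "[]" 0 r] by simp
next
  case (incl h)
  then show ?case using m by (auto simp: Sgens_def)
next
  case (inv h)
  then obtain X ps \<alpha> q where h: "h = vprod X \<otimes>\<^bsub>S\<^esub> sc \<alpha>" "homog X ps" "\<alpha> \<in> K q" "sum_list ps + q = r"
    by (auto simp: Sgens_def)
  have "inv\<^bsub>add_monoid S\<^esub> h = vprod X \<otimes>\<^bsub>S\<^esub> sc (- \<alpha>)"
    unfolding a_inv_def[symmetric] using h homog_carrier[OF h(2)] by (simp add: sc_minus S.r_minus)
  then show ?case using m[OF h(2) K_mult_ksign[OF h(3), of 1] h(4)] by simp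
next
  case (eng y z)
  then show ?case using a by (simp add: grade_S)
qed

lemma one_grade_S: "\<one>\<^bsub>S\<^esub> \<in> grade S 0"
  using grade_S_mono[of "[]" "[]" 1 0] by (simp add: K_one sc_one)

lemma sc_grade_S: "\<alpha> \<in> K p \<Longrightarrow> sc \<alpha> \<in> grade S p"
  using grade_S_mono[of "[]" "[]" \<alpha> p] by simp

lemma vc_grade_S: "x \<in> grade M p \<Longrightarrow> vc x \<in> grade S p"
  using grade_S_mono[of "[x]" "[p]" 1 0] by (simp add: K_one sc_one grade_carrier)

lemma vprod_grade_S: "homog X ps \<Longrightarrow> vprod X \<in> grade S (sum_list ps)"
  using grade_S_mono[of X ps 1 0] homog_carrier by (simp add: K_one sc_one)

lemma vc_mult_grade_S:
  assumes "x \<in> grade M p" "y \<in> grade S q"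
  shows "vc x \<otimes>\<^bsub>S\<^esub> y \<in> grade S (p + q)"
  using assms(2,1)
proof (induction rule: grade_S_induct)
  case (mono X ps \<alpha> r)
  have "vc x \<otimes>\<^bsub>S\<^esub> (vprod X \<otimes>\<^bsub>S\<^esub> sc \<alpha>) = vprod (x # X) \<otimes>\<^bsub>S\<^esub> sc \<alpha>"
    using mono homog_carrier grade_carrier by (simp add: S.m_assoc)
  then show ?case using grade_S_mono[of "x # X" "p # ps" \<alpha> r] mono(1,2,4) unfolding mono(3)[symmetric]
    by (simp add: add.assoc)
next
  case (add y z)
  then show ?case by (simp add: S.r_distr grade_carrier grade_S_carrier grade_S_add)
qed

lemma mult_sc_grade_S: "y \<in> grade S q \<Longrightarrow> \<alpha> \<in> K p \<Longrightarrow> y \<otimes>\<^bsub>S\<^esub> sc \<alpha> \<in> grade S (q + p)"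
proof (induction rule: grade_S_induct)
  case (mono X ps \<beta> r)
  then show ?case
    using grade_S_mono[of X ps "\<beta> * \<alpha>" "r + p"] homog_carrier K_mult
    by (simp add: S.m_assoc sc_mult[symmetric] add.assoc[symmetric])
next
  case (add y z)
  then show ?case by (simp add: S.l_distr grade_S_carrier grade_S_add)
qed

lemma sc_mult_homog:
  assumes "y \<in> grade S q" "\<alpha> \<in> K p"
  shows "sc \<alpha> \<otimes>\<^bsub>S\<^esub> y = y \<otimes>\<^bsub>S\<^esub> sc (\<alpha> * ksign (p * q))"
  using assms(1)
proof (induction rule: grade_S_induct)
  case (mono X ps \<beta> r)
  have c: "vprod X \<in> carrier S" using mono homog_carrier by simp
  have "sc \<alpha> \<otimes>\<^bsub>S\<^esub> (vprod X \<otimes>\<^bsub>S\<^esub> sc \<beta>) = vprod X \<otimes>\<^bsub>S\<^esub> sc (\<alpha> * ksign (p * sum_list ps) * \<beta>)"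
    using c sc_vprod_homog[OF mono(1) assms(2)]
    by (simp add: S.m_assoc[symmetric] sc_mult)
  also have "\<alpha> * ksign (p * sum_list ps) * \<beta> = \<beta> * (\<alpha> * ksign (p * q))"
  proof -
    have "\<alpha> * ksign (p * sum_list ps) * \<beta> = \<alpha> * \<beta> * ksign (p * sum_list ps)"
      by (simp add: mult.assoc ksign_commute)
    also have "\<dots> = ksign (p * r) * (\<beta> * \<alpha>) * ksign (p * sum_list ps)"
      using K_supercomm[OF assms(2) mono(2)] by simp
    also have "\<dots> = \<beta> * \<alpha> * (ksign (p * r) * ksign (p * sum_list ps))"
      by (simp only: ksign_commute[of "p * r"] mult.assoc)
    finally show ?thesis using mono(3) by (simp add: ksign_mult mult.assoc distrib_left[symmetric] add.commute)
  qed
  finally show ?case using c by (simp add: S.m_assoc sc_mult)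
next
  case (add y z)
  then show ?case by (simp add: S.l_distr S.r_distr grade_S_carrier)
qed

lemma mult_grade_S: "y \<in> grade S p \<Longrightarrow> z \<in> grade S q \<Longrightarrow> y \<otimes>\<^bsub>S\<^esub> z \<in> grade S (p + q)"
proof (induction rule: grade_S_induct)
  case (mono X ps \<alpha> r)
  have zc: "z \<in> carrier S" using mono grade_S_carrier by blast
  have a: "sc \<alpha> \<otimes>\<^bsub>S\<^esub> z \<in> grade S (q + r)"
    using mult_sc_grade_S[OF mono(4) K_mult_ksign[OF mono(2)]] sc_mult_homog[OF mono(4,2)] by simp
  have "vprod X \<otimes>\<^bsub>S\<^esub> y \<in> grade S (sum_list ps + s)" if "y \<in> grade S s" for y s
    using mono(1) 
  proof (induction rule: homog_induct)
    case (Cons x p X ps)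
    then show ?case
      using vc_mult_grade_S[OF Cons(1,3)] homog_carrier[OF Cons(2)] grade_S_carrier[OF that]
      by (simp add: S.m_assoc grade_carrier add.assoc)
  qed (use that grade_S_carrier in simp)
  from this[OF a] show ?case
    using mono homog_carrier[OF mono(1)] zc by (simp add: S.m_assoc bit_ac)
next
  case (add y w)
  then show ?case by (simp add: S.l_distr grade_S_carrier grade_S_add)
qed

section \<open>The sign involutions of scalars, letters and the symmetric algebra\<close>

definition ksigma :: "'k \<Rightarrow> 'k"
  where "ksigma \<alpha> = kcomp 0 \<alpha> + - kcomp 1 \<alpha>"

definition msigma :: "'m \<Rightarrow> 'm"
  where "msigma m = component M 0 m \<oplus> \<ominus> component M 1 m"

lemma ksigma_homog: "\<alpha> \<in> K p \<Longrightarrow> ksigma \<alpha> = \<alpha> * ksign p"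
  by (cases p) (simp_all add: ksigma_def kcomp_of_K)

lemma ksigma_add: "ksigma (\<alpha> + \<beta>) = ksigma \<alpha> + ksigma \<beta>"
  by (simp add: ksigma_def kcomp_add)

lemma ksigma_mult: "ksigma (\<alpha> * \<beta>) = ksigma \<alpha> * ksigma \<beta>"
proof (induction \<alpha> rule: K_induct)
  case (1 p \<alpha>)
  show ?case
  proof (induction \<beta> rule: K_induct)
    case (1 q \<beta>)
    then show ?case
      using \<open>\<alpha> \<in> K p\<close> K_mult[of \<alpha> p \<beta> q] by (cases p; cases q) (simp_all add: ksigma_homog)
  qed (simp add: ksigma_add distrib_left)
qed (simp add: ksigma_add distrib_right)

lemma msigma_homog: "m \<in> grade M p \<Longrightarrow> msigma m = m \<star> ksign p"
  by (cases p) (simp_all add: msigma_def component_of_grade grade_carrier rsmult_one smult_neg_one)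

lemma msigma_additive: "additive_map M M msigma"
  by (auto simp: additive_map_def msigma_def component_add minus_add a_ac)

lemma msigma_closed: "x \<in> carrier M \<Longrightarrow> msigma x \<in> carrier M"
  using additive_map_closed[OF msigma_additive] .

lemma msigma_smult: "m \<in> carrier M \<Longrightarrow> msigma (m \<star> \<alpha>) = msigma m \<star> ksigma \<alpha>"
proof (induction \<alpha> rule: K_induct)
  case (1 p \<alpha>)
  show ?case
  proof (rule additive_eq_on_grades[OF additive_map_compose[OF smult_additive msigma_additive]
        additive_map_compose[OF msigma_additive smult_additive] _ 1(2)])
    fix q m assume m: "m \<in> grade M q"
    show "msigma (m \<star> \<alpha>) = msigma m \<star> ksigma \<alpha>"
      using m rsmult_grade[OF m 1(1)] 1
      by (simp add: msigma_homog ksigma_homog grade_carrier rsmult_assoc rsmult_closed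
        smult_ksign_commute[of _ _ \<alpha>] smult_ksign_ksign)
  qed
next
  case (2 a b)
  then show ?case
    by (simp add: rsmult_r_distr ksigma_add additive_map_add[OF msigma_additive] rsmult_closed msigma_closed)
qed

lemma msigma_lsmult: "m \<in> carrier M \<Longrightarrow> msigma (lsmult K M \<alpha> m) = lsmult K M (ksigma \<alpha>) (msigma m)"
proof (induction \<alpha> rule: K_induct)
  case (1 p \<alpha>)
  show ?case
  proof (rule additive_eq_on_grades[OF additive_map_compose[OF lsmult_additive msigma_additive]
        additive_map_compose[OF msigma_additive lsmult_additive] _ 1(2)])
    fix q m assume m: "m \<in> grade M q"
    show "msigma (lsmult K M \<alpha> m) = lsmult K M (ksigma \<alpha>) (msigma m)"
      using m lsmult_grade[OF m 1(1)] 1 K_mult_ksign[OF 1(1), of p] ksign_grade[OF m, of q]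
      by (simp add: msigma_homog ksigma_homog lsmult_homog grade_carrier rsmult_assoc rsmult_closed
        smult_ksign_commute[of _ _ \<alpha>] smult_ksign_ksign bit_ac)
  qed
next
  case (2 a b)
  then show ?case
    by (simp add: lsmult_add_scal ksigma_add additive_map_add[OF msigma_additive] lsmult_closed msigma_closed)
qed

lemma left_mult_additive: "z \<in> carrier S \<Longrightarrow> additive_map S S (\<lambda>y. z \<otimes>\<^bsub>S\<^esub> y)"
  by (simp add: additive_map_def S.r_distr)

text \<open>The grading of \<open>S\<close> is separated by its grading involution, because 2 is invertible.\<close>

lemma grading_involution:
  obtains h where "additive_map S S h"
    "\<And>y p. y \<in> grade S p \<Longrightarrow> h y = y \<otimes>\<^bsub>S\<^esub> sc (ksign p)"
proof -
  have vk: "vc (x \<star> ksign p) = vc x \<otimes>\<^bsub>S\<^esub> sc (ksign p)" if "x \<in> carrier M" for x p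
    using that by (rule vc_smult)
  \<comment> \<open>The universal property is applied with \<open>S\<close> itself as target, every
    scalar and every letter acting through its image under the sign involution.\<close>
  obtain h where h: "additive_map S S h" "h \<one>\<^bsub>S\<^esub> = \<one>\<^bsub>S\<^esub>"
    "\<And>\<alpha> y. y \<in> carrier S \<Longrightarrow> h (sc \<alpha> \<otimes>\<^bsub>S\<^esub> y) = sc (ksigma \<alpha>) \<otimes>\<^bsub>S\<^esub> h y"
    "\<And>x y. x \<in> carrier M \<Longrightarrow> y \<in> carrier S \<Longrightarrow> h (vc x \<otimes>\<^bsub>S\<^esub> y) = vc (msigma x) \<otimes>\<^bsub>S\<^esub> h y"
  proof (rule module_lift[OF S.is_abelian_group S.one_closed,
        of "\<lambda>\<alpha> y. sc (ksigma \<alpha>) \<otimes>\<^bsub>S\<^esub> y" "\<lambda>x y. vc (msigma x) \<otimes>\<^bsub>S\<^esub> y"])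
    fix x y p q n assume h: "x \<in> grade M p" "y \<in> grade M q" "n \<in> carrier S"
    have k: "ksigma (ksign (p * q)) = ksign (p * q)" by (simp add: ksigma_homog[of _ 0])
    show "vc (msigma x) \<otimes>\<^bsub>S\<^esub> (vc (msigma y) \<otimes>\<^bsub>S\<^esub> n) =
        vc (msigma y) \<otimes>\<^bsub>S\<^esub> (vc (msigma x) \<otimes>\<^bsub>S\<^esub> (sc (ksigma (ksign (p * q))) \<otimes>\<^bsub>S\<^esub> n))"
      using h vc_swap[OF ksign_grade[OF h(1), of p] ksign_grade[OF h(2), of q]] unfolding k
      by (simp add: msigma_homog grade_carrier rsmult_closed S.m_assoc[symmetric])
  next
    fix u n assume "u \<in> grade M 1" "n \<in> carrier S"
    then show "vc (msigma u) \<otimes>\<^bsub>S\<^esub> (vc (msigma u) \<otimes>\<^bsub>S\<^esub> n) = \<zero>\<^bsub>S\<^esub>"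
      using vc_odd_square[OF ksign_grade[of u 1 1]]
      by (simp add: msigma_homog[of u 1] grade_carrier rsmult_closed S.m_assoc[symmetric])
  qed (use ksigma_homog[OF K_one] in \<open>auto simp: left_mult_additive msigma_closed sc_one ksigma_add sc_add
      S.l_distr ksigma_mult sc_mult S.m_assoc additive_map_add[OF msigma_additive] vc_add
      msigma_smult vc_smult msigma_lsmult vc_lsmult\<close>)
  have hv: "h (vprod X \<otimes>\<^bsub>S\<^esub> sc \<alpha>) = vprod X \<otimes>\<^bsub>S\<^esub> sc \<alpha> \<otimes>\<^bsub>S\<^esub> sc (ksign (sum_list ps + q))"
    if "homog X ps" "\<alpha> \<in> K q" for X ps \<alpha> q
    using that
  proof (induction rule: homog_induct)
    case Nil
    then show ?case using h(3)[of "\<one>\<^bsub>S\<^esub>" \<alpha>] by (simp add: h(2) ksigma_homog sc_mult)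
  next
    case (Cons x p X ps)
    have c: "x \<in> carrier M" "vprod X \<in> carrier S" using Cons homog_carrier grade_carrier by auto
    have k: "vc x \<otimes>\<^bsub>S\<^esub> sc (ksign p) \<otimes>\<^bsub>S\<^esub> z = vc x \<otimes>\<^bsub>S\<^esub> z \<otimes>\<^bsub>S\<^esub> sc (ksign p)" if "z \<in> carrier S" for z
      using that c by (simp add: sc_ksign S.r_minus S.l_minus)
    have "h (vprod (x # X) \<otimes>\<^bsub>S\<^esub> sc \<alpha>) = vc x \<otimes>\<^bsub>S\<^esub> sc (ksign p) \<otimes>\<^bsub>S\<^esub> h (vprod X \<otimes>\<^bsub>S\<^esub> sc \<alpha>)"
      using c Cons h(4)[of x "vprod X \<otimes>\<^bsub>S\<^esub> sc \<alpha>"] by (simp add: S.m_assoc msigma_homog vk)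
    also have "\<dots> = vc x \<otimes>\<^bsub>S\<^esub> (vprod X \<otimes>\<^bsub>S\<^esub> sc \<alpha>) \<otimes>\<^bsub>S\<^esub> (sc (ksign (sum_list ps + q)) \<otimes>\<^bsub>S\<^esub> sc (ksign p))"
      using c Cons by (simp add: k) (simp add: S.m_assoc)
    finally show ?case using c by (simp add: sc_mult[symmetric] ksign_mult S.m_assoc bit_ac)
  qed
  have "h y = y \<otimes>\<^bsub>S\<^esub> sc (ksign p)" if "y \<in> grade S p" for y p
    using that
  proof (induction rule: grade_S_induct)
    case (mono X ps \<alpha> q)
    then show ?case using hv by blast
  next
    case (add y z)
    then show ?case by (simp add: additive_map_add[OF h(1)] grade_S_carrier S.l_distr)
  qed
  with h(1) that show ?thesis by blast
qed

end

context rational_supermodule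
begin

lemma half: "\<exists>x::'k. 2 * x = 1"
  using rational[rule_format, of 2] by simp

lemma S_double_zero:
  assumes "y \<in> carrier S" "y \<oplus>\<^bsub>S\<^esub> y = \<zero>\<^bsub>S\<^esub>" shows "y = \<zero>\<^bsub>S\<^esub>"
proof -
  obtain x :: 'k where x: "2 * x = 1" using half by blast
  have "y \<oplus>\<^bsub>S\<^esub> y = y \<otimes>\<^bsub>S\<^esub> sc 2"
    using assms(1) sc_add[of 1 1] by (simp add: sc_one S.r_distr)
  with assms(2) have "y \<otimes>\<^bsub>S\<^esub> sc 2 = \<zero>\<^bsub>S\<^esub>" by simp
  then have "y \<otimes>\<^bsub>S\<^esub> sc 2 \<otimes>\<^bsub>S\<^esub> sc x = \<zero>\<^bsub>S\<^esub>" by simp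
  then show ?thesis using assms(1) x by (simp add: S.m_assoc sc_mult[symmetric] sc_one)
qed

text \<open>Monomials are homogeneous, which yields decompositions. For uniqueness, the involution
  turns \<open>u + v = 0\<close> into \<open>u - v = 0\<close>; hence \<open>2 u = 0\<close>, and 2
  is invertible.\<close>

lemma S_supergrading: "supergrading S"
proof (rule supergradingI[OF S.is_abelian_group grade_S_subgroup])
  fix y assume "y \<in> carrier S"
  then show "\<exists>u\<in>grade S 0. \<exists>v\<in>grade S 1. y = u \<oplus>\<^bsub>S\<^esub> v"
  proof (induction rule: S_mono_induct)
    case (mono X ps \<alpha> q)
    let ?m = "vprod X \<otimes>\<^bsub>S\<^esub> sc \<alpha>"
    have c: "?m \<in> carrier S" using mono homog_carrier by simp
    have z: "\<zero>\<^bsub>S\<^esub> \<in> grade S p" for p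
      using subgroup.one_closed[OF grade_S_subgroup[of p]] by simp
    have "?m = ?m \<oplus>\<^bsub>S\<^esub> \<zero>\<^bsub>S\<^esub>" "?m = \<zero>\<^bsub>S\<^esub> \<oplus>\<^bsub>S\<^esub> ?m" using c by simp_all
    moreover have "?m \<in> grade S 0 \<or> ?m \<in> grade S 1"
      using grade_S_mono[OF mono] by (cases "sum_list ps + q") auto
    ultimately show ?case using z by metis
  next
    case (add y z)
    then obtain u v u' v' where h: "u \<in> grade S 0" "v \<in> grade S 1" "y = u \<oplus>\<^bsub>S\<^esub> v"
      "u' \<in> grade S 0" "v' \<in> grade S 1" "z = u' \<oplus>\<^bsub>S\<^esub> v'" by blast
    then have "y \<oplus>\<^bsub>S\<^esub> z = (u \<oplus>\<^bsub>S\<^esub> u') \<oplus>\<^bsub>S\<^esub> (v \<oplus>\<^bsub>S\<^esub> v')"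
      using grade_S_carrier by (simp add: S.a_ac)
    then show ?case using h grade_S_add by blast
  qed
next
  fix u v assume uv: "u \<in> grade S 0" "v \<in> grade S 1" "u \<oplus>\<^bsub>S\<^esub> v = \<zero>\<^bsub>S\<^esub>"
  have c: "u \<in> carrier S" "v \<in> carrier S" using uv grade_S_carrier by auto
  obtain h where h: "additive_map S S h" "\<And>y p. y \<in> grade S p \<Longrightarrow> h y = y \<otimes>\<^bsub>S\<^esub> sc (ksign p)"
    using grading_involution by blast
  have "h (u \<oplus>\<^bsub>S\<^esub> v) = u \<oplus>\<^bsub>S\<^esub> \<ominus>\<^bsub>S\<^esub> v"
    using c additive_map_add[OF h(1) c] h(2)[OF uv(1)] h(2)[OF uv(2)]
    by (simp add: sc_one sc_minus S.r_minus)
  moreover have "h (u \<oplus>\<^bsub>S\<^esub> v) = \<zero>\<^bsub>S\<^esub>"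
    unfolding uv(3) by (rule additive_map_zero[OF S.is_abelian_group S.is_abelian_group h(1)])
  ultimately have "u \<oplus>\<^bsub>S\<^esub> \<ominus>\<^bsub>S\<^esub> v = \<zero>\<^bsub>S\<^esub>" by simp
  then have "u = v" by (rule S.eq_of_diff_zero[OF c])
  then have "u \<oplus>\<^bsub>S\<^esub> u = \<zero>\<^bsub>S\<^esub>" using uv(3) by metis
  then show "u = \<zero>\<^bsub>S\<^esub>" by (rule S_double_zero[OF c(1)])
qed

sublocale S: supermodule K S
proof (intro supermodule.intro supermodule_axioms.intro)
  show "comm_superring K" by (rule comm_superring_axioms)
  show "abelian_group S" by (rule S.is_abelian_group)
  show "supergrading S" by (rule S_supergrading)
qed (simp_all add: S_smult S.l_distr S.r_distr sc_add sc_mult S.m_assoc sc_one mult_sc_grade_S)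

lemma S_lsmult: "y \<in> carrier S \<Longrightarrow> lsmult K S \<alpha> y = sc \<alpha> \<otimes>\<^bsub>S\<^esub> y"
proof (induction \<alpha> rule: K_induct)
  case (1 p \<alpha>)
  show ?case
    by (rule S.additive_eq_on_grades[OF S.lsmult_additive left_mult_additive _ 1(2)])
      (use 1 in \<open>auto simp: S.lsmult_homog sc_mult_homog S_smult sc_mult S.m_assoc grade_S_carrier\<close>)
qed (simp add: S.lsmult_add_scal sc_add S.l_distr)

end

section \<open>Tensor products\<close>

lemma abelian_group_of_comm_group:
  assumes "comm_group Q" "carrier R = carrier Q" "add R = monoid.mult Q" "ring.zero R = one Q"
  shows "abelian_group R"
proof -
  interpret Q: comm_group Q by fact
  show ?thesis
    by (rule abelian_groupI) (use assms(2-4) Q.l_inv_ex in \<open>auto simp: Q.m_ac\<close>)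
qed

text \<open>The maps that respect \<open>tensor_rel\<close>, hence factor through the tensor
  product.\<close>

definition balanced_map :: "(bit \<Rightarrow> 'k::ring_1 set) \<Rightarrow> ('k, 'm, 'e) supermod_scheme \<Rightarrow>
    ('k, 'n, 'f) supermod_scheme \<Rightarrow> ('a, 'h) ring_scheme \<Rightarrow> ('m \<Rightarrow> 'n \<Rightarrow> 'a) \<Rightarrow> bool"
  where "balanced_map K M N A f \<longleftrightarrow>
    (\<forall>n\<in>carrier N. additive_map M A (\<lambda>m. f m n)) \<and>
    (\<forall>m\<in>carrier M. additive_map N A (f m)) \<and>
    (\<forall>m\<in>carrier M. \<forall>n\<in>carrier N. \<forall>\<alpha>. f (m \<star>\<^bsub>M\<^esub> \<alpha>) n = f m (lsmult K N \<alpha> n))"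

lemma balanced_mapD:
  assumes "balanced_map K M N A f"
  shows "n \<in> carrier N \<Longrightarrow> additive_map M A (\<lambda>m. f m n)" "m \<in> carrier M \<Longrightarrow> additive_map N A (f m)"
    "m \<in> carrier M \<Longrightarrow> n \<in> carrier N \<Longrightarrow> f (m \<star>\<^bsub>M\<^esub> \<alpha>) n = f m (lsmult K N \<alpha> n)"
    "m \<in> carrier M \<Longrightarrow> n \<in> carrier N \<Longrightarrow> f m n \<in> carrier A"
  using assms by (auto simp: balanced_map_def additive_map_def)

locale supermodule_pair = M: supermodule K M + N: supermodule K N
  for K :: "bit \<Rightarrow> 'k::ring_1 set" and M :: "('k, 'm, 'e) supermod_scheme"
    and N :: "('k, 'n, 'f) supermod_scheme"
begin

text \<open>The balancing condition is additive in each of its three arguments, so homogeneous ones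
  suffice; for these the left action is the right action up to an explicit sign.\<close>

lemma balanced_mapI:
  assumes l: "\<And>n. n \<in> carrier N \<Longrightarrow> additive_map M A (\<lambda>m. f m n)"
    and r: "\<And>m. m \<in> carrier M \<Longrightarrow> additive_map N A (f m)"
    and b: "\<And>m n \<alpha> p q r. m \<in> grade M r \<Longrightarrow> n \<in> grade N q \<Longrightarrow> \<alpha> \<in> K p \<Longrightarrow>
      f (m \<star>\<^bsub>M\<^esub> \<alpha>) n = f m (n \<star>\<^bsub>N\<^esub> \<alpha> \<star>\<^bsub>N\<^esub> ksign (p * q))"
  shows "balanced_map K M N A f"
proof -
  have "f (m \<star>\<^bsub>M\<^esub> \<alpha>) n = f m (lsmult K N \<alpha> n)" if m: "m \<in> carrier M" and n: "n \<in> carrier N" for m n \<alpha>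
  proof (induction \<alpha> rule: M.K_induct)
    case (1 p \<alpha>)
    have *: "f (m \<star>\<^bsub>M\<^esub> \<alpha>) n = f m (lsmult K N \<alpha> n)" if "n \<in> grade N q" for n q
    proof -
      have nc: "n \<in> carrier N" using that N.grade_carrier by blast
      have "f (m \<star>\<^bsub>M\<^esub> \<alpha>) n = f m (n \<star>\<^bsub>N\<^esub> \<alpha> \<star>\<^bsub>N\<^esub> ksign (p * q))"
        by (rule M.additive_eq_on_grades[OF additive_map_compose[OF M.smult_additive l[OF nc]] l _ m])
          (use b that 1 nc in \<open>auto intro!: N.smult_closed\<close>)
      then show ?thesis using that 1 by (simp add: N.lsmult_homog)
    qed
    have mc: "m \<star>\<^bsub>M\<^esub> \<alpha> \<in> carrier M" using m by (rule M.smult_closed)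
    show ?case
      by (rule N.additive_eq_on_grades[OF r[OF mc] additive_map_compose[OF N.lsmult_additive r[OF m]] * n])
  next
    case (2 \<alpha> \<beta>)
    then show ?case
      using m n additive_map_add[OF l[OF n], of "m \<star>\<^bsub>M\<^esub> \<alpha>" "m \<star>\<^bsub>M\<^esub> \<beta>"]
        additive_map_add[OF r[OF m], of "lsmult K N \<alpha> n" "lsmult K N \<beta> n"]
      by (simp add: M.smult_r_distr N.lsmult_add_scal M.smult_closed)
  qed
  then show ?thesis using l r by (simp add: balanced_map_def)
qed

section \<open>The tensor product as a quotient of a free abelian group\<close>

abbreviation "FA \<equiv> free_Abelian_group (carrier M \<times> carrier N)"
abbreviation "V \<equiv> tensor_ab K M N"
abbreviation "TM \<equiv> tensor_mod K M N"
abbreviation "pt \<equiv> pure_tensor K M N"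

lemma tensor_rel_closed: "tensor_rel K M N \<subseteq> carrier FA"
proof -
  have d: "f - g \<in> carrier FA" if "f \<in> carrier FA" "g \<in> carrier FA" for f g :: "'m \<times> 'n \<Rightarrow>\<^sub>0 int"
    using that keys_diff[of f g] by (auto simp: carrier_free_Abelian_group_iff)
  show ?thesis
    unfolding tensor_rel_def
    by (intro Un_least; clarify; intro d) (auto simp: M.smult_closed)
qed

lemma FA_comm_group: "comm_group FA" by (rule abelian_free_Abelian_group)

lemma FA_group: "group FA" by simp

lemma ker_subgroup: "subgroup (tensor_ker K M N) FA"
  unfolding tensor_ker_def by (rule group.generate_is_subgroup[OF FA_group tensor_rel_closed])

lemma ker_normal: "tensor_ker K M N \<lhd> FA"
  by (rule comm_group.subgroup_imp_normal[OF FA_comm_group ker_subgroup])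

lemma V_simps: "carrier V = carrier (FA Mod tensor_ker K M N)" "ring.zero V = \<one>\<^bsub>FA Mod tensor_ker K M N\<^esub>"
  "add V = monoid.mult (FA Mod tensor_ker K M N)"
  by (simp_all add: tensor_ab_def Let_def)

lemma V_abelian: "abelian_group V"
  by (rule abelian_group_of_comm_group[OF comm_group.abelian_FactGroup[OF FA_comm_group ker_subgroup]])
    (simp_all only: V_simps)

sublocale V: abelian_group V by (rule V_abelian)

definition tproj :: "('m \<times> 'n \<Rightarrow>\<^sub>0 int) \<Rightarrow> ('m \<times> 'n \<Rightarrow>\<^sub>0 int) set"
  where "tproj f = tensor_ker K M N #>\<^bsub>FA\<^esub> f"

lemma tproj_closed: "f \<in> carrier FA \<Longrightarrow> tproj f \<in> carrier V"
  using normal.r_coset_hom_Mod[OF ker_normal] by (auto simp: tproj_def V_simps hom_def)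

lemma tproj_add: "f \<in> carrier FA \<Longrightarrow> g \<in> carrier FA \<Longrightarrow> tproj (f + g) = tproj f \<oplus>\<^bsub>V\<^esub> tproj g"
  using normal.r_coset_hom_Mod[OF ker_normal] unfolding tproj_def V_simps hom_def by fastforce

lemma tproj_surj: "t \<in> carrier V \<Longrightarrow> \<exists>f\<in>carrier FA. t = tproj f"
  by (auto simp: V_simps FactGroup_def RCOSETS_def tproj_def)

lemma tproj_eq_iff:
  assumes "f \<in> carrier FA" "g \<in> carrier FA"
  shows "tproj f = tproj g \<longleftrightarrow> f - g \<in> tensor_ker K M N"
proof -
  interpret FA: group FA by simp
  have inv: "inv\<^bsub>FA\<^esub> g = - g" using assms(2) by (simp add: carrier_free_Abelian_group_iff)
  have fg: "f \<otimes>\<^bsub>FA\<^esub> inv\<^bsub>FA\<^esub> g = f - g" by (simp add: inv)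
  show ?thesis
    unfolding tproj_def
    using FA.repr_independence[OF _ assms(2) ker_subgroup, of f] FA.rcos_self[OF assms(1) ker_subgroup]
      subgroup.rcos_module[OF ker_subgroup FA_group assms(2,1)] fg by metis
qed

lemma pt_tproj: "pt m n = tproj (frag_of (m, n))"
  by (simp add: pure_tensor_def tproj_def)

lemma pt_closed [simp]: "m \<in> carrier M \<Longrightarrow> n \<in> carrier N \<Longrightarrow> pt m n \<in> carrier V"
  unfolding pt_tproj by (rule tproj_closed) simp

lemma rel_ker: "r \<in> tensor_rel K M N \<Longrightarrow> r \<in> tensor_ker K M N"
  unfolding tensor_ker_def by (rule generate.incl)

lemma FA_add: "f \<in> carrier FA \<Longrightarrow> g \<in> carrier FA \<Longrightarrow> f + g \<in> carrier FA" for f g :: "'m \<times> 'n \<Rightarrow>\<^sub>0 int"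
  using group.is_monoid[OF FA_group] monoid.m_closed[of FA f g] by simp

lemma pt_add_l:
  assumes "m \<in> carrier M" "m' \<in> carrier M" "n \<in> carrier N"
  shows "pt (m \<oplus>\<^bsub>M\<^esub> m') n = pt m n \<oplus>\<^bsub>V\<^esub> pt m' n"
proof -
  have "frag_of (m \<oplus>\<^bsub>M\<^esub> m', n) - (frag_of (m, n) + frag_of (m', n)) \<in> tensor_ker K M N"
    by (rule rel_ker) (use assms in \<open>auto simp: tensor_rel_def diff_diff_eq[symmetric]\<close>)
  moreover have "frag_of (m, n) + frag_of (m', n) \<in> carrier FA" using assms by (intro FA_add) simp_all
  moreover have "frag_of (m \<oplus>\<^bsub>M\<^esub> m', n) \<in> carrier FA" using assms by simp
  ultimately have "pt (m \<oplus>\<^bsub>M\<^esub> m') n = tproj (frag_of (m, n) + frag_of (m', n))"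
    unfolding pt_tproj using tproj_eq_iff by blast
  then show ?thesis using assms by (simp add: tproj_add pt_tproj)
qed

lemma pt_add_r:
  assumes "m \<in> carrier M" "n \<in> carrier N" "n' \<in> carrier N"
  shows "pt m (n \<oplus>\<^bsub>N\<^esub> n') = pt m n \<oplus>\<^bsub>V\<^esub> pt m n'"
proof -
  have "frag_of (m, n \<oplus>\<^bsub>N\<^esub> n') - (frag_of (m, n) + frag_of (m, n')) \<in> tensor_ker K M N"
    by (rule rel_ker) (use assms in \<open>auto simp: tensor_rel_def diff_diff_eq[symmetric]\<close>)
  moreover have "frag_of (m, n) + frag_of (m, n') \<in> carrier FA" using assms by (intro FA_add) simp_all
  moreover have "frag_of (m, n \<oplus>\<^bsub>N\<^esub> n') \<in> carrier FA" using assms by simp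
  ultimately have "pt m (n \<oplus>\<^bsub>N\<^esub> n') = tproj (frag_of (m, n) + frag_of (m, n'))"
    unfolding pt_tproj using tproj_eq_iff by blast
  then show ?thesis using assms by (simp add: tproj_add pt_tproj)
qed

lemma pt_balanced:
  assumes "m \<in> carrier M" "n \<in> carrier N"
  shows "pt (m \<star>\<^bsub>M\<^esub> \<alpha>) n = pt m (lsmult K N \<alpha> n)"
proof -
  have "frag_of (m \<star>\<^bsub>M\<^esub> \<alpha>, n) - frag_of (m, lsmult K N \<alpha> n) \<in> tensor_ker K M N"
    by (rule rel_ker) (use assms in \<open>unfold tensor_rel_def, blast\<close>)
  moreover have "frag_of (m \<star>\<^bsub>M\<^esub> \<alpha>, n) \<in> carrier FA" "frag_of (m, lsmult K N \<alpha> n) \<in> carrier FA"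
    using assms by (simp_all add: M.smult_closed)
  ultimately show ?thesis unfolding pt_tproj using tproj_eq_iff by blast
qed

lemma pt_balanced_map: "balanced_map K M N V pt"
  by (auto simp: balanced_map_def additive_map_def pt_add_l pt_add_r pt_balanced)

lemma FA_additive_diff:
  assumes A: "abelian_group A" and h: "h \<in> hom FA (add_monoid A)" and "f \<in> carrier FA" "g \<in> carrier FA"
  shows "h (f - g) = h f \<ominus>\<^bsub>A\<^esub> h g"
proof -
  interpret A: abelian_group A by fact
  interpret h: group_hom FA "add_monoid A" h
    using h A.a_group by (simp add: group_hom_def group_hom_axioms_def)
  have g: "- g \<in> carrier FA" "inv\<^bsub>FA\<^esub> g = - g" using assms(4) by (simp_all add: carrier_free_Abelian_group_iff)
  have "h (f - g) = h f \<oplus>\<^bsub>A\<^esub> h (- g)" using h.hom_mult[OF assms(3) g(1)] by simp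
  then show ?thesis using h.hom_inv[OF assms(4)] g(2) by (simp add: a_minus_def a_inv_def)
qed

lemma tensor_lift_ex:
  assumes A: "abelian_group A" and f: "balanced_map K M N A f"
  obtains h where "additive_map V A h" "\<And>m n. m \<in> carrier M \<Longrightarrow> n \<in> carrier N \<Longrightarrow> h (pt m n) = f m n"
proof -
  interpret A: abelian_group A by fact
  interpret FA: group FA by simp
  note fD = balanced_mapD[OF f]
  have "(\<lambda>(m, n). f m n) ` (carrier M \<times> carrier N) \<subseteq> carrier (add_monoid A)"
    using fD(4) by auto
  then obtain H where H: "H \<in> hom FA (add_monoid A)"
    "\<And>x. x \<in> carrier M \<times> carrier N \<Longrightarrow> H (frag_of x) = (\<lambda>(m, n). f m n) x"
    using comm_group.free_Abelian_group_universal[OF A.a_comm_group] by blast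
  note Hd = FA_additive_diff[OF A H(1)]
  have Hf: "H (frag_of (m, n)) = f m n" if "m \<in> carrier M" "n \<in> carrier N" for m n
    using H(2)[of "(m, n)"] that by simp
  have Hc: "H g \<in> carrier A" if "g \<in> carrier FA" for g
    using H(1) that unfolding hom_def by auto
  have Fd: "a - b \<in> carrier FA" if "a \<in> carrier FA" "b \<in> carrier FA" for a b :: "'m \<times> 'n \<Rightarrow>\<^sub>0 int"
    using that keys_diff[of a b] by (auto simp: carrier_free_Abelian_group_iff)
  have can: "a \<oplus>\<^bsub>A\<^esub> b \<ominus>\<^bsub>A\<^esub> a \<ominus>\<^bsub>A\<^esub> b = \<zero>\<^bsub>A\<^esub>" if "a \<in> carrier A" "b \<in> carrier A" for a b
    using that A.r_neg[of "a \<oplus>\<^bsub>A\<^esub> b"] by (simp add: a_minus_def A.minus_add A.a_assoc)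
  have rel: "H r = \<zero>\<^bsub>A\<^esub>" if "r \<in> tensor_rel K M N" for r
    using that unfolding tensor_rel_def
  proof (elim UnE CollectE exE conjE)
    fix m m' n assume h: "r = frag_of (m \<oplus>\<^bsub>M\<^esub> m', n) - frag_of (m, n) - frag_of (m', n)"
      "m \<in> carrier M" "m' \<in> carrier M" "n \<in> carrier N"
    then have "H r = f (m \<oplus>\<^bsub>M\<^esub> m') n \<ominus>\<^bsub>A\<^esub> f m n \<ominus>\<^bsub>A\<^esub> f m' n"
      by (simp add: Hd Fd Hf del: carrier_free_Abelian_group_iff)
    then show ?thesis using h additive_map_add[OF fD(1)] fD(4) can by simp
  next
    fix m n n' assume h: "r = frag_of (m, n \<oplus>\<^bsub>N\<^esub> n') - frag_of (m, n) - frag_of (m, n')"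
      "m \<in> carrier M" "n \<in> carrier N" "n' \<in> carrier N"
    then have "H r = f m (n \<oplus>\<^bsub>N\<^esub> n') \<ominus>\<^bsub>A\<^esub> f m n \<ominus>\<^bsub>A\<^esub> f m n'"
      by (simp add: Hd Fd Hf del: carrier_free_Abelian_group_iff)
    then show ?thesis using h additive_map_add[OF fD(2)] fD(4) can by simp
  next
    fix m n \<alpha> assume h: "r = frag_of (m \<star>\<^bsub>M\<^esub> \<alpha>, n) - frag_of (m, lsmult K N \<alpha> n)"
      "m \<in> carrier M" "n \<in> carrier N"
    then have "H r = f (m \<star>\<^bsub>M\<^esub> \<alpha>) n \<ominus>\<^bsub>A\<^esub> f m (lsmult K N \<alpha> n)"
      by (simp add: Hd Hf M.smult_closed del: carrier_free_Abelian_group_iff)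
    then show ?thesis using h fD(3,4) by (simp add: a_minus_def A.r_neg)
  qed
  have ker: "H r = \<zero>\<^bsub>A\<^esub>" if "r \<in> tensor_ker K M N" for r
  proof -
    have h: "group_hom FA (add_monoid A) H"
      using H(1) A.a_group by (simp add: group_hom_def group_hom_axioms_def)
    have "subgroup (kernel FA (add_monoid A) H) FA" by (rule group_hom.subgroup_kernel[OF h])
    moreover have "tensor_rel K M N \<subseteq> kernel FA (add_monoid A) H"
      using rel tensor_rel_closed by (auto simp: kernel_def simp del: carrier_free_Abelian_group_iff)
    ultimately have "tensor_ker K M N \<subseteq> kernel FA (add_monoid A) H"
      unfolding tensor_ker_def by (rule FA.generate_subgroup_incl[rotated])
    with that show ?thesis by (auto simp: kernel_def)
  qed
  define h where "h t = H (SOME g. g \<in> carrier FA \<and> t = tproj g)" for t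
  have hH: "h (tproj g) = H g" if g: "g \<in> carrier FA" for g
    unfolding h_def
  proof (rule someI2[of _ g])
    fix g' assume g': "g' \<in> carrier FA \<and> tproj g = tproj g'"
    then have "H (g - g') = \<zero>\<^bsub>A\<^esub>" using ker tproj_eq_iff[of g g'] g by blast
    then have "H g \<oplus>\<^bsub>A\<^esub> \<ominus>\<^bsub>A\<^esub> H g' = \<zero>\<^bsub>A\<^esub>" using Hd[of g g'] g g' by (simp add: a_minus_def)
    then have "H g = H g'" by (rule A.eq_of_diff_zero[OF Hc[OF g] Hc[OF conjunct1[OF g']]])
    then show "H g' = H g" by simp
  qed (use g in simp)
  show ?thesis
  proof
    show "additive_map V A h"
    proof (rule additive_mapI)
      fix t assume "t \<in> carrier V"
      then show "h t \<in> carrier A" using tproj_surj[of t] hH Hc by force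
    next
      fix s t assume "s \<in> carrier V" "t \<in> carrier V"
      then obtain a b where ab: "a \<in> carrier FA" "s = tproj a" "b \<in> carrier FA" "t = tproj b"
        using tproj_surj by metis
      have "h (s \<oplus>\<^bsub>V\<^esub> t) = H (a + b)" using ab hH[OF FA_add[OF ab(1,3)]] by (simp add: tproj_add)
      also have "\<dots> = H a \<oplus>\<^bsub>A\<^esub> H b" using hom_mult[OF H(1) ab(1,3)] by simp
      finally show "h (s \<oplus>\<^bsub>V\<^esub> t) = h s \<oplus>\<^bsub>A\<^esub> h t" using ab hH by simp
    qed
    fix m n assume "m \<in> carrier M" "n \<in> carrier N"
    then show "h (pt m n) = f m n" unfolding pt_tproj using hH Hf by simp
  qed
qed

lemma tensor_additive_eq:
  assumes A: "abelian_group A" and F: "additive_map V A F" and G: "additive_map V A G"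
    and eq: "\<And>m n. m \<in> carrier M \<Longrightarrow> n \<in> carrier N \<Longrightarrow> F (pt m n) = G (pt m n)"
    and t: "t \<in> carrier V"
  shows "F t = G t"
proof -
  interpret A: abelian_group A by fact
  obtain f where f: "f \<in> carrier FA" "t = tproj f" using tproj_surj[OF t] by blast
  have hom: "(\<lambda>f. F (tproj f)) \<in> hom FA (add_monoid A)" if "additive_map V A F" for F
    using that by (intro homI)
      (simp_all add: tproj_closed additive_map_closed[OF that] additive_map_add[OF that] tproj_add
        del: carrier_free_Abelian_group_iff)
  have "Poly_Mapping.keys f \<subseteq> carrier M \<times> carrier N" using f(1) by simp
  then have "F (tproj f) = G (tproj f)"
  proof (rule free_Abelian_group_induct)
    have "tproj 0 = \<zero>\<^bsub>V\<^esub>"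
      by (rule V.idem_zero) (use tproj_add[of 0 0, symmetric] tproj_closed[of 0] in simp_all)
    then show "F (tproj 0) = G (tproj 0)"
      using additive_map_zero[OF V_abelian A F] additive_map_zero[OF V_abelian A G] by simp
  next
    fix x y :: "'m \<times> 'n \<Rightarrow>\<^sub>0 int"
    assume "Poly_Mapping.keys x \<subseteq> carrier M \<times> carrier N" "Poly_Mapping.keys y \<subseteq> carrier M \<times> carrier N"
      "F (tproj x) = G (tproj x)" "F (tproj y) = G (tproj y)"
    then show "F (tproj (x - y)) = G (tproj (x - y))"
      using FA_additive_diff[OF A hom[OF F], of x y] FA_additive_diff[OF A hom[OF G], of x y] by simp
  next
    fix a assume "a \<in> carrier M \<times> carrier N"
    then show "F (tproj (frag_of a)) = G (tproj (frag_of a))"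
      using eq by (cases a) (auto simp: pt_tproj[symmetric])
  qed
  then show ?thesis using f by simp
qed

text \<open>Reduces an identity of maps on a tensor product to homogeneous factors, for which the
  sums over components in \<open>tensor_map\<close> and \<open>tensor_alg\<close> shrink to one
  signed term.\<close>

lemma tensor_additive_eq_homog:
  assumes A: "abelian_group A" and F: "additive_map V A F" and G: "additive_map V A G"
    and eq: "\<And>m n p q. m \<in> grade M p \<Longrightarrow> n \<in> grade N q \<Longrightarrow> F (pt m n) = G (pt m n)"
    and t: "t \<in> carrier V"
  shows "F t = G t"
proof (rule tensor_additive_eq[OF A F G _ t])
  fix m n assume m: "m \<in> carrier M" and n: "n \<in> carrier N"
  have l: "additive_map M A (\<lambda>m. F (pt m n))" if "additive_map V A F" "n \<in> carrier N" for F n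
    using additive_map_compose[OF balanced_mapD(1)[OF pt_balanced_map that(2)] that(1)] .
  have r: "additive_map N A (\<lambda>n. F (pt m n))" if "additive_map V A F" "m \<in> carrier M" for F m
    using additive_map_compose[OF balanced_mapD(2)[OF pt_balanced_map that(2)] that(1)] .
  show "F (pt m n) = G (pt m n)"
  proof (rule N.additive_eq_on_grades[OF r[OF F m] r[OF G m] _ n])
    fix q n assume n: "n \<in> grade N q"
    show "F (pt m n) = G (pt m n)"
      by (rule M.additive_eq_on_grades[OF l[OF F N.grade_carrier[OF n]] l[OF G N.grade_carrier[OF n]] _ m])
        (use eq n in blast)
  qed
qed

text \<open>The description that defines \<open>tensor_lift\<close> has exactly one solution: pure
  tensors generate, and extensionality fixes the values outside the carrier.\<close>

lemma tensor_lift: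
  assumes A: "abelian_group A" and f: "balanced_map K M N A f"
  shows tensor_lift_additive: "additive_map V A (tensor_lift K M N A f)"
    and tensor_lift_pt: "m \<in> carrier M \<Longrightarrow> n \<in> carrier N \<Longrightarrow> tensor_lift K M N A f (pt m n) = f m n"
proof -
  obtain h where h: "additive_map V A h" "\<And>m n. m \<in> carrier M \<Longrightarrow> n \<in> carrier N \<Longrightarrow> h (pt m n) = f m n"
    using tensor_lift_ex[OF A f] by blast
  let ?h = "restrict h (carrier V)"
  let ?P = "\<lambda>h. h \<in> extensional (carrier V) \<and> h \<in> hom (add_monoid V) (add_monoid A) \<and>
       (\<forall>m\<in>carrier M. \<forall>n\<in>carrier N. h (pt m n) = f m n)"
  have P: "?P ?h" using h by (auto simp: additive_map_def hom_def)
  have "tensor_lift K M N A f = ?h"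
    unfolding tensor_lift_def
  proof (rule the_equality)
    fix g assume g: "?P g"
    show "g = ?h"
    proof (rule extensionalityI)
      fix t assume t: "t \<in> carrier V"
      show "g t = ?h t"
      proof (rule tensor_additive_eq[OF A _ _ _ t])
        show "additive_map V A g" using g by (simp add: additive_map_hom)
        show "additive_map V A ?h" using h(1) by (simp add: additive_map_def)
      qed (use g h in simp)
    qed (use g P in auto)
  qed (rule P)
  with P show "additive_map V A (tensor_lift K M N A f)"
    "m \<in> carrier M \<Longrightarrow> n \<in> carrier N \<Longrightarrow> tensor_lift K M N A f (pt m n) = f m n"
    by (simp_all add: additive_map_hom)
qed

lemma TM_simps [simp]: "carrier TM = carrier V" "ring.zero TM = ring.zero V" "add TM = add V"
  by (simp_all add: tensor_mod_def Let_def)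

lemma TM_abelian: "abelian_group TM"
  by (rule abelian_group_cong_ops[OF V_abelian]) simp_all

lemma TM_additive_dom [simp]: "additive_map TM A F = additive_map V A F"
  by (simp add: additive_map_def)

lemma TM_additive_cod [simp]: "additive_map A TM F = additive_map A V F"
  by (simp add: additive_map_def)

lemma TM_smult_def: "t \<star>\<^bsub>TM\<^esub> \<alpha> = tensor_lift K M N V (\<lambda>m n. pt m (n \<star>\<^bsub>N\<^esub> \<alpha>)) t"
  by (simp add: tensor_mod_def Let_def)

lemma pt_smult_balanced: "balanced_map K M N V (\<lambda>m n. pt m (n \<star>\<^bsub>N\<^esub> \<alpha>))"
  by (auto simp: balanced_map_def additive_map_def N.smult_closed pt_add_l pt_add_r N.smult_l_distr
      pt_balanced N.lsmult_rsmult)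

lemma TM_smult_additive: "additive_map V V (\<lambda>t. t \<star>\<^bsub>TM\<^esub> \<alpha>)"
  unfolding TM_smult_def by (rule tensor_lift_additive[OF V_abelian pt_smult_balanced])

lemma pt_smult: "m \<in> carrier M \<Longrightarrow> n \<in> carrier N \<Longrightarrow> pt m n \<star>\<^bsub>TM\<^esub> \<alpha> = pt m (n \<star>\<^bsub>N\<^esub> \<alpha>)"
  unfolding TM_smult_def by (rule tensor_lift_pt[OF V_abelian pt_smult_balanced])

sublocale TM: right_module TM
proof (intro right_module.intro right_module_axioms.intro)
  show "abelian_group TM" by (rule TM_abelian)
  fix t s \<alpha> \<beta> assume t: "t \<in> carrier TM"
  show "t \<star>\<^bsub>TM\<^esub> \<alpha> \<in> carrier TM" using additive_map_closed[OF TM_smult_additive] t by simp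
  show "s \<in> carrier TM \<Longrightarrow> (t \<oplus>\<^bsub>TM\<^esub> s) \<star>\<^bsub>TM\<^esub> \<alpha> = t \<star>\<^bsub>TM\<^esub> \<alpha> \<oplus>\<^bsub>TM\<^esub> s \<star>\<^bsub>TM\<^esub> \<alpha>"
    using additive_map_add[OF TM_smult_additive] t by simp
  have tV: "t \<in> carrier V" using t by simp
  have I: "additive_map V V (\<lambda>t. t)" by (simp add: additive_map_def)
  have "t \<star>\<^bsub>TM\<^esub> (\<alpha> + \<beta>) = t \<star>\<^bsub>TM\<^esub> \<alpha> \<oplus>\<^bsub>V\<^esub> t \<star>\<^bsub>TM\<^esub> \<beta>"
    by (rule tensor_additive_eq[OF V_abelian TM_smult_additive
          additive_map_sum[OF V_abelian TM_smult_additive TM_smult_additive] _ tV])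
      (simp add: pt_smult N.smult_r_distr pt_add_r N.smult_closed)
  then show "t \<star>\<^bsub>TM\<^esub> (\<alpha> + \<beta>) = t \<star>\<^bsub>TM\<^esub> \<alpha> \<oplus>\<^bsub>TM\<^esub> t \<star>\<^bsub>TM\<^esub> \<beta>" by simp
  show "t \<star>\<^bsub>TM\<^esub> (\<alpha> * \<beta>) = t \<star>\<^bsub>TM\<^esub> \<alpha> \<star>\<^bsub>TM\<^esub> \<beta>"
    by (rule tensor_additive_eq[OF V_abelian TM_smult_additive
          additive_map_compose[OF TM_smult_additive TM_smult_additive] _ tV])
      (simp add: pt_smult N.smult_assoc N.smult_closed)
  show "t \<star>\<^bsub>TM\<^esub> 1 = t"
    by (rule tensor_additive_eq[OF V_abelian TM_smult_additive I _ tV])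
      (simp add: pt_smult N.smult_one)
qed

lemma pt_zero [simp]: "m \<in> carrier M \<Longrightarrow> pt m \<zero>\<^bsub>N\<^esub> = \<zero>\<^bsub>V\<^esub>" "n \<in> carrier N \<Longrightarrow> pt \<zero>\<^bsub>M\<^esub> n = \<zero>\<^bsub>V\<^esub>"
  using additive_map_zero[OF N.abelian_group V_abelian balanced_mapD(2)[OF pt_balanced_map]]
    additive_map_zero[OF M.abelian_group V_abelian balanced_mapD(1)[OF pt_balanced_map]] by auto

lemma pt_ksign_l:
  assumes "m \<in> carrier M" "n \<in> carrier N"
  shows "pt (m \<star>\<^bsub>M\<^esub> ksign p) n = pt m n \<star>\<^bsub>TM\<^esub> ksign p"
  using assms by (simp add: pt_balanced N.lsmult_even pt_smult)

lemma pt_grade: "m \<in> grade M p \<Longrightarrow> n \<in> grade N q \<Longrightarrow> pt m n \<in> grade TM (p + q)"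
  by (auto simp: tensor_mod_def Let_def intro!: generate.incl)

lemma TM_grade_subgroup: "subgroup (grade TM r) (add_monoid V)"
proof -
  have "{pt m n | m n p q. m \<in> grade M p \<and> n \<in> grade N q \<and> p + q = r} \<subseteq> carrier (add_monoid V)"
    using M.grade_carrier N.grade_carrier by auto
  from group.generate_is_subgroup[OF V.a_group this] show ?thesis
    by (simp add: tensor_mod_def Let_def)
qed

lemma TM_grade_add: "s \<in> grade TM r \<Longrightarrow> t \<in> grade TM r \<Longrightarrow> s \<oplus>\<^bsub>V\<^esub> t \<in> grade TM r"
  using subgroup.m_closed[OF TM_grade_subgroup[of r]] by simp

lemma TM_grade_minus: "t \<in> grade TM r \<Longrightarrow> \<ominus>\<^bsub>V\<^esub> t \<in> grade TM r"
  using subgroup.m_inv_closed[OF TM_grade_subgroup[of r]] by (simp add: a_inv_def)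

text \<open>The homogeneous parts of a tensor product are generated subgroups, so where they are
  mapped can be tested on pure tensors.\<close>

lemma TM_grade_image:
  assumes A: "abelian_group A" and F: "additive_map V A F" and B: "subgroup B (add_monoid A)"
    and pt: "\<And>m n p q. m \<in> grade M p \<Longrightarrow> n \<in> grade N q \<Longrightarrow> p + q = r \<Longrightarrow> F (pt m n) \<in> B"
    and t: "t \<in> grade TM r"
  shows "F t \<in> B"
proof -
  interpret A: abelian_group A by fact
  define G where "G = {pt m n | m n p q. m \<in> grade M p \<and> n \<in> grade N q \<and> p + q = r}"
  have Gc: "G \<subseteq> carrier V" unfolding G_def using M.grade_carrier N.grade_carrier by auto
  have "t \<in> generate (add_monoid V) G" using t by (simp add: tensor_mod_def Let_def G_def)
  then have "t \<in> carrier V \<and> F t \<in> B"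
  proof (induction rule: generate.induct)
    case one
    then show ?case
      using additive_map_zero[OF V_abelian A F] subgroup.one_closed[OF B] by simp
  next
    case (incl h)
    then have "F h \<in> B" using pt by (auto simp: G_def)
    then show ?case using incl Gc by blast
  next
    case (inv h)
    have hc: "h \<in> carrier V" using inv Gc by blast
    have "F (\<ominus>\<^bsub>V\<^esub> h) = \<ominus>\<^bsub>A\<^esub> F h" by (rule additive_map_minus[OF V_abelian A F hc])
    moreover have "F h \<in> B" using inv pt by (auto simp: G_def)
    ultimately show ?case using subgroup.m_inv_closed[OF B, of "F h"] hc
      unfolding a_inv_def[symmetric] by simp
  next
    case (eng s t)
    then show ?case using subgroup.m_closed[OF B, of "F s" "F t"] by (simp add: additive_map_add[OF F])
  qed
  then show ?thesis by simp
qed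

end

section \<open>Homomorphism modules\<close>

lemma additive_map_cong:
  assumes "abelian_group M" "additive_map M N G" "\<And>x. x \<in> carrier M \<Longrightarrow> F x = G x"
  shows "additive_map M N F"
proof -
  interpret M: abelian_group M by fact
  show ?thesis using assms(2,3) by (simp add: additive_map_def)
qed

context supermodule_pair
begin

abbreviation "HM \<equiv> Hom_mod K M N"

lemma HM_carrier: "F \<in> carrier HM \<longleftrightarrow> F \<in> extensional (carrier M) \<and> additive_map M N F \<and>
    (\<forall>x\<in>carrier M. \<forall>\<alpha>. F (x \<star>\<^bsub>M\<^esub> \<alpha>) = F x \<star>\<^bsub>N\<^esub> \<alpha>)"
  by (auto simp: Hom_mod_def Let_def additive_map_def PiE_def Pi_def)

lemma HM_additive: "F \<in> carrier HM \<Longrightarrow> additive_map M N F"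
  and HM_linear: "F \<in> carrier HM \<Longrightarrow> x \<in> carrier M \<Longrightarrow> F (x \<star>\<^bsub>M\<^esub> \<alpha>) = F x \<star>\<^bsub>N\<^esub> \<alpha>"
  and HM_closed: "F \<in> carrier HM \<Longrightarrow> x \<in> carrier M \<Longrightarrow> F x \<in> carrier N"
  and HM_ext: "F \<in> carrier HM \<Longrightarrow> F \<in> extensional (carrier M)"
  by (auto simp: HM_carrier additive_map_def)

lemma HM_add: "F \<in> carrier HM \<Longrightarrow> x \<in> carrier M \<Longrightarrow> y \<in> carrier M \<Longrightarrow> F (x \<oplus>\<^bsub>M\<^esub> y) = F x \<oplus>\<^bsub>N\<^esub> F y"
  by (rule additive_map_add[OF HM_additive])

lemma HM_restrictI:
  assumes "additive_map M N F" "\<And>x \<alpha>. x \<in> carrier M \<Longrightarrow> F (x \<star>\<^bsub>M\<^esub> \<alpha>) = F x \<star>\<^bsub>N\<^esub> \<alpha>"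
  shows "restrict F (carrier M) \<in> carrier HM"
  using assms by (auto simp: HM_carrier additive_map_def M.smult_closed)

lemma HM_eqI:
  "F \<in> carrier HM \<Longrightarrow> G \<in> carrier HM \<Longrightarrow> (\<And>x. x \<in> carrier M \<Longrightarrow> F x = G x) \<Longrightarrow> F = G"
  by (rule extensionalityI[OF HM_ext HM_ext]) auto

lemma HM_eq_on_grades:
  assumes "F \<in> carrier HM" "G \<in> carrier HM" "\<And>p x. x \<in> grade M p \<Longrightarrow> F x = G x"
  shows "F = G"
  using assms M.additive_eq_on_grades[OF HM_additive HM_additive] by (intro HM_eqI) auto

lemma HM_ops:
  "\<zero>\<^bsub>HM\<^esub> = (\<lambda>x\<in>carrier M. \<zero>\<^bsub>N\<^esub>)" "F \<oplus>\<^bsub>HM\<^esub> G = (\<lambda>x\<in>carrier M. F x \<oplus>\<^bsub>N\<^esub> G x)"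
  "F \<star>\<^bsub>HM\<^esub> \<alpha> = (\<lambda>x\<in>carrier M. F (lsmult K M \<alpha> x))"
  by (simp_all add: Hom_mod_def Let_def)

lemma HM_grade: "F \<in> grade HM p \<longleftrightarrow> F \<in> carrier HM \<and> (\<forall>q. \<forall>x\<in>grade M q. F x \<in> grade N (p + q))"
  by (auto simp: Hom_mod_def Let_def)

lemma HM_add_closed: "F \<in> carrier HM \<Longrightarrow> G \<in> carrier HM \<Longrightarrow> F \<oplus>\<^bsub>HM\<^esub> G \<in> carrier HM"
  unfolding HM_ops
  by (intro HM_restrictI additive_map_sum[OF N.abelian_group] HM_additive)
    (auto simp: HM_linear N.smult_l_distr HM_closed)

lemma HM_minus_closed: "F \<in> carrier HM \<Longrightarrow> (\<lambda>x\<in>carrier M. \<ominus>\<^bsub>N\<^esub> F x) \<in> carrier HM"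
  by (intro HM_restrictI) (auto simp: additive_map_def HM_closed HM_add HM_linear N.minus_smult N.minus_add N.a_ac)

lemma HM_abelian: "abelian_group HM"
proof (rule abelian_groupI)
  show "\<zero>\<^bsub>HM\<^esub> \<in> carrier HM"
    unfolding HM_ops by (intro HM_restrictI) (auto simp: additive_map_def)
  fix F G H assume FG: "F \<in> carrier HM" "G \<in> carrier HM"
  show "F \<oplus>\<^bsub>HM\<^esub> G \<in> carrier HM" using FG by (rule HM_add_closed)
  show "F \<oplus>\<^bsub>HM\<^esub> G = G \<oplus>\<^bsub>HM\<^esub> F"
    using FG by (auto simp: HM_ops HM_closed N.a_comm intro!: restrict_ext)
  show "H \<in> carrier HM \<Longrightarrow> F \<oplus>\<^bsub>HM\<^esub> G \<oplus>\<^bsub>HM\<^esub> H = F \<oplus>\<^bsub>HM\<^esub> (G \<oplus>\<^bsub>HM\<^esub> H)"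
    using FG by (auto simp: HM_ops HM_closed N.a_assoc intro!: restrict_ext)
  show "\<zero>\<^bsub>HM\<^esub> \<oplus>\<^bsub>HM\<^esub> F = F"
    using FG by (auto simp: HM_ops HM_closed intro!: extensionalityI[OF _ HM_ext])
  show "\<exists>G\<in>carrier HM. G \<oplus>\<^bsub>HM\<^esub> F = \<zero>\<^bsub>HM\<^esub>"
    by (rule bexI[OF _ HM_minus_closed[OF FG(1)]])
      (use FG in \<open>auto simp: HM_ops HM_closed N.l_neg intro!: restrict_ext\<close>)
qed

lemma HM_uminus: "F \<in> carrier HM \<Longrightarrow> \<ominus>\<^bsub>HM\<^esub> F = (\<lambda>x\<in>carrier M. \<ominus>\<^bsub>N\<^esub> F x)"
proof -
  interpret HM: abelian_group HM by (rule HM_abelian)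
  assume F: "F \<in> carrier HM"
  then show ?thesis
    by (intro HM.minus_equality[OF _ F HM_minus_closed[OF F]])
      (auto simp: HM_ops HM_closed N.l_neg intro!: restrict_ext)
qed

lemma HM_grade_subgroup: "subgroup (grade HM p) (add_monoid HM)"
proof (rule group.subgroupI)
  interpret HM: abelian_group HM by (rule HM_abelian)
  show "Group.group (add_monoid HM)" by (rule HM.a_group)
  show "grade HM p \<subseteq> carrier (add_monoid HM)" by (auto simp: HM_grade)
  have "\<zero>\<^bsub>HM\<^esub> \<in> grade HM p" using HM.zero_closed by (auto simp: HM_grade) (auto simp: HM_ops M.grade_carrier)
  then show "grade HM p \<noteq> {}" by blast
  fix F G assume FG: "F \<in> grade HM p" "G \<in> grade HM p"
  have c: "F \<in> carrier HM" "G \<in> carrier HM" using FG by (auto simp: HM_grade)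
  show "inv\<^bsub>add_monoid HM\<^esub> F \<in> grade HM p"
    unfolding a_inv_def[symmetric]
    using FG HM_minus_closed[OF c(1)] by (auto simp: HM_grade HM_uminus M.grade_carrier N.grade_minus)
  show "F \<otimes>\<^bsub>add_monoid HM\<^esub> G \<in> grade HM p"
    using FG HM_add_closed[OF c] by (auto simp: HM_grade) (auto simp: HM_ops M.grade_carrier N.grade_add)
qed

text \<open>A map of parity \<open>p\<close> sends even elements to parity \<open>p\<close> and odd
  ones to parity \<open>p + 1\<close>; this dictates the formula for \<open>P\<close>. Odd scalars
  merely exchange its two summands, so that \<open>P p\<close> is again linear.\<close>

lemma HM_component_ex:
  assumes F: "F \<in> carrier HM"
  defines "P \<equiv> \<lambda>p. (\<lambda>x\<in>carrier M. component N p (F (component M 0 x)) \<oplus>\<^bsub>N\<^esub> component N (p + 1) (F (component M 1 x)))"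
  shows "P p \<in> grade HM p" "P 0 \<oplus>\<^bsub>HM\<^esub> P 1 = F"
proof -
  have A: "additive_map M N (\<lambda>x. component N r (F (component M s x)))" for r s
    using additive_map_compose[OF additive_map_compose[OF M.component_additive HM_additive[OF F]] N.component_additive] .
  have lin: "component N p (F (component M 0 (x \<star>\<^bsub>M\<^esub> \<alpha>))) \<oplus>\<^bsub>N\<^esub> component N (p + 1) (F (component M 1 (x \<star>\<^bsub>M\<^esub> \<alpha>))) =
      (component N p (F (component M 0 x)) \<oplus>\<^bsub>N\<^esub> component N (p + 1) (F (component M 1 x))) \<star>\<^bsub>N\<^esub> \<alpha>"
    if x: "x \<in> carrier M" for p x \<alpha>
  proof (induction \<alpha> rule: M.K_induct)
    case (1 q \<alpha>)
    show ?case
    proof (cases "q = 0")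
      case True
      then show ?thesis using x 1
        by (simp add: M.component_smult[of _ _ q] N.component_smult[of _ _ q] HM_linear[OF F] HM_closed[OF F] N.smult_l_distr)
    next
      case False
      then show ?thesis using x \<open>\<alpha> \<in> K q\<close>
        by (simp add: M.component_smult[of _ _ q] N.component_smult[of _ _ q] HM_linear[OF F] HM_closed[OF F]
            N.smult_l_distr add.assoc N.a_comm N.smult_closed)
    qed
  next
    case (2 \<alpha> \<beta>)
    have "component N r (F (component M s (x \<star>\<^bsub>M\<^esub> (\<alpha> + \<beta>)))) =
        component N r (F (component M s (x \<star>\<^bsub>M\<^esub> \<alpha>))) \<oplus>\<^bsub>N\<^esub> component N r (F (component M s (x \<star>\<^bsub>M\<^esub> \<beta>)))" for r s
      using additive_map_add[OF A, of "x \<star>\<^bsub>M\<^esub> \<alpha>" "x \<star>\<^bsub>M\<^esub> \<beta>"] x by (simp add: M.smult_r_distr M.smult_closed)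
    moreover have c: "component N r (F (component M s (x \<star>\<^bsub>M\<^esub> \<alpha>))) \<in> carrier N" for r s \<alpha>
      using x by (simp add: M.smult_closed HM_closed[OF F])
    ultimately show ?case
      using 2 x c by (simp add: N.smult_r_distr HM_closed[OF F] N.a_ac flip: 2)
  qed
  have Pc: "P p \<in> carrier HM" for p
    unfolding P_def by (rule HM_restrictI[OF additive_map_sum[OF N.abelian_group A A] lin])
  show "P p \<in> grade HM p"
  proof -
    have z: "component N r \<zero>\<^bsub>N\<^esub> = \<zero>\<^bsub>N\<^esub>" for r
      using N.component_of_grade[OF N.grade_zero, of r r] by simp
    have "P p x \<in> grade N (p + q)" if "x \<in> grade M q" for x q
      using that HM_closed[OF F, of x] N.component_grade[of "F x" "p + q"] HM_closed[OF F, of "\<zero>\<^bsub>M\<^esub>"]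
        additive_map_zero[OF M.abelian_group N.abelian_group HM_additive[OF F]]
      by (cases q) (auto simp: P_def M.grade_carrier M.component_of_grade z)
    then show ?thesis using Pc by (simp add: HM_grade)
  qed
  show "P 0 \<oplus>\<^bsub>HM\<^esub> P 1 = F"
  proof (rule HM_eqI[OF HM_add_closed[OF Pc Pc] F])
    fix x assume x: "x \<in> carrier M"
    have c: "component N r (F (component M s x)) \<in> carrier N" for r s
      using x by (simp add: HM_closed[OF F])
    have "(P 0 \<oplus>\<^bsub>HM\<^esub> P 1) x = (component N 0 (F (component M 0 x)) \<oplus>\<^bsub>N\<^esub> component N 1 (F (component M 0 x))) \<oplus>\<^bsub>N\<^esub>
       (component N 0 (F (component M 1 x)) \<oplus>\<^bsub>N\<^esub> component N 1 (F (component M 1 x)))"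
      using x c by (simp add: HM_ops P_def N.a_ac)
    also have "\<dots> = F (component M 0 x \<oplus>\<^bsub>M\<^esub> component M 1 x)"
      using x by (simp add: N.component_sum HM_closed[OF F] HM_add[OF F])
    finally show "(P 0 \<oplus>\<^bsub>HM\<^esub> P 1) x = F x" using x by (simp add: M.component_sum)
  qed
qed

lemma HM_graded: "graded_group HM"
proof (intro graded_group.intro graded_group_axioms.intro HM_abelian supergradingI HM_grade_subgroup)
  fix F assume F: "F \<in> carrier HM"
  show "\<exists>u\<in>grade HM 0. \<exists>v\<in>grade HM 1. F = u \<oplus>\<^bsub>HM\<^esub> v"
    using HM_component_ex(1)[OF F, of 0] HM_component_ex(1)[OF F, of 1] HM_component_ex(2)[OF F, symmetric] by blast
next
  fix u v assume u: "u \<in> grade HM 0" and v: "v \<in> grade HM 1" and z: "u \<oplus>\<^bsub>HM\<^esub> v = \<zero>\<^bsub>HM\<^esub>"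
  interpret HM: abelian_group HM by (rule HM_abelian)
  have uc: "u \<in> carrier HM" using u by (simp add: HM_grade)
  show "u = \<zero>\<^bsub>HM\<^esub>"
  proof (rule HM_eq_on_grades[OF uc HM.zero_closed])
    fix p x assume x: "x \<in> grade M p"
    have "u x \<oplus>\<^bsub>N\<^esub> v x = \<zero>\<^bsub>N\<^esub>" using fun_cong[OF z, of x] x by (simp add: HM_ops M.grade_carrier)
    moreover have "u x \<in> grade N p" "v x \<in> grade N (p + 1)"
      using u v x by (auto simp: HM_grade add.commute) (metis add.commute add.right_neutral)+
    ultimately show "u x = \<zero>\<^bsub>HM\<^esub> x"
      using N.grade_decomp_unique'[of "u x" p "v x" "\<zero>\<^bsub>N\<^esub>" "\<zero>\<^bsub>N\<^esub>"] x by (simp add: HM_ops M.grade_carrier)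
  qed
qed

sublocale HM: graded_group HM by (rule HM_graded)

lemma HM_ksign: "F \<in> carrier HM \<Longrightarrow> F \<star>\<^bsub>HM\<^esub> ksign p = (\<lambda>x\<in>carrier M. F x \<star>\<^bsub>N\<^esub> ksign p)"
  by (auto simp: HM_ops M.lsmult_even HM_linear intro!: restrict_ext)

lemma HM_grade_app: "F \<in> grade HM p \<Longrightarrow> x \<in> grade M q \<Longrightarrow> r = p + q \<Longrightarrow> F x \<in> grade N r"
  by (simp add: HM_grade)

lemma HM_even_smult_closed: "F \<in> carrier HM \<Longrightarrow> c \<in> K 0 \<Longrightarrow> (\<lambda>x\<in>carrier M. F x \<star>\<^bsub>N\<^esub> c) \<in> carrier HM"
  by (intro HM_restrictI)
    (auto simp: additive_map_def HM_closed HM_add HM_linear N.smult_closed N.smult_l_distr N.smult_even_commute)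

end

context rational_supermodule
begin

sublocale SS: supermodule_pair K S S
  by unfold_locales

abbreviation "H \<equiv> Hom_mod K S S"

lemma S_mult_smult: "x \<in> carrier S \<Longrightarrow> y \<in> carrier S \<Longrightarrow> x \<otimes>\<^bsub>S\<^esub> (y \<star>\<^bsub>S\<^esub> \<alpha>) = (x \<otimes>\<^bsub>S\<^esub> y) \<star>\<^bsub>S\<^esub> \<alpha>"
  by (simp add: S_smult S.m_assoc)

lemma S_smult_mult: "x \<in> carrier S \<Longrightarrow> y \<in> carrier S \<Longrightarrow> (x \<star>\<^bsub>S\<^esub> \<alpha>) \<otimes>\<^bsub>S\<^esub> y = x \<otimes>\<^bsub>S\<^esub> lsmult K S \<alpha> y"
  by (simp add: S_smult S_lsmult S.m_assoc)

lemma S_ksign_mult: "x \<in> carrier S \<Longrightarrow> y \<in> carrier S \<Longrightarrow> (x \<star>\<^bsub>S\<^esub> ksign p) \<otimes>\<^bsub>S\<^esub> y = (x \<otimes>\<^bsub>S\<^esub> y) \<star>\<^bsub>S\<^esub> ksign p"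
  by (simp add: S_smult_mult S.lsmult_even S_mult_smult)

lemma pt_ksign_r:
  "m \<in> carrier S \<Longrightarrow> n \<in> carrier S \<Longrightarrow> SS.pt m (n \<star>\<^bsub>S\<^esub> ksign p) = SS.pt m n \<star>\<^bsub>SS.TM\<^esub> ksign p"
  by (simp add: SS.pt_smult)

section \<open>Tensor products of endomorphisms, and multiplication as a map on the tensor
  square\<close>

definition tmap_fun :: "(('k, 'm) words set set \<Rightarrow> ('k, 'm) words set set) \<Rightarrow>
    (('k, 'm) words set set \<Rightarrow> ('k, 'm) words set set) \<Rightarrow> ('k, 'm) words set set \<Rightarrow>
    ('k, 'm) words set set \<Rightarrow> (('k, 'm) words set set \<times> ('k, 'm) words set set \<Rightarrow>\<^sub>0 int) set"
  where "tmap_fun F G v w = (\<Oplus>\<^bsub>SS.TM\<^esub>p\<in>{0,1}. \<Oplus>\<^bsub>SS.TM\<^esub>q\<in>{0,1}.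
         SS.pt (F (component S p v)) (component H q G w) \<star>\<^bsub>SS.TM\<^esub> ksign (q * p))"

lemma tmap_expand:
  assumes F: "F \<in> carrier H" and G: "G \<in> carrier H" and vw: "v \<in> carrier S" "w \<in> carrier S"
  shows "tmap_fun F G v w =
      (SS.pt (F (component S 0 v)) (component H 0 G w) \<star>\<^bsub>SS.TM\<^esub> ksign (0 * 0) \<oplus>\<^bsub>SS.TM\<^esub>
       SS.pt (F (component S 0 v)) (component H 1 G w) \<star>\<^bsub>SS.TM\<^esub> ksign (1 * 0)) \<oplus>\<^bsub>SS.TM\<^esub>
      (SS.pt (F (component S 1 v)) (component H 0 G w) \<star>\<^bsub>SS.TM\<^esub> ksign (0 * 1) \<oplus>\<^bsub>SS.TM\<^esub>
       SS.pt (F (component S 1 v)) (component H 1 G w) \<star>\<^bsub>SS.TM\<^esub> ksign (1 * 1))"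
proof -
  have Gc: "component H q G \<in> carrier H" for q using SS.HM.component_closed[OF G] .
  have c: "SS.pt (F (component S p v)) (component H q G w) \<star>\<^bsub>SS.TM\<^esub> ksign r \<in> carrier SS.TM" for p q r
    by (rule SS.TM.smult_closed) (simp add: vw SS.HM_closed[OF F] SS.HM_closed[OF Gc])
  show ?thesis unfolding tmap_fun_def using c
    by (simp only: SS.TM.finsum_bit SS.TM.add.m_closed)
qed

lemma HM_zero: "F \<in> carrier H \<Longrightarrow> F \<zero>\<^bsub>S\<^esub> = \<zero>\<^bsub>S\<^esub>"
  by (rule additive_map_zero[OF S.abelian_group S.abelian_group SS.HM_additive])

lemma tmap_left_homog:
  assumes F: "F \<in> carrier H" and G: "G \<in> carrier H" and v': "v \<in> grade S r" and w': "w \<in> carrier S"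
  shows "tmap_fun F G v w = SS.pt (F v) (component H 0 G w) \<star>\<^bsub>SS.TM\<^esub> ksign (0 * r) \<oplus>\<^bsub>SS.TM\<^esub>
       SS.pt (F v) (component H 1 G w) \<star>\<^bsub>SS.TM\<^esub> ksign (1 * r)"
proof -
  have Gc: "component H q G \<in> carrier H" for q using SS.HM.component_closed[OF G] .
  have c: "SS.pt (F v) (component H q G w) \<in> carrier SS.V" for q
    using v' w' by (simp add: SS.HM_closed[OF F] SS.HM_closed[OF Gc] S.grade_carrier)
  then show ?thesis
    using tmap_expand[OF F G S.grade_carrier[OF v'] w'] v' w'
    using SS.TM.smult_closed[of "SS.pt (F v) (component H 0 G w)"] SS.TM.smult_closed[of "SS.pt (F v) (component H 1 G w)"]
    by (cases r) (simp_all add: S.component_of_grade HM_zero[OF F] SS.HM_closed[OF Gc] SS.TM.zero_smult[simplified])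
qed

lemma tmap_homog:
  assumes F: "F \<in> carrier H" and G: "G \<in> grade H q" and v: "v \<in> grade S r" and w: "w \<in> carrier S"
  shows "tmap_fun F G v w = SS.pt (F v) (G w) \<star>\<^bsub>SS.TM\<^esub> ksign (q * r)"
proof -
  have Gc: "G \<in> carrier H" using G by (rule SS.HM.grade_carrier)
  have c: "SS.pt (F v) (G w) \<in> carrier SS.V"
    using v w by (simp add: SS.HM_closed[OF F] SS.HM_closed[OF Gc] S.grade_carrier)
  have Fv: "F v \<in> carrier S" using v by (simp add: SS.HM_closed[OF F] S.grade_carrier)
  show ?thesis
    unfolding tmap_left_homog[OF F Gc v w]
    using c Fv w SS.TM.smult_closed[of "SS.pt (F v) (G w)"]
    by (cases q) (simp_all add: SS.HM.component_of_grade[OF G] SS.HM_ops SS.TM.zero_smult[simplified])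
qed

lemma tmap_balanced:
  assumes F: "F \<in> carrier H" and G: "G \<in> carrier H"
  shows "balanced_map K S S SS.TM (tmap_fun F G)"
proof (rule SS.balanced_mapI)
  have Gc: "component H q G \<in> carrier H" for q using SS.HM.component_closed[OF G] .
  have A: "additive_map S SS.TM (\<lambda>v. SS.pt (F (component S p v)) n \<star>\<^bsub>SS.TM\<^esub> ksign r)"
    if "n \<in> carrier S" for p r n
    using additive_map_compose[OF additive_map_compose[OF S.component_additive SS.HM_additive[OF F]]
        balanced_mapD(1)[OF SS.pt_balanced_map that]]
    by (intro SS.TM.additive_ksign[OF S.abelian_group]) simp
  have B: "additive_map S SS.TM (\<lambda>w. SS.pt m (component H q G w) \<star>\<^bsub>SS.TM\<^esub> ksign r)"
    if "m \<in> carrier S" for q r m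
    using additive_map_compose[OF SS.HM_additive[OF Gc] balanced_mapD(2)[OF SS.pt_balanced_map that]]
    by (intro SS.TM.additive_ksign[OF S.abelian_group]) simp
  note exp = tmap_expand[OF F G]
  note ab = SS.TM.abelian_group
  show "additive_map S SS.TM (\<lambda>v. tmap_fun F G v n)" if n: "n \<in> carrier S" for n
  proof -
    have "additive_map S SS.TM (\<lambda>v.
      (SS.pt (F (component S 0 v)) (component H 0 G n) \<star>\<^bsub>SS.TM\<^esub> ksign (0 * 0) \<oplus>\<^bsub>SS.TM\<^esub>
       SS.pt (F (component S 0 v)) (component H 1 G n) \<star>\<^bsub>SS.TM\<^esub> ksign (1 * 0)) \<oplus>\<^bsub>SS.TM\<^esub>
      (SS.pt (F (component S 1 v)) (component H 0 G n) \<star>\<^bsub>SS.TM\<^esub> ksign (0 * 1) \<oplus>\<^bsub>SS.TM\<^esub>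
       SS.pt (F (component S 1 v)) (component H 1 G n) \<star>\<^bsub>SS.TM\<^esub> ksign (1 * 1)))"
      by (intro additive_map_sum[OF ab] A SS.HM_closed[OF Gc] n)
    then show ?thesis by (rule additive_map_cong[OF S.abelian_group]) (rule exp[OF _ n])
  qed
  show "additive_map S SS.TM (tmap_fun F G m)" if m: "m \<in> carrier S" for m
  proof -
    have "additive_map S SS.TM (\<lambda>w.
      (SS.pt (F (component S 0 m)) (component H 0 G w) \<star>\<^bsub>SS.TM\<^esub> ksign (0 * 0) \<oplus>\<^bsub>SS.TM\<^esub>
       SS.pt (F (component S 0 m)) (component H 1 G w) \<star>\<^bsub>SS.TM\<^esub> ksign (1 * 0)) \<oplus>\<^bsub>SS.TM\<^esub>
      (SS.pt (F (component S 1 m)) (component H 0 G w) \<star>\<^bsub>SS.TM\<^esub> ksign (0 * 1) \<oplus>\<^bsub>SS.TM\<^esub>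
       SS.pt (F (component S 1 m)) (component H 1 G w) \<star>\<^bsub>SS.TM\<^esub> ksign (1 * 1)))"
      by (intro additive_map_sum[OF ab] B SS.HM_closed[OF F] S.component_closed m)
    then show ?thesis by (rule additive_map_cong[OF S.abelian_group]) (rule exp[OF m])
  qed
  fix v w \<alpha> s t r assume h: "v \<in> grade S r" "w \<in> grade S t" "\<alpha> \<in> K s"
  \<comment> \<open>Moving \<open>\<alpha>\<close> past the part of \<open>G\<close> of parity
    \<open>q\<close> costs the sign \<open>q * s\<close>; it cancels the one that arises because
    \<open>v \<star> \<alpha>\<close> has parity \<open>r + s\<close> instead of
    \<open>r\<close>.\<close>
  have key: "SS.pt (F (v \<star>\<^bsub>S\<^esub> \<alpha>)) (component H q G w) \<star>\<^bsub>SS.TM\<^esub> ksign (q * (r + s)) =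
      SS.pt (F v) (component H q G (w \<star>\<^bsub>S\<^esub> \<alpha> \<star>\<^bsub>S\<^esub> ksign (s * t))) \<star>\<^bsub>SS.TM\<^esub> ksign (q * r)" for q
  proof -
    have Gw: "component H q G w \<in> grade S (q + t)"
      using SS.HM_grade_app[OF SS.HM.component_grade[OF G] h(2)] by simp
    have c: "F v \<in> carrier S" "component H q G w \<in> carrier S" "v \<in> carrier S" "w \<in> carrier S"
      using h Gw S.grade_carrier SS.HM_closed[OF F] by auto
    moreover from c have "SS.pt (F v) (component H q G w \<star>\<^bsub>S\<^esub> \<alpha>) \<in> carrier SS.TM" by (simp add: S.smult_closed)
    ultimately show ?thesis
      using c h(3)
      by (simp add: SS.HM_linear[OF F] SS.HM_linear[OF Gc] S.smult_closed SS.pt_balanced S.lsmult_homog[OF Gw h(3)]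
          pt_ksign_r SS.TM.smult_ksign_ksign bit_ac)
  qed
  from tmap_left_homog[OF F G S.rsmult_grade[OF h(1,3)]] tmap_left_homog[OF F G h(1)] key
  show "tmap_fun F G (v \<star>\<^bsub>S\<^esub> \<alpha>) w = tmap_fun F G v (w \<star>\<^bsub>S\<^esub> \<alpha> \<star>\<^bsub>S\<^esub> ksign (s * t))"
    using h by (simp only: S.grade_carrier S.smult_closed)
qed

abbreviation tmap :: "(('k, 'm) words set set \<Rightarrow> ('k, 'm) words set set) \<Rightarrow>
    (('k, 'm) words set set \<Rightarrow> ('k, 'm) words set set) \<Rightarrow>
    (('k, 'm) words set set \<times> ('k, 'm) words set set \<Rightarrow>\<^sub>0 int) set \<Rightarrow>
    (('k, 'm) words set set \<times> ('k, 'm) words set set \<Rightarrow>\<^sub>0 int) set"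
  where "tmap \<equiv> tensor_map K S S S S"

lemma tmap_lift: "tmap F G = tensor_lift K S S SS.TM (tmap_fun F G)"
  unfolding tensor_map_def Let_def tmap_fun_def[abs_def] ..

lemma tmap_additive: "F \<in> carrier H \<Longrightarrow> G \<in> carrier H \<Longrightarrow> additive_map SS.V SS.V (tmap F G)"
  unfolding tmap_lift using SS.tensor_lift_additive[OF SS.TM_abelian tmap_balanced] by simp

lemma tmap_pt: "F \<in> carrier H \<Longrightarrow> G \<in> carrier H \<Longrightarrow> v \<in> carrier S \<Longrightarrow> w \<in> carrier S \<Longrightarrow>
    tmap F G (SS.pt v w) = tmap_fun F G v w"
  unfolding tmap_lift by (rule SS.tensor_lift_pt[OF SS.TM_abelian tmap_balanced])

lemma tmap_pt_homog:
  assumes "F \<in> carrier H" "G \<in> grade H q" "v \<in> grade S r" "w \<in> carrier S"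
  shows "tmap F G (SS.pt v w) = SS.pt (F v) (G w) \<star>\<^bsub>SS.TM\<^esub> ksign (q * r)"
  using assms tmap_pt[of F G v w] tmap_homog[OF assms] SS.HM.grade_carrier S.grade_carrier by simp

lemma tmap_smult:
  assumes F: "F \<in> carrier H" and G: "G \<in> grade H q" and t: "t \<in> carrier SS.V"
  shows "tmap F G (t \<star>\<^bsub>SS.TM\<^esub> \<alpha>) = tmap F G t \<star>\<^bsub>SS.TM\<^esub> \<alpha>"
proof (rule SS.tensor_additive_eq_homog[OF SS.V_abelian additive_map_compose[OF SS.TM_smult_additive]
      additive_map_compose[OF _ SS.TM_smult_additive] _ t])
  have Gc: "G \<in> carrier H" using G by (rule SS.HM.grade_carrier)
  show "additive_map SS.V SS.V (tmap F G)" "additive_map SS.V SS.V (tmap F G)"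
    using tmap_additive[OF F Gc] by auto
  fix v w p r assume h: "v \<in> grade S p" "w \<in> grade S r"
  then have c: "v \<in> carrier S" "w \<in> carrier S" "F v \<in> carrier S" "G w \<in> carrier S"
    using S.grade_carrier SS.HM_closed[OF F] SS.HM_closed[OF Gc] by auto
  then have "SS.pt (F v) (G w) \<in> carrier SS.TM" by simp
  with c h show "tmap F G (SS.pt v w \<star>\<^bsub>SS.TM\<^esub> \<alpha>) = tmap F G (SS.pt v w) \<star>\<^bsub>SS.TM\<^esub> \<alpha>"
    by (simp add: SS.pt_smult tmap_pt_homog[OF F G h(1)] S.smult_closed SS.HM_linear[OF Gc]
        S.smult_ksign_commute[of _ _ \<alpha>])
qed

abbreviation "Mult \<equiv> sym_mult K M"

lemma mult_balanced: "balanced_map K S S S (\<lambda>x y. x \<otimes>\<^bsub>S\<^esub> y)"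
  by (auto simp: balanced_map_def additive_map_def S.l_distr S.r_distr S_smult_mult)

lemma Mult_additive: "additive_map SS.V S Mult"
  and Mult_pt: "x \<in> carrier S \<Longrightarrow> y \<in> carrier S \<Longrightarrow> Mult (SS.pt x y) = x \<otimes>\<^bsub>S\<^esub> y"
  unfolding sym_mult_def Let_def
  by (rule SS.tensor_lift_additive[OF S.abelian_group mult_balanced])
    (rule SS.tensor_lift_pt[OF S.abelian_group mult_balanced])

lemma Mult_smult: "t \<in> carrier SS.V \<Longrightarrow> Mult (t \<star>\<^bsub>SS.TM\<^esub> \<alpha>) = Mult t \<star>\<^bsub>S\<^esub> \<alpha>"
  by (rule SS.tensor_additive_eq[OF S.abelian_group additive_map_compose[OF SS.TM_smult_additive Mult_additive]
        additive_map_compose[OF Mult_additive S.smult_additive]])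
    (auto simp: SS.pt_smult Mult_pt S.smult_closed S_mult_smult)

end

section \<open>The coproduct\<close>

context rational_supermodule
begin

abbreviation "SA \<equiv> tensor_alg K S S"
abbreviation "pt \<equiv> SS.pt"
abbreviation "V \<equiv> SS.V"
abbreviation "TM \<equiv> SS.TM"

lemma SA_simps [simp]: "carrier SA = carrier V" "ring.zero SA = ring.zero V" "add SA = add V"
  "rsmult SA = rsmult TM" "grade SA = grade TM" "one SA = pt \<one>\<^bsub>S\<^esub> \<one>\<^bsub>S\<^esub>"
  using SS.TM_simps by (simp_all add: tensor_alg_def Let_def)

lemma smult_V_closed [simp]: "t \<in> carrier V \<Longrightarrow> t \<star>\<^bsub>TM\<^esub> \<alpha> \<in> carrier V"
  using SS.TM.smult_closed[of t \<alpha>] by simp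

lemma ksign_ksign_V: "t \<in> carrier V \<Longrightarrow> t \<star>\<^bsub>TM\<^esub> ksign p \<star>\<^bsub>TM\<^esub> ksign q = t \<star>\<^bsub>TM\<^esub> ksign (p + q)"
  using SS.TM.smult_ksign_ksign by simp

lemma uminus_TM: "t \<in> carrier V \<Longrightarrow> \<ominus>\<^bsub>TM\<^esub> t = \<ominus>\<^bsub>V\<^esub> t"
  by (rule SS.TM.minus_equality) (simp_all add: SS.V.l_neg)

lemma smult_ksign_V: "t \<in> carrier V \<Longrightarrow> t \<star>\<^bsub>TM\<^esub> ksign p = (if p = 0 then t else \<ominus>\<^bsub>V\<^esub> t)"
  using SS.TM.smult_ksign[of t p] by (simp add: uminus_TM)

lemma additive_ksign_V: "additive_map A V F \<Longrightarrow> abelian_group A \<Longrightarrow> additive_map A V (\<lambda>x. F x \<star>\<^bsub>TM\<^esub> \<alpha>)"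
  by (rule additive_map_compose[OF _ SS.TM_smult_additive])

lemma pt_additive_l: "n \<in> carrier S \<Longrightarrow> additive_map S V (\<lambda>m. pt m n)"
  using balanced_mapD[OF SS.pt_balanced_map] by auto

section \<open>The algebra structure of the tensor square\<close>

definition tterm where
  "tterm p q a b c d = pt (a \<otimes>\<^bsub>S\<^esub> component S q c) (component S p b \<otimes>\<^bsub>S\<^esub> d) \<star>\<^bsub>TM\<^esub> ksign (p * q)"

definition tinner where
  "tinner a b c d = (\<Oplus>\<^bsub>TM\<^esub>p\<in>{0,1}. \<Oplus>\<^bsub>TM\<^esub>q\<in>{0,1}. tterm p q a b c d)"

lemma tterm_closed [simp]: "a \<in> carrier S \<Longrightarrow> b \<in> carrier S \<Longrightarrow> c \<in> carrier S \<Longrightarrow> d \<in> carrier S \<Longrightarrow>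
    tterm p q a b c d \<in> carrier V"
  by (simp add: tterm_def)

lemma tterm_additive:
  shows "b \<in> carrier S \<Longrightarrow> c \<in> carrier S \<Longrightarrow> d \<in> carrier S \<Longrightarrow> additive_map S V (\<lambda>a. tterm p q a b c d)"
    and "a \<in> carrier S \<Longrightarrow> c \<in> carrier S \<Longrightarrow> d \<in> carrier S \<Longrightarrow> additive_map S V (\<lambda>b. tterm p q a b c d)"
    and "a \<in> carrier S \<Longrightarrow> b \<in> carrier S \<Longrightarrow> d \<in> carrier S \<Longrightarrow> additive_map S V (\<lambda>c. tterm p q a b c d)"
    and "a \<in> carrier S \<Longrightarrow> b \<in> carrier S \<Longrightarrow> c \<in> carrier S \<Longrightarrow> additive_map S V (\<lambda>d. tterm p q a b c d)"
  unfolding tterm_def additive_map_def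
  by (auto simp: S.component_add S.l_distr S.r_distr SS.pt_add_l SS.pt_add_r
      additive_map_add[OF SS.TM_smult_additive])

lemma tinner_expand:
  "a \<in> carrier S \<Longrightarrow> b \<in> carrier S \<Longrightarrow> c \<in> carrier S \<Longrightarrow> d \<in> carrier S \<Longrightarrow>
    tinner a b c d = (tterm 0 0 a b c d \<oplus>\<^bsub>V\<^esub> tterm 0 1 a b c d) \<oplus>\<^bsub>V\<^esub> (tterm 1 0 a b c d \<oplus>\<^bsub>V\<^esub> tterm 1 1 a b c d)"
  unfolding tinner_def using SS.TM.finsum_bit[of "\<lambda>q. tterm _ q a b c d"]
  by (simp add: SS.TM.finsum_bit)

lemma tinner_closed [simp]:
  "a \<in> carrier S \<Longrightarrow> b \<in> carrier S \<Longrightarrow> c \<in> carrier S \<Longrightarrow> d \<in> carrier S \<Longrightarrow> tinner a b c d \<in> carrier V"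
  by (simp add: tinner_expand)

lemma tinner_additive:
  shows "b \<in> carrier S \<Longrightarrow> c \<in> carrier S \<Longrightarrow> d \<in> carrier S \<Longrightarrow> additive_map S V (\<lambda>a. tinner a b c d)"
    and "a \<in> carrier S \<Longrightarrow> c \<in> carrier S \<Longrightarrow> d \<in> carrier S \<Longrightarrow> additive_map S V (\<lambda>b. tinner a b c d)"
    and "a \<in> carrier S \<Longrightarrow> b \<in> carrier S \<Longrightarrow> d \<in> carrier S \<Longrightarrow> additive_map S V (\<lambda>c. tinner a b c d)"
    and "a \<in> carrier S \<Longrightarrow> b \<in> carrier S \<Longrightarrow> c \<in> carrier S \<Longrightarrow> additive_map S V (\<lambda>d. tinner a b c d)"
proof -
  note sum = additive_map_sum[OF SS.V_abelian]
  show "b \<in> carrier S \<Longrightarrow> c \<in> carrier S \<Longrightarrow> d \<in> carrier S \<Longrightarrow> additive_map S V (\<lambda>a. tinner a b c d)"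
    by (rule additive_map_cong[OF S.abelian_group sum[OF sum sum]])
      (auto simp: tinner_expand intro: tterm_additive)
  show "a \<in> carrier S \<Longrightarrow> c \<in> carrier S \<Longrightarrow> d \<in> carrier S \<Longrightarrow> additive_map S V (\<lambda>b. tinner a b c d)"
    by (rule additive_map_cong[OF S.abelian_group sum[OF sum sum]])
      (auto simp: tinner_expand intro: tterm_additive)
  show "a \<in> carrier S \<Longrightarrow> b \<in> carrier S \<Longrightarrow> d \<in> carrier S \<Longrightarrow> additive_map S V (\<lambda>c. tinner a b c d)"
    by (rule additive_map_cong[OF S.abelian_group sum[OF sum sum]])
      (auto simp: tinner_expand intro: tterm_additive)
  show "a \<in> carrier S \<Longrightarrow> b \<in> carrier S \<Longrightarrow> c \<in> carrier S \<Longrightarrow> additive_map S V (\<lambda>d. tinner a b c d)"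
    by (rule additive_map_cong[OF S.abelian_group sum[OF sum sum]])
      (auto simp: tinner_expand intro: tterm_additive)
qed

lemma tinner_homog:
  assumes "a \<in> carrier S" "b \<in> grade S p" "c \<in> grade S q" "d \<in> carrier S"
  shows "tinner a b c d = pt (a \<otimes>\<^bsub>S\<^esub> c) (b \<otimes>\<^bsub>S\<^esub> d) \<star>\<^bsub>TM\<^esub> ksign (p * q)"
proof -
  have c: "b \<in> carrier S" "c \<in> carrier S" using assms S.grade_carrier by auto
  have z: "\<zero>\<^bsub>V\<^esub> \<star>\<^bsub>TM\<^esub> \<alpha> = \<zero>\<^bsub>V\<^esub>" for \<alpha> using SS.TM.zero_smult by simp
  show ?thesis
    using assms c by (cases p; cases q) (simp_all add: tinner_expand tterm_def S.component_of_grade z)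
qed

lemma tinner_balanced:
  assumes a: "a \<in> carrier S" and b: "b \<in> carrier S"
  shows "balanced_map K S S TM (tinner a b)"
proof (rule SS.balanced_mapI)
  show "additive_map S TM (\<lambda>m. tinner a b m n)" if "n \<in> carrier S" for n
    using tinner_additive(3)[OF a b that] by simp
  show "additive_map S TM (tinner a b m)" if "m \<in> carrier S" for m
    using tinner_additive(4)[OF a b that] by simp
  fix c d \<alpha> p q r assume h: "c \<in> grade S r" "d \<in> grade S q" "\<alpha> \<in> K p"
  have cc: "c \<in> carrier S" "d \<in> carrier S" using h S.grade_carrier by auto
  have c2: "c \<star>\<^bsub>S\<^esub> \<alpha> \<in> carrier S" "d \<star>\<^bsub>S\<^esub> \<alpha> \<star>\<^bsub>S\<^esub> ksign (p * q) \<in> carrier S"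
    using cc by (simp_all add: S.smult_closed)
  show "tinner a b (c \<star>\<^bsub>S\<^esub> \<alpha>) d = tinner a b c (d \<star>\<^bsub>S\<^esub> \<alpha> \<star>\<^bsub>S\<^esub> ksign (p * q))"
  proof (rule S.additive_eq_on_grades[OF tinner_additive(2)[OF a c2(1) cc(2)] tinner_additive(2)[OF a cc(1) c2(2)] _ b])
    fix s b assume b: "b \<in> grade S s"
    then have bc: "b \<in> carrier S" by (rule S.grade_carrier)
    have bd: "b \<otimes>\<^bsub>S\<^esub> d \<in> grade S (s + q)" by (rule mult_grade_S[OF b h(2)])
    show "tinner a b (c \<star>\<^bsub>S\<^esub> \<alpha>) d = tinner a b c (d \<star>\<^bsub>S\<^esub> \<alpha> \<star>\<^bsub>S\<^esub> ksign (p * q))"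
      using a cc c2 bc S.lsmult_homog[OF bd h(3)]
      by (simp add: tinner_homog[OF a b S.rsmult_grade[OF h(1,3)] cc(2)] tinner_homog[OF a b h(1) c2(2)]
          S_mult_smult SS.pt_balanced pt_ksign_r ksign_ksign_V S.smult_closed bit_ac)
  qed
qed

definition tmul where "tmul t t' = t \<otimes>\<^bsub>SA\<^esub> t'"

lemma tmul_lift: "tmul t t' = tensor_lift K S S TM (\<lambda>a b. tensor_lift K S S TM (tinner a b) t') t"
  unfolding tmul_def by (simp add: tensor_alg_def Let_def tinner_def[abs_def] tterm_def)

lemma touter_additive:
  "a \<in> carrier S \<Longrightarrow> b \<in> carrier S \<Longrightarrow> additive_map V V (tensor_lift K S S TM (tinner a b))"
  using SS.tensor_lift_additive[OF SS.TM_abelian tinner_balanced] by simp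

lemma touter_pt:
  "a \<in> carrier S \<Longrightarrow> b \<in> carrier S \<Longrightarrow> c \<in> carrier S \<Longrightarrow> d \<in> carrier S \<Longrightarrow>
    tensor_lift K S S TM (tinner a b) (pt c d) = tinner a b c d"
  using SS.tensor_lift_pt[OF SS.TM_abelian tinner_balanced] by simp

lemma touter_balanced:
  assumes t: "t \<in> carrier V"
  shows "balanced_map K S S TM (\<lambda>a b. tensor_lift K S S TM (tinner a b) t)"
proof (rule SS.balanced_mapI)
  note sum = additive_map_sum[OF SS.V_abelian touter_additive touter_additive]
  show "additive_map S TM (\<lambda>a. tensor_lift K S S TM (tinner a b) t)" if b: "b \<in> carrier S" for b
  proof (rule additive_mapI)
    fix x y assume xy: "x \<in> carrier S" "y \<in> carrier S"
    have "tensor_lift K S S TM (tinner (x \<oplus>\<^bsub>S\<^esub> y) b) t =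
      tensor_lift K S S TM (tinner x b) t \<oplus>\<^bsub>V\<^esub> tensor_lift K S S TM (tinner y b) t"
      by (rule SS.tensor_additive_eq[OF SS.V_abelian touter_additive sum _ t])
        (use xy b in \<open>auto simp: touter_pt additive_map_add[OF tinner_additive(1)]\<close>)
    then show "tensor_lift K S S TM (tinner (x \<oplus>\<^bsub>S\<^esub> y) b) t =
      tensor_lift K S S TM (tinner x b) t \<oplus>\<^bsub>TM\<^esub> tensor_lift K S S TM (tinner y b) t" by simp
  qed (use additive_map_closed[OF touter_additive t] b in simp)
  show "additive_map S TM (\<lambda>b. tensor_lift K S S TM (tinner a b) t)" if a: "a \<in> carrier S" for a
  proof (rule additive_mapI)
    fix x y assume xy: "x \<in> carrier S" "y \<in> carrier S"
    have "tensor_lift K S S TM (tinner a (x \<oplus>\<^bsub>S\<^esub> y)) t =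
      tensor_lift K S S TM (tinner a x) t \<oplus>\<^bsub>V\<^esub> tensor_lift K S S TM (tinner a y) t"
      by (rule SS.tensor_additive_eq[OF SS.V_abelian touter_additive sum _ t])
        (use xy a in \<open>auto simp: touter_pt additive_map_add[OF tinner_additive(2)]\<close>)
    then show "tensor_lift K S S TM (tinner a (x \<oplus>\<^bsub>S\<^esub> y)) t =
      tensor_lift K S S TM (tinner a x) t \<oplus>\<^bsub>TM\<^esub> tensor_lift K S S TM (tinner a y) t" by simp
  qed (use additive_map_closed[OF touter_additive t] a in simp)
  fix a b \<alpha> p q r assume h: "a \<in> grade S r" "b \<in> grade S q" "\<alpha> \<in> K p"
  have c: "a \<in> carrier S" "b \<in> carrier S" using h S.grade_carrier by auto
  have c2: "a \<star>\<^bsub>S\<^esub> \<alpha> \<in> carrier S" "b \<star>\<^bsub>S\<^esub> \<alpha> \<star>\<^bsub>S\<^esub> ksign (p * q) \<in> carrier S"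
    using c by (simp_all add: S.smult_closed)
  have bg: "b \<star>\<^bsub>S\<^esub> \<alpha> \<star>\<^bsub>S\<^esub> ksign (p * q) \<in> grade S (q + p)"
    by (rule S.ksign_grade[OF S.rsmult_grade[OF h(2,3)]])
  have bl: "b \<star>\<^bsub>S\<^esub> \<alpha> \<star>\<^bsub>S\<^esub> ksign (p * q) = sc \<alpha> \<otimes>\<^bsub>S\<^esub> b"
    using S.lsmult_homog[OF h(2,3)] S_lsmult[OF c(2)] by simp
  show "tensor_lift K S S TM (tinner (a \<star>\<^bsub>S\<^esub> \<alpha>) b) t =
    tensor_lift K S S TM (tinner a (b \<star>\<^bsub>S\<^esub> \<alpha> \<star>\<^bsub>S\<^esub> ksign (p * q))) t"
  proof (rule SS.tensor_additive_eq_homog[OF SS.V_abelian touter_additive[OF c2(1) c(2)] touter_additive[OF c(1) c2(2)] _ t])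
    fix m n s u assume mn: "m \<in> grade S s" "n \<in> grade S u"
    have mc: "m \<in> carrier S" "n \<in> carrier S" using mn S.grade_carrier by auto
    have "a \<star>\<^bsub>S\<^esub> \<alpha> \<otimes>\<^bsub>S\<^esub> m = (a \<otimes>\<^bsub>S\<^esub> m) \<star>\<^bsub>S\<^esub> \<alpha> \<star>\<^bsub>S\<^esub> ksign (p * s)"
      using c mc by (simp add: S_smult_mult S.lsmult_homog[OF mn(1) h(3)] S_mult_smult S.smult_closed)
    then have "tinner (a \<star>\<^bsub>S\<^esub> \<alpha>) b m n = pt (a \<otimes>\<^bsub>S\<^esub> m) (sc \<alpha> \<otimes>\<^bsub>S\<^esub> (b \<otimes>\<^bsub>S\<^esub> n)) \<star>\<^bsub>TM\<^esub> ksign (p * s + q * s)"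
    proof -
      have "pt ((a \<otimes>\<^bsub>S\<^esub> m) \<star>\<^bsub>S\<^esub> \<alpha> \<star>\<^bsub>S\<^esub> ksign (p * s)) (b \<otimes>\<^bsub>S\<^esub> n) = pt ((a \<otimes>\<^bsub>S\<^esub> m) \<star>\<^bsub>S\<^esub> \<alpha>) (b \<otimes>\<^bsub>S\<^esub> n) \<star>\<^bsub>TM\<^esub> ksign (p * s)"
        using c mc by (intro SS.pt_ksign_l) (simp_all add: S.smult_closed)
      moreover have "pt ((a \<otimes>\<^bsub>S\<^esub> m) \<star>\<^bsub>S\<^esub> \<alpha>) (b \<otimes>\<^bsub>S\<^esub> n) = pt (a \<otimes>\<^bsub>S\<^esub> m) (sc \<alpha> \<otimes>\<^bsub>S\<^esub> (b \<otimes>\<^bsub>S\<^esub> n))"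
        using c mc by (simp add: SS.pt_balanced S_lsmult)
      ultimately show ?thesis
        using \<open>a \<star>\<^bsub>S\<^esub> \<alpha> \<otimes>\<^bsub>S\<^esub> m = _\<close> c mc by (simp add: tinner_homog[OF c2(1) h(2) mn(1) mc(2)] ksign_ksign_V)
    qed
    moreover have "tinner a (b \<star>\<^bsub>S\<^esub> \<alpha> \<star>\<^bsub>S\<^esub> ksign (p * q)) m n =
        pt (a \<otimes>\<^bsub>S\<^esub> m) (sc \<alpha> \<otimes>\<^bsub>S\<^esub> (b \<otimes>\<^bsub>S\<^esub> n)) \<star>\<^bsub>TM\<^esub> ksign ((q + p) * s)"
      using c mc by (simp add: tinner_homog[OF c(1) bg mn(1) mc(2)]) (simp add: bl S.m_assoc)
    ultimately show "tensor_lift K S S TM (tinner (a \<star>\<^bsub>S\<^esub> \<alpha>) b) (pt m n) =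
        tensor_lift K S S TM (tinner a (b \<star>\<^bsub>S\<^esub> \<alpha> \<star>\<^bsub>S\<^esub> ksign (p * q))) (pt m n)"
      using c c2 mc by (simp add: touter_pt distrib_right add.commute)
  qed
qed

lemma tmul_additive_l: "t' \<in> carrier V \<Longrightarrow> additive_map V V (\<lambda>t. tmul t t')"
  unfolding tmul_lift using SS.tensor_lift_additive[OF SS.TM_abelian touter_balanced] by simp

lemma tmul_pt_outer: "a \<in> carrier S \<Longrightarrow> b \<in> carrier S \<Longrightarrow> t \<in> carrier V \<Longrightarrow>
    tmul (pt a b) t = tensor_lift K S S TM (tinner a b) t"
  unfolding tmul_lift using SS.tensor_lift_pt[OF SS.TM_abelian touter_balanced] by simp

lemma tmul_closed [simp]: "t \<in> carrier V \<Longrightarrow> t' \<in> carrier V \<Longrightarrow> tmul t t' \<in> carrier V"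
  using additive_map_closed[OF tmul_additive_l] by simp

lemma tmul_additive_r: "t \<in> carrier V \<Longrightarrow> additive_map V V (tmul t)"
proof (rule additive_mapI)
  fix x y assume t: "t \<in> carrier V" and xy: "x \<in> carrier V" "y \<in> carrier V"
  show "tmul t (x \<oplus>\<^bsub>V\<^esub> y) = tmul t x \<oplus>\<^bsub>V\<^esub> tmul t y"
    by (rule SS.tensor_additive_eq[OF SS.V_abelian tmul_additive_l
          additive_map_sum[OF SS.V_abelian tmul_additive_l tmul_additive_l] _ t])
      (use xy in \<open>auto simp: tmul_pt_outer additive_map_add[OF touter_additive]\<close>)
qed simp

lemma tmul_pt:
  assumes "a \<in> carrier S" "b \<in> grade S p" "c \<in> grade S q" "d \<in> carrier S"
  shows "tmul (pt a b) (pt c d) = pt (a \<otimes>\<^bsub>S\<^esub> c) (b \<otimes>\<^bsub>S\<^esub> d) \<star>\<^bsub>TM\<^esub> ksign (p * q)"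
  using assms S.grade_carrier by (simp add: tmul_pt_outer touter_pt tinner_homog)

lemma tmul_ksign_l: "t \<in> carrier V \<Longrightarrow> t' \<in> carrier V \<Longrightarrow> tmul (t \<star>\<^bsub>TM\<^esub> ksign p) t' = tmul t t' \<star>\<^bsub>TM\<^esub> ksign p"
  using additive_map_minus[OF SS.V_abelian SS.V_abelian tmul_additive_l] by (simp add: smult_ksign_V)

lemma tmul_ksign_r: "t \<in> carrier V \<Longrightarrow> t' \<in> carrier V \<Longrightarrow> tmul t (t' \<star>\<^bsub>TM\<^esub> ksign p) = tmul t t' \<star>\<^bsub>TM\<^esub> ksign p"
  using additive_map_minus[OF SS.V_abelian SS.V_abelian tmul_additive_r] by (simp add: smult_ksign_V)

lemma tmul_assoc:
  assumes t: "t \<in> carrier V" and u: "u \<in> carrier V" and w: "w \<in> carrier V"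
  shows "tmul (tmul t u) w = tmul t (tmul u w)"
proof -
  have 1: "tmul (tmul (pt a b) (pt c d)) (pt e f) = tmul (pt a b) (tmul (pt c d) (pt e f))"
    if h: "a \<in> grade S pa" "b \<in> grade S pb" "c \<in> grade S pc" "d \<in> grade S pd" "e \<in> grade S pe" "f \<in> grade S pf"
    for a b c d e f pa pb pc pd pe pf
  proof -
    have C: "a \<in> carrier S" "b \<in> carrier S" "c \<in> carrier S" "d \<in> carrier S" "e \<in> carrier S" "f \<in> carrier S"
      using h S.grade_carrier by auto
    show ?thesis
      using C by (simp add: tmul_pt[OF _ h(2,3)] tmul_pt[OF _ h(4,5)] tmul_ksign_l tmul_ksign_r
          tmul_pt[OF _ mult_grade_S[OF h(2,4)] h(5)] tmul_pt[OF _ h(2) mult_grade_S[OF h(3,5)]]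
          ksign_ksign_V S.m_assoc bit_ac)
  qed
  have 2: "tmul (tmul (pt a b) (pt c d)) w = tmul (pt a b) (tmul (pt c d) w)"
    if h: "a \<in> grade S pa" "b \<in> grade S pb" "c \<in> grade S pc" "d \<in> grade S pd" and w: "w \<in> carrier V"
    for a b c d pa pb pc pd w
  proof -
    have C: "pt a b \<in> carrier V" "pt c d \<in> carrier V" using h S.grade_carrier by auto
    show ?thesis
      by (rule SS.tensor_additive_eq_homog[OF SS.V_abelian tmul_additive_r[OF tmul_closed[OF C]]
            additive_map_compose[OF tmul_additive_r[OF C(2)] tmul_additive_r[OF C(1)]] _ w])
        (rule 1[OF h])
  qed
  have 3: "tmul (tmul (pt a b) u) w = tmul (pt a b) (tmul u w)"
    if h: "a \<in> grade S pa" "b \<in> grade S pb" for a b pa pb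
  proof -
    have C: "pt a b \<in> carrier V" using h S.grade_carrier by auto
    show ?thesis
      by (rule SS.tensor_additive_eq_homog[OF SS.V_abelian
            additive_map_compose[OF tmul_additive_r[OF C] tmul_additive_l[OF w]]
            additive_map_compose[OF tmul_additive_l[OF w] tmul_additive_r[OF C]] _ u])
        (rule 2[OF h _ _ w])
  qed
  show ?thesis
    by (rule SS.tensor_additive_eq_homog[OF SS.V_abelian
          additive_map_compose[OF tmul_additive_l[OF u] tmul_additive_l[OF w]] tmul_additive_l[OF tmul_closed[OF u w]] _ t])
      (rule 3)
qed

section \<open>Multiplication by primitive tensors\<close>

definition prim :: "'m \<Rightarrow> (('k, 'm) words set set \<times> ('k, 'm) words set set \<Rightarrow>\<^sub>0 int) set"
  where "prim x = pt (vc x) \<one>\<^bsub>S\<^esub> \<oplus>\<^bsub>V\<^esub> pt \<one>\<^bsub>S\<^esub> (vc x)"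

lemma prim_closed [simp]: "x \<in> carrier M \<Longrightarrow> prim x \<in> carrier V"
  by (simp add: prim_def)

lemma prim_tmul_pt:
  assumes "x \<in> grade M p" "c \<in> grade S q" "d \<in> carrier S"
  shows "tmul (prim x) (pt c d) = pt (vc x \<otimes>\<^bsub>S\<^esub> c) d \<oplus>\<^bsub>V\<^esub> pt c (vc x \<otimes>\<^bsub>S\<^esub> d) \<star>\<^bsub>TM\<^esub> ksign (p * q)"
proof -
  have C: "x \<in> carrier M" "c \<in> carrier S" using assms grade_carrier S.grade_carrier by auto
  have "pt (vc x \<otimes>\<^bsub>S\<^esub> c) d \<star>\<^bsub>TM\<^esub> 1 = pt (vc x \<otimes>\<^bsub>S\<^esub> c) d"
    using C assms(3) SS.TM.smult_one by simp
  then show ?thesis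
    unfolding prim_def
    using C assms additive_map_add[OF tmul_additive_l, of "pt c d" "pt (vc x) \<one>\<^bsub>S\<^esub>" "pt \<one>\<^bsub>S\<^esub> (vc x)"]
    by (simp add: tmul_pt[OF _ one_grade_S assms(2,3)] tmul_pt[OF _ vc_grade_S[OF assms(1)] assms(2,3)])
qed

definition scal_act :: "'k \<Rightarrow> (('k, 'm) words set set \<times> ('k, 'm) words set set \<Rightarrow>\<^sub>0 int) set \<Rightarrow>
    (('k, 'm) words set set \<times> ('k, 'm) words set set \<Rightarrow>\<^sub>0 int) set"
  where "scal_act \<alpha> = tmul (pt (sc \<alpha>) \<one>\<^bsub>S\<^esub>)"

lemma scal_act_pt: "c \<in> carrier S \<Longrightarrow> d \<in> carrier S \<Longrightarrow> scal_act \<alpha> (pt c d) = pt (sc \<alpha> \<otimes>\<^bsub>S\<^esub> c) d"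
proof -
  assume c: "c \<in> carrier S" and d: "d \<in> carrier S"
  note A = additive_map_compose[OF pt_additive_l[OF d] tmul_additive_r[OF SS.pt_closed[OF sc_closed S.one_closed]]]
  note B = additive_map_compose[OF left_mult_additive[OF sc_closed] pt_additive_l[OF d]]
  show ?thesis
    unfolding scal_act_def
  proof (rule S.additive_eq_on_grades[OF A B _ c])
    fix q c assume c: "c \<in> grade S q"
    then have "pt (sc \<alpha> \<otimes>\<^bsub>S\<^esub> c) d \<in> carrier TM" using d S.grade_carrier by simp
    then show "tmul (pt (sc \<alpha>) \<one>\<^bsub>S\<^esub>) (pt c d) = pt (sc \<alpha> \<otimes>\<^bsub>S\<^esub> c) d"
      using d by (simp add: tmul_pt[OF _ one_grade_S c d] SS.TM.smult_one)
  qed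
qed

lemma scal_act_additive: "additive_map V V (scal_act \<alpha>)"
  unfolding scal_act_def by (rule tmul_additive_r) simp

lemma prim_act_additive: "x \<in> carrier M \<Longrightarrow> additive_map V V (tmul (prim x))"
  by (rule tmul_additive_r) simp

lemma prim_additive: "additive_map M V prim"
  by (auto simp: additive_map_def prim_def vc_add SS.pt_add_l SS.pt_add_r SS.V.a_ac)

lemma scal_act_ksign: "t \<in> carrier V \<Longrightarrow> scal_act (ksign p) t = t \<star>\<^bsub>TM\<^esub> ksign p"
  by (rule SS.tensor_additive_eq[OF SS.V_abelian scal_act_additive SS.TM_smult_additive])
    (auto simp: scal_act_pt S_lsmult[symmetric] S.lsmult_even SS.pt_ksign_l)

lemma scal_act_one: "t \<in> carrier V \<Longrightarrow> scal_act 1 t = t"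
proof -
  assume t: "t \<in> carrier V"
  have I: "additive_map V V (\<lambda>t. t)" by (simp add: additive_map_def)
  show ?thesis
    by (rule SS.tensor_additive_eq[OF SS.V_abelian scal_act_additive I _ t]) (simp add: scal_act_pt sc_one)
qed

text \<open>Together with \<open>prim_swap\<close> and \<open>prim_odd_square\<close>, this says
  that multiplication by \<open>prim x\<close> obeys the relations of the letter \<open>x\<close>,
  as the universal property demands. The scalar has to be moved across the tensor sign, where the
  balancing relation supplies the sign.\<close>

lemma prim_smult_homog:
  assumes x: "x \<in> grade M p" and al: "\<alpha> \<in> K s" and t: "t \<in> carrier V"
  shows "tmul (prim (x \<star> \<alpha>)) t = tmul (prim x) (scal_act \<alpha> t)"
    and "tmul (prim (lsmult K M \<alpha> x)) t = scal_act \<alpha> (tmul (prim x) t)"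
proof -
  have xc: "x \<in> carrier M" using x by (rule grade_carrier)
  have key: "pt (sc \<alpha> \<otimes>\<^bsub>S\<^esub> c) (vc x \<otimes>\<^bsub>S\<^esub> d) = pt c (vc (x \<star> \<alpha>) \<otimes>\<^bsub>S\<^esub> d) \<star>\<^bsub>TM\<^esub> ksign (s * q + s * p)"
    if c: "c \<in> grade S q" and d: "d \<in> carrier S" for c d q
  proof -
    have cc: "c \<in> carrier S" using c by (rule S.grade_carrier)
    have "sc \<alpha> \<otimes>\<^bsub>S\<^esub> c = c \<star>\<^bsub>S\<^esub> \<alpha> \<star>\<^bsub>S\<^esub> ksign (s * q)"
      using S.lsmult_homog[OF c al] S_lsmult[OF cc] by simp
    then have "pt (sc \<alpha> \<otimes>\<^bsub>S\<^esub> c) (vc x \<otimes>\<^bsub>S\<^esub> d) = pt (c \<star>\<^bsub>S\<^esub> \<alpha>) (vc x \<otimes>\<^bsub>S\<^esub> d) \<star>\<^bsub>TM\<^esub> ksign (s * q)"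
      using cc d xc by (simp add: SS.pt_ksign_l S.smult_closed)
    also have "pt (c \<star>\<^bsub>S\<^esub> \<alpha>) (vc x \<otimes>\<^bsub>S\<^esub> d) = pt c (sc \<alpha> \<otimes>\<^bsub>S\<^esub> vc x \<otimes>\<^bsub>S\<^esub> d)"
      using cc d xc by (simp add: SS.pt_balanced S_lsmult S.m_assoc)
    also have "sc \<alpha> \<otimes>\<^bsub>S\<^esub> vc x = vc (x \<star> \<alpha>) \<star>\<^bsub>S\<^esub> ksign (s * p)"
      using S.lsmult_homog[OF vc_grade_S[OF x] al] S_lsmult[of "vc x" \<alpha>] xc by (simp add: vc_smult S_smult)
    finally show ?thesis
      using cc d xc by (simp add: S_ksign_mult pt_ksign_r rsmult_closed ksign_ksign_V add.commute)
  qed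
  have xs: "x \<star> \<alpha> \<in> grade M (p + s)" by (rule rsmult_grade[OF x al])
  have xsc: "x \<star> \<alpha> \<in> carrier M" using xs by (rule grade_carrier)
  show "tmul (prim (x \<star> \<alpha>)) t = tmul (prim x) (scal_act \<alpha> t)"
  proof (rule SS.tensor_additive_eq_homog[OF SS.V_abelian prim_act_additive[OF xsc]
        additive_map_compose[OF scal_act_additive prim_act_additive[OF xc]] _ t])
    fix c d q r assume h: "c \<in> grade S q" "d \<in> grade S r"
    have cc: "c \<in> carrier S" "d \<in> carrier S" using h S.grade_carrier by auto
    have sg: "sc \<alpha> \<otimes>\<^bsub>S\<^esub> c \<in> grade S (s + q)" by (rule mult_grade_S[OF sc_grade_S[OF al] h(1)])
    show "tmul (prim (x \<star> \<alpha>)) (pt c d) = tmul (prim x) (scal_act \<alpha> (pt c d))"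
      using cc xc xsc
      by (simp add: scal_act_pt prim_tmul_pt[OF xs h(1)] prim_tmul_pt[OF x sg] key[OF h(1)] ksign_ksign_V)
        (simp add: vc_smult S.m_assoc bit_ac)
  qed
  have xl: "lsmult K M \<alpha> x \<in> grade M (s + p)" by (rule lsmult_grade[OF x al])
  have xlc: "lsmult K M \<alpha> x \<in> carrier M" using xl by (rule grade_carrier)
  show "tmul (prim (lsmult K M \<alpha> x)) t = scal_act \<alpha> (tmul (prim x) t)"
  proof (rule SS.tensor_additive_eq_homog[OF SS.V_abelian prim_act_additive[OF xlc]
        additive_map_compose[OF prim_act_additive[OF xc] scal_act_additive] _ t])
    fix c d q r assume h: "c \<in> grade S q" "d \<in> grade S r"
    have cc: "c \<in> carrier S" "d \<in> carrier S" using h S.grade_carrier by auto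
    have l: "vc (lsmult K M \<alpha> x) = vc (x \<star> \<alpha>) \<star>\<^bsub>S\<^esub> ksign (s * p)"
      using x al xsc by (simp add: lsmult_homog vc_smult S_smult)
    have "tmul (prim (lsmult K M \<alpha> x)) (pt c d) = pt (sc \<alpha> \<otimes>\<^bsub>S\<^esub> (vc x \<otimes>\<^bsub>S\<^esub> c)) d \<oplus>\<^bsub>V\<^esub>
        pt c (vc (x \<star> \<alpha>) \<otimes>\<^bsub>S\<^esub> d) \<star>\<^bsub>TM\<^esub> ksign (s * p + (s + p) * q)"
      using cc xc xsc xlc
      by (simp add: prim_tmul_pt[OF xl h(1)] vc_lsmult S.m_assoc)
        (simp add: S.m_assoc[symmetric] vc_lsmult[symmetric] l S_ksign_mult pt_ksign_r ksign_ksign_V)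
    moreover have "scal_act \<alpha> (tmul (prim x) (pt c d)) = pt (sc \<alpha> \<otimes>\<^bsub>S\<^esub> (vc x \<otimes>\<^bsub>S\<^esub> c)) d \<oplus>\<^bsub>V\<^esub>
        pt (sc \<alpha> \<otimes>\<^bsub>S\<^esub> c) (vc x \<otimes>\<^bsub>S\<^esub> d) \<star>\<^bsub>TM\<^esub> ksign (p * q)"
      using cc xc by (simp add: prim_tmul_pt[OF x h(1)] additive_map_add[OF scal_act_additive] scal_act_pt
          tmul_ksign_r[of "pt (sc \<alpha>) \<one>\<^bsub>S\<^esub>", folded scal_act_def])
    ultimately show "tmul (prim (lsmult K M \<alpha> x)) (pt c d) = scal_act \<alpha> (tmul (prim x) (pt c d))"
      using cc xc xsc by (simp add: key[OF h(1)] ksign_ksign_V bit_ac)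
  qed
qed

lemma scal_act_add: "t \<in> carrier V \<Longrightarrow> scal_act (\<alpha> + \<beta>) t = scal_act \<alpha> t \<oplus>\<^bsub>V\<^esub> scal_act \<beta> t"
  by (rule SS.tensor_additive_eq[OF SS.V_abelian scal_act_additive
        additive_map_sum[OF SS.V_abelian scal_act_additive scal_act_additive]])
    (auto simp: scal_act_pt sc_add S.l_distr SS.pt_add_l)

lemma scal_act_mult: "t \<in> carrier V \<Longrightarrow> scal_act (\<alpha> * \<beta>) t = scal_act \<alpha> (scal_act \<beta> t)"
  by (rule SS.tensor_additive_eq[OF SS.V_abelian scal_act_additive
        additive_map_compose[OF scal_act_additive scal_act_additive]])
    (auto simp: scal_act_pt sc_mult S.m_assoc)

lemma prim_act_add: "x \<in> carrier M \<Longrightarrow> y \<in> carrier M \<Longrightarrow> t \<in> carrier V \<Longrightarrow>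
    tmul (prim (x \<oplus> y)) t = tmul (prim x) t \<oplus>\<^bsub>V\<^esub> tmul (prim y) t"
  by (simp add: additive_map_add[OF prim_additive] additive_map_add[OF tmul_additive_l])

lemma prim_act_additive': "t \<in> carrier V \<Longrightarrow> additive_map M V (\<lambda>x. tmul (prim x) t)"
  by (simp add: additive_map_def prim_act_add)

lemma scal_act_closed [simp]: "t \<in> carrier V \<Longrightarrow> scal_act \<alpha> t \<in> carrier V"
  using additive_map_closed[OF scal_act_additive] .

lemma prim_smult:
  assumes x: "x \<in> carrier M" and t: "t \<in> carrier V"
  shows "tmul (prim (x \<star> \<alpha>)) t = tmul (prim x) (scal_act \<alpha> t)"
proof (induction \<alpha> rule: K_induct)
  case (1 p \<alpha>)
  show ?case
    by (rule additive_eq_on_grades[OF additive_map_compose[OF smult_additive prim_act_additive'[OF t]]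
          prim_act_additive' _ x]) (use prim_smult_homog(1) 1 t in auto)
next
  case (2 \<alpha> \<beta>)
  then show ?case
    using x t by (simp add: rsmult_r_distr rsmult_closed prim_act_add scal_act_add
        additive_map_add[OF prim_act_additive])
qed

lemma prim_lsmult:
  assumes x: "x \<in> carrier M" and t: "t \<in> carrier V"
  shows "tmul (prim (lsmult K M \<alpha> x)) t = scal_act \<alpha> (tmul (prim x) t)"
proof (induction \<alpha> rule: K_induct)
  case (1 p \<alpha>)
  show ?case
    by (rule additive_eq_on_grades[OF additive_map_compose[OF lsmult_additive prim_act_additive'[OF t]]
          additive_map_compose[OF prim_act_additive'[OF t] scal_act_additive] _ x])
      (use prim_smult_homog(2) 1 t in auto)
next
  case (2 \<alpha> \<beta>)
  then show ?case
    using x t by (simp add: lsmult_add_scal prim_act_add scal_act_add)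
qed

lemma prim_prim_pt:
  assumes x: "x \<in> grade M p" and y: "y \<in> grade M q" and c: "c \<in> grade S r" and d: "d \<in> carrier S"
  shows "tmul (prim x) (tmul (prim y) (pt c d)) =
      (pt (vc x \<otimes>\<^bsub>S\<^esub> (vc y \<otimes>\<^bsub>S\<^esub> c)) d \<oplus>\<^bsub>V\<^esub> pt (vc y \<otimes>\<^bsub>S\<^esub> c) (vc x \<otimes>\<^bsub>S\<^esub> d) \<star>\<^bsub>TM\<^esub> ksign (p * (q + r))) \<oplus>\<^bsub>V\<^esub>
      (pt (vc x \<otimes>\<^bsub>S\<^esub> c) (vc y \<otimes>\<^bsub>S\<^esub> d) \<star>\<^bsub>TM\<^esub> ksign (q * r) \<oplus>\<^bsub>V\<^esub> pt c (vc x \<otimes>\<^bsub>S\<^esub> (vc y \<otimes>\<^bsub>S\<^esub> d)) \<star>\<^bsub>TM\<^esub> ksign (p * r + q * r))"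
proof -
  have xy: "x \<in> carrier M" "y \<in> carrier M" "c \<in> carrier S" using x y c grade_carrier S.grade_carrier by auto
  show ?thesis
    using xy d
    by (simp add: prim_tmul_pt[OF y c] additive_map_add[OF prim_act_additive] tmul_ksign_r
        prim_tmul_pt[OF x vc_mult_grade_S[OF y c]] prim_tmul_pt[OF x c]
        additive_map_add[OF SS.TM_smult_additive] ksign_ksign_V)
qed

text \<open>Of the four terms of the product, the two with both letters in one factor are compared
  by supercommutativity in \<open>S\<close>, while the two mixed ones change places.\<close>

lemma prim_swap:
  assumes x: "x \<in> grade M p" and y: "y \<in> grade M q" and t: "t \<in> carrier V"
  shows "tmul (prim x) (tmul (prim y) t) = tmul (prim y) (tmul (prim x) t) \<star>\<^bsub>TM\<^esub> ksign (p * q)"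
proof -
  have xy: "x \<in> carrier M" "y \<in> carrier M" using x y grade_carrier by auto
  note A = additive_map_compose[OF prim_act_additive prim_act_additive]
  show ?thesis
  proof (rule SS.tensor_additive_eq_homog[OF SS.V_abelian A[OF xy(2,1)]
        additive_map_compose[OF A[OF xy] SS.TM_smult_additive] _ t])
    fix c d r s assume h: "c \<in> grade S r" "d \<in> grade S s"
    have cc: "c \<in> carrier S" "d \<in> carrier S" using h S.grade_carrier by auto
    have sw: "vc x \<otimes>\<^bsub>S\<^esub> (vc y \<otimes>\<^bsub>S\<^esub> z) = (vc y \<otimes>\<^bsub>S\<^esub> (vc x \<otimes>\<^bsub>S\<^esub> z)) \<star>\<^bsub>S\<^esub> ksign (p * q)" if "z \<in> carrier S" for z
    proof -
      have "vc x \<otimes>\<^bsub>S\<^esub> (vc y \<otimes>\<^bsub>S\<^esub> z) = ((vc y \<otimes>\<^bsub>S\<^esub> vc x) \<star>\<^bsub>S\<^esub> ksign (p * q)) \<otimes>\<^bsub>S\<^esub> z"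
        using that xy vc_swap[OF x y] by (simp add: S.m_assoc[symmetric] S_smult)
      then show ?thesis using that xy by (simp add: S_ksign_mult S.m_assoc)
    qed
    show "tmul (prim x) (tmul (prim y) (pt c d)) = tmul (prim y) (tmul (prim x) (pt c d)) \<star>\<^bsub>TM\<^esub> ksign (p * q)"
      unfolding prim_prim_pt[OF x y h(1) cc(2)] prim_prim_pt[OF y x h(1) cc(2)] sw[OF cc(1)] sw[OF cc(2)]
      using xy cc
      by (simp add: additive_map_add[OF SS.TM_smult_additive] ksign_ksign_V SS.pt_ksign_l pt_ksign_r)
        (simp add: bit_ac SS.V.a_ac)
  qed
qed

text \<open>Inside one factor the square is zero by a relation of \<open>S\<close>, and the two
  mixed terms carry opposite signs because \<open>u\<close> is odd.\<close>

lemma prim_odd_square: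
  assumes u: "u \<in> grade M 1" and t: "t \<in> carrier V"
  shows "tmul (prim u) (tmul (prim u) t) = \<zero>\<^bsub>V\<^esub>"
proof -
  have uc: "u \<in> carrier M" using u by (rule grade_carrier)
  have z: "additive_map V V (\<lambda>t. \<zero>\<^bsub>V\<^esub>)" by (simp add: additive_map_def)
  show ?thesis
  proof (rule SS.tensor_additive_eq_homog[OF SS.V_abelian
        additive_map_compose[OF prim_act_additive[OF uc] prim_act_additive[OF uc]] z _ t])
    fix c d r s assume h: "c \<in> grade S r" "d \<in> grade S s"
    have cc: "c \<in> carrier S" "d \<in> carrier S" using h S.grade_carrier by auto
    have sq: "vc u \<otimes>\<^bsub>S\<^esub> (vc u \<otimes>\<^bsub>S\<^esub> z) = \<zero>\<^bsub>S\<^esub>" if "z \<in> carrier S" for z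
      using vc_odd_square[OF u] uc that by (simp add: S.m_assoc[symmetric])
    have zz: "\<zero>\<^bsub>V\<^esub> \<star>\<^bsub>TM\<^esub> \<alpha> = \<zero>\<^bsub>V\<^esub>" for \<alpha> using SS.TM.zero_smult by simp
    show "tmul (prim u) (tmul (prim u) (pt c d)) = \<zero>\<^bsub>V\<^esub>"
      using uc cc
      unfolding prim_prim_pt[OF u u h(1) cc(2)] sq[OF cc(1)] sq[OF cc(2)]
      by (cases "r = 0") (simp_all add: smult_ksign_V SS.V.l_neg SS.V.r_neg zz del: ksign_0 ksign_1)
  qed
qed

text \<open>The universal property is used with the tensor square as a mere module on which
  \<open>x\<close> acts as \<open>prim x\<close>. The resulting map is compatible with generators on
  the left; multiplicativity comes later.\<close>

lemma coproduct_ex: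
  obtains D where "additive_map S V D" "D \<one>\<^bsub>S\<^esub> = pt \<one>\<^bsub>S\<^esub> \<one>\<^bsub>S\<^esub>"
    "\<And>\<alpha> y. y \<in> carrier S \<Longrightarrow> D (sc \<alpha> \<otimes>\<^bsub>S\<^esub> y) = scal_act \<alpha> (D y)"
    "\<And>x y. x \<in> carrier M \<Longrightarrow> y \<in> carrier S \<Longrightarrow> D (vc x \<otimes>\<^bsub>S\<^esub> y) = tmul (prim x) (D y)"
proof (rule module_lift[OF SS.V_abelian SS.pt_closed[OF S.one_closed S.one_closed],
      of scal_act "\<lambda>x. tmul (prim x)"])
  fix x y p q n assume h: "x \<in> grade M p" "y \<in> grade M q" "n \<in> carrier V"
  then have "x \<in> carrier M" "y \<in> carrier M" using grade_carrier by auto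
  then show "tmul (prim x) (tmul (prim y) n) = tmul (prim y) (tmul (prim x) (scal_act (ksign (p * q)) n))"
    using prim_swap[OF h] h(3) by (simp add: scal_act_ksign tmul_ksign_r)
qed (use prim_odd_square in \<open>auto simp: scal_act_additive prim_act_additive scal_act_one scal_act_add
    scal_act_mult prim_act_add prim_smult prim_lsmult\<close>)

end

section \<open>The coproduct as a morphism of superalgebras\<close>

context rational_supermodule
begin

abbreviation "\<Delta> \<equiv> sym_coprod K M"

lemma tmul_one_l: "t \<in> carrier V \<Longrightarrow> tmul (pt \<one>\<^bsub>S\<^esub> \<one>\<^bsub>S\<^esub>) t = t"
  using scal_act_one by (simp add: scal_act_def sc_one)

lemma pt_smult_one: "m \<in> carrier S \<Longrightarrow> n \<in> carrier S \<Longrightarrow> pt m n \<star>\<^bsub>TM\<^esub> 1 = pt m n"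
  using SS.TM.smult_one[of "pt m n"] by simp

lemma tmul_one_r: "t \<in> carrier V \<Longrightarrow> tmul t (pt \<one>\<^bsub>S\<^esub> \<one>\<^bsub>S\<^esub>) = t"
proof -
  assume t: "t \<in> carrier V"
  have I: "additive_map V V (\<lambda>t. t)" by (simp add: additive_map_def)
  have c: "pt \<one>\<^bsub>S\<^esub> \<one>\<^bsub>S\<^esub> \<in> carrier V" by simp
  show ?thesis
  proof (rule SS.tensor_additive_eq_homog[OF SS.V_abelian tmul_additive_l[OF c] I _ t])
    fix m n p q assume "m \<in> grade S p" "n \<in> grade S q"
    then show "tmul (pt m n) (pt \<one>\<^bsub>S\<^esub> \<one>\<^bsub>S\<^esub>) = pt m n"
      using S.grade_carrier tmul_pt[OF _ _ one_grade_S S.one_closed, of m n q] by (simp add: pt_smult_one)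
  qed
qed

lemma tmul_smult_r:
  assumes t: "t \<in> carrier V" and u: "u \<in> carrier V"
  shows "tmul t (u \<star>\<^bsub>TM\<^esub> \<alpha>) = tmul t u \<star>\<^bsub>TM\<^esub> \<alpha>"
proof -
  have 1: "tmul (pt a b) (u \<star>\<^bsub>TM\<^esub> \<alpha>) = tmul (pt a b) u \<star>\<^bsub>TM\<^esub> \<alpha>" if ab: "a \<in> grade S p" "b \<in> grade S q" for a b p q
  proof -
    have c: "a \<in> carrier S" "b \<in> carrier S" using ab S.grade_carrier by auto
    note A = tmul_additive_r[OF SS.pt_closed[OF c]]
    show ?thesis
    proof (rule SS.tensor_additive_eq_homog[OF SS.V_abelian additive_map_compose[OF SS.TM_smult_additive A]
          additive_map_compose[OF A SS.TM_smult_additive] _ u])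
      fix m n r s assume mn: "m \<in> grade S r" "n \<in> grade S s"
      then have mc: "m \<in> carrier S" "n \<in> carrier S" using S.grade_carrier by auto
      have "pt (a \<otimes>\<^bsub>S\<^esub> m) (b \<otimes>\<^bsub>S\<^esub> n) \<in> carrier TM" using c mc by simp
      then show "tmul (pt a b) (pt m n \<star>\<^bsub>TM\<^esub> \<alpha>) = tmul (pt a b) (pt m n) \<star>\<^bsub>TM\<^esub> \<alpha>"
        using c mc by (simp add: SS.pt_smult tmul_pt[OF c(1) ab(2) mn(1)] S.smult_closed S_mult_smult
            S.smult_ksign_commute[of _ _ \<alpha>])
    qed
  qed
  show ?thesis
    by (rule SS.tensor_additive_eq_homog[OF SS.V_abelian tmul_additive_l[OF smult_V_closed[OF u]]
          additive_map_compose[OF tmul_additive_l[OF u] SS.TM_smult_additive] 1 t])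
qed

lemma TM_grade_ksign: "t \<in> grade TM r \<Longrightarrow> t \<star>\<^bsub>TM\<^esub> ksign p \<in> grade TM r"
proof -
  assume t: "t \<in> grade TM r"
  then have "t \<in> carrier V" using subgroup.subset[OF SS.TM_grade_subgroup[of r]] by auto
  then show ?thesis using t SS.TM_grade_minus by (simp add: smult_ksign_V)
qed

lemma prim_grade:
  assumes x: "x \<in> grade M p" and t: "t \<in> grade TM r"
  shows "tmul (prim x) t \<in> grade TM (p + r)"
proof (rule SS.TM_grade_image[OF SS.V_abelian prim_act_additive[OF grade_carrier[OF x]] SS.TM_grade_subgroup _ t])
  fix m n q s assume h: "m \<in> grade S q" "n \<in> grade S s" "q + s = r"
  have "pt (vc x \<otimes>\<^bsub>S\<^esub> m) n \<in> grade TM (p + r)"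
    using SS.pt_grade[OF vc_mult_grade_S[OF x h(1)] h(2)] h(3) by (simp add: add.assoc)
  moreover have "pt m (vc x \<otimes>\<^bsub>S\<^esub> n) \<in> grade TM (p + r)"
    using SS.pt_grade[OF h(1) vc_mult_grade_S[OF x h(2)]] h(3) by (simp add: add.left_commute)
  ultimately show "tmul (prim x) (pt m n) \<in> grade TM (p + r)"
    using h S.grade_carrier by (simp add: prim_tmul_pt[OF x h(1)] SS.TM_grade_add TM_grade_ksign)
qed

lemma S_linear_eq:
  assumes "additive_map S A F" "additive_map S A G"
    and "\<And>X ps \<alpha>. homog X ps \<Longrightarrow> F (vprod X \<star>\<^bsub>S\<^esub> \<alpha>) = G (vprod X \<star>\<^bsub>S\<^esub> \<alpha>)" and y: "y \<in> carrier S"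
  shows "F y = G y"
  using y
proof (induction rule: S_mono_induct)
  case (mono X ps \<alpha> q)
  then show ?case using assms(3) by (simp add: S_smult)
qed (simp add: additive_map_add[OF assms(1)] additive_map_add[OF assms(2)])

text \<open>Multiplicativity follows by induction over the left factor, from compatibility with
  generators and the associativity of the tensor square. Linearity and parity are proved by similar
  inductions.\<close>

lemma coprod_exists:
  obtains D where "D \<in> superalg_hom K S SA" "\<And>x. x \<in> carrier M \<Longrightarrow> D (vc x) = prim x"
    "\<And>x y. x \<in> carrier M \<Longrightarrow> y \<in> carrier S \<Longrightarrow> D (vc x \<otimes>\<^bsub>S\<^esub> y) = tmul (prim x) (D y)"
proof -
  obtain D where D: "additive_map S V D" "D \<one>\<^bsub>S\<^esub> = pt \<one>\<^bsub>S\<^esub> \<one>\<^bsub>S\<^esub>"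
    "\<And>\<alpha> y. y \<in> carrier S \<Longrightarrow> D (sc \<alpha> \<otimes>\<^bsub>S\<^esub> y) = scal_act \<alpha> (D y)"
    "\<And>x y. x \<in> carrier M \<Longrightarrow> y \<in> carrier S \<Longrightarrow> D (vc x \<otimes>\<^bsub>S\<^esub> y) = tmul (prim x) (D y)"
    using coproduct_ex by blast
  have Dc: "D y \<in> carrier V" if "y \<in> carrier S" for y using additive_map_closed[OF D(1) that] .
  have mult: "D (y \<otimes>\<^bsub>S\<^esub> z) = tmul (D y) (D z)" if y: "y \<in> carrier S" and z: "z \<in> carrier S" for y z
    using y
  proof (induction rule: S_induct)
    case one
    then show ?case using z by (simp add: D(2) tmul_one_l Dc)
  next
    case (scal \<alpha> y)
    then show ?case using z by (simp add: S.m_assoc D(3)) (simp add: scal_act_def tmul_assoc Dc)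
  next
    case (vec x y)
    then show ?case using z by (simp add: S.m_assoc D(4) tmul_assoc Dc)
  next
    case (add y w)
    then show ?case using z by (simp add: S.l_distr additive_map_add[OF D(1)] additive_map_add[OF tmul_additive_l] Dc)
  qed
  have lin: "D (y \<star>\<^bsub>S\<^esub> \<alpha>) = D y \<star>\<^bsub>TM\<^esub> \<alpha>" if "y \<in> carrier S" for y \<alpha>
    using that
  proof (induction rule: S_induct)
    case one
    have "D (\<one>\<^bsub>S\<^esub> \<star>\<^bsub>S\<^esub> \<alpha>) = pt (\<one>\<^bsub>S\<^esub> \<star>\<^bsub>S\<^esub> \<alpha>) \<one>\<^bsub>S\<^esub>"
      using D(3)[of "\<one>\<^bsub>S\<^esub>" \<alpha>] by (simp add: S_smult D(2) scal_act_pt)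
    then show ?case by (simp add: SS.pt_balanced S_lsmult D(2) SS.pt_smult) (simp add: S_smult)
  next
    case (scal \<beta> y)
    have "D (sc \<beta> \<otimes>\<^bsub>S\<^esub> y \<star>\<^bsub>S\<^esub> \<alpha>) = D (sc \<beta> \<otimes>\<^bsub>S\<^esub> (y \<star>\<^bsub>S\<^esub> \<alpha>))"
      using scal by (simp add: S_mult_smult)
    then show ?case using scal by (simp add: D(3) S.smult_closed) (simp add: scal_act_def tmul_smult_r Dc)
  next
    case (vec x y)
    have "D (vc x \<otimes>\<^bsub>S\<^esub> y \<star>\<^bsub>S\<^esub> \<alpha>) = D (vc x \<otimes>\<^bsub>S\<^esub> (y \<star>\<^bsub>S\<^esub> \<alpha>))"
      using vec by (simp add: S_mult_smult)
    then show ?case using vec by (simp add: D(4) S.smult_closed tmul_smult_r Dc)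
  next
    case (add y z)
    then show ?case
      by (simp add: S.smult_l_distr additive_map_add[OF D(1)] S.smult_closed Dc additive_map_add[OF SS.TM_smult_additive])
  qed
  have gr: "D y \<in> grade TM p" if "y \<in> grade S p" for y p
    using that
  proof (induction rule: grade_S_induct)
    case (mono X ps \<alpha> q)
    have "D (vprod X \<otimes>\<^bsub>S\<^esub> sc \<alpha>) \<in> grade TM (sum_list ps + q)" using mono(1)
    proof (induction rule: homog_induct)
      case Nil
      have "D (sc \<alpha>) = pt (sc \<alpha>) \<one>\<^bsub>S\<^esub>" using D(3)[of "\<one>\<^bsub>S\<^esub>" \<alpha>] by (simp add: D(2) scal_act_pt)
      then show ?case using SS.pt_grade[OF sc_grade_S[OF mono(2)] one_grade_S] by simp
    next
      case (Cons x p X ps)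
      then show ?case
        using prim_grade[OF Cons(1,3)] homog_carrier[OF Cons(2)] by (simp add: S.m_assoc D(4) grade_carrier add.assoc)
    qed
    then show ?case using mono(3) by simp
  next
    case (add y z)
    then show ?case by (simp add: additive_map_add[OF D(1)] S.grade_carrier SS.TM_grade_add)
  qed
  let ?D = "restrict D (carrier S)"
  have "?D \<in> ring_hom S SA"
    using D(2) by (intro ring_hom_memI) (auto simp: Dc mult tmul_def additive_map_add[OF D(1)])
  moreover have "?D \<in> grade (Hom_mod K S SA) 0"
    using gr S.grade_carrier by (auto simp: Hom_mod_def Let_def Dc lin S.smult_closed additive_map_add[OF D(1)])
  moreover have "?D (vc x) = prim x" if "x \<in> carrier M" for x
    using D(4)[OF that S.one_closed] that by (simp add: D(2) tmul_one_r)
  moreover have "?D (vc x \<otimes>\<^bsub>S\<^esub> y) = tmul (prim x) (?D y)" if "x \<in> carrier M" "y \<in> carrier S" for x y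
    using D(4)[OF that] that by simp
  ultimately show ?thesis using that[of ?D] by (simp add: superalg_hom_def)
qed

lemma superalg_hom_SA:
  assumes "D \<in> superalg_hom K S SA"
  shows "D \<in> extensional (carrier S)" "additive_map S V D" "D \<one>\<^bsub>S\<^esub> = pt \<one>\<^bsub>S\<^esub> \<one>\<^bsub>S\<^esub>"
    "\<And>y z. y \<in> carrier S \<Longrightarrow> z \<in> carrier S \<Longrightarrow> D (y \<otimes>\<^bsub>S\<^esub> z) = tmul (D y) (D z)"
    "\<And>y \<alpha>. y \<in> carrier S \<Longrightarrow> D (y \<star>\<^bsub>S\<^esub> \<alpha>) = D y \<star>\<^bsub>TM\<^esub> \<alpha>"
    "\<And>y p. y \<in> grade S p \<Longrightarrow> D y \<in> grade TM p"
  using assms by (auto simp: superalg_hom_def ring_hom_def Hom_mod_def Let_def additive_map_def tmul_def PiE_def)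

text \<open>Monomials are products of letters with a scalar behind them, so a linear algebra
  morphism is determined by its values on letters; this identifies \<open>\<Delta>\<close> with the
  map just constructed.\<close>

lemma coprod_spec:
  shows coprod_hom: "\<Delta> \<in> superalg_hom K S SA"
    and coprod_vec: "\<And>x y. x \<in> carrier M \<Longrightarrow> y \<in> carrier S \<Longrightarrow> \<Delta> (vc x \<otimes>\<^bsub>S\<^esub> y) = tmul (prim x) (\<Delta> y)"
proof -
  obtain D where D: "D \<in> superalg_hom K S SA" "\<And>x. x \<in> carrier M \<Longrightarrow> D (vc x) = prim x"
    "\<And>x y. x \<in> carrier M \<Longrightarrow> y \<in> carrier S \<Longrightarrow> D (vc x \<otimes>\<^bsub>S\<^esub> y) = tmul (prim x) (D y)"
    using coprod_exists by blast
  have "\<Delta> = D"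
    unfolding sym_coprod_def Let_def
  proof (rule the_equality)
    show "D \<in> superalg_hom K S SA \<and> (\<forall>x\<in>carrier M. D (vc x) = pt (vc x) \<one>\<^bsub>S\<^esub> \<oplus>\<^bsub>SA\<^esub> pt \<one>\<^bsub>S\<^esub> (vc x))"
      using D by (simp add: prim_def)
  next
    fix E assume E: "E \<in> superalg_hom K S SA \<and> (\<forall>x\<in>carrier M. E (vc x) = pt (vc x) \<one>\<^bsub>S\<^esub> \<oplus>\<^bsub>SA\<^esub> pt \<one>\<^bsub>S\<^esub> (vc x))"
    note e = superalg_hom_SA[OF conjunct1[OF E]] and d = superalg_hom_SA[OF D(1)]
    have "E y = D y" if "y \<in> carrier S" for y
    proof (rule S_linear_eq[OF e(2) d(2) _ that])
      fix X ps \<alpha> assume h: "homog X ps"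
      have "E (vprod X) = D (vprod X)" using h
      proof (induction rule: homog_induct)
        case (Cons x p X ps)
        then show ?case using e(4) d(4) E D(2) homog_carrier[OF Cons(2)] by (simp add: grade_carrier prim_def)
      qed (simp add: e(3) d(3))
      then show "E (vprod X \<star>\<^bsub>S\<^esub> \<alpha>) = D (vprod X \<star>\<^bsub>S\<^esub> \<alpha>)"
        using homog_carrier[OF h] by (simp add: e(5) d(5))
    qed
    then show "E = D" by (intro extensionalityI[OF e(1) d(1)])
  qed
  with D show "\<Delta> \<in> superalg_hom K S SA"
    "\<And>x y. x \<in> carrier M \<Longrightarrow> y \<in> carrier S \<Longrightarrow> \<Delta> (vc x \<otimes>\<^bsub>S\<^esub> y) = tmul (prim x) (\<Delta> y)" by auto
qed

lemmas coprod_additive = superalg_hom_SA(2)[OF coprod_hom]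
  and coprod_one = superalg_hom_SA(3)[OF coprod_hom]
  and coprod_smult = superalg_hom_SA(5)[OF coprod_hom]
  and coprod_grade = superalg_hom_SA(6)[OF coprod_hom]

lemma coprod_closed [simp]: "y \<in> carrier S \<Longrightarrow> \<Delta> y \<in> carrier V"
  by (rule additive_map_closed[OF coprod_additive])

section \<open>Coderivations\<close>

definition idS :: "('k, 'm) words set set \<Rightarrow> ('k, 'm) words set set"
  where "idS = (\<lambda>x\<in>carrier S. x)"

lemma idS_grade: "idS \<in> grade H 0"
  unfolding SS.HM_grade idS_def
  by (auto simp: additive_map_def S.grade_carrier intro!: SS.HM_restrictI)

lemma idS_H: "idS \<in> carrier H"
  using SS.HM.grade_carrier[OF idS_grade] .

lemma idS_app [simp]: "x \<in> carrier S \<Longrightarrow> idS x = x"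
  by (simp add: idS_def)

text \<open>The map \<open>f\<close> takes values in \<open>S\<close> and not in \<open>L\<close>,
  so that \<open>tensor_map\<close> is only ever applied to endomorphisms of \<open>S\<close>. If
  the values of \<open>f\<close> lie in \<open>L\<close>, this is the coderivation with
  corestriction \<open>f\<close>.\<close>

definition coder where "coder f = (\<lambda>x\<in>carrier S. Mult (tmap idS f (\<Delta> x)))"

lemma coder_app: "x \<in> carrier S \<Longrightarrow> coder f x = Mult (tmap idS f (\<Delta> x))"
  by (simp add: coder_def)

lemma coder_additive_V: "f \<in> carrier H \<Longrightarrow> additive_map V S (\<lambda>t. Mult (tmap idS f t))"
  by (rule additive_map_compose[OF tmap_additive[OF idS_H] Mult_additive])

lemma coder_grade: "f \<in> grade H q \<Longrightarrow> coder f \<in> grade H q"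
proof -
  assume f: "f \<in> grade H q"
  have fc: "f \<in> carrier H" using f by (rule SS.HM.grade_carrier)
  have "coder f \<in> carrier H"
    unfolding coder_def
  proof (rule SS.HM_restrictI)
    show "additive_map S S (\<lambda>x. Mult (tmap idS f (\<Delta> x)))"
      using additive_map_compose[OF coprod_additive coder_additive_V[OF fc]] .
    fix x \<alpha> assume x: "x \<in> carrier S"
    have "tmap idS f (\<Delta> x) \<in> carrier V" using additive_map_closed[OF tmap_additive[OF idS_H fc]] x by simp
    then show "Mult (tmap idS f (\<Delta> (x \<star>\<^bsub>S\<^esub> \<alpha>))) = Mult (tmap idS f (\<Delta> x)) \<star>\<^bsub>S\<^esub> \<alpha>"
      using x by (simp add: coprod_smult tmap_smult[OF idS_H f] Mult_smult)
  qed
  moreover have "coder f x \<in> grade S (q + r)" if x: "x \<in> grade S r" for x r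
  proof -
    have "Mult (tmap idS f (\<Delta> x)) \<in> grade S (q + r)"
    proof (rule SS.TM_grade_image[OF S.abelian_group coder_additive_V[OF fc] S.grade_subgroup _ coprod_grade[OF x]])
      fix m n s t assume h: "m \<in> grade S s" "n \<in> grade S t" "s + t = r"
      have c: "m \<in> carrier S" "n \<in> carrier S" using h S.grade_carrier by auto
      have fn: "f n \<in> grade S (q + t)" using SS.HM_grade_app[OF f h(2)] by simp
      have "m \<otimes>\<^bsub>S\<^esub> f n \<in> grade S (q + r)"
        using mult_grade_S[OF h(1) fn] h(3) by (simp add: add.left_commute)
      then show "Mult (tmap idS f (pt m n)) \<in> grade S (q + r)"
        using c S.grade_carrier[OF fn]
        by (simp add: tmap_pt_homog[OF idS_H f h(1)] Mult_smult Mult_pt S.ksign_grade)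
    qed
    then show ?thesis using S.grade_carrier[OF x] by (simp add: coder_app)
  qed
  ultimately show ?thesis by (simp add: SS.HM_grade)
qed

text \<open>Contraction of \<open>f\<close> with a letter. It enters every recursion on monomials,
  because the coproduct of \<open>x y\<close> is \<open>x \<otimes> 1 + 1 \<otimes> x\<close> times
  that of \<open>y\<close> and the second summand hands \<open>x\<close> to
  \<open>f\<close>.\<close>

definition lcomp where "lcomp f x = (\<lambda>y\<in>carrier S. f (vc x \<otimes>\<^bsub>S\<^esub> y))"

lemma lcomp_app: "y \<in> carrier S \<Longrightarrow> lcomp f x y = f (vc x \<otimes>\<^bsub>S\<^esub> y)"
  by (simp add: lcomp_def)

lemma lcomp_grade: "f \<in> grade H q \<Longrightarrow> x \<in> grade M p \<Longrightarrow> lcomp f x \<in> grade H (q + p)"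
proof -
  assume f: "f \<in> grade H q" and x: "x \<in> grade M p"
  have fc: "f \<in> carrier H" using f by (rule SS.HM.grade_carrier)
  have xc: "vc x \<in> carrier S" using x grade_carrier by simp
  have "lcomp f x \<in> carrier H"
    unfolding lcomp_def
    by (rule SS.HM_restrictI[OF additive_map_compose[OF left_mult_additive[OF xc] SS.HM_additive[OF fc]]])
      (use xc in \<open>simp add: S_mult_smult SS.HM_linear[OF fc]\<close>)
  moreover have "lcomp f x y \<in> grade S (q + p + r)" if "y \<in> grade S r" for y r
    using SS.HM_grade_app[OF f vc_mult_grade_S[OF x that]] that by (simp add: lcomp_def S.grade_carrier add.assoc)
  ultimately show ?thesis by (simp add: SS.HM_grade)
qed

lemma coder_one: "f \<in> grade H q \<Longrightarrow> coder f \<one>\<^bsub>S\<^esub> = f \<one>\<^bsub>S\<^esub>"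
  using SS.HM_closed[OF SS.HM.grade_carrier, of f q "\<one>\<^bsub>S\<^esub>"]
  by (simp add: coder_app coprod_one tmap_pt_homog[OF idS_H _ one_grade_S, of f q] Mult_smult Mult_pt S.smult_one)

text \<open>The Leibniz rule that drives all inductions on coderivations:
  \<open>x \<otimes> 1\<close> puts \<open>x\<close> in front of the product, past \<open>f\<close>
  of parity \<open>q\<close>, whereas \<open>1 \<otimes> x\<close> contracts
  \<open>f\<close>.\<close>

lemma coder_vec:
  assumes f: "f \<in> grade H q" and x: "x \<in> grade M p" and y: "y \<in> carrier S"
  shows "coder f (vc x \<otimes>\<^bsub>S\<^esub> y) = (vc x \<otimes>\<^bsub>S\<^esub> coder f y) \<star>\<^bsub>S\<^esub> ksign (q * p) \<oplus>\<^bsub>S\<^esub> coder (lcomp f x) y"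
proof -
  have fc: "f \<in> carrier H" using f by (rule SS.HM.grade_carrier)
  have fx: "lcomp f x \<in> grade H (q + p)" by (rule lcomp_grade[OF f x])
  have fxc: "lcomp f x \<in> carrier H" using fx by (rule SS.HM.grade_carrier)
  have xc: "x \<in> carrier M" "vc x \<in> carrier S" using x grade_carrier by auto
  note A = coder_additive_V[OF fc] and B = coder_additive_V[OF fxc]
  have "Mult (tmap idS f (tmul (prim x) t)) =
      (vc x \<otimes>\<^bsub>S\<^esub> Mult (tmap idS f t)) \<star>\<^bsub>S\<^esub> ksign (q * p) \<oplus>\<^bsub>S\<^esub> Mult (tmap idS (lcomp f x) t)" if t: "t \<in> carrier V" for t
  proof (rule SS.tensor_additive_eq_homog[OF S.abelian_group additive_map_compose[OF prim_act_additive[OF xc(1)] A]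
        additive_map_sum[OF S.abelian_group additive_map_compose[OF additive_map_compose[OF A left_mult_additive[OF xc(2)]] S.smult_additive] B] _ t])
    fix m n r s assume h: "m \<in> grade S r" "n \<in> grade S s"
    have c: "m \<in> carrier S" "n \<in> carrier S" "f n \<in> carrier S" "f (vc x \<otimes>\<^bsub>S\<^esub> n) \<in> carrier S"
      using h S.grade_carrier SS.HM_closed[OF fc] xc by auto
    show "Mult (tmap idS f (tmul (prim x) (pt m n))) =
      (vc x \<otimes>\<^bsub>S\<^esub> Mult (tmap idS f (pt m n))) \<star>\<^bsub>S\<^esub> ksign (q * p) \<oplus>\<^bsub>S\<^esub> Mult (tmap idS (lcomp f x) (pt m n))"
      using c xc
      by (simp add: prim_tmul_pt[OF x h(1)] additive_map_add[OF A] tmap_smult[OF idS_H f] Mult_smult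
          tmap_pt_homog[OF idS_H f h(1)] tmap_pt_homog[OF idS_H f vc_mult_grade_S[OF x h(1)]]
          tmap_pt_homog[OF idS_H fx h(1)] Mult_pt lcomp_app S.smult_ksign_ksign S_mult_smult S.m_assoc bit_ac)
  qed
  then show ?thesis using y xc by (simp add: coder_app coprod_vec)
qed

text \<open>The recursion in \<open>coder_vec\<close> ends at the value of \<open>f\<close> at 1,
  which has to be primitive; the condition is imposed on all values because contraction must
  preserve it.\<close>

definition vec_valued where
  "vec_valued q f \<longleftrightarrow> f \<in> grade H q \<and> (\<forall>r. \<forall>y\<in>grade S r. \<exists>z\<in>grade M (q + r). f y = vc z)"

lemma vec_valued_lcomp: "vec_valued q f \<Longrightarrow> x \<in> grade M p \<Longrightarrow> vec_valued (q + p) (lcomp f x)"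
  unfolding vec_valued_def
  by (auto simp: lcomp_app S.grade_carrier lcomp_grade add.assoc dest: vc_mult_grade_S)

text \<open>With \<open>tmap_r_prim\<close>, the counterpart of \<open>coder_vec\<close> for the two
  terms on the right of the coderivation property.\<close>

lemma tmap_l_prim:
  assumes f: "f \<in> grade H q" and x: "x \<in> grade M p" and t: "t \<in> carrier V"
  shows "tmap (coder f) idS (tmul (prim x) t) =
    tmul (prim x) (tmap (coder f) idS t) \<star>\<^bsub>TM\<^esub> ksign (q * p) \<oplus>\<^bsub>V\<^esub> tmap (coder (lcomp f x)) idS t"
proof -
  have F: "coder f \<in> carrier H" using SS.HM.grade_carrier[OF coder_grade[OF f]] .
  have F': "coder (lcomp f x) \<in> carrier H" using SS.HM.grade_carrier[OF coder_grade[OF lcomp_grade[OF f x]]] .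
  have xc: "x \<in> carrier M" "vc x \<in> carrier S" using x grade_carrier by auto
  note A = tmap_additive[OF F idS_H] and B = tmap_additive[OF F' idS_H] and X = prim_act_additive[OF xc(1)]
  show ?thesis
  proof (rule SS.tensor_additive_eq_homog[OF SS.V_abelian additive_map_compose[OF X A]
        additive_map_sum[OF SS.V_abelian additive_map_compose[OF additive_map_compose[OF A X] SS.TM_smult_additive] B] _ t])
    fix m n r s assume h: "m \<in> grade S r" "n \<in> grade S s"
    have c: "m \<in> carrier S" "n \<in> carrier S" "coder f m \<in> carrier S" "coder (lcomp f x) m \<in> carrier S"
      using h S.grade_carrier SS.HM_closed[OF F] SS.HM_closed[OF F'] by auto
    have cm: "coder f m \<in> grade S (q + r)" using SS.HM_grade_app[OF coder_grade[OF f] h(1)] by simp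
    have e: "tmap (coder f) idS (pt v w) = pt (coder f v) w" if "v \<in> grade S u" "w \<in> carrier S" for v w u
      using that tmap_pt_homog[OF F idS_grade that] SS.HM_closed[OF F] S.grade_carrier by (simp add: pt_smult_one)
    have e': "tmap (coder (lcomp f x)) idS (pt m n) = pt (coder (lcomp f x) m) n"
      using tmap_pt_homog[OF F' idS_grade h(1) c(2)] c by (simp add: pt_smult_one)
    have k: "tmap (coder f) idS (u \<star>\<^bsub>TM\<^esub> ksign z) = tmap (coder f) idS u \<star>\<^bsub>TM\<^esub> ksign z" if "u \<in> carrier V" for u z
      by (rule tmap_smult[OF F idS_grade that])
    show "tmap (coder f) idS (tmul (prim x) (pt m n)) =
      tmul (prim x) (tmap (coder f) idS (pt m n)) \<star>\<^bsub>TM\<^esub> ksign (q * p) \<oplus>\<^bsub>V\<^esub> tmap (coder (lcomp f x)) idS (pt m n)"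
      using c xc
      by (simp add: prim_tmul_pt[OF x h(1)] additive_map_add[OF A] k e[OF h(1)] e[OF vc_mult_grade_S[OF x h(1)]] e'
          coder_vec[OF f x] prim_tmul_pt[OF x cm] additive_map_add[OF SS.TM_smult_additive] ksign_ksign_V
          SS.pt_add_l SS.pt_ksign_l S.smult_closed)
        (simp add: SS.V.a_ac bit_ac)
  qed
qed

lemma tmap_r_prim:
  assumes f: "f \<in> grade H q" and x: "x \<in> grade M p" and t: "t \<in> carrier V"
  shows "tmap idS (coder f) (tmul (prim x) t) =
    tmul (prim x) (tmap idS (coder f) t) \<star>\<^bsub>TM\<^esub> ksign (q * p) \<oplus>\<^bsub>V\<^esub> tmap idS (coder (lcomp f x)) t"
proof -
  note fg = coder_grade[OF f] and fg' = coder_grade[OF lcomp_grade[OF f x]]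
  have F: "coder f \<in> carrier H" using SS.HM.grade_carrier[OF fg] .
  have F': "coder (lcomp f x) \<in> carrier H" using SS.HM.grade_carrier[OF fg'] .
  have xc: "x \<in> carrier M" "vc x \<in> carrier S" using x grade_carrier by auto
  note A = tmap_additive[OF idS_H F] and B = tmap_additive[OF idS_H F'] and X = prim_act_additive[OF xc(1)]
  show ?thesis
  proof (rule SS.tensor_additive_eq_homog[OF SS.V_abelian additive_map_compose[OF X A]
        additive_map_sum[OF SS.V_abelian additive_map_compose[OF additive_map_compose[OF A X] SS.TM_smult_additive] B] _ t])
    fix m n r s assume h: "m \<in> grade S r" "n \<in> grade S s"
    have c: "m \<in> carrier S" "n \<in> carrier S" "coder f n \<in> carrier S" "coder (lcomp f x) n \<in> carrier S"
      using h S.grade_carrier SS.HM_closed[OF F] SS.HM_closed[OF F'] by auto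
    have k: "tmap idS (coder f) (u \<star>\<^bsub>TM\<^esub> ksign z) = tmap idS (coder f) u \<star>\<^bsub>TM\<^esub> ksign z" if "u \<in> carrier V" for u z
      by (rule tmap_smult[OF idS_H fg that])
    show "tmap idS (coder f) (tmul (prim x) (pt m n)) =
      tmul (prim x) (tmap idS (coder f) (pt m n)) \<star>\<^bsub>TM\<^esub> ksign (q * p) \<oplus>\<^bsub>V\<^esub> tmap idS (coder (lcomp f x)) (pt m n)"
      using c xc
      by (simp add: prim_tmul_pt[OF x h(1)] additive_map_add[OF A] k tmap_pt_homog[OF idS_H fg h(1)]
          tmap_pt_homog[OF idS_H fg vc_mult_grade_S[OF x h(1)]] tmap_pt_homog[OF idS_H fg' h(1)]
          coder_vec[OF f x] tmul_ksign_r additive_map_add[OF SS.TM_smult_additive] ksign_ksign_V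
          SS.pt_add_r pt_ksign_r S.smult_closed)
        (simp add: SS.V.a_ac bit_ac)
  qed
qed

text \<open>Both sides obey the same recursion in the first letter. The induction is for all
  \<open>f\<close> at once, as \<open>f\<close> gets replaced by its contraction; for the empty
  product both sides are the primitive tensor of the value of \<open>f\<close> at 1.\<close>

lemma coder_coderivation_vprod:
  assumes "homog X ps" "vec_valued q f"
  shows "\<Delta> (coder f (vprod X)) = tmap (coder f) idS (\<Delta> (vprod X)) \<oplus>\<^bsub>V\<^esub> tmap idS (coder f) (\<Delta> (vprod X))"
  using assms
proof (induction arbitrary: q f rule: homog_induct)
  case Nil
  then have f: "f \<in> grade H q" by (simp add: vec_valued_def)
  note fg = coder_grade[OF f]
  have F: "coder f \<in> carrier H" using SS.HM.grade_carrier[OF fg] .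
  obtain z where z: "z \<in> grade M q" "f \<one>\<^bsub>S\<^esub> = vc z" using Nil one_grade_S by (fastforce simp: vec_valued_def)
  have zc: "z \<in> carrier M" using z grade_carrier by blast
  have "\<Delta> (vc z) = prim z" using coprod_vec[OF zc S.one_closed] zc by (simp add: coprod_one tmul_one_r)
  then show ?case
    using zc by (simp add: coprod_one coder_one[OF f] z(2) tmap_pt_homog[OF F idS_grade one_grade_S]
        tmap_pt_homog[OF idS_H fg one_grade_S] pt_smult_one prim_def)
next
  case (Cons x p X ps)
  have f: "f \<in> grade H q" using Cons(4) by (simp add: vec_valued_def)
  note fx = lcomp_grade[OF f Cons(1)]
  have F: "coder f \<in> carrier H" "coder (lcomp f x) \<in> carrier H"
    using SS.HM.grade_carrier coder_grade f fx by blast+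
  have c: "x \<in> carrier M" "vprod X \<in> carrier S" using Cons grade_carrier homog_carrier by auto
  have Fc: "coder f (vprod X) \<in> carrier S" "coder (lcomp f x) (vprod X) \<in> carrier S"
    using SS.HM_closed F c by auto
  have tc: "tmap (coder f) idS (\<Delta> (vprod X)) \<in> carrier V" "tmap idS (coder f) (\<Delta> (vprod X)) \<in> carrier V"
    "tmap (coder (lcomp f x)) idS (\<Delta> (vprod X)) \<in> carrier V" "tmap idS (coder (lcomp f x)) (\<Delta> (vprod X)) \<in> carrier V"
    using additive_map_closed[OF tmap_additive] F idS_H c by auto
  show ?case
    using c Fc tc Cons(3)[OF Cons(4)] Cons(3)[OF vec_valued_lcomp[OF Cons(4,1)]]
    by (simp add: coder_vec[OF f Cons(1)] additive_map_add[OF coprod_additive] coprod_smult coprod_vec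
        tmap_l_prim[OF f Cons(1)] tmap_r_prim[OF f Cons(1)] additive_map_add[OF prim_act_additive]
        additive_map_add[OF SS.TM_smult_additive] S.smult_closed SS.V.a_ac)
qed

lemma coder_coderivation:
  assumes f: "vec_valued q f" and y: "y \<in> carrier S"
  shows "\<Delta> (coder f y) = tmap (coder f) idS (\<Delta> y) \<oplus>\<^bsub>V\<^esub> tmap idS (coder f) (\<Delta> y)"
proof -
  have fg: "coder f \<in> grade H q" using f by (simp add: vec_valued_def coder_grade)
  have F: "coder f \<in> carrier H" using SS.HM.grade_carrier[OF fg] .
  show ?thesis
  proof (rule S_linear_eq[OF additive_map_compose[OF SS.HM_additive[OF F] coprod_additive]
        additive_map_sum[OF SS.V_abelian additive_map_compose[OF coprod_additive tmap_additive[OF F idS_H]]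
          additive_map_compose[OF coprod_additive tmap_additive[OF idS_H F]]] _ y])
    fix X ps \<alpha> assume h: "homog X ps"
    have c: "vprod X \<in> carrier S" using homog_carrier[OF h] by simp
    have tc: "tmap (coder f) idS (\<Delta> (vprod X)) \<in> carrier V" "tmap idS (coder f) (\<Delta> (vprod X)) \<in> carrier V"
      using additive_map_closed[OF tmap_additive] F idS_H c by auto
    show "\<Delta> (coder f (vprod X \<star>\<^bsub>S\<^esub> \<alpha>)) =
      tmap (coder f) idS (\<Delta> (vprod X \<star>\<^bsub>S\<^esub> \<alpha>)) \<oplus>\<^bsub>V\<^esub> tmap idS (coder f) (\<Delta> (vprod X \<star>\<^bsub>S\<^esub> \<alpha>))"
      using c tc coder_coderivation_vprod[OF h f]
      by (simp add: SS.HM_linear[OF F] coprod_smult SS.HM_closed[OF F] tmap_smult[OF F idS_grade]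
          tmap_smult[OF idS_H fg] additive_map_add[OF SS.TM_smult_additive])
  qed
qed

section \<open>Commutators of coderivations\<close>

definition cobracket where
  "cobracket p q f g = (\<lambda>y\<in>carrier S. f (coder g y) \<oplus>\<^bsub>S\<^esub> g (coder f y) \<star>\<^bsub>S\<^esub> ksign (p * q + 1))"

lemma cobracket_app: "y \<in> carrier S \<Longrightarrow>
    cobracket p q f g y = f (coder g y) \<oplus>\<^bsub>S\<^esub> g (coder f y) \<star>\<^bsub>S\<^esub> ksign (p * q + 1)"
  by (simp add: cobracket_def)

lemma cobracket_grade:
  assumes f: "f \<in> grade H p" and g: "g \<in> grade H q"
  shows "cobracket p q f g \<in> grade H (p + q)"
proof -
  have fc: "f \<in> carrier H" "coder f \<in> carrier H" using f SS.HM.grade_carrier coder_grade by blast+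
  have gc: "g \<in> carrier H" "coder g \<in> carrier H" using g SS.HM.grade_carrier coder_grade by blast+
  have "cobracket p q f g \<in> carrier H"
    unfolding cobracket_def
  proof (rule SS.HM_restrictI)
    show "additive_map S S (\<lambda>y. f (coder g y) \<oplus>\<^bsub>S\<^esub> g (coder f y) \<star>\<^bsub>S\<^esub> ksign (p * q + 1))"
      by (intro additive_map_sum[OF S.abelian_group] S.additive_ksign[OF S.abelian_group])
        (rule additive_map_compose[OF SS.HM_additive SS.HM_additive]; use fc gc in simp)+
  qed (use fc gc in \<open>simp add: SS.HM_linear SS.HM_closed S.smult_l_distr S.smult_closed S.smult_ksign_commute[of _ _ _, symmetric]\<close>)
  moreover have "cobracket p q f g y \<in> grade S (p + q + r)" if y: "y \<in> grade S r" for y r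
  proof -
    have "f (coder g y) \<in> grade S (p + q + r)"
      by (rule SS.HM_grade_app[OF f SS.HM_grade_app[OF coder_grade[OF g] y refl]]) (simp add: add.assoc)
    moreover have "g (coder f y) \<in> grade S (p + q + r)"
      by (rule SS.HM_grade_app[OF g SS.HM_grade_app[OF coder_grade[OF f] y refl]]) (simp add: add.left_commute add.assoc)
    ultimately show ?thesis using y by (simp add: cobracket_def S.grade_carrier S.grade_add S.ksign_grade)
  qed
  ultimately show ?thesis by (simp add: SS.HM_grade)
qed

lemma coder_comb:
  assumes f: "f \<in> grade H q" and g: "g \<in> grade H q" and h: "h \<in> grade H q"
    and e: "\<And>y. y \<in> carrier S \<Longrightarrow> h y = f y \<star>\<^bsub>S\<^esub> ksign p \<oplus>\<^bsub>S\<^esub> g y"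
    and y: "y \<in> carrier S"
  shows "coder h y = coder f y \<star>\<^bsub>S\<^esub> ksign p \<oplus>\<^bsub>S\<^esub> coder g y"
proof -
  have c: "f \<in> carrier H" "g \<in> carrier H" "h \<in> carrier H" using f g h SS.HM.grade_carrier by auto
  have "Mult (tmap idS h t) = Mult (tmap idS f t) \<star>\<^bsub>S\<^esub> ksign p \<oplus>\<^bsub>S\<^esub> Mult (tmap idS g t)" if t: "t \<in> carrier V" for t
  proof (rule SS.tensor_additive_eq_homog[OF S.abelian_group coder_additive_V[OF c(3)]
        additive_map_sum[OF S.abelian_group S.additive_ksign[OF SS.V_abelian coder_additive_V[OF c(1)]] coder_additive_V[OF c(2)]] _ t])
    fix m n r s assume mn: "m \<in> grade S r" "n \<in> grade S s"
    have mc: "m \<in> carrier S" "n \<in> carrier S" "f n \<in> carrier S" "g n \<in> carrier S"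
      using mn S.grade_carrier SS.HM_closed c by auto
    then show "Mult (tmap idS h (pt m n)) = Mult (tmap idS f (pt m n)) \<star>\<^bsub>S\<^esub> ksign p \<oplus>\<^bsub>S\<^esub> Mult (tmap idS g (pt m n))"
      by (simp add: tmap_pt_homog[OF idS_H f mn(1)] tmap_pt_homog[OF idS_H g mn(1)]
          tmap_pt_homog[OF idS_H h mn(1)] Mult_smult Mult_pt e S.r_distr S_mult_smult
          S.smult_l_distr S.smult_closed S.smult_ksign_ksign add.commute)
  qed
  then show ?thesis using y by (simp add: coder_app)
qed

text \<open>When a coderivation is applied to \<open>x y\<close>, the term with \<open>x\<close> in
  front is seen by the outer map as its own contraction, and the other term contracts the inner map.
  So contraction acts on the bracket as a derivation.\<close>

lemma cobracket_lcomp: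
  assumes f: "f \<in> grade H p" and g: "g \<in> grade H q" and x: "x \<in> grade M r" and y: "y \<in> carrier S"
  shows "lcomp (cobracket p q f g) x y =
    cobracket (p + r) q (lcomp f x) g y \<star>\<^bsub>S\<^esub> ksign (q * r) \<oplus>\<^bsub>S\<^esub> cobracket p (q + r) f (lcomp g x) y"
proof -
  note fx = lcomp_grade[OF f x] and gx = lcomp_grade[OF g x]
  have fc: "f \<in> carrier H" "coder f \<in> carrier H" "lcomp f x \<in> carrier H" "coder (lcomp f x) \<in> carrier H"
    using f fx SS.HM.grade_carrier coder_grade by blast+
  have gc: "g \<in> carrier H" "coder g \<in> carrier H" "lcomp g x \<in> carrier H" "coder (lcomp g x) \<in> carrier H"
    using g gx SS.HM.grade_carrier coder_grade by blast+
  have c: "vc x \<in> carrier S" using x grade_carrier by simp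
  note cl = SS.HM_closed[OF fc(1)] SS.HM_closed[OF fc(2)] SS.HM_closed[OF fc(4)]
    SS.HM_closed[OF gc(1)] SS.HM_closed[OF gc(2)] SS.HM_closed[OF gc(4)]
  show ?thesis
    using c y
    by (simp add: lcomp_app cobracket_def coder_vec[OF f x] coder_vec[OF g x] SS.HM_add[OF fc(1)] SS.HM_add[OF gc(1)]
        SS.HM_linear[OF fc(1)] SS.HM_linear[OF gc(1)] cl S.smult_closed S.smult_l_distr S.smult_ksign_ksign)
      (simp add: S.a_ac bit_ac cl S.smult_closed)
qed

text \<open>Again both sides satisfy one recursion. In the commutator the terms with
  \<open>x\<close> in front repeat the commutator on the shorter product. Those with both maps
  uncontracted under a single contraction pair up into the two commutators that
  \<open>cobracket_lcomp\<close> predicts, and the remaining mixed terms cancel or recombine by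
  their signs.\<close>

lemma coder_commutator_vprod:
  assumes "homog X ps" "vec_valued p f" "vec_valued q g"
  shows "coder (cobracket p q f g) (vprod X) =
    coder f (coder g (vprod X)) \<oplus>\<^bsub>S\<^esub> coder g (coder f (vprod X)) \<star>\<^bsub>S\<^esub> ksign (p * q + 1)"
  using assms
proof (induction arbitrary: p q f g rule: homog_induct)
  case Nil
  then have f: "f \<in> grade H p" and g: "g \<in> grade H q" by (simp_all add: vec_valued_def)
  have fc: "f \<in> carrier H" "g \<in> carrier H" using f g SS.HM.grade_carrier by blast+
  obtain z where z: "z \<in> grade M p" "f \<one>\<^bsub>S\<^esub> = vc z" using Nil one_grade_S by (fastforce simp: vec_valued_def)
  obtain w where w: "w \<in> grade M q" "g \<one>\<^bsub>S\<^esub> = vc w" using Nil one_grade_S by (fastforce simp: vec_valued_def)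
  have c: "vc z \<in> carrier S" "vc w \<in> carrier S" using z w grade_carrier by auto
  have cf: "coder f (vc w) = (vc w \<otimes>\<^bsub>S\<^esub> vc z) \<star>\<^bsub>S\<^esub> ksign (p * q) \<oplus>\<^bsub>S\<^esub> f (vc w)"
    using coder_vec[OF f w(1) S.one_closed] c by (simp add: coder_one[OF f] coder_one[OF lcomp_grade[OF f w(1)]] z(2) lcomp_app)
  have cg: "coder g (vc z) = (vc z \<otimes>\<^bsub>S\<^esub> vc w) \<star>\<^bsub>S\<^esub> ksign (q * p) \<oplus>\<^bsub>S\<^esub> g (vc z)"
    using coder_vec[OF g z(1) S.one_closed] c by (simp add: coder_one[OF g] coder_one[OF lcomp_grade[OF g z(1)]] w(2) lcomp_app)
  have sw: "vc w \<otimes>\<^bsub>S\<^esub> vc z = (vc z \<otimes>\<^bsub>S\<^esub> vc w) \<star>\<^bsub>S\<^esub> ksign (p * q)"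
    using vc_swap[OF w(1) z(1)] by (simp add: S_smult mult.commute)
  have zw: "vc z \<otimes>\<^bsub>S\<^esub> vc w \<in> carrier S" "f (vc w) \<in> carrier S" "g (vc z) \<in> carrier S"
    using c SS.HM_closed fc by auto
  have can: "a \<oplus>\<^bsub>S\<^esub> b \<oplus>\<^bsub>S\<^esub> (\<ominus>\<^bsub>S\<^esub> a \<oplus>\<^bsub>S\<^esub> d) = b \<oplus>\<^bsub>S\<^esub> d" if "a \<in> carrier S" "b \<in> carrier S" "d \<in> carrier S" for a b d
    using that S.r_neg1[of a "b \<oplus>\<^bsub>S\<^esub> d"] S.r_neg2[of a "b \<oplus>\<^bsub>S\<^esub> d"] by (simp add: S.a_ac)
  \<comment> \<open>The quadratic terms cancel because the two primitive values supercommute; the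
    commutator at 1 is therefore again an element of \<open>L\<close>.\<close>
  have "coder f (vc w) \<oplus>\<^bsub>S\<^esub> coder g (vc z) \<star>\<^bsub>S\<^esub> ksign (p * q + 1) =
     (vc z \<otimes>\<^bsub>S\<^esub> vc w) \<oplus>\<^bsub>S\<^esub> f (vc w) \<oplus>\<^bsub>S\<^esub> (\<ominus>\<^bsub>S\<^esub> (vc z \<otimes>\<^bsub>S\<^esub> vc w) \<oplus>\<^bsub>S\<^esub> g (vc z) \<star>\<^bsub>S\<^esub> ksign (p * q + 1))"
    unfolding cf cg sw using zw
    by (simp add: S.smult_ksign_ksign S.smult_l_distr S.smult_closed mult.commute[of q p])
      (simp add: S.smult_one S.smult_neg_one)
  also have "\<dots> = f (vc w) \<oplus>\<^bsub>S\<^esub> g (vc z) \<star>\<^bsub>S\<^esub> ksign (p * q + 1)"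
    using zw can S.smult_closed by simp
  finally show ?case
    by (simp add: coder_one[OF cobracket_grade[OF f g]] coder_one[OF f] coder_one[OF g] z(2) w(2) cobracket_app)
next
  case (Cons x r X ps)
  have f: "f \<in> grade H p" and g: "g \<in> grade H q" using Cons(4,5) by (simp_all add: vec_valued_def)
  note x = Cons(1)
  note fx = lcomp_grade[OF f x] and gx = lcomp_grade[OF g x] and hb = cobracket_grade[OF f g]
  note vfx = vec_valued_lcomp[OF Cons(4) x] and vgx = vec_valued_lcomp[OF Cons(5) x]
  have cl: "coder f y \<in> carrier S" "coder g y \<in> carrier S" "coder (lcomp f x) y \<in> carrier S"
    "coder (lcomp g x) y \<in> carrier S" "coder (cobracket p q f g) y \<in> carrier S"
    "coder (cobracket (p + r) q (lcomp f x) g) y \<in> carrier S"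
    "coder (cobracket p (q + r) f (lcomp g x)) y \<in> carrier S" if "y \<in> carrier S" for y
    using that SS.HM_closed[OF SS.HM.grade_carrier[OF coder_grade]] f g fx gx hb cobracket_grade by blast+
  have c: "vc x \<in> carrier S" "vprod X \<in> carrier S" using Cons grade_carrier homog_carrier by auto
  have fH: "coder f \<in> carrier H" "coder g \<in> carrier H" using coder_grade f g SS.HM.grade_carrier by blast+
  have h1: "cobracket (p + r) q (lcomp f x) g \<in> grade H (p + q + r)" using cobracket_grade[OF fx g] by (simp add: bit_ac)
  have h2: "cobracket p (q + r) f (lcomp g x) \<in> grade H (p + q + r)" using cobracket_grade[OF f gx] by (simp add: bit_ac)
  have "coder (lcomp (cobracket p q f g) x) (vprod X) =
    coder (cobracket (p + r) q (lcomp f x) g) (vprod X) \<star>\<^bsub>S\<^esub> ksign (q * r) \<oplus>\<^bsub>S\<^esub>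
    coder (cobracket p (q + r) f (lcomp g x)) (vprod X)"
    by (rule coder_comb[OF h1 h2 lcomp_grade[OF hb x] cobracket_lcomp[OF f g x] c(2)])
  moreover have "coder f (coder g (vc x \<otimes>\<^bsub>S\<^esub> vprod X)) =
     ((vc x \<otimes>\<^bsub>S\<^esub> coder f (coder g (vprod X))) \<star>\<^bsub>S\<^esub> ksign (p * r + q * r) \<oplus>\<^bsub>S\<^esub>
      coder (lcomp f x) (coder g (vprod X)) \<star>\<^bsub>S\<^esub> ksign (q * r)) \<oplus>\<^bsub>S\<^esub> coder f (coder (lcomp g x) (vprod X))"
    using c cl by (simp add: coder_vec[OF g x] coder_vec[OF f x] SS.HM_add[OF fH(1)] SS.HM_linear[OF fH(1)]
        S.smult_closed S.smult_l_distr S.smult_ksign_ksign)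
  moreover have "coder g (coder f (vc x \<otimes>\<^bsub>S\<^esub> vprod X)) =
     ((vc x \<otimes>\<^bsub>S\<^esub> coder g (coder f (vprod X))) \<star>\<^bsub>S\<^esub> ksign (q * r + p * r) \<oplus>\<^bsub>S\<^esub>
      coder (lcomp g x) (coder f (vprod X)) \<star>\<^bsub>S\<^esub> ksign (p * r)) \<oplus>\<^bsub>S\<^esub> coder g (coder (lcomp f x) (vprod X))"
    using c cl by (simp add: coder_vec[OF g x] coder_vec[OF f x] SS.HM_add[OF fH(2)] SS.HM_linear[OF fH(2)]
        S.smult_closed S.smult_l_distr S.smult_ksign_ksign)
  ultimately show ?case
    using c cl Cons(3)[OF Cons(4,5)] Cons(3)[OF vfx Cons(5)] Cons(3)[OF Cons(4) vgx]
    by (simp add: coder_vec[OF hb x] S.smult_closed S.smult_l_distr S.smult_ksign_ksign S.r_distr S_mult_smult)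
      (simp add: S.smult_closed S.a_ac bit_ac)
qed

end

section \<open>The coefficients of the series\<close>

text \<open>The series \<open>t / (e^t - 1)\<close>, whose coefficients are the Bernoulli numbers
  divided by factorials, with linear coefficient -1/2. Rational coefficients give a domain in which
  factors may be cancelled.\<close>

definition bern :: "rat fps"
  where "bern = inverse (fps_shift 1 (fps_exp 1))"

lemma bern_exp: "bern * (fps_exp 1 - 1) = fps_X"
proof -
  let ?u = "fps_shift 1 (fps_exp (1::rat))"
  have e: "fps_exp 1 - 1 = ?u * fps_X"
    by (rule fps_ext, rename_tac n, case_tac n) simp_all
  have "inverse ?u * ?u = 1" by (rule inverse_mult_eq_1) simp
  then show ?thesis unfolding e bern_def by (simp add: mult.assoc[symmetric])
qed

text \<open>Substitution of \<open>a t\<close> for \<open>t\<close> in \<open>bern_exp\<close>. The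
  equation is kept free of denominators, so it holds for \<open>a = 0\<close> as well.\<close>

lemma bern_scaled:
  fixes a :: rat
  defines "F \<equiv> \<lambda>a::rat. Abs_fps (\<lambda>n. a ^ n * fps_nth bern n)"
  shows "F a * (fps_exp a - 1) = fps_const a * fps_X"
proof -
  let ?c = "fps_const a * fps_X"
  have c0: "fps_nth ?c 0 = 0" by simp
  have "(bern * (fps_exp 1 - 1)) oo ?c = fps_X oo ?c" by (simp only: bern_exp)
  then have "(bern oo ?c) * ((fps_exp 1 - 1) oo ?c) = ?c"
    by (simp add: fps_compose_mult_distrib[OF c0])
  moreover have "(fps_exp 1 - 1) oo ?c = fps_exp a - 1"
    by (simp add: fps_compose_sub_distrib)
  ultimately show ?thesis by (simp add: F_def fps_compose_linear)
qed

text \<open>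
  With \<open>\<psi>(t) = 1 / (e\<^sup>t - 1)\<close> this is the functional equation
  \<open>\<psi>(s + t) (1 + \<psi>(s) + \<psi>(t)) = \<psi>(s) \<psi>(t)\<close>, cleared of denominators and restricted to the line
  through \<open>(s, 1)\<close>.
\<close>

lemma bern_functional_equation:
  fixes s :: rat
  defines "F \<equiv> \<lambda>a::rat. Abs_fps (\<lambda>n. a ^ n * fps_nth bern n)"
  assumes s: "s \<noteq> 0" "s \<noteq> - 1"
  shows "F s * (F (s + 1) - F 1) + fps_const s * (F 1 * (F (s + 1) - F s)) +
    fps_const s * (fps_X * F (s + 1)) = 0"
proof -
  define u v w where "u = fps_exp s - 1" and "v = fps_exp (1::rat) - 1" and "w = fps_exp (s + 1) - 1"
  define A C D where "A = F s" and "C = F 1" and "D = F (s + 1)"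
  define c where "c = fps_const s"
  have Au: "A * u = c * fps_X" unfolding A_def u_def F_def c_def by (rule bern_scaled)
  have Cv: "C * v = fps_X" using bern_scaled[of 1] unfolding C_def v_def F_def by simp
  have Dw: "D * w = (c + 1) * fps_X"
    using bern_scaled[of "s + 1"] unfolding D_def w_def F_def c_def
    by (simp flip: fps_const_add)
  \<comment> \<open>The addition law of the exponential, written for exponentials minus one. Once
    the denominators are cleared, nothing else about exponentials enters the computation.\<close>
  have w: "w = u + v + u * v"
    unfolding u_def v_def w_def fps_exp_add_mult by (simp add: algebra_simps)
  let ?G = "A * (D - C) + c * (C * (D - A)) + c * (fps_X * D)"
  have "?G * (u * v * w) = (A * u) * ((D * w) * v - (C * v) * w) + c * ((C * v) * ((D * w) * u - (A * u) * w)) +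
      c * fps_X * (D * w) * (u * v)"
    by (simp add: algebra_simps)
  also have "\<dots> = c * fps_X * ((c + 1) * fps_X * v - fps_X * w) + c * (fps_X * ((c + 1) * fps_X * u - c * fps_X * w)) +
      c * fps_X * ((c + 1) * fps_X) * (u * v)"
    unfolding Au Cv Dw ..
  also have "\<dots> = 0" unfolding w by (simp add: algebra_simps)
  finally have "?G * (u * v * w) = 0" .
  moreover have nz: "fps_exp a - 1 \<noteq> 0" if "a \<noteq> 0" for a :: rat
    using that fps_exp_eq_iff[of a 0] by simp
  \<comment> \<open>Excluding \<open>s = 0\<close> and \<open>s = -1\<close> keeps \<open>u\<close>
    and \<open>w\<close> from vanishing, which permits the cancellation.\<close>
  have "u * v * w \<noteq> 0"
    using nz[of s] nz[of 1] nz[of "s + 1"] s unfolding u_def v_def w_def by (simp add: add_eq_0_iff2)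
  ultimately have "?G = 0" by simp
  then show ?thesis by (simp add: A_def C_def D_def c_def)
qed

text \<open>The coefficient at \<open>s^(k + 1)\<close> of a polynomial in \<open>s\<close> that is
  zero because it has infinitely many roots. The three parts of the functional equation yield the
  two sums and the right-hand side in turn.\<close>

lemma bern_identity:
  defines "b \<equiv> fps_nth bern"
  shows "(\<Sum>m\<le>k. b m * b (k + l + 1 - m) * of_nat ((k + l + 1 - m) choose (k + 1 - m))) +
    (\<Sum>m\<le>l. b m * b (k + l + 1 - m) * of_nat ((k + l + 1 - m) choose (l + 1 - m))) =
    - b (k + l) * of_nat ((k + l) choose k)"
proof -
  let ?N = "k + l"
  define L :: "rat poly" where "L = [:1, 1:]"
  \<comment> \<open>\<open>P(s)\<close> is the coefficient of \<open>t\<^sup>N\<^sup>+\<^sup>1\<close> in the functional equation; it vanishes at all but two points.\<close>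
  define P where "P = (\<Sum>m\<le>?N + 1. monom (b m * b (?N + 1 - m)) m * (L ^ (?N + 1 - m) - 1)) +
    monom 1 1 * (\<Sum>m\<le>?N + 1. smult (b m * b (?N + 1 - m)) (L ^ (?N + 1 - m) - monom 1 (?N + 1 - m))) +
    monom (b ?N) 1 * L ^ ?N"
  have root: "poly P s = 0" if s: "s \<noteq> 0" "s \<noteq> - 1" for s
  proof -
    have "fps_nth (Abs_fps (\<lambda>n. s ^ n * b n) * (Abs_fps (\<lambda>n. (s + 1) ^ n * b n) - Abs_fps (\<lambda>n. 1 ^ n * b n)) +
      fps_const s * (Abs_fps (\<lambda>n. 1 ^ n * b n) * (Abs_fps (\<lambda>n. (s + 1) ^ n * b n) - Abs_fps (\<lambda>n. s ^ n * b n))) +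
      fps_const s * (fps_X * Abs_fps (\<lambda>n. (s + 1) ^ n * b n))) (?N + 1) = 0"
      using bern_functional_equation[OF s] by (simp add: b_def)
    then have "(\<Sum>m=0..?N + 1. s ^ m * b m * ((s + 1) ^ (?N + 1 - m) * b (?N + 1 - m) - b (?N + 1 - m))) +
      s * (\<Sum>m=0..?N + 1. b m * ((s + 1) ^ (?N + 1 - m) * b (?N + 1 - m) - s ^ (?N + 1 - m) * b (?N + 1 - m))) +
      s * ((s + 1) ^ ?N * b ?N) = 0"
      by (simp only: fps_add_nth fps_mult_left_const_nth fps_X_mult_nth)
        (simp only: fps_mult_nth fps_sub_nth fps_nth_Abs_fps power_one mult_1_left, simp)
    moreover have "poly P s = (\<Sum>m=0..?N + 1. s ^ m * b m * ((s + 1) ^ (?N + 1 - m) * b (?N + 1 - m) - b (?N + 1 - m))) +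
      s * (\<Sum>m=0..?N + 1. b m * ((s + 1) ^ (?N + 1 - m) * b (?N + 1 - m) - s ^ (?N + 1 - m) * b (?N + 1 - m))) +
      s * ((s + 1) ^ ?N * b ?N)"
      by (simp add: P_def L_def poly_sum poly_monom atLeast0AtMost algebra_simps del: sum.atMost_Suc sum.op_ivl_Suc)
    ultimately show ?thesis by simp
  qed
  have "P = 0"
  proof (rule ccontr)
    assume "P \<noteq> 0"
    then have "finite {s. poly P s = 0}" by (rule poly_roots_finite)
    then have "finite ({s. poly P s = 0} \<union> {0, - 1})" by simp
    moreover have "{s. poly P s = 0} \<union> {0, - 1} = UNIV" using root by auto
    ultimately show False using infinite_UNIV_char_0 by metis
  qed
  have cL: "coeff (L ^ n) i = of_nat (n choose i)" for n i
  proof (cases "i \<le> n")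
    case True
    then show ?thesis unfolding L_def by (subst coeff_linear_poly_power) auto
  next
    case False
    have "degree (L ^ n) \<le> n" unfolding L_def using degree_power_le[of "[:1, 1 :: rat:]" n] by simp
    then have "coeff (L ^ n) i = 0" using False by (intro coeff_eq_0) simp
    then show ?thesis using False by (simp add: binomial_eq_0)
  qed
  let ?t = "\<lambda>m. b m * b (?N + 1 - m)"
  have "coeff P (k + 1) = (\<Sum>m\<le>?N + 1. coeff (monom (?t m) m * (L ^ (?N + 1 - m) - 1)) (k + 1)) +
    (\<Sum>m\<le>?N + 1. ?t m * (coeff (L ^ (?N + 1 - m)) k - coeff (monom 1 (?N + 1 - m)) k)) + b ?N * coeff (L ^ ?N) k"
    unfolding P_def coeff_add coeff_sum coeff_monom_mult[of 1 1] coeff_monom_mult[of "b ?N" 1] by simp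
  \<comment> \<open>The subtracted 1 cancels exactly the term \<open>m = k + 1\<close>, and later
    terms have no coefficient at \<open>s^(k + 1)\<close>; so the sum stops at
    \<open>k\<close>.\<close>
  also have "(\<Sum>m\<le>?N + 1. coeff (monom (?t m) m * (L ^ (?N + 1 - m) - 1)) (k + 1)) =
    (\<Sum>m\<le>k. ?t m * of_nat ((?N + 1 - m) choose (k + 1 - m)))"
    by (rule sum.mono_neutral_cong_right)
      (auto simp: coeff_monom_mult cL not_le not_less less_Suc_eq_le coeff_1)
  \<comment> \<open>Here the subtracted monomial cancels the term \<open>m = l + 1\<close>, and the
    symmetry of binomial coefficients gives them the same shape as in the first sum.\<close>
  also have "(\<Sum>m\<le>?N + 1. ?t m * (coeff (L ^ (?N + 1 - m)) k - coeff (monom 1 (?N + 1 - m)) k)) =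
    (\<Sum>m\<le>l. ?t m * of_nat ((?N + 1 - m) choose (l + 1 - m)))"
  proof (rule sum.mono_neutral_cong_right)
    show "\<forall>m\<in>{..?N + 1} - {..l}. ?t m * (coeff (L ^ (?N + 1 - m)) k - coeff (monom 1 (?N + 1 - m)) k) = 0"
      by (auto simp: cL)
    fix m assume m: "m \<in> {..l}"
    then have "(?N + 1 - m) choose (l + 1 - m) = (?N + 1 - m) choose k"
      using binomial_symmetric[of k "?N + 1 - m"] by (simp add: Suc_diff_le)
    moreover have "coeff (monom 1 (?N + 1 - m)) k = (0::rat)" using m by simp
    ultimately show "?t m * (coeff (L ^ (?N + 1 - m)) k - coeff (monom 1 (?N + 1 - m)) k) =
      ?t m * of_nat ((?N + 1 - m) choose (l + 1 - m))" by (simp add: cL)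
  qed auto
  finally show ?thesis using \<open>P = 0\<close> by (simp add: cL)
qed

section \<open>Transfer of the rational identity to the ground superring\<close>

context comm_superring
begin

context
  assumes rational: "\<forall>n::nat. n > 0 \<longrightarrow> (\<exists>x::'k. of_nat n * x = 1)"
begin

text \<open>The graph of the ring map from the rationals. The ground ring has no division operation,
  so the value at a fraction is described by the equation that it solves.\<close>

definition rat_rel :: "rat \<Rightarrow> 'k \<Rightarrow> bool"
  where "rat_rel r x \<longleftrightarrow> (\<exists>a b. b > 0 \<and> r = of_int a / of_int b \<and> x * of_int b = of_int a)"

lemma of_int_inverse: "b > 0 \<Longrightarrow> \<exists>x::'k. of_int b * x = 1"
  using rational[rule_format, of "nat b"] by simp

lemma of_int_cancel: "b > 0 \<Longrightarrow> x * of_int b = y * of_int b \<Longrightarrow> x = (y::'k)"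
proof -
  assume "b > 0" and e: "x * of_int b = y * of_int b"
  then obtain z :: 'k where "of_int b * z = 1" using of_int_inverse by blast
  then show ?thesis using e by (metis mult.assoc mult.right_neutral)
qed

lemma rat_rel_ex1: "\<exists>!x. rat_rel r x"
proof (rule ex_ex1I)
  obtain a b where ab: "quotient_of r = (a, b)" by fastforce
  then have b: "b > 0" and r: "r = of_int a / of_int b" using quotient_of_denom_pos quotient_of_div by auto
  obtain z :: 'k where z: "of_int b * z = 1" using of_int_inverse[OF b] by blast
  then have "z * of_int b = 1" by (simp add: mult_of_int_commute)
  then have "of_int a * z * of_int b = (of_int a :: 'k)" by (simp add: mult.assoc)
  with b r show "\<exists>x. rat_rel r x" unfolding rat_rel_def by blast
next
  fix x y assume "rat_rel r x" "rat_rel r y"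
  then obtain a b a' b' where h: "b > 0" "r = of_int a / of_int b" "x * of_int b = of_int a"
    "b' > 0" "r = of_int a' / of_int b'" "y * of_int b' = of_int a'" unfolding rat_rel_def by blast
  have "rat_of_int a / of_int b = of_int a' / of_int b'" using h(2,5) by simp
  then have "rat_of_int (a * b') = of_int (a' * b)" using h(1,4) by (simp add: frac_eq_eq)
  then have "a * b' = a' * b" by (simp only: of_int_eq_iff)
  then have "of_int (a * b') = (of_int (a' * b) :: 'k)" by simp
  then have "x * of_int b * of_int b' = y * of_int b' * of_int b" by (simp add: h(3,6))
  then have "x * of_int (b * b') = y * of_int (b' * b)"
    by (simp add: mult.assoc[symmetric])
  then have "x * of_int (b * b') = y * of_int (b * b')" by (simp only: mult.commute)
  then show "x = y" using of_int_cancel[of "b * b'"] h by simp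
qed

definition rat_hom :: "rat \<Rightarrow> 'k"
  where "rat_hom r = (THE x. rat_rel r x)"

lemma rat_rel_hom: "rat_rel r (rat_hom r)"
  unfolding rat_hom_def by (rule theI'[OF rat_rel_ex1])

lemma rat_homI: "rat_rel r x \<Longrightarrow> rat_hom r = x"
  using rat_rel_hom rat_rel_ex1 by blast

lemma rat_hom_add: "rat_hom (r + s) = rat_hom r + rat_hom s"
proof (rule rat_homI)
  obtain a b where r: "b > 0" "r = of_int a / of_int b" "rat_hom r * of_int b = of_int a"
    using rat_rel_hom[of r] by (auto simp: rat_rel_def)
  obtain a' b' where s: "b' > 0" "s = of_int a' / of_int b'" "rat_hom s * of_int b' = of_int a'"
    using rat_rel_hom[of s] by (auto simp: rat_rel_def)
  have "r + s = of_int (a * b' + a' * b) / of_int (b * b')"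
    using r s by (simp add: field_simps)
  moreover have "(rat_hom r + rat_hom s) * of_int (b * b') = of_int (a * b' + a' * b)"
  proof -
    have "rat_hom r * of_int (b * b') = rat_hom r * of_int b * of_int b'" by (simp add: mult.assoc)
    moreover have "rat_hom s * of_int (b * b') = rat_hom s * of_int b' * of_int b"
      by (simp only: mult.commute[of b b'] of_int_mult mult.assoc)
    ultimately show ?thesis using r s by (simp add: distrib_right)
  qed
  ultimately show "rat_rel (r + s) (rat_hom r + rat_hom s)"
    unfolding rat_rel_def using r(1) s(1) by (intro exI[of _ "a * b' + a' * b"] exI[of _ "b * b'"]) simp
qed

lemma rat_hom_mult: "rat_hom (r * s) = rat_hom r * rat_hom s"
proof (rule rat_homI)
  obtain a b where r: "b > 0" "r = of_int a / of_int b" "rat_hom r * of_int b = of_int a"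
    using rat_rel_hom[of r] by (auto simp: rat_rel_def)
  obtain a' b' where s: "b' > 0" "s = of_int a' / of_int b'" "rat_hom s * of_int b' = of_int a'"
    using rat_rel_hom[of s] by (auto simp: rat_rel_def)
  have "rat_hom r * rat_hom s * of_int (b * b') = rat_hom r * (rat_hom s * of_int b) * of_int b'"
    by (simp add: mult.assoc)
  also have "rat_hom s * of_int b = of_int b * rat_hom s" by (rule mult_of_int_commute[symmetric])
  finally have "rat_hom r * rat_hom s * of_int (b * b') = rat_hom r * of_int b * (rat_hom s * of_int b')"
    by (simp only: mult.assoc)
  then have "rat_hom r * rat_hom s * of_int (b * b') = of_int (a * a')" using r s by simp
  then show "rat_rel (r * s) (rat_hom r * rat_hom s)"
    unfolding rat_rel_def using r s by (intro exI[of _ "a * a'"] exI[of _ "b * b'"]) simp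
qed

lemma rat_hom_of_nat: "rat_hom (of_nat n) = of_nat n"
  by (rule rat_homI, unfold rat_rel_def, intro exI[of _ "int n"] exI[of _ 1]) simp

lemma rat_hom_0 [simp]: "rat_hom 0 = 0" and rat_hom_1 [simp]: "rat_hom 1 = 1"
  using rat_hom_of_nat[of 0] rat_hom_of_nat[of 1] by simp_all

lemma rat_hom_minus: "rat_hom (- r) = - rat_hom r"
  using rat_hom_add[of r "- r"] by (simp add: eq_neg_iff_add_eq_0 add.commute)

lemma rat_hom_sum: "rat_hom (sum f A) = (\<Sum>i\<in>A. rat_hom (f i))"
  by (induction A rule: infinite_finite_induct) (simp_all add: rat_hom_add)

lemma rat_hom_inverse: "n > 0 \<Longrightarrow> rat_hom (1 / of_nat n) = ring_inv (of_nat n)"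
proof -
  assume n: "n > 0"
  have "of_nat n * rat_hom (1 / of_nat n) = 1" "rat_hom (1 / of_nat n) * of_nat n = 1"
    using n unfolding rat_hom_of_nat[symmetric] rat_hom_mult[symmetric] by simp_all
  then show ?thesis by (rule ring_inv_unique[symmetric])
qed

lemma rat_hom_K: "rat_hom r \<in> K 0"
proof -
  obtain a b where ab: "quotient_of r = (a, b)" by fastforce
  then have b: "b > 0" and r: "r = of_int a / of_int b" using quotient_of_denom_pos quotient_of_div by auto
  have n: "rat_hom (of_nat n) \<in> K 0" for n by (simp add: rat_hom_of_nat K_of_nat)
  have i: "rat_hom (of_int c) \<in> K 0" for c
    using n[of "nat c"] K_minus[OF n[of "nat (- c)"]]
    by (cases "c \<ge> 0") (simp_all add: rat_hom_minus[symmetric])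
  have "(0::nat) < nat b" using b by simp
  then have "rat_hom (1 / of_nat (nat b)) \<in> K 0"
    using rational K_ring_inv_of_nat(1) rat_hom_inverse by metis
  moreover have "r = of_int a * (1 / of_nat (nat b))" using b r by simp
  ultimately show ?thesis using i K_mult_0 by (metis rat_hom_mult)
qed

text \<open>With \<open>d\<close> the inverse of \<open>c\<close>, the series is \<open>c\<close>
  times \<open>t / (e^t - 1)\<close> with \<open>d t\<close> substituted for \<open>t\<close>. All
  quantities are even and therefore central, which lets the factors be sorted.\<close>

lemma phi_series_nth:
  assumes c: "c \<in> even_units K" and d: "d \<in> K 0" "c * d = 1" "d * c = 1"
  shows "fps_nth (phi_series K c) n = rat_hom (fps_nth bern n) * d ^ n * c"
proof -
  have dc: "ring_inv c = d" by (rule ring_inv_unique) (use d in auto)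
  have cK: "c \<in> K 0" using c by (simp add: even_units_def)
  define \<phi> where "\<phi> = Abs_fps (\<lambda>n. rat_hom (fps_nth bern n) * d ^ n * c)"
  have K: "fps_nth \<phi> n \<in> K 0" for n
    by (simp add: \<phi>_def K_mult_0 rat_hom_K K_power d cK)
  have "\<phi> * (exp_series c - 1) = fps_X"
  proof (rule fps_ext)
    fix n
    have e: "fps_nth (exp_series c - 1) i = rat_hom (fps_nth (fps_exp 1 - 1) i) * d ^ i" for i
    proof (cases i)
      case 0
      have "ring_inv 1 = (1::'k)" by (rule ring_inv_unique) auto
      with 0 show ?thesis by (simp add: exp_series_def)
    next
      case (Suc j)
      then show ?thesis using rat_hom_inverse[of "fact i"] by (simp add: exp_series_def dc del: fact_Suc)
    qed
    have t: "fps_nth \<phi> i * fps_nth (exp_series c - 1) (n - i) =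
        rat_hom (fps_nth bern i * fps_nth (fps_exp 1 - 1) (n - i)) * (d ^ n * c)" if "i \<le> n" for i
    proof -
      let ?y = "rat_hom (fps_nth (fps_exp 1 - 1) (n - i))"
      have "rat_hom (fps_nth bern i) * d ^ i * c * (?y * d ^ (n - i)) =
          rat_hom (fps_nth bern i) * (?y * (d ^ i * c)) * d ^ (n - i)"
        using K_even_commute[OF rat_hom_K, of "fps_nth (fps_exp 1 - 1) (n - i)" "d ^ i * c"] by (simp add: mult.assoc)
      also have "\<dots> = rat_hom (fps_nth bern i) * ?y * (d ^ i * (c * d ^ (n - i)))" by (simp add: mult.assoc)
      also have "c * d ^ (n - i) = d ^ (n - i) * c" by (rule K_even_commute[OF cK])
      also have "d ^ i * (d ^ (n - i) * c) = d ^ n * c" using that by (simp add: mult.assoc[symmetric] power_add[symmetric])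
      finally show ?thesis by (simp only: e \<phi>_def fps_nth_Abs_fps rat_hom_mult)
    qed
    have "fps_nth (\<phi> * (exp_series c - 1)) n =
        (\<Sum>i=0..n. rat_hom (fps_nth bern i * fps_nth (fps_exp 1 - 1) (n - i)) * (d ^ n * c))"
      unfolding fps_mult_nth by (rule sum.cong) (use t in auto)
    also have "\<dots> = rat_hom (fps_nth (bern * (fps_exp 1 - 1)) n) * (d ^ n * c)"
      by (simp only: fps_mult_nth rat_hom_sum sum_distrib_right)
    also have "\<dots> = fps_nth fps_X n"
      unfolding bern_exp using d by (simp add: fps_X_def)
    finally show "fps_nth (\<phi> * (exp_series c - 1)) n = fps_nth fps_X n" .
  qed
  then have "phi_series K c = \<phi>"
    unfolding phi_series_def using the1_equality[OF phi_series_ex1[OF rational c]] K by blast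
  then show ?thesis by (simp add: \<phi>_def)
qed

lemma phi_series_K: "c \<in> even_units K \<Longrightarrow> fps_nth (phi_series K c) n \<in> K 0"
  using theI'[OF phi_series_ex1[OF rational]] unfolding phi_series_def by blast

text \<open>Both sides scale alike: on the left the two factors have indices adding up to
  \<open>k + l + 1\<close>, and one \<open>d\<close> is cancelled by the additional
  \<open>c\<close>, which leaves the factor \<open>d^(k + l) c\<close> of the right-hand
  side.\<close>

lemma phi_series_identity:
  assumes c: "c \<in> even_units K"
  defines "f \<equiv> fps_nth (phi_series K c)"
  shows "(\<Sum>m\<le>k. f m * f (k + l + 1 - m) * of_nat ((k + l + 1 - m) choose (k + 1 - m))) +
    (\<Sum>m\<le>l. f m * f (k + l + 1 - m) * of_nat ((k + l + 1 - m) choose (l + 1 - m))) =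
    - f (k + l) * of_nat ((k + l) choose k)"
proof -
  obtain d where d: "c \<in> K 0" "d \<in> K 0" "c * d = 1" "d * c = 1"
    using c by (auto simp: even_units_def)
  let ?b = "fps_nth bern"
  have f: "f n = rat_hom (?b n) * (d ^ n * c)" for n
    unfolding f_def using phi_series_nth[OF c d(2-4)] by (simp add: mult.assoc)
  have dc: "d ^ m * c * (d ^ (Suc n - m) * c) = d ^ n * c" if "m \<le> Suc n" for m n
  proof -
    have "d ^ m * c * (d ^ (Suc n - m) * c) = d ^ m * (d ^ (Suc n - m) * (c * c))"
      using K_even_commute[OF d(1), of "d ^ (Suc n - m)"] by (metis mult.assoc)
    also have "\<dots> = d ^ Suc n * (c * c)" using that by (simp add: mult.assoc[symmetric] power_add[symmetric] del: power_Suc)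
    also have "\<dots> = d ^ n * (d * c) * c" by (simp only: power_Suc2 mult.assoc)
    finally show ?thesis by (simp add: d)
  qed
  have t: "f m * f (k + l + 1 - m) * of_nat z = rat_hom (?b m * ?b (k + l + 1 - m) * of_nat z) * (d ^ (k + l) * c)"
    if "m \<le> k + l + 1" for m z
  proof -
    let ?y = "rat_hom (?b (k + l + 1 - m))"
    have "f m * f (k + l + 1 - m) = rat_hom (?b m) * (?y * (d ^ m * c)) * (d ^ (k + l + 1 - m) * c)"
      unfolding f K_even_commute[OF rat_hom_K, of "?b (k + l + 1 - m)" "d ^ m * c"] by (simp only: mult.assoc)
    also have "\<dots> = rat_hom (?b m) * ?y * (d ^ m * c * (d ^ (k + l + 1 - m) * c))"
      by (simp only: mult.assoc)
    also have "\<dots> = rat_hom (?b m) * ?y * (d ^ (k + l) * c)" using dc[of m "k + l"] that by simp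
    finally have "f m * f (k + l + 1 - m) * of_nat z = rat_hom (?b m) * ?y * (of_nat z * (d ^ (k + l) * c))"
      by (simp add: mult.assoc mult_of_nat_commute)
    then show ?thesis by (simp add: rat_hom_mult rat_hom_of_nat mult.assoc)
  qed
  have "(\<Sum>m\<le>k. f m * f (k + l + 1 - m) * of_nat ((k + l + 1 - m) choose (k + 1 - m))) +
    (\<Sum>m\<le>l. f m * f (k + l + 1 - m) * of_nat ((k + l + 1 - m) choose (l + 1 - m))) =
    rat_hom ((\<Sum>m\<le>k. ?b m * ?b (k + l + 1 - m) * of_nat ((k + l + 1 - m) choose (k + 1 - m))) +
      (\<Sum>m\<le>l. ?b m * ?b (k + l + 1 - m) * of_nat ((k + l + 1 - m) choose (l + 1 - m)))) * (d ^ (k + l) * c)"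
    unfolding rat_hom_add rat_hom_sum distrib_right sum_distrib_right
    by (intro arg_cong2[of _ _ _ _ "(+)"] sum.cong refl t) auto
  also have "\<dots> = - f (k + l) * of_nat ((k + l) choose k)"
    unfolding bern_identity f
    by (simp add: rat_hom_minus rat_hom_mult rat_hom_of_nat mult.assoc mult_of_nat_commute)
  finally show ?thesis .
qed

end

end

section \<open>Multilinear functions as functions of lists\<close>

context lie_superalgebra
begin

text \<open>
  A linear map \<open>F\<close> on \<open>S(L)\<close> is represented by the list function \<open>[(x\<^sub>1, p\<^sub>1), \<dots>, (x\<^sub>n, p\<^sub>n)] \<mapsto> F (x\<^sub>1 \<cdots> x\<^sub>n)\<close>,
  where \<open>x\<^sub>i\<close> is homogeneous of parity \<open>p\<^sub>i\<close>; then \<open>der x F\<close> represents \<open>y \<mapsto> F (x y)\<close>.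
\<close>

definition valid :: "('m \<times> bit) list \<Rightarrow> bool"
  where "valid w \<longleftrightarrow> (\<forall>(x, p)\<in>set w. x \<in> grade L p)"

definition par :: "('m \<times> bit) list \<Rightarrow> bit"
  where "par w = sum_list (map snd w)"

lemma valid_simps [simp]: "valid []" "valid (x # w) \<longleftrightarrow> fst x \<in> grade L (snd x) \<and> valid w"
  by (auto simp: valid_def)

lemma par_simps [simp]: "par [] = 0" "par (x # w) = snd x + par w"
  by (auto simp: par_def)

definition cfun :: "(('m \<times> bit) list \<Rightarrow> 'm) \<Rightarrow> bool"
  where "cfun F \<longleftrightarrow> (\<forall>w. valid w \<longrightarrow> F w \<in> carrier L)"

definition lfun :: "bit \<Rightarrow> (('m \<times> bit) list \<Rightarrow> 'm) \<Rightarrow> bool"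
  where "lfun p F \<longleftrightarrow> (\<forall>w. valid w \<longrightarrow> F w \<in> grade L (p + par w))"

definition der :: "'m \<times> bit \<Rightarrow> (('m \<times> bit) list \<Rightarrow> 'm) \<Rightarrow> ('m \<times> bit) list \<Rightarrow> 'm"
  where "der x F w = F (x # w)"

lemma lfun_cfun: "lfun p F \<Longrightarrow> cfun F"
  using grade_carrier by (auto simp: lfun_def cfun_def)

lemma cfunD: "cfun F \<Longrightarrow> valid w \<Longrightarrow> F w \<in> carrier L"
  by (simp add: cfun_def)

lemma lfunD: "lfun p F \<Longrightarrow> valid w \<Longrightarrow> F w \<in> grade L (p + par w)"
  by (simp add: lfun_def)

lemma cfun_der: "cfun F \<Longrightarrow> fst x \<in> grade L (snd x) \<Longrightarrow> cfun (der x F)"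
  by (simp add: cfun_def der_def)

lemma lfun_der: "lfun p F \<Longrightarrow> fst x \<in> grade L (snd x) \<Longrightarrow> lfun (p + snd x) (der x F)"
  unfolding lfun_def
proof (intro allI impI)
  fix w assume F: "\<forall>w. valid w \<longrightarrow> F w \<in> grade L (p + par w)" and "fst x \<in> grade L (snd x)" "valid w"
  then have "valid (x # w)" by simp
  then have "F (x # w) \<in> grade L (p + par (x # w))" using F by blast
  then show "der x F w \<in> grade L (p + snd x + par w)" by (simp add: der_def add.assoc)
qed

text \<open>
  \<open>conv q F G\<close> is the convolution bracket of \<open>F\<close> and \<open>G\<close>, the latter of parity \<open>q\<close>;
  \<open>subst r F u\<close> is the composition of \<open>F\<close> with the coderivation attached to \<open>u\<close>, of parity \<open>r\<close>.
\<close>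

fun conv :: "bit \<Rightarrow> (('m \<times> bit) list \<Rightarrow> 'm) \<Rightarrow> (('m \<times> bit) list \<Rightarrow> 'm) \<Rightarrow> ('m \<times> bit) list \<Rightarrow> 'm"
  where
    "conv q F G [] = bracket L (F []) (G [])"
  | "conv q F G (x # w) = conv q (der x F) G w \<star> ksign (q * snd x) \<oplus> conv (q + snd x) F (der x G) w"

fun subst :: "bit \<Rightarrow> (('m \<times> bit) list \<Rightarrow> 'm) \<Rightarrow> (('m \<times> bit) list \<Rightarrow> 'm) \<Rightarrow> ('m \<times> bit) list \<Rightarrow> 'm"
  where
    "subst r F u [] = F [(u [], r)]"
  | "subst r F u (x # w) = subst r (der x F) u w \<star> ksign (r * snd x) \<oplus> subst (r + snd x) F (der x u) w"

lemma conv_closed: "cfun F \<Longrightarrow> cfun G \<Longrightarrow> valid w \<Longrightarrow> conv q F G w \<in> carrier L"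
proof (induction w arbitrary: q F G)
  case (Cons x w)
  then show ?case by (simp add: cfun_der smult_closed)
qed (simp add: br_closed cfunD)

lemma cfun_conv: "cfun F \<Longrightarrow> cfun G \<Longrightarrow> cfun (conv q F G)"
  using conv_closed by (simp add: cfun_def)

lemma lfun_conv: "lfun p F \<Longrightarrow> lfun q G \<Longrightarrow> lfun (p + q) (conv q F G)"
proof -
  have "conv q F G w \<in> grade L (p + q + par w)" if "valid w" "lfun p F" "lfun q G" for w p q F G
    using that
  proof (induction w arbitrary: p q F G)
    case Nil
    then show ?case using br_even lfunD[of p F "[]"] lfunD[of q G "[]"] by simp
  next
    case (Cons x w)
    have "conv q (der x F) G w \<star> ksign (q * snd x) \<in> grade L (p + q + par (x # w))"
      using Cons(1)[OF _ lfun_der[OF Cons(3)] Cons(4)] Cons(2) by (simp add: ksign_grade bit_ac)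
    moreover have "conv (q + snd x) F (der x G) w \<in> grade L (p + q + par (x # w))"
      using Cons(1)[OF _ Cons(3) lfun_der[OF Cons(4)]] Cons(2) by (simp add: bit_ac)
    ultimately show ?case by (simp add: grade_add)
  qed
  then show "lfun p F \<Longrightarrow> lfun q G \<Longrightarrow> lfun (p + q) (conv q F G)" by (simp add: lfun_def)
qed

lemma subst_closed: "cfun F \<Longrightarrow> lfun r u \<Longrightarrow> valid w \<Longrightarrow> subst r F u w \<in> carrier L"
proof (induction w arbitrary: r F u)
  case Nil
  then show ?case using lfunD[OF Nil(2), of "[]"] by (simp add: cfun_def)
next
  case (Cons x w)
  then show ?case by (simp add: cfun_der lfun_der smult_closed)
qed

lemma cfun_subst: "cfun F \<Longrightarrow> lfun r u \<Longrightarrow> cfun (subst r F u)"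
  using subst_closed by (simp add: cfun_def)

lemma conv_cong:
  assumes "\<And>v. valid v \<Longrightarrow> length v \<le> length w \<Longrightarrow> F v = F' v"
    "\<And>v. valid v \<Longrightarrow> length v \<le> length w \<Longrightarrow> G v = G' v" "valid w"
  shows "conv q F G w = conv q F' G' w"
  using assms
proof (induction w arbitrary: q F F' G G')
  case (Cons x w)
  have "conv q (der x F) G w = conv q (der x F') G' w"
    by (rule Cons(1)) (use Cons(2-4) in \<open>auto simp: der_def\<close>)
  moreover have "conv (q + snd x) F (der x G) w = conv (q + snd x) F' (der x G') w"
    by (rule Cons(1)) (use Cons(2-4) in \<open>auto simp: der_def\<close>)
  ultimately show ?case by simp
qed simp

text \<open>The bound is one more than in \<open>conv_cong\<close>, because the coderivation may
  insert the value of \<open>u\<close> at the empty list as an additional letter.\<close>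

lemma subst_cong:
  assumes "\<And>v. valid v \<Longrightarrow> length v \<le> Suc (length w) \<Longrightarrow> F v = F' v" "lfun r u" "valid w"
  shows "subst r F u w = subst r F' u w"
  using assms
proof (induction w arbitrary: r F F' u)
  case Nil
  then show ?case using lfunD[OF Nil(2), of "[]"] by simp
next
  case (Cons x w)
  have "subst r (der x F) u w = subst r (der x F') u w"
    by (rule Cons(1)) (use Cons(2-4) in \<open>auto simp: der_def\<close>)
  moreover have "subst (r + snd x) F (der x u) w = subst (r + snd x) F' (der x u) w"
    by (rule Cons(1)[OF _ lfun_der[OF Cons(3)]]) (use Cons(2-4) in auto)
  ultimately show ?case by simp
qed

lemma bracket_even_smult:
  assumes "x \<in> carrier L" "y \<in> carrier L" "c \<in> K 0"
  shows "bracket L (x \<star> c) y = bracket L x y \<star> c"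
  using assms by (simp add: br_balanced lsmult_even br_linear)

lemma conv_add_l:
  "cfun F \<Longrightarrow> cfun F' \<Longrightarrow> cfun G \<Longrightarrow> valid w \<Longrightarrow>
    conv q (\<lambda>v. F v \<oplus> F' v) G w = conv q F G w \<oplus> conv q F' G w"
proof (induction w arbitrary: q F F' G)
  case (Cons x w)
  have "der x (\<lambda>v. F v \<oplus> F' v) = (\<lambda>v. der x F v \<oplus> der x F' v)" by (auto simp: der_def)
  with Cons show ?case by (simp add: cfun_der conv_closed smult_closed smult_l_distr a_ac)
qed (simp add: br_l_distr cfunD)

lemma conv_add_r:
  "cfun F \<Longrightarrow> cfun G \<Longrightarrow> cfun G' \<Longrightarrow> valid w \<Longrightarrow>
    conv q F (\<lambda>v. G v \<oplus> G' v) w = conv q F G w \<oplus> conv q F G' w"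
proof (induction w arbitrary: q F G G')
  case (Cons x w)
  have "der x (\<lambda>v. G v \<oplus> G' v) = (\<lambda>v. der x G v \<oplus> der x G' v)" by (auto simp: der_def)
  with Cons show ?case by (simp add: cfun_der conv_closed smult_closed smult_l_distr a_ac)
qed (simp add: br_r_distr cfunD)

lemma conv_smult_l:
  "cfun F \<Longrightarrow> cfun G \<Longrightarrow> valid w \<Longrightarrow> c \<in> K 0 \<Longrightarrow> conv q (\<lambda>v. F v \<star> c) G w = conv q F G w \<star> c"
proof (induction w arbitrary: q F G)
  case (Cons x w)
  have "der x (\<lambda>v. F v \<star> c) = (\<lambda>v. der x F v \<star> c)" by (auto simp: der_def)
  with Cons show ?case
    by (simp add: cfun_der conv_closed smult_closed smult_l_distr smult_even_commute[of _ c])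
qed (simp add: bracket_even_smult cfunD)

lemma conv_smult_r:
  "cfun F \<Longrightarrow> cfun G \<Longrightarrow> valid w \<Longrightarrow> c \<in> K 0 \<Longrightarrow> conv q F (\<lambda>v. G v \<star> c) w = conv q F G w \<star> c"
proof (induction w arbitrary: q F G)
  case (Cons x w)
  have "der x (\<lambda>v. G v \<star> c) = (\<lambda>v. der x G v \<star> c)" by (auto simp: der_def)
  with Cons show ?case
    by (simp add: cfun_der conv_closed smult_closed smult_l_distr smult_even_commute[of _ c])
qed (simp add: br_linear cfunD)

lemma subst_add:
  "cfun F \<Longrightarrow> cfun F' \<Longrightarrow> lfun r u \<Longrightarrow> valid w \<Longrightarrow>
    subst r (\<lambda>v. F v \<oplus> F' v) u w = subst r F u w \<oplus> subst r F' u w"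
proof (induction w arbitrary: r F F' u)
  case (Cons x w)
  have "der x (\<lambda>v. F v \<oplus> F' v) = (\<lambda>v. der x F v \<oplus> der x F' v)" by (auto simp: der_def)
  with Cons show ?case by (simp add: cfun_der lfun_der subst_closed smult_closed smult_l_distr a_ac)
qed simp

lemma subst_smult:
  "cfun F \<Longrightarrow> lfun r u \<Longrightarrow> valid w \<Longrightarrow> c \<in> K 0 \<Longrightarrow> subst r (\<lambda>v. F v \<star> c) u w = subst r F u w \<star> c"
proof (induction w arbitrary: r F u)
  case (Cons x w)
  have "der x (\<lambda>v. F v \<star> c) = (\<lambda>v. der x F v \<star> c)" by (auto simp: der_def)
  with Cons show ?case
    by (simp add: cfun_der lfun_der subst_closed smult_closed smult_l_distr smult_even_commute[of _ c])
qed simp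

lemma bracket_zero [simp]: "y \<in> carrier L \<Longrightarrow> bracket L \<zero> y = \<zero>" "x \<in> carrier L \<Longrightarrow> bracket L x \<zero> = \<zero>"
  using additive_map_zero[OF abelian_group abelian_group, of "\<lambda>x. bracket L x y"]
    additive_map_zero[OF abelian_group abelian_group, of "bracket L x"]
  by (auto simp: additive_map_def br_closed br_l_distr br_r_distr)

lemma der_const: "der x (\<lambda>w. \<zero>) = (\<lambda>w. \<zero>)"
  by (simp add: der_def[abs_def])

lemma conv_zero_l: "cfun G \<Longrightarrow> valid w \<Longrightarrow> conv q (\<lambda>w. \<zero>) G w = \<zero>"
  by (induction w arbitrary: q G) (simp_all add: cfunD cfun_der der_const)

lemma conv_zero_r: "cfun F \<Longrightarrow> valid w \<Longrightarrow> conv q F (\<lambda>w. \<zero>) w = \<zero>"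
  by (induction w arbitrary: q F) (simp_all add: cfunD cfun_der der_const)

lemma subst_zero: "lfun r u \<Longrightarrow> valid w \<Longrightarrow> subst r (\<lambda>w. \<zero>) u w = \<zero>"
  by (induction w arbitrary: r u) (simp_all add: lfun_der der_const)

lemma cfun_finsum: "(\<And>k. k \<in> A \<Longrightarrow> cfun (G k)) \<Longrightarrow> cfun (\<lambda>v. \<Oplus>k\<in>A. G k v)"
  by (auto simp: cfun_def intro!: finsum_closed)

lemma conv_finsum:
  assumes "cfun F" "\<And>k. k \<in> A \<Longrightarrow> cfun (G k)" "valid w"
  shows "conv q F (\<lambda>v. \<Oplus>k\<in>A. G k v) w = (\<Oplus>k\<in>A. conv q F (G k) w)"
  using assms(2)
proof (induction A rule: infinite_finite_induct)
  case (insert a A)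
  have "conv q F (\<lambda>v. \<Oplus>k\<in>insert a A. G k v) w = conv q F (\<lambda>v. G a v \<oplus> (\<Oplus>k\<in>A. G k v)) w"
    by (rule conv_cong) (use insert assms in \<open>auto simp: Pi_def cfunD\<close>)
  also have "\<dots> = conv q F (G a) w \<oplus> conv q F (\<lambda>v. \<Oplus>k\<in>A. G k v) w"
    using insert assms by (intro conv_add_r cfun_finsum) auto
  finally show ?case using insert assms by (simp add: Pi_def conv_closed)
qed (use assms in \<open>simp_all add: conv_zero_r\<close>)

lemma subst_finsum:
  assumes "lfun r u" "\<And>k. k \<in> A \<Longrightarrow> cfun (G k)" "valid w"
  shows "subst r (\<lambda>v. \<Oplus>k\<in>A. G k v) u w = (\<Oplus>k\<in>A. subst r (G k) u w)"
  using assms(2)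
proof (induction A rule: infinite_finite_induct)
  case (insert a A)
  have "subst r (\<lambda>v. \<Oplus>k\<in>insert a A. G k v) u w = subst r (\<lambda>v. G a v \<oplus> (\<Oplus>k\<in>A. G k v)) u w"
    by (rule subst_cong) (use insert assms in \<open>auto simp: Pi_def cfunD\<close>)
  also have "\<dots> = subst r (G a) u w \<oplus> subst r (\<lambda>v. \<Oplus>k\<in>A. G k v) u w"
    using insert assms by (intro subst_add cfun_finsum) auto
  finally show ?case using insert assms by (simp add: Pi_def subst_closed)
qed (use assms in \<open>simp_all add: subst_zero\<close>)

lemma conv_antisym:
  "lfun p F \<Longrightarrow> lfun q G \<Longrightarrow> valid w \<Longrightarrow> conv q F G w = conv p G F w \<star> ksign (p * q + 1)"
proof (induction w arbitrary: p q F G)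
  case Nil
  have F: "F [] \<in> grade L p" "G [] \<in> grade L q" using lfunD[OF Nil(1)] lfunD[OF Nil(2)] valid_simps(1) by fastforce+
  then have c: "bracket L (G []) (F []) \<in> carrier L" by (simp add: br_closed grade_carrier)
  then have "\<ominus> (bracket L (G []) (F []) \<star> ksign (p * q)) = bracket L (G []) (F []) \<star> ksign (p * q) \<star> ksign 1"
    by (simp add: smult_neg_one smult_closed)
  then show ?case using br_antisym[OF F] c by (simp add: smult_ksign_ksign del: ksign_1)
next
  case (Cons x w)
  have x: "fst x \<in> grade L (snd x)" using Cons by simp
  note Fx = lfun_der[OF Cons(2) x] and Gx = lfun_der[OF Cons(3) x]
  have c: "conv p' G' F' w \<in> carrier L" if "cfun F'" "cfun G'" for p' F' G'
    using conv_closed that Cons by simp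
  note cf = lfun_cfun[OF Cons(2)] lfun_cfun[OF Cons(3)] lfun_cfun[OF Fx] lfun_cfun[OF Gx]
  show ?case
    using Cons(1)[OF Fx Cons(3)] Cons(1)[OF Cons(2) Gx] Cons(4) cf
    by (simp add: c smult_ksign_ksign smult_l_distr smult_closed)
      (simp add: c smult_closed bit_ac a_ac)
qed

text \<open>The Jacobi identity of \<open>L\<close> is met only at the empty list. A first letter is
  distributed over the three arguments by the Leibniz rule, which yields three instances of the
  induction hypothesis.\<close>

lemma conv_jacobi:
  "lfun p F \<Longrightarrow> lfun q G \<Longrightarrow> lfun r H \<Longrightarrow> valid w \<Longrightarrow>
    conv (q + r) F (conv r G H) w =
      conv r (conv q F G) H w \<oplus> conv (p + r) G (conv r F H) w \<star> ksign (p * q)"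
proof (induction w arbitrary: p q r F G H)
  case Nil
  have F: "F [] \<in> grade L p" "G [] \<in> grade L q" "H [] \<in> grade L r"
    using lfunD[OF Nil(1)] lfunD[OF Nil(2)] lfunD[OF Nil(3)] valid_simps(1) by fastforce+
  have c: "bracket L (F []) (bracket L (G []) (H [])) \<in> carrier L"
    "bracket L (G []) (bracket L (F []) (H [])) \<star> ksign (p * q) \<in> carrier L"
    using F by (simp_all add: br_closed grade_carrier smult_closed)
  show ?case using br_jacobi[OF F] c by (simp add: a_minus_def a_assoc l_neg)
next
  case (Cons x w)
  have x: "fst x \<in> grade L (snd x)" and w: "valid w" using Cons by simp_all
  let ?s = "snd x"
  note Fx = lfun_der[OF Cons(2) x] and Gx = lfun_der[OF Cons(3) x] and Hx = lfun_der[OF Cons(4) x]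
  note cf = lfun_cfun[OF Cons(2)] lfun_cfun[OF Cons(3)] lfun_cfun[OF Cons(4)]
    lfun_cfun[OF Fx] lfun_cfun[OF Gx] lfun_cfun[OF Hx]
  have d: "der x (conv q' F' G') = (\<lambda>v. conv q' (der x F') G' v \<star> ksign (q' * ?s) \<oplus> conv (q' + ?s) F' (der x G') v)"
    for q' F' G' by (rule ext) (simp add: der_def)
  have cs: "cfun (\<lambda>v. F' v \<star> \<alpha>)" if "cfun F'" for F' \<alpha> using that by (simp add: cfun_def smult_closed)
  have c: "conv q' F' G' w \<in> carrier L" if "cfun F'" "cfun G'" for q' F' G' using conv_closed that w by simp
  have 1: "conv (q + r) F (conv r G H) (x # w) = conv (q + r) (der x F) (conv r G H) w \<star> ksign ((q + r) * ?s) \<oplus>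
      (conv (q + r + ?s) F (conv r (der x G) H) w \<star> ksign (r * ?s) \<oplus> conv (q + r + ?s) F (conv (r + ?s) G (der x H)) w)"
    using cf w by (simp add: d conv_add_r conv_smult_r cs cfun_conv)
  have 2: "conv r (conv q F G) H (x # w) =
      (conv r (conv q (der x F) G) H w \<star> ksign (q * ?s) \<oplus> conv r (conv (q + ?s) F (der x G)) H w) \<star> ksign (r * ?s) \<oplus>
      conv (r + ?s) (conv q F G) (der x H) w"
    using cf w by (simp add: d conv_add_l conv_smult_l cs cfun_conv)
  have 3: "conv (p + r) G (conv r F H) (x # w) = conv (p + r) (der x G) (conv r F H) w \<star> ksign ((p + r) * ?s) \<oplus>
      (conv (p + r + ?s) G (conv r (der x F) H) w \<star> ksign (r * ?s) \<oplus> conv (p + r + ?s) G (conv (r + ?s) F (der x H)) w)"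
    using cf w by (simp add: d conv_add_r conv_smult_r cs cfun_conv)
  note IH = Cons(1)[OF Fx Cons(3,4) w] Cons(1)[OF Cons(2) Gx Cons(4) w] Cons(1)[OF Cons(2,3) Hx w]
  have eq: "q + r + ?s = q + ?s + r" "q + ?s + r = q + r + ?s" by (simp_all add: bit_ac)
  have I2: "conv (q + r + ?s) F (conv r (der x G) H) w =
      conv r (conv (q + ?s) F (der x G)) H w \<oplus> conv (p + r) (der x G) (conv r F H) w \<star> ksign (p * (q + ?s))"
    using IH(2) by (simp add: bit_ac)
  have I3: "conv (q + r + ?s) F (conv (r + ?s) G (der x H)) w =
      conv (r + ?s) (conv q F G) (der x H) w \<oplus> conv (p + r + ?s) G (conv (r + ?s) F (der x H)) w \<star> ksign (p * q)"
    using IH(3) by (simp add: bit_ac)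
  have I1: "conv (q + r) (der x F) (conv r G H) w =
      conv r (conv q (der x F) G) H w \<oplus> conv (p + r + ?s) G (conv r (der x F) H) w \<star> ksign ((p + ?s) * q)"
    using IH(1) by (simp add: bit_ac)
  show ?case
    unfolding 1 2 3 I1 I2 I3
    using cf w by (simp add: c cfun_conv smult_l_distr smult_closed smult_ksign_ksign)
      (simp add: c cfun_conv smult_closed a_ac bit_ac)
qed

text \<open>Composition with a coderivation is a derivation of the convolution bracket. At the empty
  list this is the recursion of \<open>conv\<close> for the single letter \<open>u []\<close>;
  otherwise the first letter is distributed over \<open>F\<close>, \<open>G\<close> and
  \<open>u\<close>.\<close>

lemma subst_conv:
  "lfun p F \<Longrightarrow> lfun q G \<Longrightarrow> lfun r u \<Longrightarrow> valid w \<Longrightarrow>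
    subst r (conv q F G) u w = conv q (subst r F u) G w \<star> ksign (q * r) \<oplus> conv (q + r) F (subst r G u) w"
proof (induction w arbitrary: p q r F G u)
  case Nil
  then show ?case by (simp add: der_def)
next
  case (Cons x w)
  have x: "fst x \<in> grade L (snd x)" and w: "valid w" using Cons by simp_all
  let ?s = "snd x"
  note Fx = lfun_der[OF Cons(2) x] and Gx = lfun_der[OF Cons(3) x] and ux = lfun_der[OF Cons(4) x]
  note cf = lfun_cfun[OF Cons(2)] lfun_cfun[OF Cons(3)] lfun_cfun[OF Fx] lfun_cfun[OF Gx]
  have d: "der x (conv q' F' G') = (\<lambda>v. conv q' (der x F') G' v \<star> ksign (q' * ?s) \<oplus> conv (q' + ?s) F' (der x G') v)"
    for q' F' G' by (rule ext) (simp add: der_def)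
  have ds: "der x (subst r' F' u') = (\<lambda>v. subst r' (der x F') u' v \<star> ksign (r' * ?s) \<oplus> subst (r' + ?s) F' (der x u') v)"
    for r' F' u' by (rule ext) (simp add: der_def)
  have cs: "cfun (\<lambda>v. F' v \<star> \<alpha>)" if "cfun F'" for F' \<alpha> using that by (simp add: cfun_def smult_closed)
  have c: "conv q' F' G' w \<in> carrier L" if "cfun F'" "cfun G'" for q' F' G' using conv_closed that w by simp
  have 1: "subst r (conv q F G) u (x # w) =
      (subst r (conv q (der x F) G) u w \<star> ksign (q * ?s) \<oplus> subst r (conv (q + ?s) F (der x G)) u w) \<star> ksign (r * ?s) \<oplus>
      subst (r + ?s) (conv q F G) (der x u) w"
    using cf w Cons(4) by (simp add: d subst_add subst_smult cs cfun_conv)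
  have 2: "conv q (subst r F u) G (x # w) =
      (conv q (subst r (der x F) u) G w \<star> ksign (r * ?s) \<oplus> conv q (subst (r + ?s) F (der x u)) G w) \<star> ksign (q * ?s) \<oplus>
      conv (q + ?s) (subst r F u) (der x G) w"
    using cf w Cons(4) ux by (simp add: ds conv_add_l conv_smult_l cs cfun_subst)
  have 3: "conv (q + r) F (subst r G u) (x # w) =
      conv (q + r) (der x F) (subst r G u) w \<star> ksign ((q + r) * ?s) \<oplus>
      (conv (q + r + ?s) F (subst r (der x G) u) w \<star> ksign (r * ?s) \<oplus> conv (q + r + ?s) F (subst (r + ?s) G (der x u)) w)"
    using cf w Cons(4) ux by (simp add: ds conv_add_r conv_smult_r cs cfun_subst)
  note IH = Cons(1)[OF Fx Cons(3,4) w] Cons(1)[OF Cons(2) Gx Cons(4) w] Cons(1)[OF Cons(2,3) ux w]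
  show ?case
    unfolding 1 2 3 IH
    using cf w Cons(4) ux
    by (simp add: c cfun_subst smult_l_distr smult_closed smult_ksign_ksign)
      (simp add: c cfun_subst smult_closed a_ac bit_ac)
qed

section \<open>Iterated convolution brackets with \<theta>\<close>

definition theta :: "('m \<times> bit) list \<Rightarrow> 'm"
  where "theta w = (case w of [x] \<Rightarrow> fst x | _ \<Rightarrow> \<zero>)"

definition hat :: "'m \<Rightarrow> ('m \<times> bit) list \<Rightarrow> 'm"
  where "hat a w = (if w = [] then a else \<zero>)"

text \<open>\<open>adn p a n\<close> represents \<open>(ad \<theta>)\<^sup>n a\<close>, for \<open>a\<close> of parity \<open>p\<close>.\<close>

fun adn :: "bit \<Rightarrow> 'm \<Rightarrow> nat \<Rightarrow> ('m \<times> bit) list \<Rightarrow> 'm"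
  where "adn p a 0 = hat a"
  | "adn p a (Suc n) = conv p theta (adn p a n)"

lemma der_theta: "der x theta = hat (fst x)"
  by (rule ext) (auto simp: der_def theta_def hat_def split: list.splits)

lemma der_hat: "der x (hat a) = (\<lambda>w. \<zero>)"
  by (rule ext) (simp add: der_def hat_def)

lemma lfun_theta: "lfun 0 theta"
  by (auto simp: lfun_def theta_def split: list.splits)

lemma lfun_hat: "a \<in> grade L p \<Longrightarrow> lfun p (hat a)"
  by (auto simp: lfun_def hat_def)

lemma lfun_adn: "a \<in> grade L p \<Longrightarrow> lfun p (adn p a n)"
  by (induction n) (use lfun_conv[OF lfun_theta] in \<open>auto simp: lfun_hat\<close>)

lemma cfun_adn: "a \<in> grade L p \<Longrightarrow> cfun (adn p a n)"
  using lfun_cfun lfun_adn by blast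

lemma cfun_theta: "cfun theta"
  by (rule lfun_cfun[OF lfun_theta])

lemma subst_hat: "lfun r u \<Longrightarrow> valid w \<Longrightarrow> a \<in> carrier L \<Longrightarrow> subst r (hat a) u w = \<zero>"
  by (induction w arbitrary: r u) (simp_all add: der_hat subst_zero lfun_der, simp add: hat_def)

lemma subst_theta: "lfun r u \<Longrightarrow> valid w \<Longrightarrow> subst r theta u w = u w"
proof (induction w arbitrary: r u)
  case (Cons x w)
  have x: "fst x \<in> grade L (snd x)" "fst x \<in> carrier L" and w: "valid w" using Cons grade_carrier by auto
  have "u (x # w) \<in> carrier L" using lfun_cfun[OF Cons(2)] Cons(3) by (simp add: cfun_def)
  then show ?case
    using Cons(1)[OF lfun_der[OF Cons(2) x(1)] w] subst_hat[OF Cons(2) w x(2)]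
    by (simp add: der_theta) (simp add: der_def)
qed (simp add: theta_def)

lemma conv_hat: "cfun F \<Longrightarrow> valid w \<Longrightarrow> a \<in> carrier L \<Longrightarrow> conv q (hat a) F w = bracket L a (F w)"
proof (induction w arbitrary: q F)
  case (Cons x w)
  have "bracket L a (F (x # w)) \<in> carrier L" using Cons by (simp add: cfun_def br_closed)
  with Cons show ?case by (simp add: der_hat conv_zero_l cfun_der) (simp add: der_def)
qed (simp add: hat_def)

lemma conv_theta_Cons:
  "cfun F \<Longrightarrow> valid (x # w) \<Longrightarrow>
    conv q theta F (x # w) = bracket L (fst x) (F w) \<star> ksign (q * snd x) \<oplus> conv (q + snd x) theta (der x F) w"
  using grade_carrier[of "fst x" "snd x"] by (simp add: der_theta conv_hat)

lemma conv_theta_Nil: "cfun F \<Longrightarrow> conv q theta F [] = \<zero>"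
  by (simp add: theta_def cfunD)

text \<open>\<theta> consumes exactly one letter, so \<open>F\<close> is evaluated only on lists
  that are shorter by one.\<close>

lemma conv_theta_cong:
  assumes "cfun F" "cfun F'" "\<And>v. valid v \<Longrightarrow> Suc (length v) = length w \<Longrightarrow> F v = F' v" "valid w"
  shows "conv q theta F w = conv q theta F' w"
  using assms
proof (induction w arbitrary: q F F')
  case Nil
  then show ?case by (simp only: conv_theta_Nil)
next
  case (Cons x w)
  have x: "fst x \<in> grade L (snd x)" using Cons by simp
  have "conv (q + snd x) theta (der x F) w = conv (q + snd x) theta (der x F') w"
    by (rule Cons(1)[OF cfun_der[OF Cons(2) x] cfun_der[OF Cons(3) x]]) (use Cons in \<open>auto simp: der_def\<close>)
  moreover have "F w = F' w" using Cons by simp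
  ultimately show ?case using Cons(2,3,5) by (simp only: conv_theta_Cons)
qed

lemma adn_support: "a \<in> grade L p \<Longrightarrow> valid w \<Longrightarrow> length w \<noteq> n \<Longrightarrow> adn p a n w = \<zero>"
proof (induction n arbitrary: w)
  case 0
  then show ?case by (simp add: hat_def)
next
  case (Suc n)
  have "conv p theta (adn p a n) w = conv p theta (\<lambda>w. \<zero>) w"
    by (rule conv_theta_cong) (use Suc cfun_adn in \<open>auto simp: cfun_def\<close>)
  then show ?case using Suc(3) by (simp add: conv_zero_r cfun_theta)
qed

lemma conv_short:
  assumes "cfun F" "cfun G" "\<And>v. valid v \<Longrightarrow> length v < n \<Longrightarrow> F v = \<zero>" "valid w" "length w < n"
  shows "conv q F G w = \<zero>"
proof -
  have "conv q F G w = conv q (\<lambda>v. \<zero>) G w"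
    by (rule conv_cong) (use assms in auto)
  then show ?thesis using assms by (simp add: conv_zero_l)
qed

text \<open>Made for \<open>phi_list\<close>, whose coefficient depends on the length of the list.
  If \<open>F\<close> lives in degree \<open>n\<close>, the other factor meets only lists of length
  \<open>length w - n\<close>, and its coefficient can be taken out.\<close>

lemma conv_graded:
  assumes "cfun F" "\<And>m. cfun (G m)" "\<And>v. valid v \<Longrightarrow> length v \<noteq> n \<Longrightarrow> F v = \<zero>"
    "\<And>m. c m \<in> K 0" "valid w" "n \<le> length w"
  shows "conv q F (\<lambda>v. G (length v) v \<star> c (length v)) w = conv q F (G (length w - n)) w \<star> c (length w - n)"
  using assms
proof (induction w arbitrary: q F G c n)
  case Nil
  then show ?case by (simp add: cfunD br_linear)
next
  case (Cons x w)
  have x: "fst x \<in> grade L (snd x)" and w: "valid w" using Cons by simp_all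
  have G: "cfun (\<lambda>v. G (length v) v \<star> c (length v))"
    using Cons(3) by (simp add: cfun_def smult_closed)
  have cG: "cfun (G m)" "cfun (der x (G m))" for m using Cons(3) cfun_der[OF Cons(3) x] by auto
  have cF: "cfun F" "cfun (der x F)" using Cons(2) cfun_der[OF Cons(2) x] by auto
  let ?m = "length (x # w) - n"
  have 1: "conv q (der x F) (\<lambda>v. G (length v) v \<star> c (length v)) w = conv q (der x F) (G ?m) w \<star> c ?m"
  proof (cases n)
    case 0
    have "conv q (der x F) G' w = \<zero>" if "cfun G'" for G'
    proof -
      have "conv q (der x F) G' w = conv q (\<lambda>v. \<zero>) G' w"
        by (rule conv_cong) (use Cons(4) x w 0 in \<open>auto simp: der_def\<close>)
      then show ?thesis using that w by (simp add: conv_zero_l)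
    qed
    then show ?thesis using G cG by simp
  next
    case (Suc n')
    have "conv q (der x F) (\<lambda>v. G (length v) v \<star> c (length v)) w = conv q (der x F) (G (length w - n')) w \<star> c (length w - n')"
    proof (rule Cons(1)[OF cF(2) Cons(3) _ Cons(5) w])
      fix v assume "valid v" "length v \<noteq> n'"
      then show "der x F v = \<zero>" using Cons(4)[of "x # v"] x Suc by (simp add: der_def)
    qed (use Cons(7) Suc in simp)
    then show ?thesis using Suc by simp
  qed
  have d: "der x (\<lambda>v. G (length v) v \<star> c (length v)) =
      (\<lambda>v. (\<lambda>m. der x (G (Suc m))) (length v) v \<star> (\<lambda>m. c (Suc m)) (length v))"
    by (rule ext) (simp add: der_def)
  have 2: "conv (q + snd x) F (der x (\<lambda>v. G (length v) v \<star> c (length v))) w = conv (q + snd x) F (der x (G ?m)) w \<star> c ?m"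
  proof (cases "n \<le> length w")
    case True
    have "conv (q + snd x) F (der x (\<lambda>v. G (length v) v \<star> c (length v))) w =
        conv (q + snd x) F ((\<lambda>m. der x (G (Suc m))) (length w - n)) w \<star> (\<lambda>m. c (Suc m)) (length w - n)"
      unfolding d by (rule Cons(1)) (use Cons cG True w in auto)
    then show ?thesis using True by (simp add: Suc_diff_le)
  next
    case False
    have cd: "cfun (der x (\<lambda>v. G (length v) v \<star> c (length v)))" by (rule cfun_der[OF G x])
    have "conv (q + snd x) F G' w = \<zero>" if "cfun G'" for G'
      by (rule conv_short[of F G' n]) (use that cF Cons(4) w False in auto)
    then show ?thesis using cd cG by simp
  qed
  have "conv q (der x F) (G ?m) w \<in> carrier L" "conv (q + snd x) F (der x (G ?m)) w \<in> carrier L"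
    using conv_closed cF cG w by auto
  with 1 2 show ?case
    using Cons(5) by (simp add: smult_l_distr smult_closed smult_even_commute[of _ "c _" "ksign _"])
qed

section \<open>Brackets of iterated brackets as binary forms\<close>

definition lincomb :: "(nat \<Rightarrow> 'm) \<Rightarrow> nat \<Rightarrow> (nat \<Rightarrow> 'k) \<Rightarrow> 'm"
  where "lincomb v N e = (\<Oplus>k\<in>{..N}. v k \<star> e k)"

lemma lincomb_closed: "(\<And>k. v k \<in> carrier L) \<Longrightarrow> lincomb v N e \<in> carrier L"
  by (auto simp: lincomb_def smult_closed intro!: finsum_closed)

lemma lincomb_cong:
  assumes "\<And>k. k \<le> N \<Longrightarrow> v k = v' k" "\<And>k. k \<le> N \<Longrightarrow> e k = e' k" "\<And>k. v' k \<in> carrier L"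
  shows "lincomb v N e = lincomb v' N e'"
  unfolding lincomb_def by (rule finsum_cong') (use assms smult_closed in auto)

lemma lincomb_add:
  "(\<And>k. v k \<in> carrier L) \<Longrightarrow> lincomb v N (\<lambda>k. e k + e' k) = lincomb v N e \<oplus> lincomb v N e'"
  unfolding lincomb_def
  by (simp add: smult_r_distr smult_closed finsum_addf Pi_def)

lemma lincomb_smult:
  "(\<And>k. v k \<in> carrier L) \<Longrightarrow> lincomb v N e \<star> c = lincomb v N (\<lambda>k. e k * c)"
  unfolding lincomb_def
  using additive_map_finsum[OF abelian_group abelian_group smult_additive, of "{..N}" "\<lambda>k. v k \<star> e k" c]
  by (simp add: smult_closed smult_assoc)

lemma lincomb_zero: "(\<And>k. v k \<in> carrier L) \<Longrightarrow> lincomb v N (\<lambda>k. 0) = \<zero>"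
  unfolding lincomb_def by (simp add: finsum_zero)

lemma lincomb_Suc: "(\<And>k. v k \<in> carrier L) \<Longrightarrow> lincomb v (Suc N) e = v (Suc N) \<star> e (Suc N) \<oplus> lincomb v N e"
  unfolding lincomb_def by (simp add: finsum_Suc Pi_def smult_closed)

lemma lincomb_Suc2: "(\<And>k. v k \<in> carrier L) \<Longrightarrow>
    lincomb v (Suc N) e = lincomb (\<lambda>k. v (Suc k)) N (\<lambda>k. e (Suc k)) \<oplus> v 0 \<star> e 0"
  unfolding lincomb_def by (subst finsum_Suc2) (simp_all add: Pi_def smult_closed)

lemma lincomb_single:
  "(\<And>k. v k \<in> carrier L) \<Longrightarrow> j \<le> N \<Longrightarrow> lincomb v N (\<lambda>k. if k = j then c else 0) = v j \<star> c"
proof (induction N)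
  case 0
  then show ?case by (simp add: lincomb_def smult_closed)
next
  case (Suc N)
  show ?case
  proof (cases "j = Suc N")
    case True
    have "lincomb v N (\<lambda>k. if k = j then c else 0) = lincomb v N (\<lambda>k. 0)"
      by (rule lincomb_cong) (use Suc True in auto)
    then show ?thesis using Suc True by (simp add: lincomb_Suc lincomb_zero smult_closed)
  next
    case False
    then show ?thesis using Suc by (simp add: lincomb_Suc smult_closed)
  qed
qed

text \<open>With \<open>v k\<close> read as the monomial \<open>s^(N + 1 - k) t^k\<close>, this
  multiplies a form of degree \<open>N\<close> by \<open>s + t\<close>.\<close>

lemma lincomb_pascal:
  assumes v: "\<And>k. v k \<in> carrier L"
  shows "(\<Oplus>k\<in>{..N}. (v k \<oplus> v (Suc k)) \<star> e k) =
    lincomb v (Suc N) (\<lambda>k. (if k \<le> N then e k else 0) + (if k = 0 then 0 else e (k - 1)))"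
proof -
  have "(\<Oplus>k\<in>{..N}. (v k \<oplus> v (Suc k)) \<star> e k) = lincomb v N e \<oplus> lincomb (\<lambda>k. v (Suc k)) N e"
    unfolding lincomb_def using v by (simp add: smult_l_distr smult_closed finsum_addf Pi_def)
  moreover have "lincomb v (Suc N) (\<lambda>k. if k \<le> N then e k else 0) = lincomb v N e"
    using v lincomb_cong[of N v v "\<lambda>k. if k \<le> N then e k else 0" e] by (simp add: lincomb_Suc lincomb_closed)
  moreover have "lincomb v (Suc N) (\<lambda>k. if k = 0 then 0 else e (k - 1)) = lincomb (\<lambda>k. v (Suc k)) N e"
    using v by (simp add: lincomb_Suc2 lincomb_closed)
  ultimately show ?thesis using v by (simp add: lincomb_add)
qed

lemma lincomb_sum:
  assumes v: "\<And>k. v k \<in> carrier L"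
  shows "(\<Oplus>n\<in>{..M}. lincomb v N (E n) \<star> g n) = lincomb v N (\<lambda>k. \<Sum>n\<le>(M::nat). E n k * g n)"
proof (induction M)
  case 0
  then show ?case using v by (simp add: lincomb_smult lincomb_closed)
next
  case (Suc M)
  then show ?case
    using v lincomb_add[of v N "\<lambda>k. E (Suc M) k * g (Suc M)" "\<lambda>k. \<Sum>n\<le>M. E n k * g n"]
    by (simp add: finsum_Suc Pi_def lincomb_closed smult_closed lincomb_smult add.commute)
qed

text \<open>Plays the part of the monomial \<open>s^l t^k\<close>, where \<open>s\<close> and
  \<open>t\<close> are the actions of ad \<theta> on the first and on the second argument.\<close>

definition bicomm :: "bit \<Rightarrow> 'm \<Rightarrow> bit \<Rightarrow> 'm \<Rightarrow> nat \<Rightarrow> nat \<Rightarrow> ('m \<times> bit) list \<Rightarrow> 'm"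
  where "bicomm pa a pb b l k = conv pb (adn pa a l) (adn pb b k)"

lemma lfun_bicomm: "a \<in> grade L pa \<Longrightarrow> b \<in> grade L pb \<Longrightarrow> lfun (pa + pb) (bicomm pa a pb b l k)"
  unfolding bicomm_def by (intro lfun_conv lfun_adn)

lemma bicomm_closed: "a \<in> grade L pa \<Longrightarrow> b \<in> grade L pb \<Longrightarrow> valid w \<Longrightarrow> bicomm pa a pb b l k w \<in> carrier L"
  using lfun_cfun[OF lfun_bicomm] by (simp add: cfun_def)

text \<open>The Jacobi identity for the even element \<theta>, which brings in no sign: a bracket
  with \<theta> is multiplication by \<open>s + t\<close>.\<close>

lemma conv_theta_bicomm:
  assumes "a \<in> grade L pa" "b \<in> grade L pb" "valid w"
  shows "conv (pa + pb) theta (bicomm pa a pb b l k) w = bicomm pa a pb b (Suc l) k w \<oplus> bicomm pa a pb b l (Suc k) w"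
proof -
  have c: "conv pb (adn pa a l) (conv pb theta (adn pb b k)) w \<in> carrier L"
    using assms by (intro conv_closed cfun_conv cfun_theta cfun_adn)
  show ?thesis
    using conv_jacobi[OF lfun_theta lfun_adn[OF assms(1)] lfun_adn[OF assms(2)] assms(3), of l k] c
    by (simp add: bicomm_def smult_one)
qed

lemma conv_theta_lincomb:
  assumes ab: "a \<in> grade L pa" "b \<in> grade L pb" and w: "valid w" and e: "\<And>k. e k \<in> K 0"
  shows "conv (pa + pb) theta (\<lambda>v. lincomb (\<lambda>k. bicomm pa a pb b (N - k) k v) N e) w =
    lincomb (\<lambda>k. bicomm pa a pb b (Suc N - k) k w) (Suc N)
      (\<lambda>k. (if k \<le> N then e k else 0) + (if k = 0 then 0 else e (k - 1)))"
proof -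
  let ?B = "bicomm pa a pb b"
  have cB: "cfun (?B l k)" for l k by (rule lfun_cfun[OF lfun_bicomm[OF ab]])
  have cs: "cfun (\<lambda>v. F v \<star> \<alpha>)" if "cfun F" for F \<alpha> using that by (simp add: cfun_def smult_closed)
  have "conv (pa + pb) theta (\<lambda>v. lincomb (\<lambda>k. ?B (N - k) k v) N e) w =
      (\<Oplus>k\<in>{..N}. conv (pa + pb) theta (\<lambda>v. ?B (N - k) k v \<star> e k) w)"
    unfolding lincomb_def using cB cs w by (intro conv_finsum cfun_theta) auto
  also have "\<dots> = (\<Oplus>k\<in>{..N}. (?B (Suc N - k) k w \<oplus> ?B (Suc N - Suc k) (Suc k) w) \<star> e k)"
  proof (rule finsum_cong')
    show "(\<lambda>k. (?B (Suc N - k) k w \<oplus> ?B (Suc N - Suc k) (Suc k) w) \<star> e k) \<in> {..N} \<rightarrow> carrier L"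
      using bicomm_closed[OF ab w] by (auto intro!: smult_closed)
    fix k assume "k \<in> {..N}"
    then have k: "Suc N - k = Suc (N - k)" by (simp add: Suc_diff_le)
    show "conv (pa + pb) theta (\<lambda>v. ?B (N - k) k v \<star> e k) w =
        (?B (Suc N - k) k w \<oplus> ?B (Suc N - Suc k) (Suc k) w) \<star> e k"
      unfolding k using cB w e by (simp add: conv_smult_r cfun_theta conv_theta_bicomm[OF ab w])
  qed simp
  also have "\<dots> = lincomb (\<lambda>k. ?B (Suc N - k) k w) (Suc N)
      (\<lambda>k. (if k \<le> N then e k else 0) + (if k = 0 then 0 else e (k - 1)))"
    by (rule lincomb_pascal) (rule bicomm_closed[OF ab w])
  finally show ?thesis .
qed

text \<open>The Leibniz rule for an iterated derivation, that is, the expansion of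
  \<open>(s + t)^n\<close>.\<close>

lemma adn_bracket:
  assumes ab: "a \<in> grade L pa" "b \<in> grade L pb" and w: "valid w"
  shows "adn (pa + pb) (bracket L a b) n w =
    lincomb (\<lambda>k. bicomm pa a pb b (n - k) k w) n (\<lambda>k. of_nat (n choose k))"
  using w
proof (induction n arbitrary: w)
  case 0
  have "bracket L a (hat b w) \<in> carrier L" using ab 0 by (auto simp: hat_def br_closed grade_carrier)
  then show ?case
    using ab 0 conv_hat[OF lfun_cfun[OF lfun_hat[OF ab(2)]] 0 grade_carrier[OF ab(1)], of pb] grade_carrier[OF ab(1)]
    by (simp add: lincomb_def bicomm_def smult_one) (simp add: hat_def)
next
  case (Suc n)
  let ?B = "bicomm pa a pb b"
  have cl: "cfun (\<lambda>v. lincomb (\<lambda>k. ?B (n - k) k v) n (\<lambda>k. of_nat (n choose k)))"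
    using bicomm_closed[OF ab] by (auto simp: cfun_def intro!: lincomb_closed)
  have "adn (pa + pb) (bracket L a b) (Suc n) w =
      conv (pa + pb) theta (\<lambda>v. lincomb (\<lambda>k. ?B (n - k) k v) n (\<lambda>k. of_nat (n choose k))) w"
    unfolding adn.simps
    by (rule conv_theta_cong[OF cfun_adn[OF br_even[OF ab]] cl]) (use Suc in auto)
  also have "\<dots> = lincomb (\<lambda>k. ?B (Suc n - k) k w) (Suc n)
      (\<lambda>k. (if k \<le> n then of_nat (n choose k) else 0) + (if k = 0 then 0 else of_nat (n choose (k - 1))))"
    by (rule conv_theta_lincomb[OF ab Suc(2)]) (rule K_of_nat)
  also have "\<dots> = lincomb (\<lambda>k. ?B (Suc n - k) k w) (Suc n) (\<lambda>k. of_nat (Suc n choose k))"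
  proof (rule lincomb_cong)
    fix k show "(if k \<le> n then of_nat (n choose k) else 0) + (if k = 0 then 0 else of_nat (n choose (k - 1))) =
        (of_nat (Suc n choose k) :: 'k)"
      by (cases k) (auto simp: not_le binomial_eq_0)
  qed (use bicomm_closed[OF ab Suc(2)] in auto)
  finally show ?case .
qed

section \<open>The series on lists and their compositions\<close>

definition phi_list :: "(nat \<Rightarrow> 'k) \<Rightarrow> bit \<Rightarrow> 'm \<Rightarrow> ('m \<times> bit) list \<Rightarrow> 'm"
  where "phi_list f p a w = adn p a (length w) w \<star> f (length w)"

lemma lfun_phi_list: "(\<And>n. f n \<in> K 0) \<Longrightarrow> a \<in> grade L p \<Longrightarrow> lfun p (phi_list f p a)"
  using lfun_adn by (auto simp: lfun_def phi_list_def even_smult_grade)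

text \<open>The coefficient of \<open>s^(N - k) t^k\<close> in \<open>((s + t)^n - s^n) / t\<close>
  times the term of \<phi>(t) of degree \<open>N + 1 - n\<close>. Subtracting \<open>s^n\<close>
  leaves only positive powers of \<open>t\<close> in the numerator; this is the condition.\<close>

definition scoef :: "(nat \<Rightarrow> 'k) \<Rightarrow> nat \<Rightarrow> nat \<Rightarrow> nat \<Rightarrow> 'k"
  where "scoef f N n k = (if Suc N \<le> k + n then of_nat (n choose (k + n - N)) * f (Suc N - n) else 0)"

lemma scoef_K: "(\<And>n. f n \<in> K 0) \<Longrightarrow> scoef f N n k \<in> K 0"
  by (simp add: scoef_def K_mult_0 K_of_nat)

text \<open>In terms of forms: \<open>((s + t)^(n + 1) - s^(n + 1)) / t\<close> equals
  \<open>s + t\<close> times \<open>((s + t)^n - s^n) / t\<close>, plus \<open>s^n\<close>. The last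
  summand is the isolated coefficient at \<open>k = Suc N - n\<close>.\<close>

lemma scoef_Suc:
  assumes "n \<le> Suc N" "k \<le> Suc N"
  shows "scoef f (Suc N) (Suc n) k = (if k \<le> N then scoef f N n k else 0) +
    (if k = 0 then 0 else scoef f N n (k - 1)) + (if k = Suc N - n then f (Suc N - n) else 0)"
proof -
  consider "Suc N > k + n" | "Suc N = k + n" | "Suc N < k + n" by linarith
  then show ?thesis
  proof cases
    case 3
    define j where "j = k + n - Suc N"
    have j: "k + n = j + Suc N" "j > 0" using 3 by (auto simp: j_def)
    have a: "k + Suc n - Suc N = Suc j" "k + n - N = Suc j" "k - 1 + n - N = j" "Suc N - n \<noteq> k" "k \<noteq> 0"
      using j 3 assms by auto
    have z: "of_nat (n choose Suc j) = (0::'k)" if "\<not> k \<le> N"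
    proof -
      have "k = Suc N" using that assms by simp
      then have "n < Suc j" using j by simp
      then have "n choose Suc j = 0" by (rule binomial_eq_0)
      then show ?thesis by (simp only: of_nat_0)
    qed
    show ?thesis
    proof (cases "k \<le> N")
      case True
      then show ?thesis using a j 3 by (simp add: scoef_def distrib_right)
    next
      case False
      then show ?thesis using a j 3 by (simp add: scoef_def distrib_right z[OF False])
    qed
  next
    case 2
    have a: "k + Suc n - Suc N = Suc 0" "k + n - N = Suc 0" "Suc N - n = k" using 2 by auto
    show ?thesis
    proof (cases "k \<le> N")
      case True
      then show ?thesis using a 2 by (auto simp: scoef_def distrib_right)
    next
      case False
      then have "n = 0" "k = Suc N" using 2 assms by auto
      then show ?thesis by (simp add: scoef_def)
    qed
  qed (use assms in \<open>auto simp: scoef_def\<close>)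
qed

text \<open>Composition with the coderivation is a derivation that kills \<open>a\<close> and sends
  \<theta> to the series of \<open>b\<close>, so one more bracket with \<theta> adds the bracket of
  that series with \<open>adn pa a n\<close>. Turning this bracket round gives the overall minus
  sign. The bound on \<open>n\<close> keeps the truncated difference in \<open>scoef\<close>
  exact.\<close>

lemma subst_adn:
  assumes f: "\<And>n. f n \<in> K 0" and ab: "a \<in> grade L pa" "b \<in> grade L pb" and w: "valid w" "n \<le> Suc (length w)"
  shows "subst pb (adn pa a n) (phi_list f pb b) w =
    lincomb (\<lambda>k. bicomm pa a pb b (length w - k) k w) (length w) (scoef f (length w) n) \<star> ksign 1"
  using w
proof (induction n arbitrary: w)
  case 0
  let ?B = "bicomm pa a pb b" and ?N = "length w"
  have "lincomb (\<lambda>k. ?B (?N - k) k w) ?N (scoef f ?N 0) = lincomb (\<lambda>k. ?B (?N - k) k w) ?N (\<lambda>k. 0)"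
    by (rule lincomb_cong) (use 0 bicomm_closed[OF ab] in \<open>auto simp: scoef_def\<close>)
  then show ?case
    using 0 bicomm_closed[OF ab] subst_hat[OF lfun_phi_list[OF f ab(2)], of w a] grade_carrier[OF ab(1)]
    by (simp add: lincomb_zero)
next
  case (Suc n)
  let ?B = "bicomm pa a pb b" and ?N = "length w" and ?u = "phi_list f pb b"
  let ?v = "\<lambda>k. ?B (?N - k) k w"
  have v: "?v k \<in> carrier L" for k using bicomm_closed[OF ab Suc(2)] .
  have u: "lfun pb ?u" by (rule lfun_phi_list[OF f ab(2)])
  have cA: "cfun (adn pa a n)" by (rule cfun_adn[OF ab(1)])
  have nN: "n \<le> ?N" using Suc(3) by simp
  have "conv pa (subst pb theta ?u) (adn pa a n) w = conv pa ?u (adn pa a n) w"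
    by (rule conv_cong) (use subst_theta[OF u] Suc(2) in auto)
  also have "\<dots> = conv pb (adn pa a n) ?u w \<star> ksign (pb * pa + 1)"
    by (rule conv_antisym[OF u lfun_adn[OF ab(1)] Suc(2)])
  also have "conv pb (adn pa a n) ?u w = ?B n (?N - n) w \<star> f (?N - n)"
    unfolding phi_list_def[abs_def] bicomm_def
    by (rule conv_graded[OF cA cfun_adn[OF ab(2)] adn_support[OF ab(1)] f Suc(2) nN])
  finally have 1: "conv pa (subst pb theta ?u) (adn pa a n) w \<star> ksign (pa * pb) = (?v (?N - n) \<star> f (?N - n)) \<star> ksign 1"
    using nN v[of "?N - n"] by (simp add: smult_ksign_ksign smult_closed add.commute mult.commute del: ksign_1)
  \<comment> \<open>The bracket with \<theta> consumes a letter, so the induction hypothesis enters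
    in degree \<open>?N - 1\<close>; on the empty list the bracket is zero, hence the case
    distinction in the coefficients.\<close>
  have "conv (pa + pb) theta (subst pb (adn pa a n) ?u) w =
      lincomb ?v ?N (\<lambda>k. if ?N = 0 then 0 else (if k \<le> ?N - 1 then scoef f (?N - 1) n k else 0) +
        (if k = 0 then 0 else scoef f (?N - 1) n (k - 1))) \<star> ksign 1"
  proof (cases ?N)
    case 0
    then show ?thesis
      using conv_theta_Nil[OF cfun_subst[OF cA u]] v[of 0] by (simp add: lincomb_def)
  next
    case (Suc N)
    let ?F = "\<lambda>v. lincomb (\<lambda>k. ?B (N - k) k v) N (scoef f N n)"
    have cF: "cfun ?F" using bicomm_closed[OF ab] by (auto simp: cfun_def intro!: lincomb_closed)
    have "conv (pa + pb) theta (subst pb (adn pa a n) ?u) w = conv (pa + pb) theta (\<lambda>v. ?F v \<star> ksign 1) w"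
    proof (rule conv_theta_cong[OF cfun_subst[OF cA u] _ _ \<open>valid w\<close>])
      show "cfun (\<lambda>v. ?F v \<star> ksign 1)" using cF by (simp add: cfun_def smult_closed del: ksign_1)
      fix v :: "('m \<times> bit) list" assume "valid v" "Suc (length v) = length w"
      then show "subst pb (adn pa a n) ?u v = ?F v \<star> ksign 1"
        using Suc.IH[of v] nN Suc by simp
    qed
    also have "\<dots> = conv (pa + pb) theta ?F w \<star> ksign 1"
      by (rule conv_smult_r[OF cfun_theta cF \<open>valid w\<close> K_ksign])
    finally show ?thesis
      using conv_theta_lincomb[OF ab \<open>valid w\<close>, of "scoef f N n" N] scoef_K[of f N n] f
      unfolding Suc diff_Suc_1 by simp
  qed
  moreover have "?v (?N - n) \<star> f (?N - n) = lincomb ?v ?N (\<lambda>k. if k = ?N - n then f (?N - n) else 0)"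
    using v by (simp add: lincomb_single)
  ultimately have "subst pb (adn pa a (Suc n)) ?u w =
      lincomb ?v ?N (\<lambda>k. (if k = ?N - n then f (?N - n) else 0) + (if ?N = 0 then 0 else (if k \<le> ?N - 1 then scoef f (?N - 1) n k else 0) +
        (if k = 0 then 0 else scoef f (?N - 1) n (k - 1)))) \<star> ksign 1"
    using subst_conv[OF lfun_theta lfun_adn[OF ab(1)] u Suc(2), of n] v 1
    by (simp add: lincomb_add lincomb_closed smult_l_distr del: ksign_1)
  also have "lincomb ?v ?N (\<lambda>k. (if k = ?N - n then f (?N - n) else 0) + (if ?N = 0 then 0 else (if k \<le> ?N - 1 then scoef f (?N - 1) n k else 0) +
        (if k = 0 then 0 else scoef f (?N - 1) n (k - 1)))) = lincomb ?v ?N (scoef f ?N (Suc n))"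
  proof (rule lincomb_cong)
    fix k assume k: "k \<le> ?N"
    show "(if k = ?N - n then f (?N - n) else 0) + (if ?N = 0 then 0 else (if k \<le> ?N - 1 then scoef f (?N - 1) n k else 0) +
        (if k = 0 then 0 else scoef f (?N - 1) n (k - 1))) = scoef f ?N (Suc n) k"
    proof (cases ?N)
      case 0
      then show ?thesis using k nN by (simp add: scoef_def)
    next
      case (Suc N)
      then show ?thesis using scoef_Suc[of n N k f] k nN by (auto simp: add.commute)
    qed
  qed (use v in auto)
  finally show ?case .
qed

text \<open>The coefficient of \<open>s^(N - k) t^k\<close> in
  \<open>\<phi>(t) (\<phi>(s + t) - \<phi>(s)) / t\<close>, with \<open>m\<close> the degree
  contributed by the factor \<phi>(t). In terms of \<open>scoef\<close> it is the sum over
  \<open>n = Suc N - m\<close>.\<close>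

definition pcoef :: "(nat \<Rightarrow> 'k) \<Rightarrow> nat \<Rightarrow> nat \<Rightarrow> 'k"
  where "pcoef f N k = (\<Sum>m\<le>k. f m * f (Suc N - m) * of_nat ((Suc N - m) choose (Suc k - m)))"

lemma scoef_sum:
  assumes "k \<le> N"
  shows "(\<Sum>n\<le>Suc N. scoef f N n k * f n) = pcoef f N k"
proof -
  have "(\<Sum>n\<le>Suc N. scoef f N n k * f n) = (\<Sum>n\<in>{Suc N - k..Suc N}. scoef f N n k * f n)"
    by (rule sum.mono_neutral_right) (use assms in \<open>auto simp: scoef_def\<close>)
  also have "\<dots> = pcoef f N k"
    unfolding pcoef_def
  proof (rule sum.reindex_bij_witness[of _ "\<lambda>m. Suc N - m" "\<lambda>n. Suc N - n"])
    fix n assume n: "n \<in> {Suc N - k..Suc N}"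
    then have e: "Suc N - (Suc N - n) = n" "Suc k - (Suc N - n) = k + n - N" "Suc N \<le> k + n" by auto
    show "f (Suc N - n) * f (Suc N - (Suc N - n)) * of_nat ((Suc N - (Suc N - n)) choose (Suc k - (Suc N - n))) =
        scoef f N n k * f n"
      unfolding e scoef_def using e(3) by (simp add: mult_of_nat_commute mult.assoc)
  qed (use assms in auto)
  finally show ?thesis .
qed

lemma subst_phi_list:
  assumes f: "\<And>n. f n \<in> K 0" and ab: "a \<in> grade L pa" "b \<in> grade L pb" and w: "valid w"
  shows "subst pb (phi_list f pa a) (phi_list f pb b) w =
    lincomb (\<lambda>k. bicomm pa a pb b (length w - k) k w) (length w) (pcoef f (length w)) \<star> ksign 1"
proof -
  let ?B = "bicomm pa a pb b" and ?N = "length w" and ?u = "phi_list f pb b"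
  let ?v = "\<lambda>k. ?B (?N - k) k w"
  have v: "?v k \<in> carrier L" for k using bicomm_closed[OF ab w] .
  have u: "lfun pb ?u" by (rule lfun_phi_list[OF f ab(2)])
  have cs: "cfun (\<lambda>v. adn pa a n v \<star> \<alpha>)" for n \<alpha> using cfun_adn[OF ab(1)] by (simp add: cfun_def smult_closed)
  \<comment> \<open>The composition meets only lists of length at most \<open>Suc ?N\<close>. On
    these the series is a finite sum of the maps \<open>adn\<close>, each of which vanishes off its
    own length.\<close>
  have "subst pb (phi_list f pa a) ?u w = subst pb (\<lambda>v. \<Oplus>n\<in>{..Suc ?N}. adn pa a n v \<star> f n) ?u w"
  proof (rule subst_cong[OF _ u w])
    fix v :: "('m \<times> bit) list" assume h: "valid v" "length v \<le> Suc ?N"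
    have c: "adn pa a n v \<in> carrier L" for n using cfun_adn[OF ab(1)] h by (simp add: cfun_def)
    have "(\<Oplus>n\<in>{..Suc ?N}. adn pa a n v \<star> f n) = lincomb (\<lambda>n. adn pa a n v) (Suc ?N) (\<lambda>n. if n = length v then f n else 0)"
      unfolding lincomb_def
    proof (rule finsum_cong')
      fix n show "adn pa a n v \<star> f n = adn pa a n v \<star> (if n = length v then f n else 0)"
        using adn_support[OF ab(1) h(1), of n] c by auto
    qed (use c in \<open>auto intro: smult_closed\<close>)
    also have "\<dots> = lincomb (\<lambda>n. adn pa a n v) (Suc ?N) (\<lambda>n. if n = length v then f (length v) else 0)"
      by (rule lincomb_cong) (use c in auto)
    also have "\<dots> = phi_list f pa a v" unfolding phi_list_def by (rule lincomb_single) (use c h in auto)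
    finally show "phi_list f pa a v = (\<Oplus>n\<in>{..Suc ?N}. adn pa a n v \<star> f n)" by simp
  qed
  also have "\<dots> = (\<Oplus>n\<in>{..Suc ?N}. subst pb (\<lambda>v. adn pa a n v \<star> f n) ?u w)"
    by (rule subst_finsum[OF u cs w])
  also have "\<dots> = (\<Oplus>n\<in>{..Suc ?N}. lincomb ?v ?N (scoef f ?N n) \<star> (ksign 1 * f n))"
  proof (rule finsum_cong')
    show "(\<lambda>n. lincomb ?v ?N (scoef f ?N n) \<star> (ksign 1 * f n)) \<in> {..Suc ?N} \<rightarrow> carrier L"
      using v by (auto intro!: smult_closed lincomb_closed)
    fix n assume n: "n \<in> {..Suc ?N}"
    have c: "lincomb ?v ?N (scoef f ?N n) \<in> carrier L" using v by (rule lincomb_closed)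
    show "subst pb (\<lambda>v. adn pa a n v \<star> f n) ?u w = lincomb ?v ?N (scoef f ?N n) \<star> (ksign 1 * f n)"
      using subst_smult[OF cfun_adn[OF ab(1)] u w f, of n n] subst_adn[OF f ab w, of n] n c
      by (simp add: smult_assoc del: ksign_1)
  qed simp
  also have "\<dots> = lincomb ?v ?N (\<lambda>k. \<Sum>n\<le>Suc ?N. scoef f ?N n k * (ksign 1 * f n))"
    using v by (rule lincomb_sum)
  also have "\<dots> = lincomb ?v ?N (\<lambda>k. pcoef f ?N k * ksign 1)"
    by (rule lincomb_cong) (use v in \<open>auto simp: scoef_sum[symmetric] sum_negf simp del: sum.atMost_Suc\<close>)
  finally show ?thesis using v by (simp add: lincomb_smult del: ksign_1)
qed

text \<open>The second composition is a form in the brackets of \<open>b\<close> with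
  \<open>a\<close>. Antisymmetry rewrites it in those of \<open>a\<close> with \<open>b\<close> and
  reverses the index, so the coefficients at \<open>k\<close> and \<open>?N - k\<close> are added,
  as in \<open>id\<close>.\<close>

theorem phi_list_commutator:
  assumes f: "\<And>n. f n \<in> K 0"
    and id: "\<And>k l. pcoef f (k + l) k + pcoef f (k + l) l = - f (k + l) * of_nat ((k + l) choose k)"
    and ab: "a \<in> grade L pa" "b \<in> grade L pb" and w: "valid w"
  shows "subst pb (phi_list f pa a) (phi_list f pb b) w \<oplus>
      subst pa (phi_list f pb b) (phi_list f pa a) w \<star> ksign (pa * pb + 1) =
    phi_list f (pa + pb) (bracket L a b) w"
proof -
  let ?B = "bicomm pa a pb b" and ?N = "length w"
  let ?v = "\<lambda>k. ?B (?N - k) k w"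
  have v: "?v k \<in> carrier L" for k using bicomm_closed[OF ab w] .
  have B: "?B l k w \<in> carrier L" for l k using bicomm_closed[OF ab w] .
  have sw: "bicomm pb b pa a l k w = ?B k l w \<star> ksign (pa * pb + 1)" for k l
    unfolding bicomm_def using conv_antisym[OF lfun_adn[OF ab(2)] lfun_adn[OF ab(1)] w] by (simp add: mult.commute)
  have "subst pa (phi_list f pb b) (phi_list f pa a) w \<star> ksign (pa * pb + 1) =
      lincomb (\<lambda>k. ?B k (?N - k) w \<star> ksign (pa * pb + 1)) ?N (pcoef f ?N) \<star> ksign 1 \<star> ksign (pa * pb + 1)"
    unfolding subst_phi_list[OF f ab(2,1) w] sw ..
  also have "\<dots> = lincomb (\<lambda>k. ?B k (?N - k) w) ?N (pcoef f ?N) \<star> ksign 1"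
  proof -
    have "lincomb (\<lambda>k. ?B k (?N - k) w \<star> ksign (pa * pb + 1)) ?N (pcoef f ?N) =
        lincomb (\<lambda>k. ?B k (?N - k) w) ?N (\<lambda>k. ksign (pa * pb + 1) * pcoef f ?N k)"
      unfolding lincomb_def using B by (simp add: smult_assoc)
    also have "\<dots> = lincomb (\<lambda>k. ?B k (?N - k) w) ?N (pcoef f ?N) \<star> ksign (pa * pb + 1)"
      using B by (simp add: lincomb_smult ksign_commute)
    finally show ?thesis
      using B lincomb_closed[of "\<lambda>k. ?B k (?N - k) w" ?N "pcoef f ?N"] by (simp add: smult_ksign_ksign bit_ac del: ksign_1)
  qed
  also have "lincomb (\<lambda>k. ?B k (?N - k) w) ?N (pcoef f ?N) = lincomb ?v ?N (\<lambda>k. pcoef f ?N (?N - k))"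
  proof -
    have "(\<lambda>k. ?N - k) ` {..?N} = {..?N}"
    proof
      show "{..?N} \<subseteq> (\<lambda>k. ?N - k) ` {..?N}"
      proof
        fix k assume "k \<in> {..?N}"
        then have "k = ?N - (?N - k)" "?N - k \<in> {..?N}" by auto
        then show "k \<in> (\<lambda>k. ?N - k) ` {..?N}" by (rule image_eqI)
      qed
    qed auto
    moreover have "inj_on (\<lambda>k. ?N - k) {..?N}" by (auto simp: inj_on_def)
    ultimately have "lincomb (\<lambda>k. ?B k (?N - k) w) ?N (pcoef f ?N) =
        (\<Oplus>k\<in>{..?N}. ?B (?N - k) (?N - (?N - k)) w \<star> pcoef f ?N (?N - k))"
      using finsum_reindex[of "\<lambda>k. ?B k (?N - k) w \<star> pcoef f ?N k" "\<lambda>k. ?N - k" "{..?N}"] B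
      by (simp add: lincomb_def smult_closed Pi_def)
    also have "\<dots> = lincomb ?v ?N (\<lambda>k. pcoef f ?N (?N - k))"
      unfolding lincomb_def by (rule finsum_cong') (use B smult_closed in auto)
    finally show ?thesis .
  qed
  finally have "subst pb (phi_list f pa a) (phi_list f pb b) w \<oplus>
      subst pa (phi_list f pb b) (phi_list f pa a) w \<star> ksign (pa * pb + 1) =
    lincomb ?v ?N (\<lambda>k. pcoef f ?N k + pcoef f ?N (?N - k)) \<star> ksign 1"
    unfolding subst_phi_list[OF f ab w]
    using v lincomb_closed[of ?v] by (simp add: lincomb_add smult_l_distr del: ksign_1)
  also have "\<dots> = lincomb ?v ?N (\<lambda>k. (pcoef f ?N k + pcoef f ?N (?N - k)) * ksign 1)"
    using v by (rule lincomb_smult)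
  also have "\<dots> = lincomb ?v ?N (\<lambda>k. of_nat (?N choose k) * f ?N)"
  proof (rule lincomb_cong)
    fix k assume "k \<le> ?N"
    then have "pcoef f ?N k + pcoef f ?N (?N - k) = - f ?N * of_nat (?N choose k)" using id[of k "?N - k"] by simp
    then show "(pcoef f ?N k + pcoef f ?N (?N - k)) * ksign 1 = of_nat (?N choose k) * f ?N"
      by (simp add: mult_of_nat_commute)
  qed (use v in auto)
  also have "\<dots> = phi_list f (pa + pb) (bracket L a b) w"
    unfolding phi_list_def adn_bracket[OF ab w] using v by (simp add: lincomb_smult)
  finally show ?thesis .
qed

end

section \<open>Sums over permutations\<close>

lemma (in abelian_monoid) finsum_lessThan_Suc_shift:
  "(\<And>i. f i \<in> carrier G) \<Longrightarrow> (\<Oplus>i\<in>{..<Suc n}. f i) = f 0 \<oplus> (\<Oplus>i\<in>{..<n}. f (Suc i))"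
proof (induction n)
  case 0
  then show ?case by (simp add: lessThan_Suc)
next
  case (Suc n)
  then show ?case
    by (subst lessThan_Suc, subst finsum_insert) (auto simp: lessThan_Suc[of n] a_ac)
qed

section \<open>Permutations sorted by their first value\<close>

definition delete_nth :: "nat \<Rightarrow> 'a list \<Rightarrow> 'a list"
  where "delete_nth i w = take i w @ drop (Suc i) w"

text \<open>The increasing enumeration of all numbers except \<open>i\<close>: it turns positions in
  \<open>delete_nth i w\<close> into positions in \<open>w\<close>.\<close>

definition skip :: "nat \<Rightarrow> nat \<Rightarrow> nat"
  where "skip i k = (if k < i then k else Suc k)"

text \<open>The ordering that takes the letter at \<open>i\<close> first and arranges the remaining
  ones by \<open>s\<close>.\<close>

definition perm_cons :: "nat \<Rightarrow> (nat \<Rightarrow> nat) \<Rightarrow> nat \<Rightarrow> nat"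
  where "perm_cons i s = case_nat i (\<lambda>j. skip i (s j))"

lemma delete_nth_simps [simp]:
  "delete_nth 0 (x # w) = w" "delete_nth (Suc i) (x # w) = x # delete_nth i w"
  "map f (delete_nth i w) = delete_nth i (map f w)"
  by (simp_all add: delete_nth_def take_map drop_map)

lemma length_delete_nth: "i < length w \<Longrightarrow> length (delete_nth i w) = length w - 1"
  by (simp add: delete_nth_def)

lemma nth_delete_nth: "i < length w \<Longrightarrow> k < length w - 1 \<Longrightarrow> delete_nth i w ! k = w ! skip i k"
  by (auto simp: delete_nth_def skip_def nth_append min_def)

lemma skip_less_iff [simp]: "skip i a < skip i b \<longleftrightarrow> a < b" "skip i a < i \<longleftrightarrow> a < i"
  by (auto simp: skip_def)

lemma skip_inj [simp]: "skip i a = skip i b \<longleftrightarrow> a = b"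
  by (auto simp: skip_def split: if_splits)

lemma skip_neq [simp]: "skip i a \<noteq> i"
  by (auto simp: skip_def)

lemma perm_cons_simps [simp]: "perm_cons i s 0 = i" "perm_cons i s (Suc j) = skip i (s j)"
  by (simp_all add: perm_cons_def)

lemma perm_cons_inj: "perm_cons i s = perm_cons i' s' \<longleftrightarrow> i = i' \<and> s = s'"
proof
  assume e: "perm_cons i s = perm_cons i' s'"
  have i: "i = i'" using fun_cong[OF e, of 0] by simp
  moreover have "s j = s' j" for j using fun_cong[OF e, of "Suc j"] i by simp
  ultimately show "i = i' \<and> s = s'" by auto
qed auto

lemma perm_cons_permutes:
  assumes s: "s permutes {..<n}" and i: "i < Suc n"
  shows "perm_cons i s permutes {..<Suc n}"
proof (rule bij_imp_permutes)
  let ?f = "perm_cons i s"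
  have "inj ?f"
  proof (rule injI)
    fix a b assume "?f a = ?f b"
    then show "a = b" using permutes_inj[OF s] by (cases a; cases b) (auto simp: inj_eq dest: sym)
  qed
  then have inj: "inj_on ?f {..<Suc n}" by (rule inj_on_subset) simp
  have "?f ` {..<Suc n} \<subseteq> {..<Suc n}"
  proof
    fix y assume "y \<in> ?f ` {..<Suc n}"
    then obtain j where j: "j < Suc n" "y = ?f j" by auto
    show "y \<in> {..<Suc n}"
    proof (cases j)
      case (Suc j')
      then have "s j' < n" using permutes_in_image[OF s, of j'] j by simp
      then show ?thesis using Suc j by (simp add: skip_def)
    qed (use i j in simp)
  qed
  then have "?f ` {..<Suc n} = {..<Suc n}" using inj by (intro endo_inj_surj) auto
  then show "bij_betw ?f {..<Suc n} {..<Suc n}" using inj by (simp add: bij_betw_def)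
  fix x assume "x \<notin> {..<Suc n}"
  then obtain j where j: "x = Suc j" "j \<ge> n" by (cases x) auto
  then have "s j = j" using permutes_not_in[OF s, of j] by simp
  then show "?f x = x" using i j by (simp add: skip_def)
qed

text \<open>Counting spares the construction of a decomposition: the \<open>Suc n\<close> images are
  disjoint with \<open>fact n\<close> elements each, and together they have as many elements as
  there are permutations.\<close>

lemma permutes_Suc_eq:
  "{s. s permutes {..<Suc n}} = (\<Union>i\<in>{..<Suc n}. perm_cons i ` {s. s permutes {..<n}})"
    (is "?P (Suc n) = ?U")
proof -
  have fin: "finite (?P n)" for n by (simp add: finite_permutations)
  have cP: "card (?P n) = fact n" for n by (rule card_permutations) auto
  have sub: "?U \<subseteq> ?P (Suc n)" using perm_cons_permutes by auto
  have "card ?U = (\<Sum>i\<in>{..<Suc n}. card (perm_cons i ` ?P n))"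
    by (rule card_UN_disjoint) (auto simp: fin perm_cons_inj simp del: lessThan_iff)
  also have "\<dots> = (\<Sum>i\<in>{..<Suc n}. fact n)"
    by (rule sum.cong) (auto simp: card_image inj_on_def perm_cons_inj cP)
  also have "\<dots> = card (?P (Suc n))" by (simp add: cP)
  finally show ?thesis using card_subset_eq[OF fin sub] by simp
qed

lemma koszul_sum:
  "koszul ps s = (\<Sum>j<length ps. \<Sum>i<j. if s j < s i then ps ! s i * ps ! s j else 0)"
proof -
  have "koszul ps s = (\<Sum>(j, i)\<in>(SIGMA j:{..<length ps}. {i\<in>{..<j}. s j < s i}). ps ! s i * ps ! s j)"
    unfolding koszul_def
    by (rule sum.reindex_bij_witness[of _ prod.swap prod.swap]) auto
  also have "\<dots> = (\<Sum>j<length ps. \<Sum>i\<in>{i\<in>{..<j}. s j < s i}. ps ! s i * ps ! s j)"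
    by (subst sum.Sigma[symmetric]) auto
  also have "\<dots> = (\<Sum>j<length ps. \<Sum>i<j. if s j < s i then ps ! s i * ps ! s j else 0)"
    by (intro sum.cong refl sum.inter_filter) simp
  finally show ?thesis .
qed

text \<open>The inversions that involve the first value are those with the letters standing before
  \<open>i\<close>, which the letter at \<open>i\<close> has to pass; all other inversions are those
  of \<open>s\<close> in the shortened list.\<close>

lemma koszul_perm_cons:
  assumes s: "s permutes {..<n}" and i: "i < Suc n" and n: "length ps = Suc n"
  shows "koszul ps (perm_cons i s) = ps ! i * sum_list (take i ps) + koszul (delete_nth i ps) s"
proof -
  have d: "length (delete_nth i ps) = n" using i n by (simp add: length_delete_nth)
  have nd: "delete_nth i ps ! s j = ps ! skip i (s j)" if "j < n" for j
    using nth_delete_nth[of i ps "s j"] permutes_in_image[OF s, of j] that i n by simp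
  \<comment> \<open>Which letters stand before \<open>i\<close> does not depend on their later
    order, so the sum may be reindexed along \<open>s\<close>.\<close>
  have "(\<Sum>j<n. if s j < i then ps ! i * ps ! skip i (s j) else 0) =
      (\<Sum>j<n. (\<lambda>k. if k < i then ps ! i * ps ! k else 0) (s j))"
    by (rule sum.cong) (auto simp: skip_def)
  also have "\<dots> = (\<Sum>k<n. if k < i then ps ! i * ps ! k else 0)"
    using sum.permute[OF s, of "\<lambda>k. if k < i then ps ! i * ps ! k else 0"] by (simp add: comp_def)
  also have "\<dots> = (\<Sum>k\<in>{k\<in>{..<n}. k < i}. ps ! i * ps ! k)" by (rule sum.inter_filter[symmetric]) simp
  also have "{k\<in>{..<n}. k < i} = {..<i}" using i by auto
  also have "(\<Sum>k<i. ps ! i * ps ! k) = ps ! i * sum_list (take i ps)"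
    using i n by (simp add: sum_list_sum_nth sum_distrib_left atLeast0LessThan)
  finally have 1: "(\<Sum>j<n. if s j < i then ps ! i * ps ! skip i (s j) else 0) = ps ! i * sum_list (take i ps)" .
  have "koszul ps (perm_cons i s) = (\<Sum>j<n. (if s j < i then ps ! i * ps ! skip i (s j) else 0) +
      (\<Sum>k<j. if s j < s k then ps ! skip i (s k) * ps ! skip i (s j) else 0))"
    unfolding koszul_sum n sum.lessThan_Suc_shift perm_cons_simps by (simp cong: if_cong)
  also have "\<dots> = ps ! i * sum_list (take i ps) + (\<Sum>j<n. \<Sum>k<j. if s j < s k then ps ! skip i (s k) * ps ! skip i (s j) else 0)"
    by (simp add: sum.distrib 1)
  also have "(\<Sum>j<n. \<Sum>k<j. if s j < s k then ps ! skip i (s k) * ps ! skip i (s j) else 0) = koszul (delete_nth i ps) s"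
    unfolding koszul_sum d by (intro sum.cong refl) (use nd in auto)
  finally show ?thesis .
qed

section \<open>The sum of nested brackets over permutations as an iterated convolution
  bracket\<close>

context lie_superalgebra
begin

lemma valid_nth: "valid w \<Longrightarrow> i < length w \<Longrightarrow> fst (w ! i) \<in> grade L (snd (w ! i))"
  by (induction w arbitrary: i) (auto simp: nth_Cons split: nat.splits)

lemma valid_delete_nth: "valid w \<Longrightarrow> valid (delete_nth i w)"
  by (auto simp: valid_def delete_nth_def dest: in_set_takeD in_set_dropD)

lemma par_delete_nth: "i < length w \<Longrightarrow> par w = snd (w ! i) + par (delete_nth i w)"
  by (induction w arbitrary: i) (auto simp: nth_Cons bit_ac split: nat.splits)

text \<open>Each letter in turn is the one that \<theta> consumes. Its sign comes from passing the
  letters before it and the map \<open>F\<close> of parity \<open>q\<close>.\<close>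

lemma conv_theta_sum:
  "cfun F \<Longrightarrow> valid w \<Longrightarrow> conv q theta F w = (\<Oplus>i\<in>{..<length w}.
    bracket L (fst (w ! i)) (F (delete_nth i w)) \<star> ksign (snd (w ! i) * (q + par (take i w))))"
proof (induction w arbitrary: q F)
  case Nil
  then show ?case using conv_theta_Nil[OF Nil(1), of q] by (simp del: conv.simps)
next
  case (Cons x w)
  have x: "fst x \<in> grade L (snd x)" and w: "valid w" using Cons by simp_all
  have c: "i < length (x # w) \<Longrightarrow> bracket L (fst ((x # w) ! i)) (F (delete_nth i (x # w))) \<star> \<alpha> \<in> carrier L" for i \<alpha>
    using grade_carrier[OF valid_nth[OF Cons(3), of i]] valid_delete_nth[OF Cons(3), of i] cfunD[OF Cons(2)]
    by (intro smult_closed br_closed) auto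
  let ?g = "\<lambda>i. if i < length (x # w) then bracket L (fst ((x # w) ! i)) (F (delete_nth i (x # w))) \<star>
      ksign (snd ((x # w) ! i) * (q + par (take i (x # w)))) else \<zero>"
  have "(\<Oplus>i\<in>{..<length (x # w)}. bracket L (fst ((x # w) ! i)) (F (delete_nth i (x # w))) \<star>
      ksign (snd ((x # w) ! i) * (q + par (take i (x # w))))) = (\<Oplus>i\<in>{..<Suc (length w)}. ?g i)"
    by (rule finsum_cong') (use c in auto)
  also have "\<dots> = ?g 0 \<oplus> (\<Oplus>i\<in>{..<length w}. ?g (Suc i))"
    by (rule finsum_lessThan_Suc_shift) (use c in auto)
  also have "(\<Oplus>i\<in>{..<length w}. ?g (Suc i)) = (\<Oplus>i\<in>{..<length w}.
      bracket L (fst (w ! i)) (der x F (delete_nth i w)) \<star> ksign (snd (w ! i) * (q + snd x + par (take i w))))"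
  proof (rule finsum_cong')
    show "(\<lambda>i. bracket L (fst (w ! i)) (der x F (delete_nth i w)) \<star> ksign (snd (w ! i) * (q + snd x + par (take i w))))
        \<in> {..<length w} \<rightarrow> carrier L"
    proof
      fix i assume "i \<in> {..<length w}"
      then show "bracket L (fst (w ! i)) (der x F (delete_nth i w)) \<star> ksign (snd (w ! i) * (q + snd x + par (take i w))) \<in> carrier L"
        using c[of "Suc i"] by (simp add: der_def)
    qed
  qed (simp_all add: der_def add.assoc)
  also have "\<dots> = conv (q + snd x) theta (der x F) w"
    by (rule Cons(1)[OF cfun_der[OF Cons(2) x] w, symmetric])
  finally show ?case unfolding conv_theta_Cons[OF Cons(2,3)] by (simp add: mult.commute)
qed

text \<open>The recursion of \<open>adn\<close> stripped of the signs that involve the parity of the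
  innermost element, so that it makes sense for inhomogeneous \<open>a\<close> and is additive in
  \<open>a\<close>.\<close>

fun symad :: "nat \<Rightarrow> 'm \<Rightarrow> ('m \<times> bit) list \<Rightarrow> 'm"
  where
    "symad 0 a w = a"
  | "symad (Suc n) a w = (\<Oplus>i\<in>{..<Suc n}.
      bracket L (fst (w ! i)) (symad n a (delete_nth i w)) \<star> ksign (snd (w ! i) * par (take i w)))"

lemma symad_closed: "a \<in> carrier L \<Longrightarrow> valid w \<Longrightarrow> length w = n \<Longrightarrow> symad n a w \<in> carrier L"
proof (induction n arbitrary: w)
  case (Suc n)
  show ?case
    unfolding symad.simps
  proof (rule finsum_closed, rule)
    fix i assume "i \<in> {..<Suc n}"
    then show "bracket L (fst (w ! i)) (symad n a (delete_nth i w)) \<star> ksign (snd (w ! i) * par (take i w)) \<in> carrier L"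
      using Suc valid_nth[of w i] by (intro smult_closed br_closed) (auto simp: grade_carrier valid_delete_nth length_delete_nth)
  qed
qed simp

lemma symad_term_closed:
  assumes "a \<in> carrier L" "valid w" "length w = Suc n" "i < Suc n"
  shows "bracket L (fst (w ! i)) (symad n a (delete_nth i w)) \<in> carrier L"
  using assms valid_nth[of w i] by (intro br_closed symad_closed) (auto simp: grade_carrier valid_delete_nth length_delete_nth)

lemma symad_additive: "valid w \<Longrightarrow> length w = n \<Longrightarrow> additive_map L L (\<lambda>a. symad n a w)"
proof (induction n arbitrary: w)
  case (Suc n)
  show ?case
  proof (rule additive_mapI)
    fix a b assume ab: "a \<in> carrier L" "b \<in> carrier L"
    note c = symad_term_closed[OF ab(1) Suc(2,3)] symad_term_closed[OF ab(2) Suc(2,3)]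
    have "symad (Suc n) (a \<oplus> b) w = (\<Oplus>i\<in>{..<Suc n}.
        bracket L (fst (w ! i)) (symad n a (delete_nth i w)) \<star> ksign (snd (w ! i) * par (take i w)) \<oplus>
        bracket L (fst (w ! i)) (symad n b (delete_nth i w)) \<star> ksign (snd (w ! i) * par (take i w)))"
      unfolding symad.simps
    proof (rule finsum_cong')
      fix i assume i: "i \<in> {..<Suc n}"
      have "symad n (a \<oplus> b) (delete_nth i w) = symad n a (delete_nth i w) \<oplus> symad n b (delete_nth i w)"
        using Suc i ab by (intro additive_map_add[OF Suc(1)]) (auto simp: valid_delete_nth length_delete_nth)
      moreover have "symad n a (delete_nth i w) \<in> carrier L" "symad n b (delete_nth i w) \<in> carrier L"
        using Suc i ab by (auto intro!: symad_closed simp: valid_delete_nth length_delete_nth)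
      moreover have "fst (w ! i) \<in> carrier L" using valid_nth[OF Suc(2), of i] Suc(3) i grade_carrier by simp
      ultimately show "bracket L (fst (w ! i)) (symad n (a \<oplus> b) (delete_nth i w)) \<star> ksign (snd (w ! i) * par (take i w)) =
          bracket L (fst (w ! i)) (symad n a (delete_nth i w)) \<star> ksign (snd (w ! i) * par (take i w)) \<oplus>
          bracket L (fst (w ! i)) (symad n b (delete_nth i w)) \<star> ksign (snd (w ! i) * par (take i w))"
        by (simp add: br_r_distr smult_l_distr br_closed)
    qed (use c in \<open>auto intro!: smult_closed\<close>)
    also have "\<dots> = symad (Suc n) a w \<oplus> symad (Suc n) b w"
      unfolding symad.simps by (rule finsum_addf) (use c in \<open>auto intro!: smult_closed\<close>)
    finally show "symad (Suc n) (a \<oplus> b) w = symad (Suc n) a w \<oplus> symad (Suc n) b w" .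
  qed (rule symad_closed[OF _ Suc(2,3)])
qed (simp add: additive_map_def)

lemma symad_smult:
  "valid w \<Longrightarrow> length w = n \<Longrightarrow> a \<in> carrier L \<Longrightarrow> symad n (a \<star> \<alpha>) w = symad n a w \<star> \<alpha>"
proof (induction n arbitrary: w)
  case (Suc n)
  note c = symad_term_closed[OF Suc(4,2,3)]
  have "symad (Suc n) (a \<star> \<alpha>) w = (\<Oplus>i\<in>{..<Suc n}.
      bracket L (fst (w ! i)) (symad n a (delete_nth i w)) \<star> ksign (snd (w ! i) * par (take i w)) \<star> \<alpha>)"
    unfolding symad.simps
  proof (rule finsum_cong')
    fix i assume i: "i \<in> {..<Suc n}"
    have "symad n (a \<star> \<alpha>) (delete_nth i w) = symad n a (delete_nth i w) \<star> \<alpha>"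
      using Suc i by (intro Suc(1)) (auto simp: valid_delete_nth length_delete_nth)
    moreover have "symad n a (delete_nth i w) \<in> carrier L"
      using Suc i by (auto intro!: symad_closed simp: valid_delete_nth length_delete_nth)
    moreover have "fst (w ! i) \<in> carrier L" using valid_nth[OF Suc(2), of i] Suc(3) i grade_carrier by simp
    ultimately show "bracket L (fst (w ! i)) (symad n (a \<star> \<alpha>) (delete_nth i w)) \<star> ksign (snd (w ! i) * par (take i w)) =
        bracket L (fst (w ! i)) (symad n a (delete_nth i w)) \<star> ksign (snd (w ! i) * par (take i w)) \<star> \<alpha>"
      by (simp add: br_linear smult_ksign_commute br_closed)
  qed (use c in \<open>auto intro!: smult_closed\<close>)
  also have "\<dots> = symad (Suc n) a w \<star> \<alpha>"
    unfolding symad.simps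
    by (rule additive_map_finsum[OF abelian_group abelian_group smult_additive, symmetric])
      (use c in \<open>auto intro!: smult_closed\<close>)
  finally show ?case .
qed simp

text \<open>Every consumed letter passes \<open>a\<close> once. The accumulated sign is the one in
  front of the sum in the definition of \<phi>^a.\<close>

lemma adn_symad:
  "a \<in> grade L p \<Longrightarrow> valid w \<Longrightarrow> length w = n \<Longrightarrow> adn p a n w = symad n a w \<star> ksign (p * par w)"
proof (induction n arbitrary: w)
  case 0
  then show ?case using grade_carrier by (simp add: hat_def smult_one)
next
  case (Suc n)
  note c = symad_term_closed[OF grade_carrier[OF Suc(2)] Suc(3,4)]
  have "adn p a (Suc n) w = (\<Oplus>i\<in>{..<Suc n}.
      bracket L (fst (w ! i)) (adn p a n (delete_nth i w)) \<star> ksign (snd (w ! i) * (p + par (take i w))))"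
    unfolding adn.simps using conv_theta_sum[OF cfun_adn[OF Suc(2)] Suc(3), of p n] Suc(4) by simp
  also have "\<dots> = (\<Oplus>i\<in>{..<Suc n}.
      bracket L (fst (w ! i)) (symad n a (delete_nth i w)) \<star> ksign (snd (w ! i) * par (take i w)) \<star> ksign (p * par w))"
  proof (rule finsum_cong')
    fix i assume i: "i \<in> {..<Suc n}"
    have e: "adn p a n (delete_nth i w) = symad n a (delete_nth i w) \<star> ksign (p * par (delete_nth i w))"
      using Suc i by (intro Suc(1)) (auto simp: valid_delete_nth length_delete_nth)
    have s: "symad n a (delete_nth i w) \<in> carrier L"
      using Suc i grade_carrier by (auto intro!: symad_closed simp: valid_delete_nth length_delete_nth)
    have x: "fst (w ! i) \<in> carrier L" using valid_nth[OF Suc(3), of i] Suc(4) i grade_carrier by simp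
    have "par w = snd (w ! i) + par (delete_nth i w)" using i Suc(4) by (intro par_delete_nth) simp
    then show "bracket L (fst (w ! i)) (adn p a n (delete_nth i w)) \<star> ksign (snd (w ! i) * (p + par (take i w))) =
        bracket L (fst (w ! i)) (symad n a (delete_nth i w)) \<star> ksign (snd (w ! i) * par (take i w)) \<star> ksign (p * par w)"
      using s x by (simp add: e br_linear br_closed smult_ksign_ksign) (simp add: bit_ac)
  qed (use c in \<open>auto intro!: smult_closed\<close>)
  also have "\<dots> = symad (Suc n) a w \<star> ksign (p * par w)"
    unfolding symad.simps
    by (rule additive_map_finsum[OF abelian_group abelian_group smult_additive, symmetric])
      (use c in \<open>auto intro!: smult_closed\<close>)
  finally show ?case .
qed

definition perm_term :: "('m \<times> bit) list \<Rightarrow> 'm \<Rightarrow> (nat \<Rightarrow> nat) \<Rightarrow> 'm"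
  where "perm_term w a s = foldr (\<lambda>i. bracket L (fst (w ! s i))) [0..<length w] a \<star> ksign (koszul (map snd w) s)"

lemma foldr_bracket_closed:
  "(\<And>i. i \<in> set I \<Longrightarrow> f i \<in> carrier L) \<Longrightarrow> a \<in> carrier L \<Longrightarrow> foldr (\<lambda>i. bracket L (f i)) I a \<in> carrier L"
  by (induction I) (auto simp: br_closed)

lemma perm_term_closed:
  assumes "a \<in> carrier L" "valid w" "s permutes {..<length w}"
  shows "perm_term w a s \<in> carrier L"
  unfolding perm_term_def
proof (rule smult_closed, rule foldr_bracket_closed)
  fix i assume "i \<in> set [0..<length w]"
  then have "s i < length w" using permutes_in_image[OF assms(3), of i] by simp
  then show "fst (w ! s i) \<in> carrier L" using valid_nth[OF assms(2)] grade_carrier by blast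
qed fact

lemma perm_term_cons:
  assumes a: "a \<in> carrier L" and w: "valid w" "length w = Suc n" and i: "i < Suc n" and s: "s permutes {..<n}"
  shows "perm_term w a (perm_cons i s) =
    bracket L (fst (w ! i)) (perm_term (delete_nth i w) a s) \<star> ksign (snd (w ! i) * par (take i w))"
proof -
  have d: "length (delete_nth i w) = n" using i w by (simp add: length_delete_nth)
  have si: "s j < n" if "j < n" for j using permutes_in_image[OF s, of j] that by simp
  have "foldr (\<lambda>j. bracket L (fst (w ! perm_cons i s (Suc j)))) [0..<n] a =
      foldr (\<lambda>j. bracket L (fst (delete_nth i w ! s j))) [0..<n] a"
    by (rule foldr_cong) (use si i w in \<open>auto simp: nth_delete_nth\<close>)
  moreover have "[0..<Suc n] = 0 # map Suc [0..<n]" by (simp add: map_Suc_upt upt_conv_Cons)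
  ultimately have f: "foldr (\<lambda>j. bracket L (fst (w ! perm_cons i s j))) [0..<Suc n] a =
      bracket L (fst (w ! i)) (foldr (\<lambda>j. bracket L (fst (delete_nth i w ! s j))) [0..<n] a)"
    by (simp add: foldr_map comp_def del: upt_Suc)
  have c: "foldr (\<lambda>j. bracket L (fst (delete_nth i w ! s j))) [0..<n] a \<in> carrier L"
    by (rule foldr_bracket_closed[OF _ a])
      (use grade_carrier[OF valid_nth[OF valid_delete_nth[OF w(1)]]] si d in auto)
  have x: "fst (w ! i) \<in> carrier L" using valid_nth[OF w(1)] i w(2) grade_carrier by auto
  have k: "koszul (map snd w) (perm_cons i s) = snd (w ! i) * par (take i w) + koszul (map snd (delete_nth i w)) s"
    using koszul_perm_cons[OF s i, of "map snd w"] w i by (simp add: par_def take_map)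
  show ?thesis
    unfolding perm_term_def d w(2) f k
    using c x by (simp add: br_linear smult_ksign_ksign br_closed add.commute)
qed

text \<open>Grouping the permutations by the letter that they take first turns the sum into the
  recursion of \<open>symad\<close>.\<close>

lemma perm_sum_symad:
  "a \<in> carrier L \<Longrightarrow> valid w \<Longrightarrow> length w = n \<Longrightarrow>
    (\<Oplus>s\<in>{s. s permutes {..<n}}. perm_term w a s) = symad n a w"
proof (induction n arbitrary: w)
  case 0
  then show ?case by (simp add: perm_term_def koszul_def smult_one)
next
  case (Suc n)
  let ?P = "{s. s permutes {..<n}}"
  have fin: "finite ?P" by (simp add: finite_permutations)
  have w: "valid (delete_nth i w)" "length (delete_nth i w) = n" if "i < Suc n" for i
    using Suc that by (auto simp: valid_delete_nth length_delete_nth)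
  have c: "perm_term (delete_nth i w) a s \<in> carrier L" if "i < Suc n" "s \<in> ?P" for i s
    using perm_term_closed[OF Suc(2) w(1)] w(2) that by simp
  have x: "fst (w ! i) \<in> carrier L" if "i < Suc n" for i using valid_nth[OF Suc(3)] Suc(4) that grade_carrier by auto
  have "(\<Oplus>s\<in>{s. s permutes {..<Suc n}}. perm_term w a s) =
      (\<Oplus>i\<in>{..<Suc n}. \<Oplus>s\<in>perm_cons i ` ?P. perm_term w a s)"
    unfolding permutes_Suc_eq
  proof (rule add.finprod_UN_disjoint)
    show "pairwise (\<lambda>i j. disjnt (perm_cons i ` ?P) (perm_cons j ` ?P)) {..<Suc n}"
      by (auto simp: pairwise_def disjnt_def perm_cons_inj)
    fix i s assume "i \<in> {..<Suc n}" "s \<in> perm_cons i ` ?P"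
    then show "perm_term w a s \<in> carrier L"
      using perm_term_closed[OF Suc(2,3)] perm_cons_permutes Suc(4) by auto
  qed (use fin in auto)
  also have "\<dots> = (\<Oplus>i\<in>{..<Suc n}. bracket L (fst (w ! i)) (symad n a (delete_nth i w)) \<star> ksign (snd (w ! i) * par (take i w)))"
  proof (rule finsum_cong')
    show "(\<lambda>i. bracket L (fst (w ! i)) (symad n a (delete_nth i w)) \<star> ksign (snd (w ! i) * par (take i w)))
        \<in> {..<Suc n} \<rightarrow> carrier L"
      using symad_term_closed[OF Suc(2-4)] by (auto intro!: smult_closed)
    fix i assume "i \<in> {..<Suc n}"
    then have i: "i < Suc n" by simp
    let ?h = "\<lambda>y. bracket L (fst (w ! i)) y \<star> ksign (snd (w ! i) * par (take i w))"
    have h: "additive_map L L ?h"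
      using x[OF i] by (auto intro!: additive_mapI simp: br_r_distr smult_l_distr br_closed smult_closed)
    have "(\<Oplus>s\<in>perm_cons i ` ?P. perm_term w a s) = (\<Oplus>s\<in>?P. perm_term w a (perm_cons i s))"
      by (rule finsum_reindex)
        (use perm_term_closed[OF Suc(2,3)] perm_cons_permutes i Suc(4) in \<open>auto simp: inj_on_def perm_cons_inj\<close>)
    also have "\<dots> = (\<Oplus>s\<in>?P. ?h (perm_term (delete_nth i w) a s))"
      by (rule finsum_cong') (use perm_term_cons[OF Suc(2-4) i] c[OF i] h[THEN additive_map_closed] in auto)
    also have "\<dots> = ?h (\<Oplus>s\<in>?P. perm_term (delete_nth i w) a s)"
      by (rule additive_map_finsum[OF abelian_group abelian_group h, symmetric]) (use c[OF i] in auto)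
    also have "\<dots> = ?h (symad n a (delete_nth i w))" using Suc(1)[OF Suc(2) w[OF i]] by simp
    finally show "(\<Oplus>s\<in>perm_cons i ` ?P. perm_term w a s) = ?h (symad n a (delete_nth i w))" .
  qed simp
  finally show ?case by simp
qed

end

section \<open>Linear maps on the symmetric algebra attached to a power series\<close>

lemma (in supermodule) lsmult_assoc:
  assumes m: "m \<in> carrier M"
  shows "lsmult K M (\<alpha> * \<beta>) m = lsmult K M \<alpha> (lsmult K M \<beta> m)"
proof (rule grade_induct[OF m])
  fix q m assume 2: "m \<in> grade M q"
  have m: "m \<in> carrier M" using 2 by (rule grade_carrier)
  show "lsmult K M (\<alpha> * \<beta>) m = lsmult K M \<alpha> (lsmult K M \<beta> m)"
  proof (induction \<alpha> rule: K_induct)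
    case (1 p \<alpha>)
    show ?case
    proof (induction \<beta> rule: K_induct)
      fix r \<beta> assume b: "\<beta> \<in> K r"
      have "lsmult K M \<alpha> (lsmult K M \<beta> m) = lsmult K M \<alpha> m \<star> \<beta> \<star> ksign (r * q)"
        using b 2 m by (simp add: lsmult_homog[OF 2 b] lsmult_rsmult smult_closed)
      also have "\<dots> = m \<star> (\<alpha> * \<beta>) \<star> ksign ((p + r) * q)"
        using m by (simp add: lsmult_homog[OF 2 1] smult_assoc smult_closed smult_ksign_commute[of _ _ \<beta>] smult_ksign_ksign distrib_right)
      also have "\<dots> = lsmult K M (\<alpha> * \<beta>) m" using lsmult_homog[OF 2 K_mult[OF 1 b]] by simp
      finally show "lsmult K M (\<alpha> * \<beta>) m = lsmult K M \<alpha> (lsmult K M \<beta> m)" by simp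
    qed (use m in \<open>simp add: distrib_left lsmult_add_scal lsmult_add\<close>)
  qed (use m in \<open>simp add: distrib_right lsmult_add_scal\<close>)
qed (simp add: lsmult_add)

locale rational_lie = lie_superalgebra K L + rational_supermodule K L
  for K :: "bit \<Rightarrow> 'k::ring_1 set" and L :: "('k, 'm, 'e) lie_super_scheme" (structure)
begin

sublocale SL: supermodule_pair K S L
  by (intro supermodule_pair.intro S.supermodule_axioms supermodule_axioms)

text \<open>The projections of \<open>S(L)\<close> onto its parts of degree 0 and 1.\<close>

definition low_group :: "('k \<times> 'm) ring"
  where "low_group = \<lparr>carrier = UNIV \<times> carrier L, monoid.mult = undefined, one = undefined,
    ring.zero = (0, \<zero>), add = (\<lambda>u v. (fst u + fst v, snd u \<oplus> snd v))\<rparr>"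

lemma low_group_abelian: "abelian_group low_group"
proof (rule abelian_groupI)
  fix x assume x: "x \<in> carrier low_group"
  then have "(- fst x, \<ominus> snd x) \<in> carrier low_group" "(- fst x, \<ominus> snd x) \<oplus>\<^bsub>low_group\<^esub> x = \<zero>\<^bsub>low_group\<^esub>"
    by (auto simp: low_group_def l_neg)
  then show "\<exists>y\<in>carrier low_group. y \<oplus>\<^bsub>low_group\<^esub> x = \<zero>\<^bsub>low_group\<^esub>" by blast
qed (auto simp: low_group_def a_ac add_ac)

text \<open>Truncation after degree 1 leaves the sum of \<open>K\<close> and \<open>L\<close>, on
  which a letter kills the summand \<open>L\<close>. Two letters in succession act as zero, so the
  relations of the symmetric algebra hold trivially.\<close>

lemma low_ex:
  "\<exists>h. additive_map S low_group h \<and> h \<one>\<^bsub>S\<^esub> = (1, \<zero>) \<and>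
    (\<forall>\<alpha>. \<forall>y\<in>carrier S. h (sc \<alpha> \<otimes>\<^bsub>S\<^esub> y) = (\<alpha> * fst (h y), lsmult K L \<alpha> (snd (h y)))) \<and>
    (\<forall>x\<in>carrier L. \<forall>y\<in>carrier S. h (vc x \<otimes>\<^bsub>S\<^esub> y) = (0, x \<star> fst (h y)))"
proof -
  let ?s = "\<lambda>\<alpha> n. (\<alpha> * fst n, lsmult K L \<alpha> (snd n))" and ?v = "\<lambda>x n. (0, x \<star> fst n)"
  obtain h where "additive_map S low_group h" "h \<one>\<^bsub>S\<^esub> = (1, \<zero>)"
    "\<And>\<alpha> y. y \<in> carrier S \<Longrightarrow> h (sc \<alpha> \<otimes>\<^bsub>S\<^esub> y) = ?s \<alpha> (h y)"
    "\<And>x y. x \<in> carrier L \<Longrightarrow> y \<in> carrier S \<Longrightarrow> h (vc x \<otimes>\<^bsub>S\<^esub> y) = ?v x (h y)"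
  proof (rule module_lift[OF low_group_abelian, of "(1, \<zero>)" ?s ?v])
    have l1: "lsmult K L 1 m = m" if "m \<in> carrier L" for m
      using lsmult_even[OF that K_one] that by (simp add: smult_one)
    have lz: "lsmult K L \<alpha> \<zero> = \<zero>" for \<alpha>
      by (rule additive_map_zero[OF abelian_group abelian_group lsmult_additive])
    show "?s 1 n = n" if "n \<in> carrier low_group" for n using that l1 by (auto simp: low_group_def)
    show "additive_map low_group low_group (?s \<alpha>)" for \<alpha>
      by (rule additive_mapI) (auto simp: low_group_def distrib_left lsmult_add)
    show "additive_map low_group low_group (?v x)" if "x \<in> carrier L" for x
      using that by (intro additive_mapI) (auto simp: low_group_def smult_r_distr smult_closed)
    show "?v x (?v y n) = ?v y (?v x (?s (ksign (p * q)) n))" if "x \<in> grade L p" "y \<in> grade L q" for x y p q n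
      using that grade_carrier by auto
  qed (auto simp: low_group_def distrib_right lsmult_add_scal lsmult_assoc mult.assoc smult_l_distr
      smult_assoc lsmult_rsmult smult_closed dest: grade_carrier)
  then show ?thesis by blast
qed

definition low :: "('k, 'm) words set set \<Rightarrow> 'k \<times> 'm"
  where "low = (SOME h. additive_map S low_group h \<and> h \<one>\<^bsub>S\<^esub> = (1, \<zero>) \<and>
    (\<forall>\<alpha>. \<forall>y\<in>carrier S. h (sc \<alpha> \<otimes>\<^bsub>S\<^esub> y) = (\<alpha> * fst (h y), lsmult K L \<alpha> (snd (h y)))) \<and>
    (\<forall>x\<in>carrier L. \<forall>y\<in>carrier S. h (vc x \<otimes>\<^bsub>S\<^esub> y) = (0, x \<star> fst (h y))))"

definition deg0 :: "('k, 'm) words set set \<Rightarrow> 'k" where "deg0 y = fst (low y)"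
definition deg1 :: "('k, 'm) words set set \<Rightarrow> 'm" where "deg1 y = snd (low y)"

lemmas low_spec = someI_ex[OF low_ex, folded low_def]

lemma deg0_add: "y \<in> carrier S \<Longrightarrow> z \<in> carrier S \<Longrightarrow> deg0 (y \<oplus>\<^bsub>S\<^esub> z) = deg0 y + deg0 z"
  and deg1_additive: "additive_map S L deg1"
  and deg0_one: "deg0 \<one>\<^bsub>S\<^esub> = 1" and deg1_one: "deg1 \<one>\<^bsub>S\<^esub> = \<zero>"
  and deg0_sc: "y \<in> carrier S \<Longrightarrow> deg0 (sc \<alpha> \<otimes>\<^bsub>S\<^esub> y) = \<alpha> * deg0 y"
  and deg1_sc: "y \<in> carrier S \<Longrightarrow> deg1 (sc \<alpha> \<otimes>\<^bsub>S\<^esub> y) = lsmult K L \<alpha> (deg1 y)"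
  and deg0_vec: "x \<in> carrier L \<Longrightarrow> y \<in> carrier S \<Longrightarrow> deg0 (vc x \<otimes>\<^bsub>S\<^esub> y) = 0"
  and deg1_vec: "x \<in> carrier L \<Longrightarrow> y \<in> carrier S \<Longrightarrow> deg1 (vc x \<otimes>\<^bsub>S\<^esub> y) = x \<star> deg0 y"
  using low_spec unfolding deg0_def deg1_def additive_map_def low_group_def by auto

lemma deg1_closed [simp]: "y \<in> carrier S \<Longrightarrow> deg1 y \<in> carrier L"
  using additive_map_closed[OF deg1_additive] .

text \<open>In particular \<open>L\<close> embeds into \<open>S(L)\<close>, and a map with values in
  the image of \<open>L\<close> can be recovered from its composite with the embedding.\<close>

lemma deg1_vc [simp]: "x \<in> carrier L \<Longrightarrow> deg1 (vc x) = x"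
  using deg1_vec[of x "\<one>\<^bsub>S\<^esub>"] by (simp add: deg0_one smult_one)

lemma sc_app_one: "deg0 (sc \<alpha>) = \<alpha>" "deg1 (sc \<alpha>) = \<zero>"
proof -
  have "lsmult K L \<alpha> \<zero> = \<zero>" by (rule additive_map_zero[OF abelian_group abelian_group lsmult_additive])
  then show "deg0 (sc \<alpha>) = \<alpha>" "deg1 (sc \<alpha>) = \<zero>"
    using deg0_sc[of "\<one>\<^bsub>S\<^esub>" \<alpha>] deg1_sc[of "\<one>\<^bsub>S\<^esub>" \<alpha>] by (simp_all add: deg0_one deg1_one)
qed

lemma deg_mono:
  assumes "set X \<subseteq> carrier L"
  shows "deg0 (vprod X \<otimes>\<^bsub>S\<^esub> sc \<alpha>) = (if X = [] then \<alpha> else 0)"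
    and "deg1 (vprod X \<otimes>\<^bsub>S\<^esub> sc \<alpha>) = (case X of [x] \<Rightarrow> x \<star> \<alpha> | _ \<Rightarrow> \<zero>)"
proof -
  have 0: "deg0 (vprod X \<otimes>\<^bsub>S\<^esub> sc \<alpha>) = (if X = [] then \<alpha> else 0)" if "set X \<subseteq> carrier L" for X
    using that by (cases X) (simp_all add: sc_app_one S.m_assoc deg0_vec)
  show "deg1 (vprod X \<otimes>\<^bsub>S\<^esub> sc \<alpha>) = (case X of [x] \<Rightarrow> x \<star> \<alpha> | _ \<Rightarrow> \<zero>)"
  proof (cases X)
    case (Cons x X')
    then show ?thesis using assms 0[of X'] by (auto simp: S.m_assoc deg1_vec split: list.splits)
  qed (simp add: sc_app_one)
  show "deg0 (vprod X \<otimes>\<^bsub>S\<^esub> sc \<alpha>) = (if X = [] then \<alpha> else 0)" by (rule 0[OF assms])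
qed

lemma deg0_smult: "y \<in> carrier S \<Longrightarrow> deg0 (y \<star>\<^bsub>S\<^esub> \<beta>) = deg0 y * \<beta>"
  and deg1_smult: "y \<in> carrier S \<Longrightarrow> deg1 (y \<star>\<^bsub>S\<^esub> \<beta>) = deg1 y \<star> \<beta>"
proof -
  have "deg0 (y \<star>\<^bsub>S\<^esub> \<beta>) = deg0 y * \<beta> \<and> deg1 (y \<star>\<^bsub>S\<^esub> \<beta>) = deg1 y \<star> \<beta>" if "y \<in> carrier S"
    using that
  proof (induction rule: S_mono_induct)
    case (mono X ps \<alpha> q)
    have X: "set X \<subseteq> carrier L" using mono(1) by (rule homog_carrier)
    have "(vprod X \<otimes>\<^bsub>S\<^esub> sc \<alpha>) \<star>\<^bsub>S\<^esub> \<beta> = vprod X \<otimes>\<^bsub>S\<^esub> sc (\<alpha> * \<beta>)"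
      using X by (simp add: S_smult sc_mult S.m_assoc)
    then show ?case using X by (auto simp: deg_mono smult_assoc split: list.splits)
  next
    case (add y z)
    then show ?case
      by (simp add: S.smult_l_distr S.smult_closed deg0_add additive_map_add[OF deg1_additive] smult_l_distr distrib_right)
  qed
  then show "y \<in> carrier S \<Longrightarrow> deg0 (y \<star>\<^bsub>S\<^esub> \<beta>) = deg0 y * \<beta>"
    "y \<in> carrier S \<Longrightarrow> deg1 (y \<star>\<^bsub>S\<^esub> \<beta>) = deg1 y \<star> \<beta>" by auto
qed

lemma deg0_grade: "y \<in> grade S r \<Longrightarrow> deg0 y \<in> K r"
proof (induction rule: grade_S_induct)
  case (mono X ps \<alpha> q)
  then show ?case using homog_carrier[OF mono(1)] by (auto simp: deg_mono homog_Nil)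
next
  case (add y z)
  then show ?case using grade_S_carrier by (simp add: deg0_add K_add')
qed

lemma deg1_grade: "y \<in> grade S r \<Longrightarrow> deg1 y \<in> grade L r"
proof (induction rule: grade_S_induct)
  case (mono X ps \<alpha> q)
  show ?case
  proof (cases "\<exists>x. X = [x]")
    case True
    then obtain x p where x: "X = [x]" "ps = [p]" "x \<in> grade L p"
      using mono(1) by (auto simp: homog_def list_all2_Cons1)
    then show ?thesis using rsmult_grade[OF x(3) mono(2)] mono(3) grade_carrier[OF x(3)]
      by (simp add: deg_mono del: list_prod_Cons list.map)
  next
    case False
    then have "deg1 (vprod X \<otimes>\<^bsub>S\<^esub> sc \<alpha>) = \<zero>" using deg_mono(2)[OF homog_carrier[OF mono(1)]] by (auto split: list.splits)
    then show ?thesis by simp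
  qed
next
  case (add y z)
  then show ?case using grade_S_carrier by (simp add: additive_map_add[OF deg1_additive] grade_add)
qed

lemma vc_deg1_lsmult: "y \<in> carrier S \<Longrightarrow> deg1 (lsmult K S \<alpha> y) = lsmult K L \<alpha> (deg1 y)"
  by (simp add: S_lsmult deg1_sc)

text \<open>Projecting both factors to degree 1 undoes the embedding of \<open>L\<close> by which
  maps into \<open>L\<close> were made into endomorphisms of \<open>S\<close>. Preceded by a tensor
  product of maps and the coproduct, this is the convolution bracket.\<close>

definition br_lift :: "(('k, 'm) words set set \<times> ('k, 'm) words set set \<Rightarrow>\<^sub>0 int) set \<Rightarrow> 'm"
  where "br_lift = tensor_lift K S S L (\<lambda>y z. bracket L (deg1 y) (deg1 z))"

lemma br_lift_balanced: "balanced_map K S S L (\<lambda>y z. bracket L (deg1 y) (deg1 z))"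
  unfolding balanced_map_def
proof (intro conjI ballI allI)
  fix y z \<alpha> assume yz: "y \<in> carrier S" "z \<in> carrier S"
  show "bracket L (deg1 (y \<star>\<^bsub>S\<^esub> \<alpha>)) (deg1 z) = bracket L (deg1 y) (deg1 (lsmult K S \<alpha> z))"
    using yz by (simp add: deg1_smult vc_deg1_lsmult br_balanced)
qed (auto intro!: additive_mapI simp: br_closed br_l_distr br_r_distr additive_map_add[OF deg1_additive])

lemma br_lift_additive: "additive_map V L br_lift"
  and br_lift_pt: "y \<in> carrier S \<Longrightarrow> z \<in> carrier S \<Longrightarrow> br_lift (pt y z) = bracket L (deg1 y) (deg1 z)"
  unfolding br_lift_def
  using SS.tensor_lift_additive[OF abelian_group br_lift_balanced] SS.tensor_lift_pt[OF abelian_group br_lift_balanced]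
  by auto

lemma br_lift_smult:
  assumes t: "t \<in> carrier V" shows "br_lift (t \<star>\<^bsub>TM\<^esub> \<alpha>) = br_lift t \<star> \<alpha>"
proof (rule SS.tensor_additive_eq[OF abelian_group _ _ _ t])
  show "additive_map V L (\<lambda>t. br_lift (t \<star>\<^bsub>TM\<^esub> \<alpha>))"
    by (rule additive_map_compose[OF SS.TM_smult_additive br_lift_additive])
  show "additive_map V L (\<lambda>t. br_lift t \<star> \<alpha>)"
    by (rule additive_map_compose[OF br_lift_additive smult_additive])
qed (simp add: SS.pt_smult br_lift_pt S.smult_closed deg1_smult br_linear)

text \<open>The Leibniz rule for convolutions; its two summands are those of the recursive equation
  of \<open>conv\<close>.\<close>

lemma tmap_prim:
  assumes F: "F \<in> grade H f" and G: "G \<in> grade H g" and x: "x \<in> grade L p" and t: "t \<in> carrier V"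
  shows "tmap F G (tmul (prim x) t) =
    tmap (lcomp F x) G t \<star>\<^bsub>TM\<^esub> ksign (g * p) \<oplus>\<^bsub>V\<^esub> tmap F (lcomp G x) t"
proof (rule SS.tensor_additive_eq_homog[OF SS.V_abelian _ _ _ t])
  note Fx = lcomp_grade[OF F x] and Gx = lcomp_grade[OF G x]
  note FH = SS.HM.grade_carrier[OF F] and GH = SS.HM.grade_carrier[OF G]
    and FxH = SS.HM.grade_carrier[OF Fx] and GxH = SS.HM.grade_carrier[OF Gx]
  have xc: "x \<in> carrier L" by (rule grade_carrier[OF x])
  show "additive_map V V (\<lambda>t. tmap F G (tmul (prim x) t))"
    by (rule additive_map_compose[OF prim_act_additive[OF xc] tmap_additive[OF FH GH]])
  show "additive_map V V (\<lambda>t. tmap (lcomp F x) G t \<star>\<^bsub>TM\<^esub> ksign (g * p) \<oplus>\<^bsub>V\<^esub> tmap F (lcomp G x) t)"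
    by (rule additive_map_sum[OF SS.V_abelian additive_ksign_V[OF tmap_additive[OF FxH GH] SS.V_abelian] tmap_additive[OF FH GxH]])
  fix c d q r assume c: "c \<in> grade S q" and d: "d \<in> grade S r"
  have cc: "c \<in> carrier S" "d \<in> carrier S" using c d grade_S_carrier by auto
  have xcq: "vc x \<otimes>\<^bsub>S\<^esub> c \<in> grade S (p + q)" by (rule vc_mult_grade_S[OF x c])
  have Fc: "F (vc x \<otimes>\<^bsub>S\<^esub> c) \<in> carrier S" "G d \<in> carrier S" "F c \<in> carrier S" "G (vc x \<otimes>\<^bsub>S\<^esub> d) \<in> carrier S"
    using SS.HM_closed[OF FH] SS.HM_closed[OF GH] cc xc by auto
  have "tmap F G (tmul (prim x) (pt c d)) =
      tmap F G (pt (vc x \<otimes>\<^bsub>S\<^esub> c) d) \<oplus>\<^bsub>V\<^esub> tmap F G (pt c (vc x \<otimes>\<^bsub>S\<^esub> d)) \<star>\<^bsub>TM\<^esub> ksign (p * q)"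
    unfolding prim_tmul_pt[OF x c cc(2)] using cc xc
    by (simp add: additive_map_add[OF tmap_additive[OF FH GH]] tmap_smult[OF FH G])
  also have "\<dots> = pt (F (vc x \<otimes>\<^bsub>S\<^esub> c)) (G d) \<star>\<^bsub>TM\<^esub> ksign (g * (p + q)) \<oplus>\<^bsub>V\<^esub>
      pt (F c) (G (vc x \<otimes>\<^bsub>S\<^esub> d)) \<star>\<^bsub>TM\<^esub> ksign (g * q + p * q)"
    using tmap_pt_homog[OF FH G xcq cc(2)] tmap_pt_homog[OF FH G c, of "vc x \<otimes>\<^bsub>S\<^esub> d"] cc xc Fc
    by (simp add: ksign_ksign_V)
  also have "\<dots> = tmap (lcomp F x) G (pt c d) \<star>\<^bsub>TM\<^esub> ksign (g * p) \<oplus>\<^bsub>V\<^esub> tmap F (lcomp G x) (pt c d)"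
    using tmap_pt_homog[OF FxH G c cc(2)] tmap_pt_homog[OF FH Gx c cc(2)] cc xc Fc
    by (simp add: ksign_ksign_V lcomp_app) (simp add: bit_ac)
  finally show "tmap F G (tmul (prim x) (pt c d)) =
      tmap (lcomp F x) G (pt c d) \<star>\<^bsub>TM\<^esub> ksign (g * p) \<oplus>\<^bsub>V\<^esub> tmap F (lcomp G x) (pt c d)" .
qed

section \<open>From endomorphisms of the symmetric algebra to functions of lists\<close>

definition on_lists :: "(('k, 'm) words set set \<Rightarrow> ('k, 'm) words set set) \<Rightarrow> ('m \<times> bit) list \<Rightarrow> 'm"
  where "on_lists F w = deg1 (F (vprod (map fst w)))"

lemma valid_homog: "valid w \<Longrightarrow> homog (map fst w) (map snd w)"
  by (induction w) auto

lemma homog_valid: "homog X ps \<Longrightarrow> valid (zip X ps)" "homog X ps \<Longrightarrow> par (zip X ps) = sum_list ps"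
  "homog X ps \<Longrightarrow> map fst (zip X ps) = X" "homog X ps \<Longrightarrow> map snd (zip X ps) = ps"
  "homog X ps \<Longrightarrow> length (zip X ps) = length X"
  by (induction rule: homog_induct) auto

lemma valid_vprod: "valid w \<Longrightarrow> vprod (map fst w) \<in> grade S (par w)"
  using vprod_grade_S[OF valid_homog] by (simp add: par_def)

lemma lfun_on_lists: "F \<in> grade H p \<Longrightarrow> lfun p (on_lists F)"
  unfolding lfun_def on_lists_def using valid_vprod SS.HM_grade deg1_grade by fastforce

lemma on_lists_lcomp: "valid w \<Longrightarrow> on_lists (lcomp F x) w = der (x, p) (on_lists F) w"
  using grade_S_carrier[OF valid_vprod] by (simp add: on_lists_def der_def lcomp_app)

lemma on_lists_lcomp': "valid w \<Longrightarrow> on_lists (lcomp F (fst x)) w = der x (on_lists F) w"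
  by (cases x) (simp add: on_lists_lcomp)

text \<open>The coproduct of a product is reached by successive multiplication with primitive
  tensors, so \<open>tmap_prim\<close> gives the left side the recursion that defines
  \<open>conv\<close>.\<close>

lemma conv_on_lists:
  "valid w \<Longrightarrow> F \<in> grade H f \<Longrightarrow> G \<in> grade H g \<Longrightarrow>
    br_lift (tmap F G (\<Delta> (vprod (map fst w)))) = conv g (on_lists F) (on_lists G) w"
proof (induction w arbitrary: f g F G)
  case Nil
  have FG: "F \<one>\<^bsub>S\<^esub> \<in> carrier S" "G \<one>\<^bsub>S\<^esub> \<in> carrier S"
    using Nil SS.HM_closed SS.HM.grade_carrier by blast+
  have "tmap F G (pt \<one>\<^bsub>S\<^esub> \<one>\<^bsub>S\<^esub>) = pt (F \<one>\<^bsub>S\<^esub>) (G \<one>\<^bsub>S\<^esub>) \<star>\<^bsub>TM\<^esub> ksign (g * 0)"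
    using Nil SS.HM.grade_carrier by (intro tmap_pt_homog one_grade_S) auto
  then show ?case using FG by (simp add: coprod_one on_lists_def br_lift_pt pt_smult_one)
next
  case (Cons x w)
  have x: "fst x \<in> grade L (snd x)" and w: "valid w" using Cons by simp_all
  have wS: "vprod (map fst w) \<in> carrier S" by (rule grade_S_carrier[OF valid_vprod[OF w]])
  note Fx = lcomp_grade[OF Cons(3) x] and Gx = lcomp_grade[OF Cons(4) x]
  note gc = SS.HM.grade_carrier
  have cl: "tmap F' G' (\<Delta> (vprod (map fst w))) \<in> carrier V" if "F' \<in> carrier H" "G' \<in> carrier H" for F' G'
    using additive_map_closed[OF tmap_additive[OF that]] wS by simp
  have e: "conv q (on_lists (lcomp F (fst x))) G' w = conv q (der x (on_lists F)) G' w"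
    "conv q F' (on_lists (lcomp G (fst x))) w = conv q F' (der x (on_lists G)) w" for q F' G'
    by (rule conv_cong; simp add: on_lists_lcomp' w)+
  have "br_lift (tmap F G (\<Delta> (vprod (map fst (x # w))))) =
      br_lift (tmap F G (tmul (prim (fst x)) (\<Delta> (vprod (map fst w)))))"
    using coprod_vec[OF grade_carrier[OF x] wS] by simp
  also have "\<dots> = br_lift (tmap (lcomp F (fst x)) G (\<Delta> (vprod (map fst w)))) \<star> ksign (g * snd x) \<oplus>
      br_lift (tmap F (lcomp G (fst x)) (\<Delta> (vprod (map fst w))))"
    using tmap_prim[OF Cons(3,4) x coprod_closed[OF wS]] cl gc[OF Cons(3)] gc[OF Cons(4)] gc[OF Fx] gc[OF Gx]
    by (simp add: additive_map_add[OF br_lift_additive] br_lift_smult)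
  also have "\<dots> = conv g (on_lists F) (on_lists G) (x # w)"
    using Cons(1)[OF w Fx Cons(4)] Cons(1)[OF w Cons(3) Gx] by (simp add: e)
  finally show ?case .
qed

end

section \<open>The maps \<phi>^a as linear maps on the symmetric algebra\<close>

context rational_lie
begin

lemma vc_smult': "x \<in> carrier L \<Longrightarrow> vc (x \<star> \<alpha>) = vc x \<star>\<^bsub>S\<^esub> \<alpha>"
  by (simp add: vc_smult S_smult)

lemma vc_additive: "additive_map L S vc"
  by (auto intro!: additive_mapI simp: vc_add)

abbreviation vc_comp :: "(('k, 'm) words set set \<Rightarrow> 'm) \<Rightarrow> ('k, 'm) words set set \<Rightarrow> ('k, 'm) words set set"
  where "vc_comp F \<equiv> compose (carrier S) vc F"

lemma vc_comp_app: "y \<in> carrier S \<Longrightarrow> vc_comp F y = vc (F y)"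
  by (simp add: compose_def)

lemma vc_comp_H: "F \<in> carrier SL.HM \<Longrightarrow> vc_comp F \<in> carrier H"
  unfolding compose_def
  by (rule SS.HM_restrictI)
    (auto simp: SL.HM_linear vc_smult' SL.HM_closed intro!: additive_map_compose[OF SL.HM_additive vc_additive])

lemma vc_comp_grade: "F \<in> grade SL.HM p \<Longrightarrow> vc_comp F \<in> grade H p"
  using vc_comp_H vc_grade_S grade_S_carrier by (simp add: SL.HM_grade SS.HM_grade vc_comp_app)

lemma vc_comp_vec_valued: "F \<in> grade SL.HM p \<Longrightarrow> vec_valued p (vc_comp F)"
  using vc_comp_grade grade_S_carrier by (auto simp: vec_valued_def SL.HM_grade vc_comp_app)

lemma deg1_vc_comp: "F \<in> carrier SL.HM \<Longrightarrow> y \<in> carrier S \<Longrightarrow> deg1 (vc_comp F y) = F y"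
  by (simp add: vc_comp_app SL.HM_closed)

lemma SL_eqI:
  assumes "F \<in> carrier SL.HM" "G \<in> carrier SL.HM"
    and e: "\<And>w. valid w \<Longrightarrow> F (vprod (map fst w)) = G (vprod (map fst w))"
  shows "F = G"
proof (rule SL.HM_eqI[OF assms(1,2)])
  fix y assume y: "y \<in> carrier S"
  show "F y = G y"
  proof (rule S_linear_eq[OF SL.HM_additive[OF assms(1)] SL.HM_additive[OF assms(2)] _ y])
    fix X ps \<alpha> assume h: "homog X ps"
    then show "F (vprod X \<star>\<^bsub>S\<^esub> \<alpha>) = G (vprod X \<star>\<^bsub>S\<^esub> \<alpha>)"
      using e[OF homog_valid(1)[OF h]] homog_valid(3)[OF h] homog_carrier[OF h] assms by (simp add: SL.HM_linear)
  qed
qed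

text \<open>The list functions \<open>adn\<close> realised on the symmetric algebra, hence well
  defined there. The identity of \<open>S\<close> serves as \<theta>, since \<open>br_lift\<close>
  projects it to degree 1, and the constant map \<open>a\<close> is extended by
  \<open>deg0\<close>.\<close>

primrec adS :: "'m \<Rightarrow> nat \<Rightarrow> ('k, 'm) words set set \<Rightarrow> 'm"
  where
    "adS a 0 = (\<lambda>y\<in>carrier S. a \<star> deg0 y)"
  | "adS a (Suc n) = (\<lambda>y\<in>carrier S. br_lift (tmap idS (vc_comp (adS a n)) (\<Delta> y)))"

lemma adS_grade: "a \<in> grade L p \<Longrightarrow> adS a n \<in> grade SL.HM p"
proof (induction n)
  case 0
  have a: "a \<in> carrier L" by (rule grade_carrier[OF 0])
  have "adS a 0 \<in> carrier SL.HM"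
    unfolding adS.simps using a
    by (intro SL.HM_restrictI additive_mapI) (auto simp: smult_closed deg0_add smult_r_distr deg0_smult smult_assoc)
  moreover have "adS a 0 y \<in> grade L (p + q)" if "y \<in> grade S q" for y q
    using grade_S_carrier[OF that] rsmult_grade[OF 0 deg0_grade[OF that]] by simp
  ultimately show ?case by (simp add: SL.HM_grade del: adS.simps)
next
  case (Suc n)
  let ?G = "vc_comp (adS a n)"
  have G: "?G \<in> grade H p" by (rule vc_comp_grade[OF Suc(1)[OF Suc(2)]])
  note GH = SS.HM.grade_carrier[OF G]
  have ad: "additive_map V L (\<lambda>t. br_lift (tmap idS ?G t))"
    by (rule additive_map_compose[OF tmap_additive[OF idS_H GH] br_lift_additive])
  have tc: "t \<in> carrier V \<Longrightarrow> tmap idS ?G t \<in> carrier V" for t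
    using additive_map_closed[OF tmap_additive[OF idS_H GH]] .
  have "adS a (Suc n) \<in> carrier SL.HM"
    unfolding adS.simps
  proof (rule SL.HM_restrictI)
    show "additive_map S L (\<lambda>y. br_lift (tmap idS ?G (\<Delta> y)))" by (rule additive_map_compose[OF coprod_additive ad])
  qed (simp add: coprod_smult tmap_smult[OF idS_H G] br_lift_smult tc)
  moreover have "adS a (Suc n) y \<in> grade L (p + q)" if y: "y \<in> grade S q" for y q
  proof -
    have "br_lift (tmap idS ?G (\<Delta> y)) \<in> grade L (p + q)"
    proof (rule SS.TM_grade_image[OF abelian_group ad grade_subgroup _ coprod_grade[OF y]])
      fix m n' u v assume m: "m \<in> grade S u" and n: "n' \<in> grade S v" and uv: "u + v = q"
      have mn: "m \<in> carrier S" "n' \<in> carrier S" using m n grade_S_carrier by auto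
      have Gn: "?G n' \<in> grade S (p + v)" using G n by (simp add: SS.HM_grade)
      have "br_lift (tmap idS ?G (pt m n')) = bracket L (deg1 m) (deg1 (?G n')) \<star> ksign (p * u)"
        using tmap_pt_homog[OF idS_H G m mn(2)] mn grade_S_carrier[OF Gn] by (simp add: br_lift_smult br_lift_pt)
      moreover have "bracket L (deg1 m) (deg1 (?G n')) \<in> grade L (u + (p + v))"
        by (rule br_even[OF deg1_grade[OF m] deg1_grade[OF Gn]])
      ultimately show "br_lift (tmap idS ?G (pt m n')) \<in> grade L (p + q)"
        using uv by (simp add: ksign_grade bit_ac)
    qed
    then show ?thesis using grade_S_carrier[OF y] by simp
  qed
  ultimately show ?case by (simp add: SL.HM_grade del: adS.simps)
qed

lemma deg_vprod: "valid w \<Longrightarrow> deg0 (vprod (map fst w)) = (if w = [] then 1 else 0)"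
  "valid w \<Longrightarrow> deg1 (vprod (map fst w)) = theta w"
proof -
  assume w: "valid w"
  then have c: "set (map fst w) \<subseteq> carrier L" by (rule homog_carrier[OF valid_homog])
  have "vprod (map fst w) \<otimes>\<^bsub>S\<^esub> sc 1 = vprod (map fst w)" using c by (simp only: sc_one S.r_one vprod_closed)
  then show "deg0 (vprod (map fst w)) = (if w = [] then 1 else 0)" "deg1 (vprod (map fst w)) = theta w"
    using deg_mono[OF c, of 1] c unfolding theta_def
    by (auto simp: smult_one split: list.splits)
qed

lemma adS_vprod: "a \<in> grade L p \<Longrightarrow> valid w \<Longrightarrow> adS a n (vprod (map fst w)) = adn p a n w"
proof (induction n arbitrary: w)
  case 0
  then show ?case using grade_S_carrier[OF valid_vprod[OF 0(2)]] grade_carrier[OF 0(1)] deg_vprod(1)[OF 0(2)]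
    by (simp add: smult_one hat_def del: map_map)
next
  case (Suc n)
  have w: "vprod (map fst w) \<in> carrier S" by (rule grade_S_carrier[OF valid_vprod[OF Suc(3)]])
  note G = adS_grade[OF Suc(2), of n]
  have "adS a (Suc n) (vprod (map fst w)) = conv p (on_lists idS) (on_lists (vc_comp (adS a n))) w"
    using conv_on_lists[OF Suc(3) idS_grade vc_comp_grade[OF G]] w by simp
  also have "\<dots> = conv p theta (adn p a n) w"
  proof (rule conv_cong[OF _ _ Suc(3)])
    fix v assume v: "valid v"
    have vS: "vprod (map fst v) \<in> carrier S" by (rule grade_S_carrier[OF valid_vprod[OF v]])
    show "on_lists idS v = theta v" using vS deg_vprod(2)[OF v] by (simp add: on_lists_def del: map_map)
    show "on_lists (vc_comp (adS a n)) v = adn p a n v"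
      using Suc.IH[OF Suc(2) v] deg1_vc_comp[OF SL.HM.grade_carrier[OF G] vS] by (simp add: on_lists_def)
  qed
  finally show ?case by simp
qed

text \<open>An element is a finite sum of monomials, and each monomial is killed by all iterated
  brackets except the one of its own length. This makes the sum over all degrees locally
  finite.\<close>

lemma adS_eventually_zero:
  assumes a: "a \<in> grade L p" and y: "y \<in> carrier S"
  shows "\<exists>N. \<forall>n\<ge>N. adS a n y = \<zero>"
  using y
proof (induction rule: S_mono_induct)
  case (mono X ps \<alpha> q)
  have X: "vprod X \<in> carrier S" using homog_carrier[OF mono(1)] by simp
  have "adS a n (vprod X \<otimes>\<^bsub>S\<^esub> sc \<alpha>) = \<zero>" if "n \<ge> Suc (length X)" for n
  proof -
    have "adS a n (vprod X) = \<zero>"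
      using adS_vprod[OF a homog_valid(1)[OF mono(1)], of n]
        adn_support[OF a homog_valid(1)[OF mono(1)], of n] homog_valid(3,5)[OF mono(1)] that by simp
    then show ?thesis using SL.HM_linear[OF SL.HM.grade_carrier[OF adS_grade[OF a]] X, of n \<alpha>] by (simp add: S_smult)
  qed
  then show ?case by blast
next
  case (add y z)
  then obtain N N' where "\<forall>n\<ge>N. adS a n y = \<zero>" "\<forall>n\<ge>N'. adS a n z = \<zero>" by blast
  then have "\<forall>n\<ge>max N N'. adS a n (y \<oplus>\<^bsub>S\<^esub> z) = \<zero>"
    using add SL.HM_add[OF SL.HM.grade_carrier[OF adS_grade[OF a]]] by simp
  then show ?case by blast
qed

text \<open>The infinite sum over all \<open>n\<close>, cut off at the least admissible bound only
  to obtain a definite one; by \<open>phiS_eq\<close> every admissible bound gives the same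
  value.\<close>

definition phiS :: "(nat \<Rightarrow> 'k) \<Rightarrow> 'm \<Rightarrow> ('k, 'm) words set set \<Rightarrow> 'm"
  where "phiS f a = (\<lambda>y\<in>carrier S. \<Oplus>n\<in>{..<LEAST N. \<forall>n\<ge>N. adS a n y = \<zero>}. adS a n y \<star> f n)"

lemma adS_closed: "a \<in> grade L p \<Longrightarrow> y \<in> carrier S \<Longrightarrow> adS a n y \<in> carrier L"
  using SL.HM_closed[OF SL.HM.grade_carrier[OF adS_grade]] .

lemma phiS_eq:
  assumes a: "a \<in> grade L p" and y: "y \<in> carrier S" and N: "\<forall>n\<ge>N. adS a n y = \<zero>"
  shows "phiS f a y = (\<Oplus>n\<in>{..<N}. adS a n y \<star> f n)"
proof -
  let ?M = "LEAST N. \<forall>n\<ge>N. adS a n y = \<zero>"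
  have M: "\<forall>n\<ge>?M. adS a n y = \<zero>" using N by (rule LeastI)
  have "?M \<le> N" using N by (rule Least_le)
  then have "(\<Oplus>n\<in>{..<?M}. adS a n y \<star> f n) = (\<Oplus>n\<in>{..<N}. adS a n y \<star> f n)"
  proof (intro add.finprod_mono_neutral_cong_left)
    fix n assume "n \<in> {..<N} - {..<?M}"
    then have "adS a n y = \<zero>" using M by (simp only: Diff_iff lessThan_iff not_less)
    then show "adS a n y \<star> f n = \<zero>" by simp
  next
    show "(\<lambda>n. adS a n y \<star> f n) \<in> {..<N} \<rightarrow> carrier L"
      using adS_closed[OF a y] by (intro Pi_I smult_closed)
  qed simp_all
  then show ?thesis using y by (simp add: phiS_def)
qed

lemma phiS_grade:
  assumes a: "a \<in> grade L p" and f: "\<And>n. f n \<in> K 0"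
  shows "phiS f a \<in> grade SL.HM p"
proof -
  note A = SL.HM.grade_carrier[OF adS_grade[OF a]] and c = adS_closed[OF a]
  have ex: "\<exists>N. phiS f a y = (\<Oplus>n\<in>{..<N}. adS a n y \<star> f n) \<and> (\<forall>n\<ge>N. adS a n y = \<zero>)" if "y \<in> carrier S" for y
    using adS_eventually_zero[OF a that] phiS_eq[OF a that] by blast
  have "additive_map S L (phiS f a)"
  proof (rule additive_mapI)
    fix y assume "y \<in> carrier S"
    with ex[OF this] c show "phiS f a y \<in> carrier L" by (auto intro!: finsum_closed smult_closed)
  next
    fix y z assume yz: "y \<in> carrier S" "z \<in> carrier S"
    obtain N N' where N: "\<forall>n\<ge>N. adS a n y = \<zero>" "\<forall>n\<ge>N'. adS a n z = \<zero>"
      using adS_eventually_zero[OF a] yz by blast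
    \<comment> \<open>The least bounds for \<open>y\<close>, \<open>z\<close> and their sum may
      differ, so all three values are written with a common bound.\<close>
    let ?N = "max N N'"
    have "phiS f a (y \<oplus>\<^bsub>S\<^esub> z) = (\<Oplus>n\<in>{..<?N}. adS a n (y \<oplus>\<^bsub>S\<^esub> z) \<star> f n)"
      using yz N SL.HM_add[OF A] by (intro phiS_eq[OF a]) auto
    also have "\<dots> = (\<Oplus>n\<in>{..<?N}. adS a n y \<star> f n \<oplus> adS a n z \<star> f n)"
      by (rule finsum_cong') (use yz c SL.HM_add[OF A] in \<open>auto simp: smult_l_distr smult_closed\<close>)
    also have "\<dots> = (\<Oplus>n\<in>{..<?N}. adS a n y \<star> f n) \<oplus> (\<Oplus>n\<in>{..<?N}. adS a n z \<star> f n)"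
      by (rule finsum_addf) (use yz c smult_closed in auto)
    also have "\<dots> = phiS f a y \<oplus> phiS f a z"
      using phiS_eq[OF a yz(1), of ?N f] phiS_eq[OF a yz(2), of ?N f] N by simp
    finally show "phiS f a (y \<oplus>\<^bsub>S\<^esub> z) = phiS f a y \<oplus> phiS f a z" .
  qed
  moreover have "phiS f a (y \<star>\<^bsub>S\<^esub> \<alpha>) = phiS f a y \<star> \<alpha>" if y: "y \<in> carrier S" for y \<alpha>
  proof -
    obtain N where N: "\<forall>n\<ge>N. adS a n y = \<zero>" using adS_eventually_zero[OF a y] by blast
    have "phiS f a (y \<star>\<^bsub>S\<^esub> \<alpha>) = (\<Oplus>n\<in>{..<N}. adS a n (y \<star>\<^bsub>S\<^esub> \<alpha>) \<star> f n)"
      using y N SL.HM_linear[OF A] by (intro phiS_eq[OF a]) (auto simp: S.smult_closed)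
    also have "\<dots> = (\<Oplus>n\<in>{..<N}. adS a n y \<star> f n \<star> \<alpha>)"
      by (rule finsum_cong') (use y c SL.HM_linear[OF A] smult_even_commute[OF _ f] smult_closed in auto)
    also have "\<dots> = phiS f a y \<star> \<alpha>"
      unfolding phiS_eq[OF a y N]
      by (rule additive_map_finsum[OF abelian_group abelian_group smult_additive, symmetric]) (use y c smult_closed in auto)
    finally show ?thesis .
  qed
  ultimately have "restrict (phiS f a) (carrier S) \<in> carrier SL.HM" by (rule SL.HM_restrictI)
  moreover have "restrict (phiS f a) (carrier S) = phiS f a" by (simp add: phiS_def)
  ultimately have "phiS f a \<in> carrier SL.HM" by simp
  moreover have "phiS f a y \<in> grade L (p + q)" if y: "y \<in> grade S q" for y q
  proof -
    obtain N where N: "phiS f a y = (\<Oplus>n\<in>{..<N}. adS a n y \<star> f n)" using ex[OF grade_S_carrier[OF y]] by blast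
    have t: "adS a n y \<star> f n \<in> grade L (p + q)" for n
      using adS_grade[OF a, of n] y f by (simp add: SL.HM_grade even_smult_grade)
    have "(\<Oplus>n\<in>{..<M}. adS a n y \<star> f n) \<in> grade L (p + q)" for M
    proof (induction M)
      case (Suc M)
      have "(\<Oplus>n\<in>{..<Suc M}. adS a n y \<star> f n) = adS a M y \<star> f M \<oplus> (\<Oplus>n\<in>{..<M}. adS a n y \<star> f n)"
        unfolding lessThan_Suc using grade_carrier[OF t] by (intro finsum_insert) auto
      then show ?case using Suc t by (simp add: grade_add)
    qed simp
    then show ?thesis using N by simp
  qed
  ultimately show ?thesis by (simp add: SL.HM_grade)
qed

lemma phiS_vprod:
  assumes a: "a \<in> grade L p" and w: "valid w"
  shows "phiS f a (vprod (map fst w)) = phi_list f p a w"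
proof -
  let ?y = "vprod (map fst w)" and ?n = "length w"
  have y: "?y \<in> carrier S" by (rule grade_S_carrier[OF valid_vprod[OF w]])
  have z: "adS a n ?y = \<zero>" if "n \<noteq> ?n" for n
    using adS_vprod[OF a w, of n] adn_support[OF a w, of n] that by simp
  have "phiS f a ?y = (\<Oplus>n\<in>{..<Suc ?n}. adS a n ?y \<star> f n)"
    by (rule phiS_eq[OF a y]) (use z in auto)
  also have "\<dots> = adS a ?n ?y \<star> f ?n \<oplus> (\<Oplus>n\<in>{..<?n}. adS a n ?y \<star> f n)"
    unfolding lessThan_Suc using adS_closed[OF a y] by (intro finsum_insert) (auto simp: smult_closed)
  also have "(\<Oplus>n\<in>{..<?n}. adS a n ?y \<star> f n) = (\<Oplus>n\<in>{..<?n}. \<zero>)"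
    by (rule finsum_cong') (use z in auto)
  finally show ?thesis
    using adS_closed[OF a y, of ?n] adS_vprod[OF a w, of ?n] by (simp add: finsum_zero smult_closed phi_list_def)
qed

definition phi_val :: "(nat \<Rightarrow> 'k) \<Rightarrow> 'm \<Rightarrow> ('m \<times> bit) list \<Rightarrow> 'm"
  where "phi_val f a w = symad (length w) (component L 0 a) w \<star> f (length w) \<oplus>
    symad (length w) (component L 1 a) w \<star> f (length w) \<star> ksign (par w)"

text \<open>The sign in \<phi>^a depends on the parity of \<open>a\<close>, so an inhomogeneous
  \<open>a\<close> is split, as in the definition of \<open>series_map\<close>.\<close>

definition smap :: "(nat \<Rightarrow> 'k) \<Rightarrow> 'm \<Rightarrow> ('k, 'm) words set set \<Rightarrow> 'm"
  where "smap f a = phiS f (component L 0 a) \<oplus>\<^bsub>SL.HM\<^esub> phiS f (component L 1 a)"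

lemma smap_H:
  assumes "a \<in> carrier L" and f: "\<And>n. f n \<in> K 0" shows "smap f a \<in> carrier SL.HM"
  unfolding smap_def
  using assms phiS_grade[OF component_grade] SL.HM.grade_carrier by (blast intro: SL.HM_add_closed)

lemma phi_list_symad:
  assumes a: "a \<in> grade L p" and w: "valid w" and f: "\<And>n. f n \<in> K 0"
  shows "phi_list f p a w = symad (length w) a w \<star> f (length w) \<star> ksign (p * par w)"
  unfolding phi_list_def adn_symad[OF a w refl]
  using symad_closed[OF grade_carrier[OF a] w refl] by (simp add: smult_ksign_commute)

lemma smap_vprod:
  assumes a: "a \<in> carrier L" and w: "valid w" and f: "\<And>n. f n \<in> K 0"
  shows "smap f a (vprod (map fst w)) = phi_val f a w"
  unfolding smap_def SL.HM_ops phi_val_def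
  using grade_S_carrier[OF valid_vprod[OF w]] phiS_vprod[OF component_grade[OF a] w, of f]
    phi_list_symad[OF component_grade[OF a] w f] symad_closed[OF component_closed[OF a] w refl]
  by (simp add: smult_one smult_closed)

lemma smap_homog:
  assumes a: "a \<in> grade L p" and f: "\<And>n. f n \<in> K 0"
  shows "smap f a = phiS f a"
proof (rule SL_eqI)
  show "smap f a \<in> carrier SL.HM" by (rule smap_H[OF grade_carrier[OF a] f])
  show "phiS f a \<in> carrier SL.HM" by (rule SL.HM.grade_carrier[OF phiS_grade[OF a f]])
  fix w assume w: "valid w"
  have z: "symad (length w) \<zero> w = \<zero>"
    by (rule additive_map_zero[OF abelian_group abelian_group symad_additive[OF w refl]])
  have c: "symad (length w) a w \<star> f (length w) \<in> carrier L"
    by (rule smult_closed[OF symad_closed[OF grade_carrier[OF a] w refl]])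
  show "smap f a (vprod (map fst w)) = phiS f a (vprod (map fst w))"
    unfolding smap_vprod[OF grade_carrier[OF a] w f] phiS_vprod[OF a w] phi_list_symad[OF a w f] phi_val_def
      component_of_grade[OF a]
    using c z by (cases "p = 0") (simp_all add: smult_one smult_closed)
qed

text \<open>The prescribed values on products are attained by \<open>smap\<close>, which settles
  existence; a linear map is determined by its values on products of homogeneous letters, which
  settles uniqueness.\<close>

lemma series_map_smap:
  assumes a: "a \<in> carrier L" and f: "\<And>n. fps_nth \<phi> n \<in> K 0"
  shows "series_map K L \<phi> a = smap (fps_nth \<phi>) a"
proof -
  let ?f = "fps_nth \<phi>"
  \<comment> \<open>For each homogeneous component of \<open>a\<close>, the inner sum over
    permutations is \<open>symad\<close>; the zipped list carries the letters together with their
    parities.\<close>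
  have val: "(\<Oplus>q\<in>{0,1}. lsmult K L (?f (length X)) (\<Oplus>s\<in>{s. s permutes {..<length X}}.
      foldr (\<lambda>i. bracket L (X ! s i)) [0..<length X] (component L q a) \<star> ksign (koszul ps s)) \<star> ksign (q * sum_list ps)) =
    phi_val ?f a (zip X ps)" if h: "homog X ps" for X ps
  proof -
    let ?w = "zip X ps"
    note w = homog_valid[OF h]
    have "(\<Oplus>s\<in>{s. s permutes {..<length X}}.
        foldr (\<lambda>i. bracket L (X ! s i)) [0..<length X] b \<star> ksign (koszul ps s)) = symad (length ?w) b ?w"
      if b: "b \<in> carrier L" for b
    proof -
      have "(\<Oplus>s\<in>{s. s permutes {..<length X}}.
          foldr (\<lambda>i. bracket L (X ! s i)) [0..<length X] b \<star> ksign (koszul ps s)) =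
        (\<Oplus>s\<in>{s. s permutes {..<length ?w}}. perm_term ?w b s)"
      proof (rule finsum_cong')
        fix s assume s: "s \<in> {s. s permutes {..<length ?w}}"
        have l: "length ps = length X" using h by (auto simp: homog_def list_all2_lengthD)
        have "foldr (\<lambda>i. bracket L (X ! s i)) [0..<length X] b = foldr (\<lambda>i. bracket L (fst (?w ! s i))) [0..<length X] b"
        proof (rule foldr_cong)
          fix z i assume "i \<in> set [0..<length X]"
          then have "s i < length X" using permutes_in_image[of s "{..<length X}" i] s w by simp
          then show "bracket L (X ! s i) z = bracket L (fst (?w ! s i)) z" using l by simp
        qed auto
        then show "foldr (\<lambda>i. bracket L (X ! s i)) [0..<length X] b \<star> ksign (koszul ps s) = perm_term ?w b s"
          using w by (simp add: perm_term_def)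
      qed (use w perm_term_closed[OF b w(1)] in auto)
      then show ?thesis using perm_sum_symad[OF b w(1) refl] by simp
    qed
    then show ?thesis
      using a symad_closed[OF _ w(1) refl] w f
      by (subst finsum_bit) (simp_all add: phi_val_def lsmult_even smult_closed smult_one)
  qed
  show ?thesis
    unfolding series_map_def Let_def
  proof (rule the_equality)
    show "smap ?f a \<in> carrier (Hom_mod K S L) \<and> (\<forall>X ps. list_all2 (\<lambda>x p. x \<in> grade L p) X ps \<longrightarrow>
        smap ?f a (vprod X) = (\<Oplus>q\<in>{0,1}. lsmult K L (?f (length X)) (\<Oplus>s\<in>{s. s permutes {..<length X}}.
          foldr (\<lambda>i. bracket L (X ! s i)) [0..<length X] (component L q a) \<star> ksign (koszul ps s)) \<star> ksign (q * sum_list ps)))"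
    proof (intro conjI allI impI)
      fix X ps assume "list_all2 (\<lambda>x p. x \<in> grade L p) X ps"
      then have h: "homog X ps" by (simp add: homog_def)
      then show "smap ?f a (vprod X) = (\<Oplus>q\<in>{0,1}. lsmult K L (?f (length X)) (\<Oplus>s\<in>{s. s permutes {..<length X}}.
          foldr (\<lambda>i. bracket L (X ! s i)) [0..<length X] (component L q a) \<star> ksign (koszul ps s)) \<star> ksign (q * sum_list ps))"
        unfolding val[OF h] using smap_vprod[OF a homog_valid(1)[OF h] f] homog_valid(3)[OF h] by simp
    qed (rule smap_H[OF a f])
  next
    fix F assume F: "F \<in> carrier (Hom_mod K S L) \<and> (\<forall>X ps. list_all2 (\<lambda>x p. x \<in> grade L p) X ps \<longrightarrow>
        F (vprod X) = (\<Oplus>q\<in>{0,1}. lsmult K L (?f (length X)) (\<Oplus>s\<in>{s. s permutes {..<length X}}.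
          foldr (\<lambda>i. bracket L (X ! s i)) [0..<length X] (component L q a) \<star> ksign (koszul ps s)) \<star> ksign (q * sum_list ps)))"
    show "F = smap ?f a"
    proof (rule SL_eqI[OF _ smap_H[OF a f]])
      fix w assume w: "valid w"
      have h: "homog (map fst w) (map snd w)" by (rule valid_homog[OF w])
      have "F (vprod (map fst w)) = phi_val ?f a (zip (map fst w) (map snd w))"
        using conjunct2[OF F, rule_format, OF h[unfolded homog_def]] val[OF h] by (rule trans)
      then show "F (vprod (map fst w)) = smap ?f a (vprod (map fst w))"
        using smap_vprod[OF a w f] by (simp add: zip_map_fst_snd)
    qed (use F in simp)
  qed
qed

end

section \<open>The representation\<close>

lemma supermod_extend_simps [simp]:
  "carrier (supermod.extend R m) = carrier R" "ring.zero (supermod.extend R m) = ring.zero R"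
  "add (supermod.extend R m) = add R" "rsmult (supermod.extend R m) = rsmult R"
  "grade (supermod.extend R m) = grade R" "bracket (supermod.extend R (lie_super.fields b)) = b"
  by (simp_all add: supermod.extend_def lie_super.fields_def)

context rational_supermodule
begin

lemma H_eqI:
  assumes F: "F \<in> carrier H" "G \<in> carrier H" and e: "\<And>X ps. homog X ps \<Longrightarrow> F (vprod X) = G (vprod X)"
  shows "F = G"
proof (rule SS.HM_eqI[OF F])
  fix y assume y: "y \<in> carrier S"
  show "F y = G y"
  proof (rule S_linear_eq[OF SS.HM_additive[OF F(1)] SS.HM_additive[OF F(2)] _ y])
    fix X ps \<alpha> assume h: "homog X ps"
    then show "F (vprod X \<star>\<^bsub>S\<^esub> \<alpha>) = G (vprod X \<star>\<^bsub>S\<^esub> \<alpha>)"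
      using e[OF h] homog_carrier[OF h] F by (simp add: SS.HM_linear)
  qed
qed

lemma compose_H: "F \<in> carrier H \<Longrightarrow> G \<in> carrier H \<Longrightarrow> compose (carrier S) F G \<in> carrier H"
  unfolding compose_def
  by (rule SS.HM_restrictI)
    (auto simp: SS.HM_linear SS.HM_closed intro: additive_map_compose[OF SS.HM_additive SS.HM_additive])

lemma tmap_component_r:
  assumes f: "f \<in> carrier H" and t: "t \<in> carrier V"
  shows "tmap idS f t = tmap idS (component H 0 f) t \<oplus>\<^bsub>V\<^esub> tmap idS (component H 1 f) t"
proof (rule SS.tensor_additive_eq_homog[OF SS.V_abelian _ _ _ t])
  note c = SS.HM.component_closed[OF f] and g = SS.HM.component_grade[OF f]
  show "additive_map V V (tmap idS f)" by (rule tmap_additive[OF idS_H f])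
  show "additive_map V V (\<lambda>t. tmap idS (component H 0 f) t \<oplus>\<^bsub>V\<^esub> tmap idS (component H 1 f) t)"
    by (rule additive_map_sum[OF SS.V_abelian tmap_additive[OF idS_H c] tmap_additive[OF idS_H c]])
  fix m n p q assume m: "m \<in> grade S p" and n: "n \<in> grade S q"
  have mn: "m \<in> carrier S" "n \<in> carrier S" using m n grade_S_carrier by auto
  show "tmap idS f (pt m n) = tmap idS (component H 0 f) (pt m n) \<oplus>\<^bsub>V\<^esub> tmap idS (component H 1 f) (pt m n)"
    unfolding tmap_pt[OF idS_H f mn] tmap_left_homog[OF idS_H f m mn(2)]
      tmap_pt_homog[OF idS_H g m mn(2)] by simp
qed

lemma tmap_component_l:
  assumes f: "f \<in> carrier H" and t: "t \<in> carrier V"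
  shows "tmap f idS t = tmap (component H 0 f) idS t \<oplus>\<^bsub>V\<^esub> tmap (component H 1 f) idS t"
proof (rule SS.tensor_additive_eq_homog[OF SS.V_abelian _ _ _ t])
  note c = SS.HM.component_closed[OF f]
  show "additive_map V V (tmap f idS)" by (rule tmap_additive[OF f idS_H])
  show "additive_map V V (\<lambda>t. tmap (component H 0 f) idS t \<oplus>\<^bsub>V\<^esub> tmap (component H 1 f) idS t)"
    by (rule additive_map_sum[OF SS.V_abelian tmap_additive[OF c idS_H] tmap_additive[OF c idS_H]])
  fix m n p q assume m: "m \<in> grade S p" and n: "n \<in> grade S q"
  have mn: "m \<in> carrier S" "n \<in> carrier S" using m n grade_S_carrier by auto
  have "f m = component H 0 f m \<oplus>\<^bsub>S\<^esub> component H 1 f m"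
    using fun_cong[OF SS.HM.component_sum[OF f], of m] mn by (simp add: SS.HM_ops)
  then show "tmap f idS (pt m n) = tmap (component H 0 f) idS (pt m n) \<oplus>\<^bsub>V\<^esub> tmap (component H 1 f) idS (pt m n)"
    using mn SS.HM_closed[OF c] by (simp add: tmap_pt_homog[OF f idS_grade m] tmap_pt_homog[OF c idS_grade m]
        SS.TM.smult_one SS.pt_add_l)
qed

text \<open>The rules for \<open>coder\<close> require a homogeneous map; this reduces the general
  case to them.\<close>

lemma coder_components:
  assumes f: "f \<in> carrier H"
  shows "coder f = coder (component H 0 f) \<oplus>\<^bsub>H\<^esub> coder (component H 1 f)"
proof (rule ext)
  fix y
  note c = SS.HM.component_closed[OF f]
  have "tmap idS (component H p f) (\<Delta> y) \<in> carrier V" if "y \<in> carrier S" for p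
    using additive_map_closed[OF tmap_additive[OF idS_H c]] that by simp
  then show "coder f y = (coder (component H 0 f) \<oplus>\<^bsub>H\<^esub> coder (component H 1 f)) y"
    by (simp add: SS.HM_ops coder_def tmap_component_r[OF f] additive_map_add[OF Mult_additive])
qed

text \<open>The tensors \<open>\<alpha> \<otimes> 1\<close> and \<open>1 \<otimes> \<alpha>\<close>
  agree by balancing, so the coproduct commutes with scalars on the left too. The claim is what
  linearity of the representation in \<open>a\<close> comes down to, given the right action on
  homomorphisms.\<close>

lemma coder_lsmult:
  assumes F: "F \<in> grade H p" and G: "G \<in> grade H (p + s)" and al: "\<alpha> \<in> K s"
    and e: "\<And>y. y \<in> carrier S \<Longrightarrow> G y = F (sc \<alpha> \<otimes>\<^bsub>S\<^esub> y)" and y: "y \<in> carrier S"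
  shows "coder G y = coder F (sc \<alpha> \<otimes>\<^bsub>S\<^esub> y)"
proof -
  note FH = SS.HM.grade_carrier[OF F] and GH = SS.HM.grade_carrier[OF G]
  have "\<Delta> (sc \<alpha>) = \<Delta> (\<one>\<^bsub>S\<^esub> \<star>\<^bsub>S\<^esub> \<alpha>)" by (simp add: S_smult)
  also have "\<dots> = pt \<one>\<^bsub>S\<^esub> (sc \<alpha>)"
    using coprod_smult[of "\<one>\<^bsub>S\<^esub>" \<alpha>] by (simp add: coprod_one SS.pt_smult) (simp add: S_smult)
  also have "\<dots> = pt (sc \<alpha>) \<one>\<^bsub>S\<^esub>"
    using SS.pt_balanced[of "\<one>\<^bsub>S\<^esub>" "\<one>\<^bsub>S\<^esub>" \<alpha>] by (simp add: S_lsmult) (simp add: S_smult)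
  finally have "\<Delta> (sc \<alpha> \<otimes>\<^bsub>S\<^esub> y) = scal_act \<alpha> (\<Delta> y)"
    using superalg_hom_SA(4)[OF coprod_hom sc_closed y, of \<alpha>] by (simp add: scal_act_def)
  moreover have "tmap idS G t = tmap idS F (scal_act \<alpha> t)" if t: "t \<in> carrier V" for t
  proof (rule SS.tensor_additive_eq_homog[OF SS.V_abelian _ _ _ t])
    show "additive_map V V (tmap idS G)" by (rule tmap_additive[OF idS_H GH])
    show "additive_map V V (\<lambda>t. tmap idS F (scal_act \<alpha> t))"
      by (rule additive_map_compose[OF scal_act_additive tmap_additive[OF idS_H FH]])
    fix m n q r assume m: "m \<in> grade S q" and n: "n \<in> grade S r"
    have mn: "m \<in> carrier S" "n \<in> carrier S" using m n grade_S_carrier by auto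
    have "tmap idS F (scal_act \<alpha> (pt m n)) = tmap idS F (pt (m \<star>\<^bsub>S\<^esub> \<alpha> \<star>\<^bsub>S\<^esub> ksign (s * q)) n)"
      using S.lsmult_homog[OF m al] mn by (simp add: scal_act_pt S_lsmult)
    also have "\<dots> = tmap idS F (pt m (sc \<alpha> \<otimes>\<^bsub>S\<^esub> n)) \<star>\<^bsub>TM\<^esub> ksign (s * q)"
      unfolding SS.pt_ksign_l[OF S.smult_closed[OF mn(1)] mn(2)] SS.pt_balanced[OF mn] S_lsmult[OF mn(2)]
      using mn by (intro tmap_smult[OF idS_H F]) simp
    also have "\<dots> = pt m (G n) \<star>\<^bsub>TM\<^esub> ksign ((p + s) * q)"
      using tmap_pt_homog[OF idS_H F m, of "sc \<alpha> \<otimes>\<^bsub>S\<^esub> n"] mn e[OF mn(2)] SS.HM_closed[OF GH mn(2)]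
      by (simp add: ksign_ksign_V distrib_right)
    also have "\<dots> = tmap idS G (pt m n)" using tmap_pt_homog[OF idS_H G m mn(2)] mn by simp
    finally show "tmap idS G (pt m n) = tmap idS F (scal_act \<alpha> (pt m n))" by simp
  qed
  ultimately show ?thesis using y by (simp add: coder_app)
qed

end

context rational_lie
begin

lemma subst_cong_r:
  assumes "\<And>v. valid v \<Longrightarrow> u v = u' v" "valid w"
  shows "subst r F u w = subst r F u' w"
  using assms
proof (induction w arbitrary: r F u u')
  case (Cons x w)
  have "subst (r + snd x) F (der x u) w = subst (r + snd x) F (der x u') w"
    by (rule Cons(1)) (use Cons(2-3) in \<open>auto simp: der_def\<close>)
  moreover have "subst r (der x F) u w = subst r (der x F) u' w"
    by (rule Cons(1)) (use Cons(2-3) in auto)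
  ultimately show ?case by simp
qed simp

text \<open>The bridge to the list calculus: \<open>coder_vec\<close> is the recursive equation of
  \<open>subst\<close>, and on the empty product the coderivation yields the single letter given by
  the value of \<open>g\<close> at 1.\<close>

lemma coder_on_lists:
  "valid w \<Longrightarrow> F \<in> grade H p \<Longrightarrow> vec_valued q g \<Longrightarrow>
    deg1 (F (coder g (vprod (map fst w)))) = subst q (on_lists F) (on_lists g) w"
proof (induction w arbitrary: p q F g)
  case Nil
  have g: "g \<in> grade H q" using Nil by (simp add: vec_valued_def)
  obtain z where z: "z \<in> grade L q" "g \<one>\<^bsub>S\<^esub> = vc z"
    using Nil(3) one_grade_S unfolding vec_valued_def by force
  show ?case using z grade_carrier[OF z(1)] by (simp add: coder_one[OF g] on_lists_def)
next
  case (Cons x w)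
  have x: "fst x \<in> grade L (snd x)" and w: "valid w" using Cons by simp_all
  have wS: "vprod (map fst w) \<in> carrier S" by (rule grade_S_carrier[OF valid_vprod[OF w]])
  have g: "g \<in> grade H q" using Cons by (simp add: vec_valued_def)
  note FH = SS.HM.grade_carrier[OF Cons(3)] and Fx = lcomp_grade[OF Cons(3) x] and gx = vec_valued_lcomp[OF Cons(4) x]
  have gxg: "lcomp g (fst x) \<in> grade H (q + snd x)" using gx by (simp add: vec_valued_def)
  let ?c = "coder g (vprod (map fst w))" and ?d = "coder (lcomp g (fst x)) (vprod (map fst w))"
  have c: "?c \<in> carrier S" "?d \<in> carrier S" "fst x \<in> carrier L"
    using SS.HM_closed[OF SS.HM.grade_carrier[OF coder_grade[OF g]] wS]
      SS.HM_closed[OF SS.HM.grade_carrier[OF coder_grade[OF gxg]] wS] grade_carrier[OF x] by auto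
  have "deg1 (F (coder g (vprod (map fst (x # w))))) =
      deg1 (lcomp F (fst x) ?c) \<star> ksign (q * snd x) \<oplus> deg1 (F ?d)"
    using coder_vec[OF g x wS] c SS.HM_closed[OF FH]
    by (simp add: SS.HM_add[OF FH] SS.HM_linear[OF FH] S.smult_closed deg1_smult
        additive_map_add[OF deg1_additive] lcomp_app)
  also have "\<dots> = subst q (on_lists (lcomp F (fst x))) (on_lists g) w \<star> ksign (q * snd x) \<oplus>
      subst (q + snd x) (on_lists F) (on_lists (lcomp g (fst x))) w"
    using Cons(1)[OF w Fx Cons(4)] Cons(1)[OF w Cons(3) gx] by simp
  also have "\<dots> = subst q (on_lists F) (on_lists g) (x # w)"
    using subst_cong[of w "on_lists (lcomp F (fst x))" "der x (on_lists F)" q "on_lists g"]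
      subst_cong_r[of "on_lists (lcomp g (fst x))" "der x (on_lists g)" w "q + snd x" "on_lists F"]
      lfun_on_lists[OF g] w by (simp add: on_lists_lcomp')
  finally show ?case .
qed

section \<open>The representation for any coefficients that satisfy the quadratic identity\<close>

context
  fixes f :: "nat \<Rightarrow> 'k"
  assumes f: "\<And>n. f n \<in> K 0"
    and f_id: "\<And>k l. pcoef f (k + l) k + pcoef f (k + l) l = - f (k + l) * of_nat ((k + l) choose k)"
begin

abbreviation "ser a \<equiv> vc_comp (smap f a)"
definition "Phi a = coder (ser a)"

lemma smap_grade: "a \<in> grade L p \<Longrightarrow> smap f a \<in> grade SL.HM p"
  by (simp add: smap_homog f phiS_grade)

lemma ser_grade: "a \<in> grade L p \<Longrightarrow> ser a \<in> grade H p"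
  and ser_vec_valued: "a \<in> grade L p \<Longrightarrow> vec_valued p (ser a)"
  and ser_H: "a \<in> carrier L \<Longrightarrow> ser a \<in> carrier H"
  using vc_comp_grade[OF smap_grade] vc_comp_vec_valued[OF smap_grade] vc_comp_H[OF smap_H[OF _ f]] by auto

lemma smap_add:
  assumes ab: "a \<in> carrier L" "b \<in> carrier L"
  shows "smap f (a \<oplus> b) = smap f a \<oplus>\<^bsub>SL.HM\<^esub> smap f b"
proof (rule SL_eqI)
  fix w assume w: "valid w"
  have "phi_val f (a \<oplus> b) w = phi_val f a w \<oplus> phi_val f b w"
    using ab symad_closed[OF component_closed[OF ab(1)] w refl] symad_closed[OF component_closed[OF ab(2)] w refl]
    by (simp add: phi_val_def component_add additive_map_add[OF symad_additive[OF w refl]] smult_l_distr smult_closed a_ac)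
  then show "smap f (a \<oplus> b) (vprod (map fst w)) = (smap f a \<oplus>\<^bsub>SL.HM\<^esub> smap f b) (vprod (map fst w))"
    using smap_vprod[OF _ w f] ab grade_S_carrier[OF valid_vprod[OF w]] by (simp add: SL.HM_ops del: map_map)
qed (use ab smap_H[OF _ f] SL.HM_add_closed in auto)

lemma ser_add: "a \<in> carrier L \<Longrightarrow> b \<in> carrier L \<Longrightarrow> ser (a \<oplus> b) = ser a \<oplus>\<^bsub>H\<^esub> ser b"
  by (rule ext) (simp add: smap_add compose_def SL.HM_ops SS.HM_ops vc_add SL.HM_closed[OF smap_H[OF _ f]])

lemma ser_component: "a \<in> carrier L \<Longrightarrow> component H p (ser a) = ser (component L p a)"
proof -
  assume a: "a \<in> carrier L"
  have "a = component L p a \<oplus> component L (p + 1) a"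
    using component_sum[OF a] a by (cases "p = 0") (simp_all add: a_comm)
  then have "ser a = ser (component L p a) \<oplus>\<^bsub>H\<^esub> ser (component L (p + 1) a)"
    using ser_add[OF component_closed[OF a] component_closed[OF a], of p "p + 1"] by simp
  then show ?thesis
    using SS.HM.component_eqI[OF ser_grade[OF component_grade[OF a]] ser_grade[OF component_grade[OF a]]] by simp
qed

lemma Phi_grade: "a \<in> grade L p \<Longrightarrow> Phi a \<in> grade H p"
  unfolding Phi_def by (rule coder_grade[OF ser_grade])

lemma Phi_component_H: "a \<in> carrier L \<Longrightarrow> Phi (component L p a) \<in> carrier H"
  by (rule SS.HM.grade_carrier[OF Phi_grade[OF component_grade]])

lemma Phi_components: "a \<in> carrier L \<Longrightarrow> Phi a = Phi (component L 0 a) \<oplus>\<^bsub>H\<^esub> Phi (component L 1 a)"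
  unfolding Phi_def by (subst coder_components[OF ser_H]) (simp_all add: ser_component)

lemma Phi_H: "a \<in> carrier L \<Longrightarrow> Phi a \<in> carrier H"
  by (subst Phi_components) (simp_all add: Phi_component_H SS.HM_add_closed)

lemma Phi_add_grade:
  assumes a: "a \<in> grade L p" and b: "b \<in> grade L p"
  shows "Phi (a \<oplus> b) = Phi a \<oplus>\<^bsub>H\<^esub> Phi b"
proof (rule SS.HM_eqI)
  note ab = grade_carrier[OF a] grade_carrier[OF b]
  show "Phi (a \<oplus> b) \<in> carrier H" "Phi a \<oplus>\<^bsub>H\<^esub> Phi b \<in> carrier H" using ab by (simp_all add: Phi_H SS.HM_add_closed)
  fix y assume y: "y \<in> carrier S"
  have "coder (ser (a \<oplus> b)) y = coder (ser a) y \<star>\<^bsub>S\<^esub> ksign 0 \<oplus>\<^bsub>S\<^esub> coder (ser b) y"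
    by (rule coder_comb[OF ser_grade[OF a] ser_grade[OF b] ser_grade[OF grade_add[OF a b]] _ y])
      (use ab ser_H SS.HM_closed in \<open>simp add: ser_add SS.HM_ops S.smult_one\<close>)
  then show "Phi (a \<oplus> b) y = (Phi a \<oplus>\<^bsub>H\<^esub> Phi b) y"
    using y SS.HM_closed[OF Phi_H[OF ab(1)] y] by (simp add: Phi_def SS.HM_ops S.smult_one)
qed

lemma Phi_add:
  assumes ab: "a \<in> carrier L" "b \<in> carrier L"
  shows "Phi (a \<oplus> b) = Phi a \<oplus>\<^bsub>H\<^esub> Phi b"
proof -
  have "Phi (a \<oplus> b) = (Phi (component L 0 a) \<oplus>\<^bsub>H\<^esub> Phi (component L 0 b)) \<oplus>\<^bsub>H\<^esub>
      (Phi (component L 1 a) \<oplus>\<^bsub>H\<^esub> Phi (component L 1 b))"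
    using ab by (simp add: Phi_components[of "a \<oplus> b"] component_add
        Phi_add_grade[OF component_grade component_grade])
  also have "\<dots> = Phi a \<oplus>\<^bsub>H\<^esub> Phi b"
    unfolding Phi_components[OF ab(1)] Phi_components[OF ab(2)]
    using ab by (simp add: SS.HM.a_ac Phi_component_H)
  finally show ?thesis .
qed

lemma Phi_component: "a \<in> carrier L \<Longrightarrow> component H p (Phi a) = Phi (component L p a)"
proof -
  assume a: "a \<in> carrier L"
  have "a = component L p a \<oplus> component L (p + 1) a"
    using component_sum[OF a] a by (cases "p = 0") (simp_all add: a_comm)
  then have "Phi a = Phi (component L p a) \<oplus>\<^bsub>H\<^esub> Phi (component L (p + 1) a)"
    using Phi_add[OF component_closed[OF a] component_closed[OF a], of p "p + 1"] by simp
  then show ?thesis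
    using SS.HM.component_eqI[OF Phi_grade[OF component_grade[OF a]] Phi_grade[OF component_grade[OF a]]] by simp
qed

text \<open>Both sides are additive in the endomorphism, so the homogeneous components of
  \<open>a\<close> can be treated separately.\<close>

lemma Phi_coderivation:
  assumes a: "a \<in> carrier L" and y: "y \<in> carrier S"
  shows "\<Delta> (Phi a y) = tmap (Phi a) idS (\<Delta> y) \<oplus>\<^bsub>V\<^esub> tmap idS (Phi a) (\<Delta> y)"
proof -
  let ?P = "\<lambda>p. Phi (component L p a)"
  have P: "?P p \<in> carrier H" for p by (rule Phi_component_H[OF a])
  have t: "\<Delta> y \<in> carrier V" using y by simp
  have c: "tmap (?P p) idS (\<Delta> y) \<in> carrier V" "tmap idS (?P p) (\<Delta> y) \<in> carrier V" for p
    using additive_map_closed[OF tmap_additive[OF P idS_H] t] additive_map_closed[OF tmap_additive[OF idS_H P] t] by auto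
  have h: "\<Delta> (?P p y) = tmap (?P p) idS (\<Delta> y) \<oplus>\<^bsub>V\<^esub> tmap idS (?P p) (\<Delta> y)" for p
    unfolding Phi_def by (rule coder_coderivation[OF ser_vec_valued[OF component_grade[OF a]] y])
  have "\<Delta> (Phi a y) = \<Delta> (?P 0 y) \<oplus>\<^bsub>V\<^esub> \<Delta> (?P 1 y)"
    using y SS.HM_closed[OF P y] by (simp add: Phi_components[OF a] SS.HM_ops additive_map_add[OF coprod_additive])
  then show ?thesis
    unfolding h tmap_component_l[OF Phi_H[OF a] t] tmap_component_r[OF Phi_H[OF a] t] Phi_component[OF a]
    using c by (simp add: SS.V.a_ac)
qed

text \<open>The parity of \<open>a \<star> \<alpha>\<close> exceeds that of \<open>a\<close> by
  \<open>s\<close>, which changes the sign in \<phi>^a by \<open>s * par w\<close>; this is also the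
  sign of moving \<open>\<alpha>\<close> to the left of the argument.\<close>

lemma smap_smult:
  assumes a: "a \<in> grade L p" and al: "\<alpha> \<in> K s" and y: "y \<in> carrier S"
  shows "smap f (a \<star> \<alpha>) y = smap f a (sc \<alpha> \<otimes>\<^bsub>S\<^esub> y)"
proof -
  note ac = grade_carrier[OF a] and aa = rsmult_grade[OF a al]
  have A: "smap f a \<in> carrier SL.HM" by (rule smap_H[OF ac f])
  let ?G = "\<lambda>y\<in>carrier S. smap f a (lsmult K S \<alpha> y)"
  have "smap f (a \<star> \<alpha>) = ?G"
  proof (rule SL_eqI)
    show "smap f (a \<star> \<alpha>) \<in> carrier SL.HM" by (rule smap_H[OF smult_closed[OF ac] f])
    show "?G \<in> carrier SL.HM"
      by (rule SL.HM_restrictI[OF additive_map_compose[OF S.lsmult_additive SL.HM_additive[OF A]]])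
        (simp add: S.lsmult_rsmult SL.HM_linear[OF A])
    fix w assume w: "valid w"
    let ?y = "vprod (map fst w)" and ?s = "symad (length w) a w"
    have yS: "?y \<in> grade S (par w)" "?y \<in> carrier S" using valid_vprod[OF w] grade_S_carrier by auto
    have s: "?s \<in> carrier L" by (rule symad_closed[OF ac w refl])
    have "?G ?y = smap f a ?y \<star> \<alpha> \<star> ksign (s * par w)"
      using yS(2) by (simp add: S.lsmult_homog[OF yS(1) al] SL.HM_linear[OF A] S.smult_closed del: map_map)
    also have "smap f a ?y = ?s \<star> f (length w) \<star> ksign (p * par w)"
      using phiS_vprod[OF a w, of f] phi_list_symad[OF a w f] by (simp add: smap_homog[OF a f])
    also have "?s \<star> f (length w) \<star> ksign (p * par w) \<star> \<alpha> \<star> ksign (s * par w) =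
        ?s \<star> \<alpha> \<star> f (length w) \<star> ksign ((p + s) * par w)"
      using s by (simp add: smult_closed smult_ksign_commute[of _ _ \<alpha>] smult_ksign_ksign distrib_right
          smult_even_commute[OF s f, of _ \<alpha>])
    also have "\<dots> = smap f (a \<star> \<alpha>) ?y"
      using phiS_vprod[OF aa w, of f] phi_list_symad[OF aa w f] symad_smult[OF w refl ac]
      by (simp add: smap_homog[OF aa f])
    finally show "smap f (a \<star> \<alpha>) ?y = ?G ?y" by simp
  qed
  then show ?thesis using y by (simp add: S_lsmult)
qed

lemma Phi_smult_homog:
  assumes a: "a \<in> grade L p" and al: "\<alpha> \<in> K s" and y: "y \<in> carrier S"
  shows "Phi (a \<star> \<alpha>) y = Phi a (lsmult K S \<alpha> y)"
  unfolding Phi_def S_lsmult[OF y]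
  by (rule coder_lsmult[OF ser_grade[OF a] ser_grade[OF rsmult_grade[OF a al]] al _ y])
    (simp add: vc_comp_app smap_smult[OF a al])

lemma Phi_smult:
  assumes a: "a \<in> carrier L" and y: "y \<in> carrier S"
  shows "Phi (a \<star> \<alpha>) y = Phi a (lsmult K S \<alpha> y)"
proof (rule grade_induct[OF a])
  fix p a assume a: "a \<in> grade L p"
  note ac = grade_carrier[OF a]
  show "Phi (a \<star> \<alpha>) y = Phi a (lsmult K S \<alpha> y)"
  proof (induction \<alpha> rule: K_induct)
    case (1 s \<alpha>)
    show ?case by (rule Phi_smult_homog[OF a 1 y])
  next
    case (2 \<alpha> \<beta>)
    then show ?case
      using y ac by (simp add: smult_r_distr smult_closed Phi_add SS.HM_ops S.lsmult_add_scal SS.HM_add[OF Phi_H])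
  qed
next
  fix a b assume "a \<in> carrier L" "b \<in> carrier L" "Phi (a \<star> \<alpha>) y = Phi a (lsmult K S \<alpha> y)"
    "Phi (b \<star> \<alpha>) y = Phi b (lsmult K S \<alpha> y)"
  then show "Phi ((a \<oplus> b) \<star> \<alpha>) y = Phi (a \<oplus> b) (lsmult K S \<alpha> y)"
    using y by (simp add: smult_l_distr smult_closed Phi_add SS.HM_ops)
qed

lemma on_lists_ser: "a \<in> grade L p \<Longrightarrow> valid w \<Longrightarrow> on_lists (ser a) w = phi_list f p a w"
  using deg1_vc_comp[OF smap_H[OF grade_carrier f] grade_S_carrier[OF valid_vprod]] phiS_vprod
  by (simp add: on_lists_def smap_homog f del: map_map)

lemma ser_coder_vprod:
  assumes a: "a \<in> grade L p" and b: "b \<in> grade L q" and w: "valid w"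
  shows "ser a (coder (ser b) (vprod (map fst w))) = vc (subst q (phi_list f p a) (phi_list f q b) w)"
proof -
  have "coder (ser b) (vprod (map fst w)) \<in> carrier S"
    by (rule SS.HM_closed[OF SS.HM.grade_carrier[OF coder_grade[OF ser_grade[OF b]]] grade_S_carrier[OF valid_vprod[OF w]]])
  moreover have "subst q (on_lists (ser a)) (on_lists (ser b)) w = subst q (phi_list f p a) (phi_list f q b) w"
    using subst_cong[of w "on_lists (ser a)" "phi_list f p a" q "on_lists (ser b)"]
      subst_cong_r[of "on_lists (ser b)" "phi_list f q b" w q "phi_list f p a"]
      lfun_on_lists[OF ser_grade[OF b]] w by (simp add: on_lists_ser[OF a] on_lists_ser[OF b])
  ultimately show ?thesis
    using coder_on_lists[OF w ser_grade[OF a] ser_vec_valued[OF b]]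
      deg1_vc_comp[OF smap_H[OF grade_carrier[OF a] f], of "coder (ser b) (vprod (map fst w))"]
    by (simp add: vc_comp_app del: map_map)
qed

text \<open>Here the coefficient identity enters the algebra: on a product both sides are values of
  list functions, and these agree by \<open>phi_list_commutator\<close>.\<close>

lemma cobracket_ser:
  assumes a: "a \<in> grade L p" and b: "b \<in> grade L q"
  shows "cobracket p q (ser a) (ser b) = ser (bracket L a b)"
proof (rule H_eqI)
  note ab = br_even[OF a b]
  show "cobracket p q (ser a) (ser b) \<in> carrier H"
    by (rule SS.HM.grade_carrier[OF cobracket_grade[OF ser_grade[OF a] ser_grade[OF b]]])
  show "ser (bracket L a b) \<in> carrier H" by (rule ser_H[OF grade_carrier[OF ab]])
  fix X ps assume h: "homog X ps"
  let ?w = "zip X ps"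
  have w: "valid ?w" "X = map fst ?w" using homog_valid[OF h] by auto
  have XS: "vprod X \<in> carrier S" using homog_carrier[OF h] by simp
  have s: "subst q (phi_list f p a) (phi_list f q b) ?w \<in> carrier L" "subst p (phi_list f q b) (phi_list f p a) ?w \<in> carrier L"
    using subst_closed[OF lfun_cfun[OF lfun_phi_list[OF f a]] lfun_phi_list[OF f b] w(1)]
      subst_closed[OF lfun_cfun[OF lfun_phi_list[OF f b]] lfun_phi_list[OF f a] w(1)] by auto
  have "cobracket p q (ser a) (ser b) (vprod X) =
      vc (subst q (phi_list f p a) (phi_list f q b) ?w \<oplus> subst p (phi_list f q b) (phi_list f p a) ?w \<star> ksign (p * q + 1))"
    using ser_coder_vprod[OF a b w(1)] ser_coder_vprod[OF b a w(1)] XS s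
    unfolding w(2)[symmetric] by (simp add: cobracket_app vc_add vc_smult' smult_closed)
  also have "\<dots> = vc (phi_list f (p + q) (bracket L a b) ?w)"
    using phi_list_commutator[OF f f_id a b w(1)] by simp
  also have "\<dots> = ser (bracket L a b) (vprod X)"
    using phiS_vprod[OF ab w(1), of f] XS unfolding w(2)[symmetric] by (simp add: vc_comp_app smap_homog[OF ab f])
  finally show "cobracket p q (ser a) (ser b) (vprod X) = ser (bracket L a b) (vprod X)" .
qed

lemma Phi_commutator:
  assumes a: "a \<in> grade L p" and b: "b \<in> grade L q"
  shows "Phi (bracket L a b) = compose (carrier S) (Phi a) (Phi b) \<ominus>\<^bsub>H\<^esub>
    compose (carrier S) (Phi b) (Phi a) \<star>\<^bsub>H\<^esub> ksign (p * q)"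
proof -
  note ab = br_even[OF a b]
  have ac: "a \<in> carrier L" "b \<in> carrier L" using a b grade_carrier by auto
  let ?A = "compose (carrier S) (Phi a) (Phi b)" and ?B = "compose (carrier S) (Phi b) (Phi a)"
  have AB: "?A \<in> carrier H" "?B \<in> carrier H" using ac by (simp_all add: compose_H Phi_H)
  let ?C = "\<lambda>y\<in>carrier S. ?B y \<star>\<^bsub>S\<^esub> ksign (p * q)"
  have C: "?C \<in> carrier H" by (rule SS.HM_even_smult_closed[OF AB(2) K_ksign])
  show ?thesis
    unfolding SS.HM_ksign[OF AB(2)]
  proof (rule H_eqI)
    show "Phi (bracket L a b) \<in> carrier H" by (rule Phi_H[OF grade_carrier[OF ab]])
    show "?A \<ominus>\<^bsub>H\<^esub> ?C \<in> carrier H" using AB C by (rule_tac SS.HM.minus_closed) auto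
    fix X ps assume h: "homog X ps"
    have XS: "vprod X \<in> carrier S" using homog_carrier[OF h] by simp
    have c: "?A (vprod X) \<in> carrier S" "?B (vprod X) \<in> carrier S" using SS.HM_closed AB XS by auto
    have "Phi (bracket L a b) (vprod X) = ?A (vprod X) \<oplus>\<^bsub>S\<^esub> ?B (vprod X) \<star>\<^bsub>S\<^esub> ksign (p * q + 1)"
      using coder_commutator_vprod[OF h ser_vec_valued[OF a] ser_vec_valued[OF b]] XS
      unfolding cobracket_ser[OF a b] Phi_def[symmetric] by (simp add: compose_def)
    also have "?B (vprod X) \<star>\<^bsub>S\<^esub> ksign (p * q + 1) = \<ominus>\<^bsub>S\<^esub> (?B (vprod X) \<star>\<^bsub>S\<^esub> ksign (p * q))"
      using S.smult_ksign_ksign[OF c(2), of "p * q" 1] S.smult_neg_one[OF S.smult_closed[OF c(2)]] by simp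
    finally show "Phi (bracket L a b) (vprod X) = (?A \<ominus>\<^bsub>H\<^esub> ?C) (vprod X)"
      using XS C by (simp add: a_minus_def SS.HM_uminus SS.HM_ops(2))
  qed
qed

lemma bracket_components:
  assumes "a \<in> carrier L" "b \<in> carrier L"
  shows "bracket L a b = (\<Oplus>p\<in>{0,1}. \<Oplus>q\<in>{0,1}. bracket L (component L p a) (component L q b))"
proof -
  have "bracket L a b = bracket L (component L 0 a \<oplus> component L 1 a) (component L 0 b \<oplus> component L 1 b)"
    using assms by (simp add: component_sum)
  then show ?thesis using assms by (simp add: finsum_bit br_closed br_l_distr br_r_distr)
qed

text \<open>The bracket of endomorphisms is defined by summing over homogeneous components, and
  passing from \<open>a\<close> to its coderivation respects components; so the homogeneous
  commutator formula can be summed.\<close>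

lemma Phi_bracket:
  assumes ab: "a \<in> carrier L" "b \<in> carrier L"
  shows "Phi (bracket L a b) = bracket (End_lie K S) (Phi a) (Phi b)"
proof -
  have E: "bracket (End_lie K S) (Phi a) (Phi b) = (\<Oplus>\<^bsub>H\<^esub>p\<in>{0,1}. \<Oplus>\<^bsub>H\<^esub>q\<in>{0,1}.
      compose (carrier S) (component H p (Phi a)) (component H q (Phi b)) \<ominus>\<^bsub>H\<^esub>
      compose (carrier S) (component H q (Phi b)) (component H p (Phi a)) \<star>\<^bsub>H\<^esub> ksign (p * q))"
    by (simp add: End_lie_def Let_def)
  have "\<dots> = (\<Oplus>\<^bsub>H\<^esub>p\<in>{0,1}. \<Oplus>\<^bsub>H\<^esub>q\<in>{0,1}. Phi (bracket L (component L p a) (component L q b)))"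
    by (simp only: Phi_component[OF ab(1)] Phi_component[OF ab(2)]
        Phi_commutator[OF component_grade[OF ab(1)] component_grade[OF ab(2)]])
  also have "\<dots> = Phi (bracket L a b)"
    unfolding bracket_components[OF ab]
    using ab by (simp add: finsum_bit SS.HM.finsum_bit br_closed Phi_H Phi_add SS.HM_add_closed)
  finally show ?thesis unfolding E by simp
qed

text \<open>Formulated for functions that agree with \<open>Phi\<close> on the carrier, as
  \<open>series_coder\<close> has been identified with it only there.\<close>

lemma lie_hom_Phi:
  assumes e: "\<And>a. a \<in> carrier L \<Longrightarrow> \<Phi> a = Phi a"
  shows "lie_hom K L (End_lie K S) \<Phi>"
  unfolding lie_hom_def
proof (intro conjI ballI)
  fix a b assume "a \<in> carrier L" "b \<in> carrier L"
  then show "\<Phi> (bracket L a b) = bracket (End_lie K S) (\<Phi> a) (\<Phi> b)" by (simp add: e br_closed Phi_bracket)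
next
  have E: "carrier (End_lie K S) = carrier H" "add (End_lie K S) = add H" "rsmult (End_lie K S) = rsmult H"
    "grade (End_lie K S) = grade H" by (simp_all add: End_lie_def Let_def)
  have r: "restrict \<Phi> (carrier L) = restrict Phi (carrier L)" using e by (intro restrict_ext) auto
  have s: "Phi (a \<star> \<alpha>) = Phi a \<star>\<^bsub>H\<^esub> \<alpha>" if a: "a \<in> carrier L" for a \<alpha>
  proof (rule ext)
    fix y show "Phi (a \<star> \<alpha>) y = (Phi a \<star>\<^bsub>H\<^esub> \<alpha>) y"
      using Phi_smult[OF a] by (simp add: SS.HM_ops) (simp add: Phi_def coder_def)
  qed
  show "restrict \<Phi> (carrier L) \<in> grade (Hom_mod K L (End_lie K S)) 0"
    unfolding r Hom_mod_def[of K L] Let_def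
    using grade_carrier by (auto simp: E Phi_H Phi_add s smult_closed Phi_grade)
qed

lemma coderivation_Phi: "a \<in> carrier L \<Longrightarrow> coderivation K L (Phi a)"
  unfolding coderivation_def Let_def idS_def[symmetric] by (simp add: Phi_H Phi_coderivation)

end

lemma series_coder_Phi:
  assumes f: "\<And>n. fps_nth \<phi> n \<in> K 0" and a: "a \<in> carrier L"
  shows "series_coder K L \<phi> a = coder (vc_comp (smap (fps_nth \<phi>) a))"
  unfolding series_coder_def Let_def series_map_smap[OF a f] coder_def idS_def ..

text \<open>Isolates the two properties of the series that make the construction work: even
  coefficients and the quadratic identity among them.\<close>

theorem rep_series_coder:
  assumes f: "\<And>n. fps_nth \<phi> n \<in> K 0"
    and id: "\<And>k l. pcoef (fps_nth \<phi>) (k + l) k + pcoef (fps_nth \<phi>) (k + l) l =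
      - fps_nth \<phi> (k + l) * of_nat ((k + l) choose k)"
  shows "rep_by_coderivations K L (series_coder K L \<phi>)"
proof -
  have e: "series_coder K L \<phi> a = Phi (fps_nth \<phi>) a" if "a \<in> carrier L" for a
    using series_coder_Phi[OF f that] by (simp add: Phi_def[OF f id])
  show ?thesis
    unfolding rep_by_coderivations_def
    using lie_hom_Phi[OF f id e] coderivation_Phi[OF f id] e by simp
qed

end

theorem theorem5p3:
  fixes K :: "bit \<Rightarrow> 'k::ring_1 set"
    and \<gg> :: "('k, 'g, 'e) lie_super_scheme"
    and c :: 'k
  assumes "comm_superring K"
    and "\<forall>n::nat. n > 0 \<longrightarrow> (\<exists>x::'k. of_nat n * x = 1)"
    and "lie_superalgebra K \<gg>"
    and "c \<in> even_units K"
  shows "rep_by_coderivations K \<gg> (series_coder K \<gg> (phi_series K c))"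
proof -
  interpret K: comm_superring K by fact
  interpret g: lie_superalgebra K \<gg> by fact
  interpret rational_lie K \<gg>
    by (intro rational_lie.intro rational_supermodule.intro rational_supermodule_axioms.intro
        g.supermodule_axioms g.lie_superalgebra_axioms assms(2))
  note phi = K.phi_series_K[OF assms(2,4)] and id = K.phi_series_identity[OF assms(2,4)]
  show ?thesis
  proof (rule rep_series_coder[OF phi])
    fix k l :: nat
    show "g.pcoef (fps_nth (phi_series K c)) (k + l) k + g.pcoef (fps_nth (phi_series K c)) (k + l) l =
        - fps_nth (phi_series K c) (k + l) * of_nat ((k + l) choose k)"
      using id[of k l] by (simp add: g.pcoef_def)
  qed
qed

end
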